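(* Let $K$ be a commutative ring, let $\mathcal{T}$ and $\mathcal{U}$ be small dg-categories over $K$, let $M\in\mathrm{DgMod}(\mathcal{U}\otimes\mathcal{T}^{op})$, and let $\Lambda=\left[\begin{smallmatrix}\mathcal{T}&0\\ M&\mathcal{U}\end{smallmatrix}\right]$ be the associated differential graded triangular matrix category. Then the differential graded functor $$\mathfrak{F}:\Big(\mathrm{DgMod}(\mathcal{T}),\mathbb{G}\big(\mathrm{DgMod}(\mathcal{U})\big)\Big)\longrightarrow \mathrm{DgMod}(\Lambda),\qquad (A,f,B)\mapsto A\amalg_f B,\quad (\alpha,\beta)\mapsto\alpha\amalg\beta,$$ is a dg-equivalence of dg-categories.
   Context: Basics. $\otimes=\otimes_K$. A dg $K$-module is a graded $K$-module $M=\bigoplus_{n\in\mathbb{Z}}M^n$ with a $K$-linear $d_M$ of degree $+1$, $d_M^2=0$; $|\cdot|$ denotes degree. $\mathrm{DgMod}(K)$ has as objects the dg $K$-modules, $\mathrm{Hom}(M,N)=\bigoplus_n\mathrm{Hom}^n(M,N)$ ($\mathrm{Hom}^n$ = graded $K$-linear maps of degree $n$) with differential $d(\alpha)=d_N\alpha-(-1)^{|\alpha|}\alpha d_M$. On $M\otimes N$: $d(m\otimes n)=d_M(m)\otimes n+(-1)^{|m|}m\otimes d_N(n)$. A dg-category is a $K$-category whose Hom's are dg $K$-modules and whose composition $\mathrm{Hom}(Y,Z)\otimes\mathrm{Hom}(X,Y)\to\mathrm{Hom}(X,Z)$ has degree zero and commutes with differentials. $\mathcal{A}^{op}$ has the same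 differentials and composition $\beta^{op}\circ\alpha^{op}=(-1)^{|\alpha||\beta|}(\alpha\circ\beta)^{op}$. $\mathcal{A}\otimes\mathcal{B}$ has objects pairs, $\mathrm{Hom}((X,Y),(X',Y'))=\mathcal{A}(X,X')\otimes\mathcal{B}(Y,Y')$, and $(\alpha_2\otimes\beta_2)\circ(\alpha_1\otimes\beta_1)=(-1)^{|\beta_2||\alpha_1|}\alpha_2\alpha_1\otimes\beta_2\beta_1$. A dg-functor (differential graded functor) is a $K$-linear functor preserving degrees of morphisms and commuting with differentials. A dg-natural transformation of degree $n$, $\eta:F\to G$, is a family $\eta_X\in\mathrm{Hom}^n(F(X),G(X))$ with $G(f)\circ\eta_X=(-1)^{n|f|}\eta_Y\circ F(f)$ for homogeneous $f:X\to Y$. For a small dg-category $\mathcal{C}$, $\mathrm{DgMod}(\mathcal{C})$ is the dg-category of dg-functors $\mathcal{C}\to\mathrm{DgMod}(K)$ (dg $\mathcal{C}$-modules), with $\mathrm{Hom}^n(F,G)$ the dg-natural transformations of degree $n$, $\mathrm{Hom}=\bigoplus_n\mathrm{Hom}^n$, and $d(\eta)_X=d(\eta_X)$. A dg-equivalence is a dg-functor admitting a quasi-inverse dg-functor up to degree-zero closed (differential zero) natural isomorphisms. The functor $\mathbb{G}$. For $T\in\mathcal{T}$, $M_T\in\mathrm{DgMod}(\mathcal{U})$ is $M_T(U)=M(U,T)$, $M_T(u)=M(u\otimes 1_T^{op})$. For homogeneous $t:T\to T'$, $\overline{t}:M_{T'}\to M_T$ is $[\overline{t}]_U=M(1_U\otimes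 t^{op})$. $\mathbb{G}:\mathrm{DgMod}(\mathcal{U})\to\mathrm{DgMod}(\mathcal{T})$ is the dg-functor with $\mathbb{G}(B)(T)=\mathrm{Hom}_{\mathrm{DgMod}(\mathcal{U})}(M_T,B)$, $\mathbb{G}(B)(t)(\eta)=(-1)^{|\eta||t|}\eta\circ\overline{t}$, and $[\mathbb{G}(\varepsilon)]_T(\eta)=\varepsilon\circ\eta$. The comma category $\big(\mathrm{DgMod}(\mathcal{T}),\mathbb{G}(\mathrm{DgMod}(\mathcal{U}))\big)$. Objects: triples $(A,f,B)$ with $A\in\mathrm{DgMod}(\mathcal{T})$, $B\in\mathrm{DgMod}(\mathcal{U})$, $f\in\mathrm{Hom}^0(A,\mathbb{G}(B))$, $d(f)=0$. Degree $n$ morphisms $(A,f,B)\to(A',f',B')$: pairs $(\alpha,\beta)$ with $\alpha:A\to A'$, $\beta:B\to B'$ of degree $n$ and $f'\circ\alpha=\mathbb{G}(\beta)\circ f$; differential $(\alpha,\beta)\mapsto(d\alpha,d\beta)$; componentwise composition. The category $\Lambda$. Objects: matrices $\left[\begin{smallmatrix}T&0\\ M&U\end{smallmatrix}\right]$ with $T\in\mathcal{T}$, $U\in\mathcal{U}$ (i.e. pairs $(T,U)$). Morphisms from $\left[\begin{smallmatrix}T&0\\ M&U\end{smallmatrix}\right]$ to $\left[\begin{smallmatrix}T'&0\\ M&U'\end{smallmatrix}\right]$: matrices $\left[\begin{smallmatrix}t&0\\ m&u\end{smallmatrix}\right]$ with $t\in\mathcal{T}(T,T')$, $m\in M(U',T)$,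 $u\in\mathcal{U}(U,U')$, graded and with differential entrywise. Composition: $\left[\begin{smallmatrix}t_2&0\\ m_2&u_2\end{smallmatrix}\right]\circ\left[\begin{smallmatrix}t_1&0\\ m_1&u_1\end{smallmatrix}\right]=\left[\begin{smallmatrix}t_2t_1&0\\ m_2\bullet t_1+u_2\bullet m_1&u_2u_1\end{smallmatrix}\right]$, where, for homogeneous elements and extended bilinearly, $m\bullet t=(-1)^{|m||t|}M(1\otimes t^{op})(m)$ and $u\bullet m=M(u\otimes 1)(m)$. $\Lambda$ is a dg-category. The functor $\mathfrak{F}$. For $(A,f,B)$ in the comma category and homogeneous $m\in M(U,T)$, $x\in A(T)$, put $m\cdot x=(-1)^{|x||m|}[f_T(x)]_U(m)\in B(U)$, extended bilinearly. The dg $\Lambda$-module $A\amalg_fB$ sends $\left[\begin{smallmatrix}T&0\\ M&U\end{smallmatrix}\right]$ to $A(T)\amalg B(U)$ (direct sum) and $\left[\begin{smallmatrix}t&0\\ m&u\end{smallmatrix}\right]$ to the map $(x,y)\mapsto(A(t)(x),\,m\cdot x+B(u)(y))$. $\alpha\amalg\beta$ has components $\alpha_T\amalg\beta_U$.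
   Formalization: Assumes T and U are both nonempty or both empty; if exactly one has no objects, Λ is empty and DgMod(Λ) is trivial while the comma category need not be. Dg modules are taken with underlying sets inside an arbitrary infinite set. *)

theory Defs
  imports "HOL-Algebra.Module" "HOL-Algebra.AbelCoset"
begin

section \<open>Graded and dg modules\<close>

text \<open>Only the additive part of the underlying module record is used; the ring fields
  \<open>mult\<close> and \<open>one\<close> that it inherits carry no meaning. The grading is internal:
  \<open>grade M n\<close> is the submodule of elements of degree \<open>n\<close>.\<close>

record ('k, 'v) dgmod = "('k, 'v) module" +
  grade :: "int \<Rightarrow> 'v set"
  dif :: "'v \<Rightarrow> 'v"

locale dg_module = module K M for K :: "'k ring" (structure) and M :: "('k, 'v) dgmod" (structure) +
  assumes grade_submodule: "\<And>n. submodule (grade M n) K M"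
    and direct_sum: "\<And>x. x \<in> carrier M \<Longrightarrow>
      \<exists>!c. (\<forall>n. c n \<in> grade M n) \<and> finite {n. c n \<noteq> \<zero>\<^bsub>M\<^esub>} \<and> x = (\<Oplus>\<^bsub>M\<^esub>n\<in>{n. c n \<noteq> \<zero>\<^bsub>M\<^esub>}. c n)"
    and dif_closed: "\<And>x. x \<in> carrier M \<Longrightarrow> dif M x \<in> carrier M"
    and dif_add: "\<And>x y. \<lbrakk>x \<in> carrier M; y \<in> carrier M\<rbrakk> \<Longrightarrow> dif M (x \<oplus>\<^bsub>M\<^esub> y) = dif M x \<oplus>\<^bsub>M\<^esub> dif M y"
    and dif_smult: "\<And>a x. \<lbrakk>a \<in> carrier K; x \<in> carrier M\<rbrakk> \<Longrightarrow> dif M (a \<odot>\<^bsub>M\<^esub> x) = a \<odot>\<^bsub>M\<^esub> dif M x"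
    and dif_grade: "\<And>n x. x \<in> grade M n \<Longrightarrow> dif M x \<in> grade M (n + 1)"
    and dif_dif: "\<And>x. x \<in> carrier M \<Longrightarrow> dif M (dif M x) = \<zero>\<^bsub>M\<^esub>"

definition hcomp :: "('k, 'v) dgmod \<Rightarrow> 'v \<Rightarrow> int \<Rightarrow> 'v" where
  "hcomp M x = (THE c. (\<forall>n. c n \<in> grade M n) \<and> finite {n. c n \<noteq> \<zero>\<^bsub>M\<^esub>} \<and>
     x = (\<Oplus>\<^bsub>M\<^esub>n\<in>{n. c n \<noteq> \<zero>\<^bsub>M\<^esub>}. c n))"

text \<open>\<open>sg M k x\<close> is \<open>(-1)^k x\<close>. The operators \<open>lin_ext\<close> and \<open>bilin_ext\<close> extend to all elements
  a formula given for homogeneous ones; the formula receives the degrees as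
  additional arguments.\<close>

definition sg :: "('k, 'v) dgmod \<Rightarrow> int \<Rightarrow> 'v \<Rightarrow> 'v" where
  "sg M k x = (if even k then x else \<ominus>\<^bsub>M\<^esub> x)"

definition lin_ext :: "('k, 'v) dgmod \<Rightarrow> ('k, 'w) dgmod \<Rightarrow> (int \<Rightarrow> 'v \<Rightarrow> 'w) \<Rightarrow> 'v \<Rightarrow> 'w" where
  "lin_ext M P \<phi> x = (\<Oplus>\<^bsub>P\<^esub>n\<in>{n. hcomp M x n \<noteq> \<zero>\<^bsub>M\<^esub>}. \<phi> n (hcomp M x n))"

definition bilin_ext :: "('k, 'v) dgmod \<Rightarrow> ('k, 'w) dgmod \<Rightarrow> ('k, 'p) dgmod \<Rightarrow>
    (int \<Rightarrow> int \<Rightarrow> 'v \<Rightarrow> 'w \<Rightarrow> 'p) \<Rightarrow> 'v \<Rightarrow> 'w \<Rightarrow> 'p" where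
  "bilin_ext M N P \<phi> x y = lin_ext M P (\<lambda>p x'. lin_ext N P (\<lambda>q y'. \<phi> p q x' y') y) x"

text \<open>Finite sums of elements of \<open>S\<close>.\<close>

inductive_set fin_sums :: "'v \<Rightarrow> ('v \<Rightarrow> 'v \<Rightarrow> 'v) \<Rightarrow> 'v set \<Rightarrow> 'v set"
  for z :: 'v and pl :: "'v \<Rightarrow> 'v \<Rightarrow> 'v" and S :: "'v set" where
  fin_sums_zero: "z \<in> fin_sums z pl S"
| fin_sums_add: "\<lbrakk>x \<in> S; y \<in> fin_sums z pl S\<rbrakk> \<Longrightarrow> pl x y \<in> fin_sums z pl S"

definition dg_sum :: "('k, 'v) dgmod \<Rightarrow> ('k, 'w) dgmod \<Rightarrow> ('k, 'v \<times> 'w) dgmod" where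
  "dg_sum M N = \<lparr>carrier = carrier M \<times> carrier N, mult = undefined, one = undefined,
     zero = (\<zero>\<^bsub>M\<^esub>, \<zero>\<^bsub>N\<^esub>),
     add = (\<lambda>(x, y) (x', y'). (x \<oplus>\<^bsub>M\<^esub> x', y \<oplus>\<^bsub>N\<^esub> y')),
     smult = (\<lambda>a (x, y). (a \<odot>\<^bsub>M\<^esub> x, a \<odot>\<^bsub>N\<^esub> y)),
     grade = (\<lambda>n. grade M n \<times> grade N n),
     dif = (\<lambda>(x, y). (dif M x, dif N y))\<rparr>"

subsection \<open>Hom of dg modules\<close>

text \<open>Maps are extensional outside the carrier, so that they are determined by their values on it.
  The two modules may live in different carrier types.\<close>

definition hom_deg :: "'k ring \<Rightarrow> ('k, 'v) dgmod \<Rightarrow> ('k, 'w) dgmod \<Rightarrow> int \<Rightarrow> ('v \<Rightarrow> 'w) set" where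
  "hom_deg K M N n = {f \<in> carrier M \<rightarrow>\<^sub>E carrier N.
     (\<forall>x\<in>carrier M. \<forall>y\<in>carrier M. f (x \<oplus>\<^bsub>M\<^esub> y) = f x \<oplus>\<^bsub>N\<^esub> f y) \<and>
     (\<forall>a\<in>carrier K. \<forall>x\<in>carrier M. f (a \<odot>\<^bsub>M\<^esub> x) = a \<odot>\<^bsub>N\<^esub> f x) \<and>
     (\<forall>p. \<forall>x\<in>grade M p. f x \<in> grade N (p + n))}"

definition gr_hom :: "'k ring \<Rightarrow> ('k, 'v) dgmod \<Rightarrow> ('k, 'w) dgmod \<Rightarrow> ('k, 'v \<Rightarrow> 'w) dgmod" where
  "gr_hom K M N =
     (let z = (\<lambda>x\<in>carrier M. \<zero>\<^bsub>N\<^esub>); pl = (\<lambda>f g. \<lambda>x\<in>carrier M. f x \<oplus>\<^bsub>N\<^esub> g x) in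
     \<lparr>carrier = fin_sums z pl (\<Union>n. hom_deg K M N n), mult = undefined, one = undefined,
      zero = z, add = pl,
      smult = (\<lambda>a f. \<lambda>x\<in>carrier M. a \<odot>\<^bsub>N\<^esub> f x),
      grade = hom_deg K M N,
      dif = undefined\<rparr>)"

definition dg_hom :: "'k ring \<Rightarrow> ('k, 'v) dgmod \<Rightarrow> ('k, 'w) dgmod \<Rightarrow> ('k, 'v \<Rightarrow> 'w) dgmod" where
  "dg_hom K M N = (let H = gr_hom K M N in
     H\<lparr>dif := lin_ext H H (\<lambda>n \<alpha>. \<lambda>x\<in>carrier M. dif N (\<alpha> x) \<ominus>\<^bsub>N\<^esub> sg N n (\<alpha> (dif M x)))\<rparr>)"

subsection \<open>Tensor product of dg modules\<close>

text \<open>The quotient of the free module on \<open>carrier M \<times> carrier N\<close> (finitely supported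
  functions) by the submodule generated by the bilinearity relations.\<close>

definition free_mod :: "'k ring \<Rightarrow> 'a set \<Rightarrow> ('k, 'a \<Rightarrow> 'k) module" where
  "free_mod K S = \<lparr>carrier = {c. finite {z. c z \<noteq> \<zero>\<^bsub>K\<^esub>} \<and> (\<forall>z. c z \<in> carrier K) \<and> (\<forall>z. z \<notin> S \<longrightarrow> c z = \<zero>\<^bsub>K\<^esub>)},
     mult = undefined, one = undefined,
     zero = (\<lambda>z. \<zero>\<^bsub>K\<^esub>), add = (\<lambda>c c'. \<lambda>z. c z \<oplus>\<^bsub>K\<^esub> c' z),
     smult = (\<lambda>a c. \<lambda>z. a \<otimes>\<^bsub>K\<^esub> c z)\<rparr>"

definition free_gen :: "'k ring \<Rightarrow> 'a \<Rightarrow> 'a \<Rightarrow> 'k" where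
  "free_gen K z = (\<lambda>w. if w = z then \<one>\<^bsub>K\<^esub> else \<zero>\<^bsub>K\<^esub>)"

definition tens_free :: "'k ring \<Rightarrow> ('k, 'v) dgmod \<Rightarrow> ('k, 'w) dgmod \<Rightarrow> ('k, 'v \<times> 'w \<Rightarrow> 'k) module" where
  "tens_free K M N = free_mod K (carrier M \<times> carrier N)"

definition tens_rels :: "'k ring \<Rightarrow> ('k, 'v) dgmod \<Rightarrow> ('k, 'w) dgmod \<Rightarrow> ('v \<times> 'w \<Rightarrow> 'k) set" where
  "tens_rels K M N = (let F = tens_free K M N; e = free_gen K in
     {e (x \<oplus>\<^bsub>M\<^esub> x', y) \<ominus>\<^bsub>F\<^esub> (e (x, y) \<oplus>\<^bsub>F\<^esub> e (x', y)) | x x' y.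
        x \<in> carrier M \<and> x' \<in> carrier M \<and> y \<in> carrier N} \<union>
     {e (x, y \<oplus>\<^bsub>N\<^esub> y') \<ominus>\<^bsub>F\<^esub> (e (x, y) \<oplus>\<^bsub>F\<^esub> e (x, y')) | x y y'.
        x \<in> carrier M \<and> y \<in> carrier N \<and> y' \<in> carrier N} \<union>
     {e (a \<odot>\<^bsub>M\<^esub> x, y) \<ominus>\<^bsub>F\<^esub> (a \<odot>\<^bsub>F\<^esub> e (x, y)) | a x y.
        a \<in> carrier K \<and> x \<in> carrier M \<and> y \<in> carrier N} \<union>
     {e (x, a \<odot>\<^bsub>N\<^esub> y) \<ominus>\<^bsub>F\<^esub> (a \<odot>\<^bsub>F\<^esub> e (x, y)) | a x y.
        a \<in> carrier K \<and> x \<in> carrier M \<and> y \<in> carrier N})"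

definition tens_null :: "'k ring \<Rightarrow> ('k, 'v) dgmod \<Rightarrow> ('k, 'w) dgmod \<Rightarrow> ('v \<times> 'w \<Rightarrow> 'k) set" where
  "tens_null K M N = \<Inter>{H. submodule H K (tens_free K M N) \<and> tens_rels K M N \<subseteq> H}"

text \<open>The pure tensor of \<open>x\<close> and \<open>y\<close>.\<close>

definition tens :: "'k ring \<Rightarrow> ('k, 'v) dgmod \<Rightarrow> ('k, 'w) dgmod \<Rightarrow> 'v \<Rightarrow> 'w \<Rightarrow> ('v \<times> 'w \<Rightarrow> 'k) set" where
  "tens K M N x y = tens_null K M N +>\<^bsub>tens_free K M N\<^esub> free_gen K (x, y)"

definition gr_tensor :: "'k ring \<Rightarrow> ('k, 'v) dgmod \<Rightarrow> ('k, 'w) dgmod \<Rightarrow> ('k, ('v \<times> 'w \<Rightarrow> 'k) set) dgmod" where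
  "gr_tensor K M N = (let F = tens_free K M N; R = tens_null K M N in
     \<lparr>carrier = a_rcosets\<^bsub>F\<^esub> R, mult = undefined, one = undefined,
      zero = R, add = set_add F,
      smult = (\<lambda>a C. \<Union>c\<in>C. R +>\<^bsub>F\<^esub> (a \<odot>\<^bsub>F\<^esub> c)),
      grade = (\<lambda>n. fin_sums R (set_add F)
         {tens K M N x y | x y p q. x \<in> grade M p \<and> y \<in> grade N q \<and> p + q = n}),
      dif = undefined\<rparr>)"

text \<open>The linear map on the tensor product induced by a bilinear map \<open>\<phi>\<close> on
  \<open>carrier M \<times> carrier N\<close>, computed on some representative; for bilinear \<open>\<phi>\<close> the
  choice is immaterial.\<close>

definition tens_ext :: "'k ring \<Rightarrow> ('k, 'p) dgmod \<Rightarrow> ('v \<Rightarrow> 'w \<Rightarrow> 'p) \<Rightarrow> ('v \<times> 'w \<Rightarrow> 'k) set \<Rightarrow> 'p" where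
  "tens_ext K P \<phi> \<tau> = (let c = (SOME c. c \<in> \<tau>) in
     \<Oplus>\<^bsub>P\<^esub>z\<in>{z. c z \<noteq> \<zero>\<^bsub>K\<^esub>}. c z \<odot>\<^bsub>P\<^esub> \<phi> (fst z) (snd z))"

definition dg_tensor :: "'k ring \<Rightarrow> ('k, 'v) dgmod \<Rightarrow> ('k, 'w) dgmod \<Rightarrow> ('k, ('v \<times> 'w \<Rightarrow> 'k) set) dgmod" where
  "dg_tensor K M N = (let P = gr_tensor K M N in
     P\<lparr>dif := tens_ext K P (\<lambda>x y. tens K M N (dif M x) y \<oplus>\<^bsub>P\<^esub>
        lin_ext M P (\<lambda>p x'. sg P p (tens K M N x' (dif N y))) x)\<rparr>)"

section \<open>dg categories and dg functors\<close>

text \<open>Hom-modules need not be disjoint, so composition and functor actions take the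
  objects as arguments: \<open>Comp C X Y Z g f\<close> is \<open>g \<circ> f\<close> for \<open>f : X \<rightarrow> Y\<close>, \<open>g : Y \<rightarrow> Z\<close>.\<close>

record ('k, 'o, 'h) dgcat =
  Ob :: "'o set"
  Hom :: "'o \<Rightarrow> 'o \<Rightarrow> ('k, 'h) dgmod"
  Id :: "'o \<Rightarrow> 'h"
  Comp :: "'o \<Rightarrow> 'o \<Rightarrow> 'o \<Rightarrow> 'h \<Rightarrow> 'h \<Rightarrow> 'h"

text \<open>That composition is a map of dg modules out of the tensor product is spelled out
  as bilinearity, additivity of degrees and the Leibniz rule.\<close>

locale dg_category = cring K for K :: "'k ring" (structure) +
  fixes C :: "('k, 'o, 'h) dgcat"
  assumes hom_dg_module: "\<And>X Y. \<lbrakk>X \<in> Ob C; Y \<in> Ob C\<rbrakk> \<Longrightarrow> dg_module K (Hom C X Y)"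
    and id_closed: "\<And>X. X \<in> Ob C \<Longrightarrow> Id C X \<in> carrier (Hom C X X)"
    and comp_closed: "\<And>X Y Z g f. \<lbrakk>X \<in> Ob C; Y \<in> Ob C; Z \<in> Ob C;
        g \<in> carrier (Hom C Y Z); f \<in> carrier (Hom C X Y)\<rbrakk> \<Longrightarrow> Comp C X Y Z g f \<in> carrier (Hom C X Z)"
    and id_left: "\<And>X Y f. \<lbrakk>X \<in> Ob C; Y \<in> Ob C; f \<in> carrier (Hom C X Y)\<rbrakk> \<Longrightarrow> Comp C X Y Y (Id C Y) f = f"
    and id_right: "\<And>X Y f. \<lbrakk>X \<in> Ob C; Y \<in> Ob C; f \<in> carrier (Hom C X Y)\<rbrakk> \<Longrightarrow> Comp C X X Y f (Id C X) = f"
    and comp_assoc: "\<And>W X Y Z h g f. \<lbrakk>W \<in> Ob C; X \<in> Ob C; Y \<in> Ob C; Z \<in> Ob C;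
        h \<in> carrier (Hom C Y Z); g \<in> carrier (Hom C X Y); f \<in> carrier (Hom C W X)\<rbrakk> \<Longrightarrow>
        Comp C W X Z (Comp C X Y Z h g) f = Comp C W Y Z h (Comp C W X Y g f)"
    and comp_add_left: "\<And>X Y Z g g' f. \<lbrakk>X \<in> Ob C; Y \<in> Ob C; Z \<in> Ob C;
        g \<in> carrier (Hom C Y Z); g' \<in> carrier (Hom C Y Z); f \<in> carrier (Hom C X Y)\<rbrakk> \<Longrightarrow>
        Comp C X Y Z (g \<oplus>\<^bsub>Hom C Y Z\<^esub> g') f = Comp C X Y Z g f \<oplus>\<^bsub>Hom C X Z\<^esub> Comp C X Y Z g' f"
    and comp_add_right: "\<And>X Y Z g f f'. \<lbrakk>X \<in> Ob C; Y \<in> Ob C; Z \<in> Ob C;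
        g \<in> carrier (Hom C Y Z); f \<in> carrier (Hom C X Y); f' \<in> carrier (Hom C X Y)\<rbrakk> \<Longrightarrow>
        Comp C X Y Z g (f \<oplus>\<^bsub>Hom C X Y\<^esub> f') = Comp C X Y Z g f \<oplus>\<^bsub>Hom C X Z\<^esub> Comp C X Y Z g f'"
    and comp_smult_left: "\<And>X Y Z a g f. \<lbrakk>X \<in> Ob C; Y \<in> Ob C; Z \<in> Ob C; a \<in> carrier K;
        g \<in> carrier (Hom C Y Z); f \<in> carrier (Hom C X Y)\<rbrakk> \<Longrightarrow>
        Comp C X Y Z (a \<odot>\<^bsub>Hom C Y Z\<^esub> g) f = a \<odot>\<^bsub>Hom C X Z\<^esub> Comp C X Y Z g f"
    and comp_smult_right: "\<And>X Y Z a g f. \<lbrakk>X \<in> Ob C; Y \<in> Ob C; Z \<in> Ob C; a \<in> carrier K;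
        g \<in> carrier (Hom C Y Z); f \<in> carrier (Hom C X Y)\<rbrakk> \<Longrightarrow>
        Comp C X Y Z g (a \<odot>\<^bsub>Hom C X Y\<^esub> f) = a \<odot>\<^bsub>Hom C X Z\<^esub> Comp C X Y Z g f"
    and comp_grade: "\<And>X Y Z p q g f. \<lbrakk>X \<in> Ob C; Y \<in> Ob C; Z \<in> Ob C;
        g \<in> grade (Hom C Y Z) p; f \<in> grade (Hom C X Y) q\<rbrakk> \<Longrightarrow> Comp C X Y Z g f \<in> grade (Hom C X Z) (p + q)"
    and comp_dif: "\<And>X Y Z p g f. \<lbrakk>X \<in> Ob C; Y \<in> Ob C; Z \<in> Ob C;
        g \<in> grade (Hom C Y Z) p; f \<in> carrier (Hom C X Y)\<rbrakk> \<Longrightarrow>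
        dif (Hom C X Z) (Comp C X Y Z g f) =
          Comp C X Y Z (dif (Hom C Y Z) g) f \<oplus>\<^bsub>Hom C X Z\<^esub> sg (Hom C X Z) p (Comp C X Y Z g (dif (Hom C X Y) f))"

definition dg_op :: "('k, 'o, 'h) dgcat \<Rightarrow> ('k, 'o, 'h) dgcat" where
  "dg_op C = \<lparr>Ob = Ob C, Hom = (\<lambda>X Y. Hom C Y X), Id = Id C,
     Comp = (\<lambda>X Y Z g f. bilin_ext (Hom C Z Y) (Hom C Y X) (Hom C Z X)
       (\<lambda>p q g' f'. sg (Hom C Z X) (p * q) (Comp C Z Y X f' g')) g f)\<rparr>"

definition dg_tensor_cat :: "'k ring \<Rightarrow> ('k, 'o, 'h) dgcat \<Rightarrow> ('k, 'o2, 'h2) dgcat \<Rightarrow>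
    ('k, 'o \<times> 'o2, ('h \<times> 'h2 \<Rightarrow> 'k) set) dgcat" where
  "dg_tensor_cat K A B = \<lparr>Ob = Ob A \<times> Ob B,
     Hom = (\<lambda>(X, Y) (X', Y'). dg_tensor K (Hom A X X') (Hom B Y Y')),
     Id = (\<lambda>(X, Y). tens K (Hom A X X) (Hom B Y Y) (Id A X) (Id B Y)),
     Comp = (\<lambda>(X, Y) (X', Y') (X'', Y'') \<tau>\<^sub>2 \<tau>\<^sub>1.
       let P = dg_tensor K (Hom A X X'') (Hom B Y Y'') in
       tens_ext K P (\<lambda>\<alpha>\<^sub>2 \<beta>\<^sub>2. tens_ext K P (\<lambda>\<alpha>\<^sub>1 \<beta>\<^sub>1.
         bilin_ext (Hom B Y' Y'') (Hom A X X') P (\<lambda>q p \<beta> \<alpha>. sg P (q * p)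
           (tens K (Hom A X X'') (Hom B Y Y'') (Comp A X X' X'' \<alpha>\<^sub>2 \<alpha>) (Comp B Y Y' Y'' \<beta> \<beta>\<^sub>1))) \<beta>\<^sub>2 \<alpha>\<^sub>1)
         \<tau>\<^sub>1) \<tau>\<^sub>2)\<rparr>"

record ('o, 'h, 'o2, 'h2) dgfun =
  FOb :: "'o \<Rightarrow> 'o2"
  FMor :: "'o \<Rightarrow> 'o \<Rightarrow> 'h \<Rightarrow> 'h2"

locale dg_functor =
  fixes K :: "'k ring" and C :: "('k, 'o, 'h) dgcat" and D :: "('k, 'o2, 'h2) dgcat"
    and F :: "('o, 'h, 'o2, 'h2) dgfun"
  assumes F_ob: "\<And>X. X \<in> Ob C \<Longrightarrow> FOb F X \<in> Ob D"
    and F_closed: "\<And>X Y f. \<lbrakk>X \<in> Ob C; Y \<in> Ob C; f \<in> carrier (Hom C X Y)\<rbrakk> \<Longrightarrow>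
        FMor F X Y f \<in> carrier (Hom D (FOb F X) (FOb F Y))"
    and F_add: "\<And>X Y f g. \<lbrakk>X \<in> Ob C; Y \<in> Ob C; f \<in> carrier (Hom C X Y); g \<in> carrier (Hom C X Y)\<rbrakk> \<Longrightarrow>
        FMor F X Y (f \<oplus>\<^bsub>Hom C X Y\<^esub> g) = FMor F X Y f \<oplus>\<^bsub>Hom D (FOb F X) (FOb F Y)\<^esub> FMor F X Y g"
    and F_smult: "\<And>X Y a f. \<lbrakk>X \<in> Ob C; Y \<in> Ob C; a \<in> carrier K; f \<in> carrier (Hom C X Y)\<rbrakk> \<Longrightarrow>
        FMor F X Y (a \<odot>\<^bsub>Hom C X Y\<^esub> f) = a \<odot>\<^bsub>Hom D (FOb F X) (FOb F Y)\<^esub> FMor F X Y f"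
    and F_id: "\<And>X. X \<in> Ob C \<Longrightarrow> FMor F X X (Id C X) = Id D (FOb F X)"
    and F_comp: "\<And>X Y Z g f. \<lbrakk>X \<in> Ob C; Y \<in> Ob C; Z \<in> Ob C;
        g \<in> carrier (Hom C Y Z); f \<in> carrier (Hom C X Y)\<rbrakk> \<Longrightarrow>
        FMor F X Z (Comp C X Y Z g f) = Comp D (FOb F X) (FOb F Y) (FOb F Z) (FMor F Y Z g) (FMor F X Y f)"
    and F_grade: "\<And>X Y n f. \<lbrakk>X \<in> Ob C; Y \<in> Ob C; f \<in> grade (Hom C X Y) n\<rbrakk> \<Longrightarrow>
        FMor F X Y f \<in> grade (Hom D (FOb F X) (FOb F Y)) n"
    and F_dif: "\<And>X Y f. \<lbrakk>X \<in> Ob C; Y \<in> Ob C; f \<in> carrier (Hom C X Y)\<rbrakk> \<Longrightarrow>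
        FMor F X Y (dif (Hom C X Y) f) = dif (Hom D (FOb F X) (FOb F Y)) (FMor F X Y f)"

definition dg_id_fun :: "('o, 'h, 'o, 'h) dgfun" where
  "dg_id_fun = \<lparr>FOb = (\<lambda>X. X), FMor = (\<lambda>X Y f. f)\<rparr>"

definition dg_fun_comp :: "('o2, 'h2, 'o3, 'h3) dgfun \<Rightarrow> ('o, 'h, 'o2, 'h2) dgfun \<Rightarrow> ('o, 'h, 'o3, 'h3) dgfun" where
  "dg_fun_comp G F = \<lparr>FOb = (\<lambda>X. FOb G (FOb F X)),
     FMor = (\<lambda>X Y f. FMor G (FOb F X) (FOb F Y) (FMor F X Y f))\<rparr>"

definition dg_nat :: "('k, 'o, 'h) dgcat \<Rightarrow> ('k, 'o2, 'h2) dgcat \<Rightarrow> ('o, 'h, 'o2, 'h2) dgfun \<Rightarrow>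
    ('o, 'h, 'o2, 'h2) dgfun \<Rightarrow> int \<Rightarrow> ('o \<Rightarrow> 'h2) \<Rightarrow> bool" where
  "dg_nat C D F G n \<eta> \<longleftrightarrow>
     (\<forall>X\<in>Ob C. \<eta> X \<in> grade (Hom D (FOb F X) (FOb G X)) n) \<and>
     (\<forall>X\<in>Ob C. \<forall>Y\<in>Ob C. \<forall>p. \<forall>f\<in>grade (Hom C X Y) p.
        Comp D (FOb F X) (FOb G X) (FOb G Y) (FMor G X Y f) (\<eta> X) =
        sg (Hom D (FOb F X) (FOb G Y)) (n * p)
          (Comp D (FOb F X) (FOb F Y) (FOb G Y) (\<eta> Y) (FMor F X Y f)))"

definition dg_iso :: "('k, 'o, 'h) dgcat \<Rightarrow> 'o \<Rightarrow> 'o \<Rightarrow> 'h \<Rightarrow> bool" where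
  "dg_iso D X Y f \<longleftrightarrow> f \<in> carrier (Hom D X Y) \<and>
     (\<exists>g\<in>carrier (Hom D Y X). Comp D X Y X g f = Id D X \<and> Comp D Y X Y f g = Id D Y)"

definition closed_nat_iso :: "('k, 'o, 'h) dgcat \<Rightarrow> ('k, 'o2, 'h2) dgcat \<Rightarrow>
    ('o, 'h, 'o2, 'h2) dgfun \<Rightarrow> ('o, 'h, 'o2, 'h2) dgfun \<Rightarrow> bool" where
  "closed_nat_iso C D F G \<longleftrightarrow> (\<exists>\<eta>. dg_nat C D F G 0 \<eta> \<and>
     (\<forall>X\<in>Ob C. dif (Hom D (FOb F X) (FOb G X)) (\<eta> X) = \<zero>\<^bsub>Hom D (FOb F X) (FOb G X)\<^esub> \<and>
        dg_iso D (FOb F X) (FOb G X) (\<eta> X)))"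

definition dg_equivalence :: "'k ring \<Rightarrow> ('k, 'o, 'h) dgcat \<Rightarrow> ('k, 'o2, 'h2) dgcat \<Rightarrow>
    ('o, 'h, 'o2, 'h2) dgfun \<Rightarrow> bool" where
  "dg_equivalence K C D F \<longleftrightarrow> dg_category K C \<and> dg_category K D \<and> dg_functor K C D F \<and>
     (\<exists>G. dg_functor K D C G \<and>
        closed_nat_iso C C (dg_fun_comp G F) dg_id_fun \<and>
        closed_nat_iso D D (dg_fun_comp F G) dg_id_fun)"

section \<open>dg modules over a dg category\<close>

text \<open>The type \<open>'v\<close> is the universe of the dg-category of dg \<open>K\<close>-modules: its objects are
  the dg modules whose carrier is a subset of \<open>'v\<close>. Functors that agree on all objects and
  morphisms but differ outside them count as distinct (canonically isomorphic) objects of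
  \<open>DgMod\<close>.\<close>

definition DgModK :: "'k ring \<Rightarrow> ('k, ('k, 'v) dgmod, 'v \<Rightarrow> 'v) dgcat" where
  "DgModK K = \<lparr>Ob = {M. dg_module K M}, Hom = dg_hom K,
     Id = (\<lambda>M. \<lambda>x\<in>carrier M. x),
     Comp = (\<lambda>M N P g f. compose (carrier M) g f)\<rparr>"

type_synonym ('k, 'o, 'h, 'v) dgm = "('o, 'h, ('k, 'v) dgmod, 'v \<Rightarrow> 'v) dgfun"

text \<open>Natural transformations between modules in possibly different universes \<open>'v\<close> and \<open>'w\<close>:
  the comma category below uses transformations from a module in \<open>'v\<close> to a module whose
  values are themselves sets of transformations, which cannot be of type \<open>'v\<close>. For
  \<open>'v = 'w\<close>, \<open>mnat_deg\<close> is \<open>dg_nat\<close> with target \<open>DgModK K\<close>, restricted to families extensional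
  on the objects.\<close>

definition mnat_deg :: "'k ring \<Rightarrow> ('k, 'o, 'h) dgcat \<Rightarrow> ('k, 'o, 'h, 'v) dgm \<Rightarrow> ('k, 'o, 'h, 'w) dgm \<Rightarrow>
    int \<Rightarrow> ('o \<Rightarrow> 'v \<Rightarrow> 'w) set" where
  "mnat_deg K C F G n = {\<eta> \<in> (\<Pi>\<^sub>E X\<in>Ob C. grade (dg_hom K (FOb F X) (FOb G X)) n).
     \<forall>X\<in>Ob C. \<forall>Y\<in>Ob C. \<forall>p. \<forall>f\<in>grade (Hom C X Y) p.
        compose (carrier (FOb F X)) (FMor G X Y f) (\<eta> X) =
        sg (dg_hom K (FOb F X) (FOb G Y)) (n * p) (compose (carrier (FOb F X)) (\<eta> Y) (FMor F X Y f))}"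

definition mnat :: "'k ring \<Rightarrow> ('k, 'o, 'h) dgcat \<Rightarrow> ('k, 'o, 'h, 'v) dgm \<Rightarrow> ('k, 'o, 'h, 'w) dgm \<Rightarrow>
    ('k, 'o \<Rightarrow> 'v \<Rightarrow> 'w) dgmod" where
  "mnat K C F G =
     (let H = (\<lambda>X. dg_hom K (FOb F X) (FOb G X));
          z = (\<lambda>X\<in>Ob C. \<zero>\<^bsub>H X\<^esub>); pl = (\<lambda>\<eta> \<theta>. \<lambda>X\<in>Ob C. \<eta> X \<oplus>\<^bsub>H X\<^esub> \<theta> X) in
     \<lparr>carrier = fin_sums z pl (\<Union>n. mnat_deg K C F G n), mult = undefined, one = undefined,
      zero = z, add = pl,
      smult = (\<lambda>a \<eta>. \<lambda>X\<in>Ob C. a \<odot>\<^bsub>H X\<^esub> \<eta> X),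
      grade = mnat_deg K C F G,
      dif = (\<lambda>\<eta>. \<lambda>X\<in>Ob C. dif (H X) (\<eta> X))\<rparr>)"

definition mnat_comp :: "('k, 'o, 'h) dgcat \<Rightarrow> ('k, 'o, 'h, 'v) dgm \<Rightarrow>
    ('o \<Rightarrow> 'w \<Rightarrow> 'x) \<Rightarrow> ('o \<Rightarrow> 'v \<Rightarrow> 'w) \<Rightarrow> 'o \<Rightarrow> 'v \<Rightarrow> 'x" where
  "mnat_comp C F \<theta> \<eta> = (\<lambda>X\<in>Ob C. compose (carrier (FOb F X)) (\<theta> X) (\<eta> X))"

definition mnat_id :: "('k, 'o, 'h) dgcat \<Rightarrow> ('k, 'o, 'h, 'v) dgm \<Rightarrow> 'o \<Rightarrow> 'v \<Rightarrow> 'v" where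
  "mnat_id C F = (\<lambda>X\<in>Ob C. \<lambda>x\<in>carrier (FOb F X). x)"

definition DgMod :: "'k ring \<Rightarrow> ('k, 'o, 'h) dgcat \<Rightarrow> ('k, ('k, 'o, 'h, 'v) dgm, 'o \<Rightarrow> 'v \<Rightarrow> 'v) dgcat" where
  "DgMod K C = \<lparr>Ob = {F. dg_functor K C (DgModK K) F}, Hom = mnat K C,
     Id = mnat_id C,
     Comp = (\<lambda>F G H \<theta> \<eta>. mnat_comp C F \<theta> \<eta>)\<rparr>"

section \<open>The functor from U-modules to T-modules and its comma category\<close>

text \<open>A module over \<open>U \<otimes> T\<^sup>o\<^sup>p\<close>.\<close>

type_synonym ('k, 'to, 'th, 'uo, 'uh, 'm) bimod = "('k, 'uo \<times> 'to, ('uh \<times> 'th \<Rightarrow> 'k) set, 'm) dgm"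

text \<open>\<open>bi_left u u' t b\<close> is \<open>M(b \<otimes> 1)\<close> for \<open>b : u \<rightarrow> u'\<close> in \<open>U\<close>, and \<open>bi_right u t t' a\<close> is
  \<open>M(1 \<otimes> a\<^sup>o\<^sup>p) : M(u, t') \<rightarrow> M(u, t)\<close> for \<open>a : t \<rightarrow> t'\<close> in \<open>T\<close>.\<close>

definition bi_left :: "'k ring \<Rightarrow> ('k, 'to, 'th) dgcat \<Rightarrow> ('k, 'uo, 'uh) dgcat \<Rightarrow>
    ('k, 'to, 'th, 'uo, 'uh, 'm) bimod \<Rightarrow> 'uo \<Rightarrow> 'uo \<Rightarrow> 'to \<Rightarrow> 'uh \<Rightarrow> 'm \<Rightarrow> 'm" where
  "bi_left K T U M u u' t b =
     FMor M (u, t) (u', t) (tens K (Hom U u u') (Hom (dg_op T) t t) b (Id (dg_op T) t))"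

definition bi_right :: "'k ring \<Rightarrow> ('k, 'to, 'th) dgcat \<Rightarrow> ('k, 'uo, 'uh) dgcat \<Rightarrow>
    ('k, 'to, 'th, 'uo, 'uh, 'm) bimod \<Rightarrow> 'uo \<Rightarrow> 'to \<Rightarrow> 'to \<Rightarrow> 'th \<Rightarrow> 'm \<Rightarrow> 'm" where
  "bi_right K T U M u t t' a =
     FMor M (u, t') (u, t) (tens K (Hom U u u) (Hom (dg_op T) t' t) (Id U u) a)"

definition M_at :: "'k ring \<Rightarrow> ('k, 'to, 'th) dgcat \<Rightarrow> ('k, 'uo, 'uh) dgcat \<Rightarrow>
    ('k, 'to, 'th, 'uo, 'uh, 'm) bimod \<Rightarrow> 'to \<Rightarrow> ('k, 'uo, 'uh, 'm) dgm" where
  "M_at K T U M t = \<lparr>FOb = (\<lambda>u. FOb M (u, t)), FMor = (\<lambda>u u' b. bi_left K T U M u u' t b)\<rparr>"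

definition M_bar :: "'k ring \<Rightarrow> ('k, 'to, 'th) dgcat \<Rightarrow> ('k, 'uo, 'uh) dgcat \<Rightarrow>
    ('k, 'to, 'th, 'uo, 'uh, 'm) bimod \<Rightarrow> 'to \<Rightarrow> 'to \<Rightarrow> 'th \<Rightarrow> 'uo \<Rightarrow> 'm \<Rightarrow> 'm" where
  "M_bar K T U M t t' a = (\<lambda>u\<in>Ob U. bi_right K T U M u t t' a)"

text \<open>A module with values in \<open>'v\<close> is sent to one with values in \<open>'uo \<Rightarrow> 'm \<Rightarrow> 'v\<close>, the type of the
  transformations from \<open>M_at K T U M t\<close> to it.\<close>

definition GG :: "'k ring \<Rightarrow> ('k, 'to, 'th) dgcat \<Rightarrow> ('k, 'uo, 'uh) dgcat \<Rightarrow>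
    ('k, 'to, 'th, 'uo, 'uh, 'm) bimod \<Rightarrow>
    (('k, 'uo, 'uh, 'v) dgm, 'uo \<Rightarrow> 'v \<Rightarrow> 'v,
     ('k, 'to, 'th, 'uo \<Rightarrow> 'm \<Rightarrow> 'v) dgm, 'to \<Rightarrow> ('uo \<Rightarrow> 'm \<Rightarrow> 'v) \<Rightarrow> 'uo \<Rightarrow> 'm \<Rightarrow> 'v) dgfun" where
  "GG K T U M =
     (let E = (\<lambda>B t. mnat K U (M_at K T U M t) B) in
     \<lparr>FOb = (\<lambda>B.
        \<lparr>FOb = E B,
         FMor = (\<lambda>t t' a. \<lambda>\<eta>\<in>carrier (E B t).
           bilin_ext (E B t) (Hom T t t') (E B t')
             (\<lambda>p q \<eta>' a'. sg (E B t') (p * q)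
                (mnat_comp U (M_at K T U M t') \<eta>' (M_bar K T U M t t' a'))) \<eta> a)\<rparr>),
      FMor = (\<lambda>B B' \<epsilon>. \<lambda>t\<in>Ob T. \<lambda>\<eta>\<in>carrier (E B t). mnat_comp U (M_at K T U M t) \<epsilon> \<eta>)\<rparr>)"

type_synonym ('k, 'to, 'th, 'uo, 'uh, 'm, 'v) comma_ob =
  "('k, 'to, 'th, 'v) dgm \<times> ('to \<Rightarrow> 'v \<Rightarrow> 'uo \<Rightarrow> 'm \<Rightarrow> 'v) \<times> ('k, 'uo, 'uh, 'v) dgm"

type_synonym ('to, 'uo, 'v) comma_mor = "('to \<Rightarrow> 'v \<Rightarrow> 'v) \<times> ('uo \<Rightarrow> 'v \<Rightarrow> 'v)"

definition comma_deg :: "'k ring \<Rightarrow> ('k, 'to, 'th) dgcat \<Rightarrow> ('k, 'uo, 'uh) dgcat \<Rightarrow>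
    ('k, 'to, 'th, 'uo, 'uh, 'm) bimod \<Rightarrow>
    ('k, 'to, 'th, 'uo, 'uh, 'm, 'v) comma_ob \<Rightarrow> ('k, 'to, 'th, 'uo, 'uh, 'm, 'v) comma_ob \<Rightarrow>
    int \<Rightarrow> ('to, 'uo, 'v) comma_mor set" where
  "comma_deg K T U M = (\<lambda>(A, f, B) (A', f', B') n.
     {(\<alpha>, \<beta>). \<alpha> \<in> grade (mnat K T A A') n \<and> \<beta> \<in> grade (mnat K U B B') n \<and>
        mnat_comp T A f' \<alpha> = mnat_comp T A (FMor (GG K T U M) B B' \<beta>) f})"

definition comma :: "'k ring \<Rightarrow> ('k, 'to, 'th) dgcat \<Rightarrow> ('k, 'uo, 'uh) dgcat \<Rightarrow>
    ('k, 'to, 'th, 'uo, 'uh, 'm) bimod \<Rightarrow>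
    ('k, ('k, 'to, 'th, 'uo, 'uh, 'm, 'v) comma_ob, ('to, 'uo, 'v) comma_mor) dgcat" where
  "comma K T U M =
     \<lparr>Ob = {(A, f, B). A \<in> Ob (DgMod K T) \<and> B \<in> Ob (DgMod K U) \<and>
        f \<in> grade (mnat K T A (FOb (GG K T U M) B)) 0 \<and>
        dif (mnat K T A (FOb (GG K T U M) B)) f = \<zero>\<^bsub>mnat K T A (FOb (GG K T U M) B)\<^esub>},
      Hom = (\<lambda>(A, f, B) (A', f', B').
        let S = dg_sum (mnat K T A A') (mnat K U B B'); H = comma_deg K T U M (A, f, B) (A', f', B') in
        S\<lparr>carrier := fin_sums \<zero>\<^bsub>S\<^esub> (add S) (\<Union>n. H n), grade := H\<rparr>),
      Id = (\<lambda>(A, f, B). (mnat_id T A, mnat_id U B)),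
      Comp = (\<lambda>(A, f, B) _ _ (\<alpha>', \<beta>') (\<alpha>, \<beta>). (mnat_comp T A \<alpha>' \<alpha>, mnat_comp U B \<beta>' \<beta>))\<rparr>"

section \<open>The triangular matrix category\<close>

text \<open>The products of \<open>m \<in> M(u, t')\<close> with \<open>a : t \<rightarrow> t'\<close>, and of \<open>b : u \<rightarrow> u'\<close> with
  \<open>m \<in> M(u, t)\<close>.\<close>

definition m_bullet :: "'k ring \<Rightarrow> ('k, 'to, 'th) dgcat \<Rightarrow> ('k, 'uo, 'uh) dgcat \<Rightarrow>
    ('k, 'to, 'th, 'uo, 'uh, 'm) bimod \<Rightarrow> 'uo \<Rightarrow> 'to \<Rightarrow> 'to \<Rightarrow> 'm \<Rightarrow> 'th \<Rightarrow> 'm" where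
  "m_bullet K T U M u t t' m a =
     bilin_ext (FOb M (u, t')) (Hom T t t') (FOb M (u, t))
       (\<lambda>p q m' a'. sg (FOb M (u, t)) (p * q) (bi_right K T U M u t t' a' m')) m a"

definition bullet_m :: "'k ring \<Rightarrow> ('k, 'to, 'th) dgcat \<Rightarrow> ('k, 'uo, 'uh) dgcat \<Rightarrow>
    ('k, 'to, 'th, 'uo, 'uh, 'm) bimod \<Rightarrow> 'uo \<Rightarrow> 'uo \<Rightarrow> 'to \<Rightarrow> 'uh \<Rightarrow> 'm \<Rightarrow> 'm" where
  "bullet_m K T U M u u' t b m = bi_left K T U M u u' t b m"

text \<open>The pair \<open>(t, u)\<close> is the object with diagonal entries \<open>t\<close>, \<open>u\<close>; the triple \<open>(a, m, b)\<close> is the lower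
  triangular matrix with diagonal entries \<open>a\<close>, \<open>b\<close> and lower left entry \<open>m\<close>.\<close>

definition Lam :: "'k ring \<Rightarrow> ('k, 'to, 'th) dgcat \<Rightarrow> ('k, 'uo, 'uh) dgcat \<Rightarrow>
    ('k, 'to, 'th, 'uo, 'uh, 'm) bimod \<Rightarrow> ('k, 'to \<times> 'uo, 'th \<times> 'm \<times> 'uh) dgcat" where
  "Lam K T U M =
     \<lparr>Ob = Ob T \<times> Ob U,
      Hom = (\<lambda>(t, u) (t', u'). dg_sum (Hom T t t') (dg_sum (FOb M (u', t)) (Hom U u u'))),
      Id = (\<lambda>(t, u). (Id T t, \<zero>\<^bsub>FOb M (u, t)\<^esub>, Id U u)),
      Comp = (\<lambda>(t, u) (t', u') (t'', u'') (a\<^sub>2, m\<^sub>2, b\<^sub>2) (a\<^sub>1, m\<^sub>1, b\<^sub>1).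
        (Comp T t t' t'' a\<^sub>2 a\<^sub>1,
         m_bullet K T U M u'' t t' m\<^sub>2 a\<^sub>1 \<oplus>\<^bsub>FOb M (u'', t)\<^esub> bullet_m K T U M u' u'' t b\<^sub>2 m\<^sub>1,
         Comp U u u' u'' b\<^sub>2 b\<^sub>1))\<rparr>"

section \<open>The comparison functor\<close>

text \<open>Direct sums of modules in \<open>'v\<close> are modules in \<open>'v \<times> 'v\<close>. For infinite \<open>'v\<close> this is the same
  universe up to a bijection, and every \<open>Lam\<close>-module in \<open>'v \<times> 'v\<close> has components of the size of a subset
  of \<open>'v\<close>; for finite \<open>'v\<close> the comparison functor is not essentially surjective in general.

  The objects of \<open>Lam\<close> are pairs: if exactly one of \<open>T\<close> and \<open>U\<close> has no objects, \<open>Lam\<close> is empty,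
  while the comma category is the module category of the other one. Hence the equivalence
  needs \<open>T\<close> and \<open>U\<close> both nonempty or both empty.\<close>

text \<open>\<open>m \<cdot> x\<close> for \<open>m \<in> M(u, t)\<close> and \<open>x \<in> A(t)\<close>.\<close>

definition dot :: "('k, 'to, 'th, 'uo, 'uh, 'm) bimod \<Rightarrow>
    ('k, 'to, 'th, 'uo, 'uh, 'm, 'v) comma_ob \<Rightarrow> 'uo \<Rightarrow> 'to \<Rightarrow> 'm \<Rightarrow> 'v \<Rightarrow> 'v" where
  "dot M = (\<lambda>(A, f, B) u t m x. bilin_ext (FOb M (u, t)) (FOb A t) (FOb B u)
     (\<lambda>p q m' x'. sg (FOb B u) (q * p) (f t x' u m')) m x)"

definition amalg :: "('k, 'to, 'th, 'uo, 'uh, 'm) bimod \<Rightarrow>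
    ('k, 'to, 'th, 'uo, 'uh, 'm, 'v) comma_ob \<Rightarrow> ('k, 'to \<times> 'uo, 'th \<times> 'm \<times> 'uh, 'v \<times> 'v) dgm" where
  "amalg M = (\<lambda>(A, f, B).
     \<lparr>FOb = (\<lambda>(t, u). dg_sum (FOb A t) (FOb B u)),
      FMor = (\<lambda>(t, u) (t', u') (a, m, b). \<lambda>(x, y)\<in>carrier (dg_sum (FOb A t) (FOb B u)).
        (FMor A t t' a x, dot M (A, f, B) u' t m x \<oplus>\<^bsub>FOb B u'\<^esub> FMor B u u' b y))\<rparr>)"

definition FF :: "('k, 'to, 'th) dgcat \<Rightarrow> ('k, 'uo, 'uh) dgcat \<Rightarrow>
    ('k, 'to, 'th, 'uo, 'uh, 'm) bimod \<Rightarrow>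
    (('k, 'to, 'th, 'uo, 'uh, 'm, 'v) comma_ob, ('to, 'uo, 'v) comma_mor,
     ('k, 'to \<times> 'uo, 'th \<times> 'm \<times> 'uh, 'v \<times> 'v) dgm, 'to \<times> 'uo \<Rightarrow> 'v \<times> 'v \<Rightarrow> 'v \<times> 'v) dgfun" where
  "FF T U M =
     \<lparr>FOb = amalg M,
      FMor = (\<lambda>(A, f, B) _ (\<alpha>, \<beta>). \<lambda>(t, u)\<in>Ob T \<times> Ob U.
        \<lambda>(x, y)\<in>carrier (dg_sum (FOb A t) (FOb B u)). (\<alpha> t x, \<beta> u y))\<rparr>"

end

theory Submission
  imports Defs
begin

text \<open>The transformation \<open>f\<close> of a comma object \<open>(A, f, B)\<close> is the same datum as a bilinear pairing
  \<open>m \<cdot> x\<close> of degree zero, closed and compatible with the actions of \<open>T\<close> and \<open>U\<close>; these are the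
  conditions that make the triangular matrices act on \<open>A(t) \<oplus> B(u)\<close>. Naturality with respect to the
  matrix units forces a transformation between two such modules to be diagonal, with one entry
  depending only on \<open>t\<close> and the other only on \<open>u\<close>, so the comparison functor is fully faithful.

  Conversely, let \<open>N\<close> be a module over the matrix category and fix objects \<open>t\<^sub>0\<close> and \<open>u\<^sub>0\<close>. The
  diagonal idempotents split \<open>N(t, u\<^sub>0)\<close> and \<open>N(t\<^sub>0, u)\<close>, which yields a \<open>T\<close>-module \<open>A\<close> and a
  \<open>U\<close>-module \<open>B\<close>; the off-diagonal units \<open>m\<close> give the pairing. The matrix units with identity
  entries between \<open>(t, u\<^sub>0)\<close>, \<open>(t\<^sub>0, u)\<close> and \<open>(t, u)\<close> are of degree zero and closed, and they
  identify \<open>N(t, u)\<close> with \<open>A(t) \<oplus> B(u)\<close>.\<close>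

section \<open>Graded modules and linear maps\<close>

text \<open>Signs such as (-1)^(|m||x|) make sense on homogeneous elements only, while Hom modules
  contain all finite sums of these. Identities are therefore proved for homogeneous arguments and
  carried over by linearity, and each Hom object (graded maps, transformations, comma morphisms)
  must first be shown to be the direct sum of its degrees. The values of \<open>GG\<close> are sets
  of transformations and cannot lie in the universe of A, which is why transformations are treated
  between modules with different carrier types. The equivalence is obtained from full faithfulness
  and essential surjectivity by choosing preimages, so a closed isomorphism of degree zero must be
  produced for each module. Two side conditions shape that step. The corners of N have elements of
  type \<open>'v \<times> 'v\<close> and must be re-embedded in \<open>'v\<close>, which
  infiniteness allows. The base objects t0 and u0 exist only when both object sets are nonempty; if
  both are empty, every claim indexed by objects is vacuous.\<close>

lemma sg_closed: "abelian_group M \<Longrightarrow> x \<in> carrier M \<Longrightarrow> sg M k x \<in> carrier M"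
  by (simp add: sg_def abelian_group.a_inv_closed)

lemma sg_sg: "abelian_group M \<Longrightarrow> x \<in> carrier M \<Longrightarrow> sg M k (sg M l x) = sg M (k + l) x"
  by (simp add: sg_def abelian_group.minus_minus)

lemma sg_add: "abelian_group M \<Longrightarrow> x \<in> carrier M \<Longrightarrow> y \<in> carrier M \<Longrightarrow>
    sg M k (x \<oplus>\<^bsub>M\<^esub> y) = sg M k x \<oplus>\<^bsub>M\<^esub> sg M k y"
  by (simp add: sg_def abelian_group.minus_add)

lemma sg_even [simp]: "even k \<Longrightarrow> sg M k x = x"
  by (simp add: sg_def)

lemma sg_smult: "module K M \<Longrightarrow> a \<in> carrier K \<Longrightarrow> x \<in> carrier M \<Longrightarrow>
    a \<odot>\<^bsub>M\<^esub> sg M k x = sg M k (a \<odot>\<^bsub>M\<^esub> x)"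
  by (simp add: sg_def module.smult_r_minus)

lemma sg_cong: "even k = even l \<Longrightarrow> sg M k x = sg M l x"
  by (simp add: sg_def)

lemma sg_zero: "abelian_group M \<Longrightarrow> sg M k \<zero>\<^bsub>M\<^esub> = \<zero>\<^bsub>M\<^esub>"
  by (metis (no_types) abelian_group.a_inv_closed abelian_group.r_neg
      abelian_groupE(2,5) sg_def)

lemma smult_comm:
  assumes "module K P" "a \<in> carrier K" "b \<in> carrier K" "x \<in> carrier P"
  shows "a \<odot>\<^bsub>P\<^esub> (b \<odot>\<^bsub>P\<^esub> x) = b \<odot>\<^bsub>P\<^esub> (a \<odot>\<^bsub>P\<^esub> x)"
proof -
  interpret module K P by fact
  show ?thesis using assms(2-) by (simp add: R.m_comm flip: smult_assoc1)
qed

text \<open>Weaker than \<open>hom_deg\<close>: neither a degree nor extensionality outside the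
  carrier is demanded, so composites and abstractions can be compared as linear maps without
  adjusting them off the carrier.\<close>

definition klin :: "'k ring \<Rightarrow> ('k, 'v) dgmod \<Rightarrow> ('k, 'w) dgmod \<Rightarrow> ('v \<Rightarrow> 'w) \<Rightarrow> bool" where
  "klin K M N f \<longleftrightarrow> (\<forall>x\<in>carrier M. f x \<in> carrier N) \<and>
     (\<forall>x\<in>carrier M. \<forall>y\<in>carrier M. f (x \<oplus>\<^bsub>M\<^esub> y) = f x \<oplus>\<^bsub>N\<^esub> f y) \<and>
     (\<forall>a\<in>carrier K. \<forall>x\<in>carrier M. f (a \<odot>\<^bsub>M\<^esub> x) = a \<odot>\<^bsub>N\<^esub> f x)"

lemma klinI:
  assumes "\<And>x. x \<in> carrier M \<Longrightarrow> f x \<in> carrier N"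
    and "\<And>x y. x \<in> carrier M \<Longrightarrow> y \<in> carrier M \<Longrightarrow> f (x \<oplus>\<^bsub>M\<^esub> y) = f x \<oplus>\<^bsub>N\<^esub> f y"
    and "\<And>a x. a \<in> carrier K \<Longrightarrow> x \<in> carrier M \<Longrightarrow> f (a \<odot>\<^bsub>M\<^esub> x) = a \<odot>\<^bsub>N\<^esub> f x"
  shows "klin K M N f"
  using assms by (simp add: klin_def)

lemma klin_closed: "klin K M N f \<Longrightarrow> x \<in> carrier M \<Longrightarrow> f x \<in> carrier N"
  and klin_add: "klin K M N f \<Longrightarrow> x \<in> carrier M \<Longrightarrow> y \<in> carrier M \<Longrightarrow> f (x \<oplus>\<^bsub>M\<^esub> y) = f x \<oplus>\<^bsub>N\<^esub> f y"
  and klin_smult: "klin K M N f \<Longrightarrow> a \<in> carrier K \<Longrightarrow> x \<in> carrier M \<Longrightarrow> f (a \<odot>\<^bsub>M\<^esub> x) = a \<odot>\<^bsub>N\<^esub> f x"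
  by (simp_all add: klin_def)

lemma klin_cong: "module K M \<Longrightarrow> (\<And>x. x \<in> carrier M \<Longrightarrow> f x = g x) \<Longrightarrow> klin K M N f = klin K M N g"
proof -
  assume M: "module K M" and eq: "\<And>x. x \<in> carrier M \<Longrightarrow> f x = g x"
  interpret M: module K M by (rule M)
  show ?thesis by (auto simp: klin_def eq)
qed

lemma klin_comp: "klin K M N f \<Longrightarrow> klin K N P g \<Longrightarrow> klin K M P (\<lambda>x. g (f x))"
  by (simp add: klin_def)

lemma klin_zero: "module K M \<Longrightarrow> module K N \<Longrightarrow> klin K M N f \<Longrightarrow> f \<zero>\<^bsub>M\<^esub> = \<zero>\<^bsub>N\<^esub>"
proof -
  assume MN: "module K M" "module K N" and f: "klin K M N f"
  interpret M: module K M by fact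
  interpret N: module K N by fact
  have "f \<zero>\<^bsub>M\<^esub> \<oplus>\<^bsub>N\<^esub> f \<zero>\<^bsub>M\<^esub> = f \<zero>\<^bsub>M\<^esub>"
    using klin_add[OF f, of "\<zero>\<^bsub>M\<^esub>" "\<zero>\<^bsub>M\<^esub>"] by simp
  then show ?thesis
    using klin_closed[OF f, of "\<zero>\<^bsub>M\<^esub>"] by (metis M.zero_closed N.add.r_cancel_one)
qed

lemma klin_minus: "module K M \<Longrightarrow> module K N \<Longrightarrow> klin K M N f \<Longrightarrow> x \<in> carrier M \<Longrightarrow> f (\<ominus>\<^bsub>M\<^esub> x) = \<ominus>\<^bsub>N\<^esub> f x"
proof -
  assume MN: "module K M" "module K N" and f: "klin K M N f" and x: "x \<in> carrier M"
  interpret M: module K M by fact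
  interpret N: module K N by fact
  have "f (\<ominus>\<^bsub>M\<^esub> x) \<oplus>\<^bsub>N\<^esub> f x = \<zero>\<^bsub>N\<^esub>"
    using klin_add[OF f, of "\<ominus>\<^bsub>M\<^esub> x" x] x klin_zero[OF MN f] by (simp add: M.l_neg)
  then show ?thesis
    using klin_closed[OF f] x by (metis M.a_inv_closed N.minus_equality)
qed

lemma klin_sg: "module K M \<Longrightarrow> module K N \<Longrightarrow> klin K M N f \<Longrightarrow> x \<in> carrier M \<Longrightarrow> f (sg M k x) = sg N k (f x)"
  by (simp add: sg_def klin_minus)

lemma klin_sg_fun: "module K N \<Longrightarrow> klin K M N f \<Longrightarrow> klin K M N (\<lambda>x. sg N k (f x))"
  by (simp add: klin_def sg_add sg_smult sg_closed module.axioms(2))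

lemma klin_plus:
  assumes "module K M" "module K N" "klin K M N f" "klin K M N g"
  shows "klin K M N (\<lambda>x. f x \<oplus>\<^bsub>N\<^esub> g x)"
proof -
  interpret N: module K N by fact
  show ?thesis using assms by (simp add: klin_def N.smult_r_distr N.a_ac)
qed

definition kbilin :: "'k ring \<Rightarrow> ('k, 'v) dgmod \<Rightarrow> ('k, 'w) dgmod \<Rightarrow> ('k, 'p) dgmod \<Rightarrow> ('v \<Rightarrow> 'w \<Rightarrow> 'p) \<Rightarrow> bool" where
  "kbilin K M N P f \<longleftrightarrow> (\<forall>x\<in>carrier M. klin K N P (f x)) \<and> (\<forall>y\<in>carrier N. klin K M P (\<lambda>x. f x y))"

lemma kbilin_closed: "kbilin K M N P f \<Longrightarrow> x \<in> carrier M \<Longrightarrow> y \<in> carrier N \<Longrightarrow> f x y \<in> carrier P"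
  by (simp add: kbilin_def klin_def)

lemma kbilinD1: "kbilin K M N P f \<Longrightarrow> y \<in> carrier N \<Longrightarrow> klin K M P (\<lambda>x. f x y)"
  and kbilinD2: "kbilin K M N P f \<Longrightarrow> x \<in> carrier M \<Longrightarrow> klin K N P (f x)"
  by (simp_all add: kbilin_def)

text \<open>\<open>dg_module\<close> with the differential removed: \<open>gr_hom\<close> and the
  fields \<open>dif\<close> defined through \<open>lin_ext\<close> presuppose a grading before a
  differential is available.\<close>

locale gr_module = module K M for K :: "'k ring" (structure) and M :: "('k, 'v) dgmod" (structure) +
  assumes grade_submodule: "\<And>n. submodule (grade M n) K M"
    and direct_sum: "\<And>x. x \<in> carrier M \<Longrightarrow>
      \<exists>!c. (\<forall>n. c n \<in> grade M n) \<and> finite {n. c n \<noteq> \<zero>\<^bsub>M\<^esub>} \<and> x = (\<Oplus>\<^bsub>M\<^esub>n\<in>{n. c n \<noteq> \<zero>\<^bsub>M\<^esub>}. c n)"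

lemma dg_module_gr_module: "dg_module K M \<Longrightarrow> gr_module K M"
  by (simp add: dg_module_def dg_module_axioms_def gr_module_def gr_module_axioms_def)

lemma gr_module_module: "gr_module K M \<Longrightarrow> module K M"
  by (simp add: gr_module_def)

lemma dg_module_module: "dg_module K M \<Longrightarrow> module K M"
  by (simp add: dg_module_def)

lemma module_abelian_group: "module K M \<Longrightarrow> abelian_group M"
  by (simp add: module_def)

context gr_module
begin

lemma grade_carrier: "x \<in> grade M n \<Longrightarrow> x \<in> carrier M"
  using submoduleE(1)[OF grade_submodule] by blast

lemma grade_zero: "\<zero>\<^bsub>M\<^esub> \<in> grade M n"
  using subgroup.one_closed[OF submodule.axioms(1)[OF grade_submodule]] by simp

lemma grade_add: "x \<in> grade M n \<Longrightarrow> y \<in> grade M n \<Longrightarrow> x \<oplus>\<^bsub>M\<^esub> y \<in> grade M n"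
  by (rule submoduleE(5)[OF grade_submodule])

lemma grade_smult: "a \<in> carrier K \<Longrightarrow> x \<in> grade M n \<Longrightarrow> a \<odot>\<^bsub>M\<^esub> x \<in> grade M n"
  by (rule submoduleE(4)[OF grade_submodule])

lemma grade_minus: "x \<in> grade M n \<Longrightarrow> \<ominus>\<^bsub>M\<^esub> x \<in> grade M n"
  by (rule submoduleE(3)[OF grade_submodule])

lemma grade_sg: "x \<in> grade M n \<Longrightarrow> sg M k x \<in> grade M n"
  by (simp add: sg_def grade_minus)

lemma hcomp_spec:
  assumes "x \<in> carrier M"
  shows "(\<forall>n. hcomp M x n \<in> grade M n) \<and> finite {n. hcomp M x n \<noteq> \<zero>\<^bsub>M\<^esub>} \<and>
    x = (\<Oplus>\<^bsub>M\<^esub>n\<in>{n. hcomp M x n \<noteq> \<zero>\<^bsub>M\<^esub>}. hcomp M x n)"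
  using theI'[OF direct_sum[OF assms]] unfolding hcomp_def .

lemma hcomp_grade: "x \<in> carrier M \<Longrightarrow> hcomp M x n \<in> grade M n"
  and hcomp_finite: "x \<in> carrier M \<Longrightarrow> finite {n. hcomp M x n \<noteq> \<zero>\<^bsub>M\<^esub>}"
  using hcomp_spec by blast+

lemma hcomp_closed: "x \<in> carrier M \<Longrightarrow> hcomp M x n \<in> carrier M"
  using hcomp_grade grade_carrier by blast

lemma finsum_supp:
  assumes "finite S" "{n. c n \<noteq> \<zero>\<^bsub>M\<^esub>} \<subseteq> S" "\<And>n. c n \<in> carrier M"
  shows "(\<Oplus>\<^bsub>M\<^esub>n\<in>{n. c n \<noteq> \<zero>\<^bsub>M\<^esub>}. c n) = (\<Oplus>\<^bsub>M\<^esub>n\<in>S. c n)"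
  using assms by (intro M.add.finprod_mono_neutral_cong_left) auto

lemma hcomp_sum:
  assumes "x \<in> carrier M" "finite S" "{n. hcomp M x n \<noteq> \<zero>\<^bsub>M\<^esub>} \<subseteq> S"
  shows "x = (\<Oplus>\<^bsub>M\<^esub>n\<in>S. hcomp M x n)"
  using hcomp_spec[OF assms(1)] finsum_supp[OF assms(2,3) hcomp_closed[OF assms(1)]] by argo

text \<open>The index set S may be larger than the support, since components of a sum or a multiple
  can vanish; directness of the grading then identifies the given family with the
  components.\<close>

lemma hcomp_unique:
  assumes "\<And>n. c n \<in> grade M n" "finite S" "{n. c n \<noteq> \<zero>\<^bsub>M\<^esub>} \<subseteq> S"
  shows "hcomp M (\<Oplus>\<^bsub>M\<^esub>n\<in>S. c n) = c"
proof -
  have c: "c n \<in> carrier M" for n using assms(1) grade_carrier by blast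
  have "(\<Oplus>\<^bsub>M\<^esub>n\<in>S. c n) \<in> carrier M" using c by (simp add: Pi_def)
  then show ?thesis unfolding hcomp_def
    by (rule the1_equality[OF direct_sum])
      (use assms(1) finsum_supp[OF assms(2,3) c] finite_subset[OF assms(3,2)] in simp)
qed

lemma hcomp_homog: "x \<in> grade M n \<Longrightarrow> hcomp M x m = (if m = n then x else \<zero>\<^bsub>M\<^esub>)"
proof -
  assume x: "x \<in> grade M n"
  let ?c = "\<lambda>m. if m = n then x else \<zero>\<^bsub>M\<^esub>"
  have eq: "(\<Oplus>\<^bsub>M\<^esub>m\<in>{n}. ?c m) = x" using grade_carrier[OF x] by simp
  have "hcomp M (\<Oplus>\<^bsub>M\<^esub>m\<in>{n}. ?c m) = ?c"
    by (rule hcomp_unique) (use x grade_zero in auto)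
  then show ?thesis unfolding eq by simp
qed

lemma hcomp_add:
  assumes x: "x \<in> carrier M" and y: "y \<in> carrier M"
  shows "hcomp M (x \<oplus>\<^bsub>M\<^esub> y) n = hcomp M x n \<oplus>\<^bsub>M\<^esub> hcomp M y n"
proof -
  let ?S = "{n. hcomp M x n \<noteq> \<zero>\<^bsub>M\<^esub>} \<union> {n. hcomp M y n \<noteq> \<zero>\<^bsub>M\<^esub>}"
  have S: "finite ?S" using hcomp_finite x y by blast
  have "x \<oplus>\<^bsub>M\<^esub> y = (\<Oplus>\<^bsub>M\<^esub>n\<in>?S. hcomp M x n) \<oplus>\<^bsub>M\<^esub> (\<Oplus>\<^bsub>M\<^esub>n\<in>?S. hcomp M y n)"
    by (rule arg_cong2[where f = "add M", OF hcomp_sum[OF x S Un_upper1] hcomp_sum[OF y S Un_upper2]])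
  also have "\<dots> = (\<Oplus>\<^bsub>M\<^esub>n\<in>?S. hcomp M x n \<oplus>\<^bsub>M\<^esub> hcomp M y n)"
    using hcomp_closed x y by (intro M.add.finprod_multf[symmetric]) auto
  finally have eq: "x \<oplus>\<^bsub>M\<^esub> y = (\<Oplus>\<^bsub>M\<^esub>n\<in>?S. hcomp M x n \<oplus>\<^bsub>M\<^esub> hcomp M y n)" .
  have "hcomp M (\<Oplus>\<^bsub>M\<^esub>n\<in>?S. hcomp M x n \<oplus>\<^bsub>M\<^esub> hcomp M y n) = (\<lambda>n. hcomp M x n \<oplus>\<^bsub>M\<^esub> hcomp M y n)"
    using S grade_add[OF hcomp_grade[OF x] hcomp_grade[OF y]] by (intro hcomp_unique) auto
  then show ?thesis by (simp only: eq)
qed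

lemma hcomp_smult:
  assumes x: "x \<in> carrier M" and a: "a \<in> carrier K"
  shows "hcomp M (a \<odot>\<^bsub>M\<^esub> x) n = a \<odot>\<^bsub>M\<^esub> hcomp M x n"
proof -
  let ?S = "{n. hcomp M x n \<noteq> \<zero>\<^bsub>M\<^esub>}"
  have S: "finite ?S" using hcomp_finite x by blast
  have "a \<odot>\<^bsub>M\<^esub> x = a \<odot>\<^bsub>M\<^esub> (\<Oplus>\<^bsub>M\<^esub>n\<in>?S. hcomp M x n)"
    by (rule arg_cong[where f = "smult M a", OF hcomp_sum[OF x S order_refl]])
  also have "\<dots> = (\<Oplus>\<^bsub>M\<^esub>n\<in>?S. a \<odot>\<^bsub>M\<^esub> hcomp M x n)"
    using hcomp_closed x a S by (intro finsum_smult_ldistr) auto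
  finally have eq: "a \<odot>\<^bsub>M\<^esub> x = (\<Oplus>\<^bsub>M\<^esub>n\<in>?S. a \<odot>\<^bsub>M\<^esub> hcomp M x n)" .
  have "hcomp M (\<Oplus>\<^bsub>M\<^esub>n\<in>?S. a \<odot>\<^bsub>M\<^esub> hcomp M x n) = (\<lambda>n. a \<odot>\<^bsub>M\<^esub> hcomp M x n)"
    using S grade_smult[OF a hcomp_grade[OF x]] a by (intro hcomp_unique) auto
  then show ?thesis by (simp only: eq)
qed

lemma klin_hcomp: "klin K M M (\<lambda>x. hcomp M x n)"
  by (simp add: klin_def hcomp_closed hcomp_add hcomp_smult)

text \<open>An element is a finite sum of homogeneous components, so induction over the index set
  suffices; the empty sum is zero, which is homogeneous of any degree.\<close>

lemma homog_induct [consumes 1, case_names homog add]: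
  assumes x: "x \<in> carrier M"
    and homog: "\<And>n x. x \<in> grade M n \<Longrightarrow> P x"
    and add: "\<And>x y. x \<in> carrier M \<Longrightarrow> y \<in> carrier M \<Longrightarrow> P x \<Longrightarrow> P y \<Longrightarrow> P (x \<oplus>\<^bsub>M\<^esub> y)"
  shows "P x"
proof -
  have "P (\<Oplus>\<^bsub>M\<^esub>n\<in>S. hcomp M x n)" if "finite S" for S
    using that
  proof (induction S rule: finite_induct)
    case empty show ?case using homog[OF grade_zero] by simp
  next
    case (insert n S)
    have "(\<Oplus>\<^bsub>M\<^esub>n\<in>S. hcomp M x n) \<in> carrier M"
      using hcomp_closed x by simp
    then show ?case
      using insert add[OF _ _ homog[OF hcomp_grade]] hcomp_closed[OF x] x by (simp add: Pi_def)
  qed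
  from this[OF hcomp_finite[OF x]] show ?thesis
    using hcomp_spec[OF x] by argo
qed

text \<open>The device that carries an identity between linear maps from homogeneous arguments,
  where signs make sense, to arbitrary ones.\<close>

lemma klin_eqI:
  assumes "module K N" "klin K M N f" "klin K M N g" "\<And>n x. x \<in> grade M n \<Longrightarrow> f x = g x" "x \<in> carrier M"
  shows "f x = g x"
  using assms(5)
  by (induction rule: homog_induct) (simp_all add: assms(4) klin_add[OF assms(2)] klin_add[OF assms(3)])

text \<open>Indices outside the support contribute \<phi> n 0 = 0, so two extensions can be summed
  over one common index set.\<close>

lemma lin_ext_superset:
  assumes "module K P" "\<And>n x. x \<in> grade M n \<Longrightarrow> \<phi> n x \<in> carrier P" "\<And>n. \<phi> n \<zero>\<^bsub>M\<^esub> = \<zero>\<^bsub>P\<^esub>"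
    "x \<in> carrier M" "finite S" "{n. hcomp M x n \<noteq> \<zero>\<^bsub>M\<^esub>} \<subseteq> S"
  shows "lin_ext M P \<phi> x = (\<Oplus>\<^bsub>P\<^esub>n\<in>S. \<phi> n (hcomp M x n))"
proof -
  interpret P: module K P by fact
  show ?thesis unfolding lin_ext_def using assms(2-)
    by (intro P.add.finprod_mono_neutral_cong_left) (auto simp: hcomp_grade)
qed

end

text \<open>What a formula that receives the degree must satisfy for \<open>lin_ext\<close> to be
  linear: linearity within each degree, with no condition on how \<phi> n acts outside degree
  n.\<close>

definition gr_lin :: "'k ring \<Rightarrow> ('k, 'v) dgmod \<Rightarrow> ('k, 'w) dgmod \<Rightarrow> (int \<Rightarrow> 'v \<Rightarrow> 'w) \<Rightarrow> bool" where
  "gr_lin K M P \<phi> \<longleftrightarrow> (\<forall>n. \<forall>x\<in>grade M n. \<phi> n x \<in> carrier P \<and>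
     (\<forall>y\<in>grade M n. \<phi> n (x \<oplus>\<^bsub>M\<^esub> y) = \<phi> n x \<oplus>\<^bsub>P\<^esub> \<phi> n y) \<and>
     (\<forall>a\<in>carrier K. \<phi> n (a \<odot>\<^bsub>M\<^esub> x) = a \<odot>\<^bsub>P\<^esub> \<phi> n x))"

lemma gr_linI:
  assumes "\<And>n x. x \<in> grade M n \<Longrightarrow> \<phi> n x \<in> carrier P"
    and "\<And>n x y. x \<in> grade M n \<Longrightarrow> y \<in> grade M n \<Longrightarrow> \<phi> n (x \<oplus>\<^bsub>M\<^esub> y) = \<phi> n x \<oplus>\<^bsub>P\<^esub> \<phi> n y"
    and "\<And>n a x. a \<in> carrier K \<Longrightarrow> x \<in> grade M n \<Longrightarrow> \<phi> n (a \<odot>\<^bsub>M\<^esub> x) = a \<odot>\<^bsub>P\<^esub> \<phi> n x"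
  shows "gr_lin K M P \<phi>"
  using assms by (simp add: gr_lin_def)

lemma gr_linD:
  assumes "gr_lin K M P \<phi>"
  shows "x \<in> grade M n \<Longrightarrow> \<phi> n x \<in> carrier P"
    and "x \<in> grade M n \<Longrightarrow> y \<in> grade M n \<Longrightarrow> \<phi> n (x \<oplus>\<^bsub>M\<^esub> y) = \<phi> n x \<oplus>\<^bsub>P\<^esub> \<phi> n y"
    and "a \<in> carrier K \<Longrightarrow> x \<in> grade M n \<Longrightarrow> \<phi> n (a \<odot>\<^bsub>M\<^esub> x) = a \<odot>\<^bsub>P\<^esub> \<phi> n x"
  using assms by (simp_all add: gr_lin_def)

lemma klin_gr_lin: "gr_module K M \<Longrightarrow> (\<And>n. klin K M P (\<phi> n)) \<Longrightarrow> gr_lin K M P \<phi>"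
  by (simp add: gr_lin_def klin_def gr_module.grade_carrier)

lemma gr_lin_zero:
  assumes "gr_module K M" "module K P" "gr_lin K M P \<phi>"
  shows "\<phi> n \<zero>\<^bsub>M\<^esub> = \<zero>\<^bsub>P\<^esub>"
proof -
  interpret M: gr_module K M by fact
  interpret P: module K P by fact
  have "\<phi> n \<zero>\<^bsub>M\<^esub> \<oplus>\<^bsub>P\<^esub> \<phi> n \<zero>\<^bsub>M\<^esub> = \<phi> n \<zero>\<^bsub>M\<^esub>"
    using gr_linD(2)[OF assms(3), of "\<zero>\<^bsub>M\<^esub>" n "\<zero>\<^bsub>M\<^esub>"] M.grade_zero by simp
  then show ?thesis
    using gr_linD(1)[OF assms(3)] M.grade_zero by (metis P.add.r_cancel_one)
qed

text \<open>Components are linear in x, but the support of a sum can shrink; both arguments are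
  therefore summed over the union of their supports.\<close>

lemma klin_lin_ext:
  assumes "gr_module K M" "module K P" "gr_lin K M P \<phi>"
  shows "klin K M P (lin_ext M P \<phi>)"
proof (rule klinI)
  interpret M: gr_module K M by fact
  interpret P: module K P by fact
  note cl = gr_linD(1)[OF assms(3)] and z = gr_lin_zero[OF assms]
  have sup: "lin_ext M P \<phi> x = (\<Oplus>\<^bsub>P\<^esub>n\<in>S. \<phi> n (hcomp M x n))"
    if "x \<in> carrier M" "finite S" "{n. hcomp M x n \<noteq> \<zero>\<^bsub>M\<^esub>} \<subseteq> S" for x S
    by (rule M.lin_ext_superset) (use assms(2) cl z that in auto)
  fix x assume x: "x \<in> carrier M"
  note hx = M.hcomp_grade[OF x]
  note fx = M.hcomp_finite[OF x]
  show "lin_ext M P \<phi> x \<in> carrier P"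
    unfolding sup[OF x fx order_refl] using cl[OF hx] by (intro P.finsum_closed) auto
  { fix y assume y: "y \<in> carrier M"
    note hy = M.hcomp_grade[OF y]
    let ?S = "{n. hcomp M x n \<noteq> \<zero>\<^bsub>M\<^esub>} \<union> {n. hcomp M y n \<noteq> \<zero>\<^bsub>M\<^esub>}"
    have S: "finite ?S" using M.hcomp_finite x y by blast
    have "{n. hcomp M (x \<oplus>\<^bsub>M\<^esub> y) n \<noteq> \<zero>\<^bsub>M\<^esub>} \<subseteq> ?S" using x y by (auto simp: M.hcomp_add)
    then have "lin_ext M P \<phi> (x \<oplus>\<^bsub>M\<^esub> y) = (\<Oplus>\<^bsub>P\<^esub>n\<in>?S. \<phi> n (hcomp M (x \<oplus>\<^bsub>M\<^esub> y) n))"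
      using sup[OF _ S] x y by auto
    also have "\<dots> = (\<Oplus>\<^bsub>P\<^esub>n\<in>?S. \<phi> n (hcomp M x n) \<oplus>\<^bsub>P\<^esub> \<phi> n (hcomp M y n))"
      using cl[OF hx] cl[OF hy] gr_linD(2)[OF assms(3) hx hy] x y
      by (intro P.finsum_cong') (auto simp: M.hcomp_add)
    also have "\<dots> = (\<Oplus>\<^bsub>P\<^esub>n\<in>?S. \<phi> n (hcomp M x n)) \<oplus>\<^bsub>P\<^esub> (\<Oplus>\<^bsub>P\<^esub>n\<in>?S. \<phi> n (hcomp M y n))"
      using cl[OF hx] cl[OF hy] by (intro P.add.finprod_multf) auto
    also have "\<dots> = lin_ext M P \<phi> x \<oplus>\<^bsub>P\<^esub> lin_ext M P \<phi> y"
      using sup[OF x S] sup[OF y S] by auto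
    finally show "lin_ext M P \<phi> (x \<oplus>\<^bsub>M\<^esub> y) = lin_ext M P \<phi> x \<oplus>\<^bsub>P\<^esub> lin_ext M P \<phi> y" . }
  { fix a assume a: "a \<in> carrier K"
    let ?S = "{n. hcomp M x n \<noteq> \<zero>\<^bsub>M\<^esub>}"
    have "{n. hcomp M (a \<odot>\<^bsub>M\<^esub> x) n \<noteq> \<zero>\<^bsub>M\<^esub>} \<subseteq> ?S" using x a by (auto simp: M.hcomp_smult)
    then have "lin_ext M P \<phi> (a \<odot>\<^bsub>M\<^esub> x) = (\<Oplus>\<^bsub>P\<^esub>n\<in>?S. \<phi> n (hcomp M (a \<odot>\<^bsub>M\<^esub> x) n))"
      using sup[OF _ fx] x a by auto
    also have "\<dots> = (\<Oplus>\<^bsub>P\<^esub>n\<in>?S. a \<odot>\<^bsub>P\<^esub> \<phi> n (hcomp M x n))"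
      using cl[OF hx] gr_linD(3)[OF assms(3) a hx] x a
      by (intro P.finsum_cong') (auto simp: M.hcomp_smult)
    also have "\<dots> = a \<odot>\<^bsub>P\<^esub> (\<Oplus>\<^bsub>P\<^esub>n\<in>?S. \<phi> n (hcomp M x n))"
      using cl[OF hx] a fx by (intro P.finsum_smult_ldistr[symmetric]) auto
    also have "\<dots> = a \<odot>\<^bsub>P\<^esub> lin_ext M P \<phi> x"
      using sup[OF x fx] by auto
    finally show "lin_ext M P \<phi> (a \<odot>\<^bsub>M\<^esub> x) = a \<odot>\<^bsub>P\<^esub> lin_ext M P \<phi> x" . }
qed

lemma lin_ext_homog:
  assumes "gr_module K M" "module K P" "gr_lin K M P \<phi>" "x \<in> grade M n"
  shows "lin_ext M P \<phi> x = \<phi> n x"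
proof -
  interpret M: gr_module K M by fact
  interpret P: module K P by fact
  note cl = gr_linD(1)[OF assms(3)] and z = gr_lin_zero[OF assms(1-3)]
  have "lin_ext M P \<phi> x = (\<Oplus>\<^bsub>P\<^esub>m\<in>{n}. \<phi> m (hcomp M x m))"
    using M.hcomp_homog[OF assms(4)] M.grade_carrier[OF assms(4)]
    by (intro M.lin_ext_superset) (use assms(2) cl z in auto)
  then show ?thesis using cl[OF assms(4)] by (simp add: M.hcomp_homog[OF assms(4)])
qed

definition gr_bilin :: "'k ring \<Rightarrow> ('k, 'v) dgmod \<Rightarrow> ('k, 'w) dgmod \<Rightarrow> ('k, 'p) dgmod \<Rightarrow>
    (int \<Rightarrow> int \<Rightarrow> 'v \<Rightarrow> 'w \<Rightarrow> 'p) \<Rightarrow> bool" where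
  "gr_bilin K M N P \<phi> \<longleftrightarrow> (\<forall>p. \<forall>x\<in>grade M p. gr_lin K N P (\<lambda>q. \<phi> p q x)) \<and>
     (\<forall>q. \<forall>y\<in>grade N q. gr_lin K M P (\<lambda>p x. \<phi> p q x y))"

text \<open>\<open>bilin_ext\<close> nests two extensions. This is what the outer one needs: at
  fixed y the inner extension is linear in homogeneous x, and that is compared on homogeneous
  y.\<close>

lemma gr_bilin_ext_aux:
  assumes "gr_module K M" "gr_module K N" "module K P" "gr_bilin K M N P \<phi>" and that: "y \<in> carrier N"
  shows "gr_lin K M P (\<lambda>p x. lin_ext N P (\<lambda>q y. \<phi> p q x y) y)"
proof -
  interpret M: gr_module K M by fact
  interpret N: gr_module K N by fact
  interpret P: module K P by fact
  have g2: "gr_lin K N P (\<lambda>q. \<phi> p q x)" if "x \<in> grade M p" for x p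
    using assms(4) that by (simp add: gr_bilin_def)
  have g1: "gr_lin K M P (\<lambda>p x. \<phi> p q x y)" if "y \<in> grade N q" for y q
    using assms(4) that by (simp add: gr_bilin_def)
  note le = klin_lin_ext[OF assms(2,3) g2] and lh = lin_ext_homog[OF assms(2,3) g2]
  show ?thesis
  proof (rule gr_linI)
    fix p x assume x: "x \<in> grade M p"
    show "lin_ext N P (\<lambda>q. \<phi> p q x) y \<in> carrier P"
      using klin_closed[OF le[OF x]] that by simp
    { fix x' assume x': "x' \<in> grade M p"
      show "lin_ext N P (\<lambda>q. \<phi> p q (x \<oplus>\<^bsub>M\<^esub> x')) y = lin_ext N P (\<lambda>q. \<phi> p q x) y \<oplus>\<^bsub>P\<^esub> lin_ext N P (\<lambda>q. \<phi> p q x') y"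
        by (rule N.klin_eqI[OF assms(3) le[OF M.grade_add[OF x x']] klin_plus[OF N.module_axioms assms(3) le[OF x] le[OF x']] _ that])
          (simp add: lh x x' M.grade_add gr_linD(2)[OF g1]) }
    { fix a assume a: "a \<in> carrier K"
      have "klin K N P (\<lambda>y. a \<odot>\<^bsub>P\<^esub> lin_ext N P (\<lambda>q. \<phi> p q x) y)"
        using le[OF x] a by (simp add: klin_def P.smult_r_distr smult_comm[OF assms(3)])
      then show "lin_ext N P (\<lambda>q. \<phi> p q (a \<odot>\<^bsub>M\<^esub> x)) y = a \<odot>\<^bsub>P\<^esub> lin_ext N P (\<lambda>q. \<phi> p q x) y"
        by (rule N.klin_eqI[OF assms(3) le[OF M.grade_smult[OF a x]] _ _ that])
          (simp add: lh x a M.grade_smult gr_linD(3)[OF g1]) }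
  qed
qed

text \<open>Linearity in x is that of the outer extension. Linearity in y is visible only for
  homogeneous x, where the outer extension disappears, and spreads by induction over x.\<close>

lemma kbilin_bilin_ext:
  assumes "gr_module K M" "gr_module K N" "module K P" "gr_bilin K M N P \<phi>"
  shows "kbilin K M N P (bilin_ext M N P \<phi>)"
proof -
  interpret M: gr_module K M by fact
  interpret N: gr_module K N by fact
  interpret P: module K P by fact
  have g2: "gr_lin K N P (\<lambda>q. \<phi> p q x)" if "x \<in> grade M p" for x p
    using assms(4) that by (simp add: gr_bilin_def)
  note aux = gr_bilin_ext_aux[OF assms]
  have 1: "klin K M P (\<lambda>x. bilin_ext M N P \<phi> x y)" if "y \<in> carrier N" for y
    unfolding bilin_ext_def using klin_lin_ext[OF assms(1,3) aux[OF that]] by simp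
  have h: "bilin_ext M N P \<phi> x y = lin_ext N P (\<lambda>q. \<phi> p q x) y" if "y \<in> carrier N" "x \<in> grade M p" for x y p
    unfolding bilin_ext_def using lin_ext_homog[OF assms(1,3) aux[OF that(1)] that(2)] by simp
  have "klin K N P (bilin_ext M N P \<phi> x)" if "x \<in> carrier M" for x
    using that
  proof (induction rule: M.homog_induct)
    case (homog p x)
    then show ?case
      using klin_cong[OF N.module_axioms h[OF _ homog]] klin_lin_ext[OF assms(2,3) g2[OF homog]] by simp
  next
    case (add x y)
    have "klin K N P (\<lambda>z. bilin_ext M N P \<phi> x z \<oplus>\<^bsub>P\<^esub> bilin_ext M N P \<phi> y z)"
      by (rule klin_plus[OF N.module_axioms assms(3) add(3,4)])
    with klin_cong[OF N.module_axioms klin_add[OF 1 add(1,2)]] show ?case by simp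
  qed
  with 1 show ?thesis by (simp add: kbilin_def)
qed

lemma bilin_ext_homog:
  assumes "gr_module K M" "gr_module K N" "module K P" "gr_bilin K M N P \<phi>" "x \<in> grade M p" "y \<in> grade N q"
  shows "bilin_ext M N P \<phi> x y = \<phi> p q x y"
proof -
  have g2: "gr_lin K N P (\<lambda>q. \<phi> p q x)"
    using assms(4,5) by (simp add: gr_bilin_def)
  have y: "y \<in> carrier N" by (rule gr_module.grade_carrier[OF assms(2,6)])
  show ?thesis unfolding bilin_ext_def
    using lin_ext_homog[OF assms(1,3) gr_bilin_ext_aux[OF assms(1-4) y] assms(5)] lin_ext_homog[OF assms(2,3) g2 assms(6)]
    by simp
qed

text \<open>Covers formulas such as (-1)^(pq) times a bilinear map, which are bilinear for every
  fixed pair of degrees.\<close>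

lemma kbilin_gr_bilin:
  assumes "gr_module K M" "gr_module K N" "\<And>p q. kbilin K M N P (\<phi> p q)"
  shows "gr_bilin K M N P \<phi>"
  unfolding gr_bilin_def
proof (intro conjI allI ballI)
  fix p x assume "x \<in> grade M p"
  then show "gr_lin K N P (\<lambda>q. \<phi> p q x)"
    using kbilinD2[OF assms(3)] gr_module.grade_carrier[OF assms(1)] by (blast intro: klin_gr_lin[OF assms(2)])
next
  fix q y assume "y \<in> grade N q"
  then show "gr_lin K M P (\<lambda>p x. \<phi> p q x y)"
    using kbilinD1[OF assms(3)] gr_module.grade_carrier[OF assms(2)] by (blast intro: klin_gr_lin[OF assms(1)])
qed

section \<open>Constructing graded modules\<close>

text \<open>Serves for records that differ in grading, differential or the meaningless ring fields;
  the module axioms depend on the fields listed.\<close>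

lemma module_transfer:
  fixes A B :: "('k, 'v) dgmod"
  assumes "module K A" "carrier B = carrier A" "add B = add A" "zero B = zero A" "smult B = smult A"
  shows "module K B"
proof -
  interpret A: module K A by fact
  have "add_monoid B = add_monoid A" by (simp add: assms(2-4))
  then have "abelian_group B"
    using A.a_comm_group A.a_comm_monoid
    by (simp add: abelian_group_def abelian_monoid_def abelian_group_axioms_def)
  then show ?thesis
    by (intro moduleI) (simp_all add: assms(2-) A.R.is_cring A.smult_l_distr A.smult_r_distr A.smult_assoc1)
qed

lemma fin_sums_subset:
  assumes "S \<subseteq> C" "z \<in> C" "\<And>x y. x \<in> C \<Longrightarrow> y \<in> C \<Longrightarrow> pl x y \<in> C"
  shows "fin_sums z pl S \<subseteq> C"
proof
  fix x assume "x \<in> fin_sums z pl S"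
  then show "x \<in> C" by induction (use assms in auto)
qed

context module
begin

text \<open>Hom carriers are declared as \<open>fin_sums\<close> of graded pieces. As the pieces are
  submodules, closure under negation comes from multiplication by -1 and the result is the submodule
  that they generate.\<close>

lemma submodule_fin_sums:
  assumes "\<And>n. submodule (G n) R M"
  shows "submodule (fin_sums \<zero>\<^bsub>M\<^esub> (add M) (\<Union>n. G n)) R M" and "G n \<subseteq> fin_sums \<zero>\<^bsub>M\<^esub> (add M) (\<Union>n. G n)"
proof -
  let ?F = "fin_sums \<zero>\<^bsub>M\<^esub> (add M) (\<Union>n. G n)"
  have sub: "?F \<subseteq> carrier M"
    by (rule fin_sums_subset) (use submoduleE(1)[OF assms] in auto)
  show G: "G n \<subseteq> ?F" for n
  proof
    fix x assume x: "x \<in> G n"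
    then have "x \<oplus>\<^bsub>M\<^esub> \<zero>\<^bsub>M\<^esub> \<in> ?F" by (intro fin_sums.intros) auto
    then show "x \<in> ?F" using subsetD[OF submoduleE(1)[OF assms] x] by simp
  qed
  have add: "x \<oplus>\<^bsub>M\<^esub> y \<in> ?F" if "x \<in> ?F" "y \<in> ?F" for x y
    using that(1)
  proof induction
    case fin_sums_zero then show ?case using that(2) sub by auto
  next
    case (fin_sums_add x x')
    then have "x \<in> carrier M" "x' \<in> carrier M" "y \<in> carrier M"
      using that sub submoduleE(1)[OF assms] by auto
    then show ?case using fin_sums.fin_sums_add[OF fin_sums_add(1,3)] by (simp add: M.a_assoc)
  qed
  have sm: "a \<odot>\<^bsub>M\<^esub> x \<in> ?F" if "a \<in> carrier R" "x \<in> ?F" for a x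
    using that(2)
  proof induction
    case fin_sums_zero then show ?case using that(1) by (simp add: fin_sums.fin_sums_zero)
  next
    case (fin_sums_add x x')
    then have "x \<in> carrier M" "x' \<in> carrier M" using sub submoduleE(1)[OF assms] by auto
    moreover have "a \<odot>\<^bsub>M\<^esub> x \<in> (\<Union>n. G n)"
      using fin_sums_add(1) submoduleE(4)[OF assms that(1)] by auto
    ultimately show ?case using fin_sums.fin_sums_add[OF _ fin_sums_add(3)] that(1) by (simp add: smult_r_distr)
  qed
  have "\<ominus>\<^bsub>M\<^esub> x \<in> ?F" if "x \<in> ?F" for x
    using sm[of "\<ominus> \<one>" x] that sub by (auto simp: smult_l_minus)
  then show "submodule ?F R M"
    by (intro submoduleI sub add sm fin_sums.fin_sums_zero)
qed

end

text \<open>Existence of a decomposition is generation by the graded pieces. For uniqueness, each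
  degree m has additive tests \<open>ev m i\<close> that vanish on all other degrees and jointly
  detect zero in degree m, so the m-th components of two decompositions have a difference that all
  tests kill.\<close>

lemma gr_module_unique_sumI:
  fixes H :: "('k, 'v) dgmod"
  assumes H: "module K H" and G: "\<And>n. submodule (grade H n) K H"
    and gen: "\<And>x. x \<in> carrier H \<Longrightarrow> x \<in> fin_sums \<zero>\<^bsub>H\<^esub> (add H) (\<Union>n. grade H n)"
    and Q: "\<And>m i. i \<in> I m \<Longrightarrow> abelian_group (Q m i)"
    and ev_cl: "\<And>m i x. i \<in> I m \<Longrightarrow> x \<in> carrier H \<Longrightarrow> ev m i x \<in> carrier (Q m i)"
    and ev_add: "\<And>m i x y. i \<in> I m \<Longrightarrow> x \<in> carrier H \<Longrightarrow> y \<in> carrier H \<Longrightarrow>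
      ev m i (x \<oplus>\<^bsub>H\<^esub> y) = ev m i x \<oplus>\<^bsub>Q m i\<^esub> ev m i y"
    and ev_off: "\<And>m n i x. i \<in> I m \<Longrightarrow> n \<noteq> m \<Longrightarrow> x \<in> grade H n \<Longrightarrow> ev m i x = \<zero>\<^bsub>Q m i\<^esub>"
    and sep: "\<And>m x. x \<in> grade H m \<Longrightarrow> (\<And>i. i \<in> I m \<Longrightarrow> ev m i x = \<zero>\<^bsub>Q m i\<^esub>) \<Longrightarrow> x = \<zero>\<^bsub>H\<^esub>"
  shows "gr_module K H"
proof -
  interpret H: module K H by fact
  have sub: "grade H n \<subseteq> carrier H" for n by (rule H.submoduleE(1)[OF G])
  have zero: "\<zero>\<^bsub>H\<^esub> \<in> grade H n" for n
    using subgroup.one_closed[OF submodule.axioms(1)[OF G]] by simp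
  have supp: "(\<Oplus>\<^bsub>H\<^esub>n\<in>{n. c n \<noteq> \<zero>\<^bsub>H\<^esub>}. c n) = (\<Oplus>\<^bsub>H\<^esub>n\<in>S. c n)"
    if "finite S" "{n. c n \<noteq> \<zero>\<^bsub>H\<^esub>} \<subseteq> S" "\<forall>n. c n \<in> grade H n" for c and S :: "int set"
    using that sub by (intro H.add.finprod_mono_neutral_cong_left) auto
  define dec where "dec x c \<longleftrightarrow> (\<forall>n. c n \<in> grade H n) \<and> finite {n. c n \<noteq> \<zero>\<^bsub>H\<^esub>} \<and>
      x = (\<Oplus>\<^bsub>H\<^esub>n\<in>{n. c n \<noteq> \<zero>\<^bsub>H\<^esub>}. c n)" for x c
  have ex: "\<exists>c. dec x c" if "x \<in> carrier H" for x
    using gen[OF that]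
  proof induction
    case fin_sums_zero
    have "dec \<zero>\<^bsub>H\<^esub> (\<lambda>_. \<zero>\<^bsub>H\<^esub>)" by (simp add: dec_def zero)
    then show ?case by blast
  next
    case (fin_sums_add x y)
    then obtain k c where x: "x \<in> grade H k" and c: "dec y c" by blast
    \<comment> \<open>Joining k to the support lets the new summand and the old decomposition run
      over the same index set.\<close>
    define S where "S = insert k {n. c n \<noteq> \<zero>\<^bsub>H\<^esub>}"
    define b where "b n = (if n = k then x else \<zero>\<^bsub>H\<^esub>)" for n
    have S: "finite S" and cg: "\<forall>n. c n \<in> grade H n" and bg: "\<forall>n. b n \<in> grade H n"
      using c x zero by (auto simp: dec_def S_def b_def)
    have "x = (\<Oplus>\<^bsub>H\<^esub>n\<in>{k}. b n)" using subsetD[OF sub x] by (simp add: b_def)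
    also have "\<dots> = (\<Oplus>\<^bsub>H\<^esub>n\<in>S. b n)"
      using S bg subsetD[OF sub x] by (intro H.add.finprod_mono_neutral_cong_left) (auto simp: S_def b_def)
    finally have x_eq: "x = (\<Oplus>\<^bsub>H\<^esub>n\<in>S. b n)" .
    have y_eq: "y = (\<Oplus>\<^bsub>H\<^esub>n\<in>S. c n)"
      using c supp[OF S _ cg] by (simp add: dec_def S_def subset_insertI)
    have "x \<oplus>\<^bsub>H\<^esub> y = (\<Oplus>\<^bsub>H\<^esub>n\<in>S. b n) \<oplus>\<^bsub>H\<^esub> (\<Oplus>\<^bsub>H\<^esub>n\<in>S. c n)"
      by (rule arg_cong2[OF x_eq y_eq])
    also have "\<dots> = (\<Oplus>\<^bsub>H\<^esub>n\<in>S. b n \<oplus>\<^bsub>H\<^esub> c n)"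
      using cg bg sub by (intro H.add.finprod_multf[symmetric]) auto
    finally have eq: "x \<oplus>\<^bsub>H\<^esub> y = (\<Oplus>\<^bsub>H\<^esub>n\<in>S. b n \<oplus>\<^bsub>H\<^esub> c n)" .
    have g: "\<forall>n. b n \<oplus>\<^bsub>H\<^esub> c n \<in> grade H n"
      using bg cg H.submoduleE(5)[OF G] by blast
    have sS: "{n. b n \<oplus>\<^bsub>H\<^esub> c n \<noteq> \<zero>\<^bsub>H\<^esub>} \<subseteq> S"
      by (auto simp: S_def b_def)
    have "dec (x \<oplus>\<^bsub>H\<^esub> y) (\<lambda>n. b n \<oplus>\<^bsub>H\<^esub> c n)"
      unfolding dec_def eq using g finite_subset[OF sS S] supp[OF S sS g] by auto
    then show ?case by blast
  qed
  have uniq: "c = c'" if "dec x c" "dec x c'" for x c c'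
  proof
    fix m
    define S where "S = insert m ({n. c n \<noteq> \<zero>\<^bsub>H\<^esub>} \<union> {n. c' n \<noteq> \<zero>\<^bsub>H\<^esub>})"
    have S: "finite S" and cg: "\<forall>n. c n \<in> grade H n" and cg': "\<forall>n. c' n \<in> grade H n"
      using that by (auto simp: dec_def S_def)
    have xc: "x = (\<Oplus>\<^bsub>H\<^esub>n\<in>S. c n)" and xc': "x = (\<Oplus>\<^bsub>H\<^esub>n\<in>S. c' n)"
      using that supp[OF S _ cg] supp[OF S _ cg'] by (auto simp: dec_def S_def)
    have evs: "ev m i (\<Oplus>\<^bsub>H\<^esub>n\<in>S. b n) = ev m i (b m)" if i: "i \<in> I m" and b: "\<forall>n. b n \<in> grade H n" for i b
    proof -
      interpret Q: abelian_group "Q m i" by (rule Q[OF i])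
      have bc: "b n \<in> carrier H" for n using b sub by blast
      \<comment> \<open>Zero lies in every degree, in particular in degree m + 1, so the off-degree
        rule applies to it.\<close>
      have z: "ev m i \<zero>\<^bsub>H\<^esub> = \<zero>\<^bsub>Q m i\<^esub>"
        using ev_off[OF i, of "m + 1"] zero by simp
      have *: "ev m i (\<Oplus>\<^bsub>H\<^esub>n\<in>S'. b n) = \<zero>\<^bsub>Q m i\<^esub>" if "finite S'" "m \<notin> S'" for S'
        using that
      proof (induction S' rule: finite_induct)
        case (insert n S')
        have "(\<Oplus>\<^bsub>H\<^esub>n\<in>S'. b n) \<in> carrier H" using bc by auto
        then show ?case
          using insert ev_add[OF i] ev_off[OF i, of n] bc b by (simp add: Pi_def)
      qed (simp add: z)
      have "(\<Oplus>\<^bsub>H\<^esub>n\<in>S - {m}. b n) \<in> carrier H" using bc by auto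
      moreover have "(\<Oplus>\<^bsub>H\<^esub>n\<in>insert m (S - {m}). b n) = b m \<oplus>\<^bsub>H\<^esub> (\<Oplus>\<^bsub>H\<^esub>n\<in>S - {m}. b n)"
        using S bc by (intro H.finsum_insert) auto
      moreover have "insert m (S - {m}) = S" by (auto simp: S_def)
      ultimately show ?thesis
        using ev_add[OF i bc, of _ m] *[of "S - {m}"] S ev_cl[OF i bc] by simp
    qed
    have eq: "ev m i (c m) = ev m i (c' m)" if "i \<in> I m" for i
      using evs[OF that cg] evs[OF that cg'] xc xc' by simp
    have cc: "c m \<in> carrier H" "c' m \<in> carrier H" using cg cg' sub by auto
    have "c m \<oplus>\<^bsub>H\<^esub> (\<ominus>\<^bsub>H\<^esub> c' m) = \<zero>\<^bsub>H\<^esub>"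
    proof (rule sep)
      show "c m \<oplus>\<^bsub>H\<^esub> (\<ominus>\<^bsub>H\<^esub> c' m) \<in> grade H m"
        using cg cg' H.submoduleE(3,5)[OF G] by blast
      fix i assume i: "i \<in> I m"
      interpret Q: abelian_group "Q m i" by (rule Q[OF i])
      have "ev m i (c m \<oplus>\<^bsub>H\<^esub> (\<ominus>\<^bsub>H\<^esub> c' m)) = ev m i (c' m \<oplus>\<^bsub>H\<^esub> (\<ominus>\<^bsub>H\<^esub> c' m))"
        using cc eq[OF i] by (simp add: ev_add[OF i])
      then show "ev m i (c m \<oplus>\<^bsub>H\<^esub> (\<ominus>\<^bsub>H\<^esub> c' m)) = \<zero>\<^bsub>Q m i\<^esub>"
        using cc ev_off[OF i, of "m + 1" "\<zero>\<^bsub>H\<^esub>"] zero by (simp add: H.r_neg)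
    qed
    then show "c m = c' m"
      using cc by (metis H.a_inv_closed H.minus_minus H.minus_equality)
  qed
  show ?thesis
    by (intro gr_module.intro gr_module_axioms.intro H G)
      (use ex uniq in \<open>unfold dec_def, blast\<close>)
qed

text \<open>Since d d is linear, its vanishing is a question about homogeneous elements.\<close>

lemma dg_moduleI:
  assumes "gr_module K H" "klin K H H (dif H)"
    "\<And>n x. x \<in> grade H n \<Longrightarrow> dif H x \<in> grade H (n + 1)"
    "\<And>n x. x \<in> grade H n \<Longrightarrow> dif H (dif H x) = \<zero>\<^bsub>H\<^esub>"
  shows "dg_module K H"
proof -
  interpret H: gr_module K H by fact
  have "klin K H H (\<lambda>x. dif H (dif H x))" by (rule klin_comp[OF assms(2,2)])
  moreover have "klin K H H (\<lambda>x. \<zero>\<^bsub>H\<^esub>)" by (simp add: klin_def)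
  ultimately have "dif H (dif H x) = \<zero>\<^bsub>H\<^esub>" if "x \<in> carrier H" for x
    by (rule H.klin_eqI[OF H.module_axioms _ _ _ that]) (use assms(4) in auto)
  then show ?thesis
    using assms by (intro dg_module.intro dg_module_axioms.intro H.module_axioms H.grade_submodule H.direct_sum)
      (auto simp: klin_def)
qed

lemma dg_module_klin_dif: "dg_module K M \<Longrightarrow> klin K M M (dif M)"
  by (simp add: klin_def dg_module.dif_closed dg_module.dif_add dg_module.dif_smult)

text \<open>An ambient module with neither grading nor differential. Families of maps live here, and
  the pieces of \<open>gr_hom\<close> and \<open>mnat\<close> become submodules of it, so that the
  module axioms are proved once.\<close>

definition pi_mod :: "'k ring \<Rightarrow> 'i set \<Rightarrow> ('i \<Rightarrow> ('k, 'v) dgmod) \<Rightarrow> ('k, 'i \<Rightarrow> 'v) dgmod" where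
  "pi_mod K I X = \<lparr>carrier = (\<Pi>\<^sub>E i\<in>I. carrier (X i)), mult = undefined, one = undefined,
     zero = (\<lambda>i\<in>I. \<zero>\<^bsub>X i\<^esub>), add = (\<lambda>f g. \<lambda>i\<in>I. f i \<oplus>\<^bsub>X i\<^esub> g i),
     smult = (\<lambda>a f. \<lambda>i\<in>I. a \<odot>\<^bsub>X i\<^esub> f i), grade = undefined, dif = undefined\<rparr>"

lemma pi_mod_simps [simp]:
  "carrier (pi_mod K I X) = (\<Pi>\<^sub>E i\<in>I. carrier (X i))"
  "zero (pi_mod K I X) = (\<lambda>i\<in>I. \<zero>\<^bsub>X i\<^esub>)"
  "add (pi_mod K I X) = (\<lambda>f g. \<lambda>i\<in>I. f i \<oplus>\<^bsub>X i\<^esub> g i)"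
  "smult (pi_mod K I X) = (\<lambda>a f. \<lambda>i\<in>I. a \<odot>\<^bsub>X i\<^esub> f i)"
  by (simp_all add: pi_mod_def)

lemma module_pi_mod:
  assumes "cring K" "\<And>i. i \<in> I \<Longrightarrow> module K (X i)"
  shows "module K (pi_mod K I X)"
proof (rule moduleI[OF assms(1)])
  note ag = module_abelian_group[OF assms(2)]
  show "abelian_group (pi_mod K I X)"
  proof (rule abelian_groupI)
    fix f assume f: "f \<in> carrier (pi_mod K I X)"
    then have fi: "f i \<in> carrier (X i)" if "i \<in> I" for i using that by auto
    show "\<zero>\<^bsub>pi_mod K I X\<^esub> \<oplus>\<^bsub>pi_mod K I X\<^esub> f = f"
      using f fi by (auto simp: PiE_iff abelian_groupE(5)[OF ag] intro!: extensionalityI[of _ I])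
    have "\<ominus>\<^bsub>X i\<^esub> f i \<in> carrier (X i)" "\<ominus>\<^bsub>X i\<^esub> f i \<oplus>\<^bsub>X i\<^esub> f i = \<zero>\<^bsub>X i\<^esub>" if "i \<in> I" for i
      using abelian_group.a_inv_closed[OF ag fi] abelian_group.l_neg[OF ag fi] that by blast+
    with f show "\<exists>g\<in>carrier (pi_mod K I X). g \<oplus>\<^bsub>pi_mod K I X\<^esub> f = \<zero>\<^bsub>pi_mod K I X\<^esub>"
      by (intro bexI[of _ "\<lambda>i\<in>I. \<ominus>\<^bsub>X i\<^esub> f i"])
        (auto intro!: restrict_ext)
  qed (auto simp: PiE_iff abelian_groupE(1-3)[OF ag] intro!: restrict_ext abelian_groupE(4)[OF ag])
qed (auto simp: PiE_iff module.smult_closed[OF assms(2)] module.smult_l_distr[OF assms(2)]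
    module.smult_r_distr[OF assms(2)] module.smult_assoc1[OF assms(2)] module.smult_one[OF assms(2)]
    abelian_groupE(1)[OF module_abelian_group[OF assms(2)]] intro!: restrict_ext extensionalityI[of _ I])

text \<open>Closure under negation follows from scalars, as -x is (-1) x.\<close>

lemma submoduleI':
  assumes "module K P" "G \<subseteq> carrier P" "\<zero>\<^bsub>P\<^esub> \<in> G"
    "\<And>x y. x \<in> G \<Longrightarrow> y \<in> G \<Longrightarrow> x \<oplus>\<^bsub>P\<^esub> y \<in> G"
    "\<And>a x. a \<in> carrier K \<Longrightarrow> x \<in> G \<Longrightarrow> a \<odot>\<^bsub>P\<^esub> x \<in> G"
  shows "submodule G K P"
proof -
  interpret P: module K P by fact
  have "\<ominus>\<^bsub>P\<^esub> x \<in> G" if "x \<in> G" for x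
    using assms(5)[of "\<ominus>\<^bsub>K\<^esub> \<one>\<^bsub>K\<^esub>" x] that assms(2) by (auto simp: P.smult_l_minus)
  then show ?thesis by (intro P.submoduleI) (use assms in auto)
qed

text \<open>The form in which Hom modules arise: operations of a larger module P, carrier generated
  by the graded pieces. The tests of \<open>gr_module_unique_sumI\<close> can then be defined on all
  of P.\<close>

lemma gr_module_fin_sumsI:
  fixes P H :: "('k, 'v) dgmod"
  assumes P: "module K P" and G: "\<And>n. submodule (grade H n) K P"
    and H: "carrier H = fin_sums \<zero>\<^bsub>P\<^esub> (add P) (\<Union>n. grade H n)" "add H = add P" "zero H = zero P" "smult H = smult P"
    and Q: "\<And>m i. i \<in> I m \<Longrightarrow> abelian_group (Q m i)"
    and ev_cl: "\<And>m i x. i \<in> I m \<Longrightarrow> x \<in> carrier P \<Longrightarrow> ev m i x \<in> carrier (Q m i)"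
    and ev_add: "\<And>m i x y. i \<in> I m \<Longrightarrow> x \<in> carrier P \<Longrightarrow> y \<in> carrier P \<Longrightarrow>
      ev m i (x \<oplus>\<^bsub>P\<^esub> y) = ev m i x \<oplus>\<^bsub>Q m i\<^esub> ev m i y"
    and ev_off: "\<And>m n i x. i \<in> I m \<Longrightarrow> n \<noteq> m \<Longrightarrow> x \<in> grade H n \<Longrightarrow> ev m i x = \<zero>\<^bsub>Q m i\<^esub>"
    and sep: "\<And>m x. x \<in> grade H m \<Longrightarrow> (\<And>i. i \<in> I m \<Longrightarrow> ev m i x = \<zero>\<^bsub>Q m i\<^esub>) \<Longrightarrow> x = \<zero>\<^bsub>P\<^esub>"
  shows "gr_module K H" and "carrier H \<subseteq> carrier P"
proof -
  interpret P: module K P by fact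
  have S: "submodule (carrier H) K P" and sub: "grade H n \<subseteq> carrier H" for n
    unfolding H using P.submodule_fin_sums[of "grade H", OF G] by simp_all
  show CP: "carrier H \<subseteq> carrier P" by (rule P.submoduleE(1)[OF S])
  have mH: "module K H"
    by (rule module_transfer[OF submodule.submodule_is_module[OF S P]]) (simp_all add: H)
  show "gr_module K H"
  proof (rule gr_module_unique_sumI[where I = I and Q = Q and ev = ev, OF mH])
    show "submodule (grade H n) K H" for n
      using P.submoduleE[OF G[of n]] subgroup.one_closed[OF submodule.axioms(1)[OF G[of n]]] sub[of n]
      by (intro submoduleI'[OF mH]) (simp_all add: H)
  qed (use CP in \<open>auto simp: H intro: Q ev_cl ev_add ev_off sep\<close>)
qed

section \<open>The dg module of graded maps\<close>

lemma hom_degI: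
  assumes "klin K M N f" "f \<in> extensional (carrier M)" "\<And>p x. x \<in> grade M p \<Longrightarrow> f x \<in> grade N (p + n)"
  shows "f \<in> hom_deg K M N n"
  using assms by (auto simp: hom_deg_def klin_def PiE_iff)

lemma hom_degD:
  assumes "f \<in> hom_deg K M N n"
  shows "klin K M N f" and "f \<in> extensional (carrier M)" and "x \<in> grade M p \<Longrightarrow> f x \<in> grade N (p + n)"
  using assms by (auto simp: hom_deg_def klin_def PiE_iff)

lemma gr_hom_simps [simp]:
  "carrier (gr_hom K M N) = fin_sums (\<lambda>x\<in>carrier M. \<zero>\<^bsub>N\<^esub>) (\<lambda>f g. \<lambda>x\<in>carrier M. f x \<oplus>\<^bsub>N\<^esub> g x) (\<Union>n. hom_deg K M N n)"
  "add (gr_hom K M N) = (\<lambda>f g. \<lambda>x\<in>carrier M. f x \<oplus>\<^bsub>N\<^esub> g x)"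
  "zero (gr_hom K M N) = (\<lambda>x\<in>carrier M. \<zero>\<^bsub>N\<^esub>)"
  "smult (gr_hom K M N) = (\<lambda>a f. \<lambda>x\<in>carrier M. a \<odot>\<^bsub>N\<^esub> f x)"
  "grade (gr_hom K M N) = hom_deg K M N"
  by (simp_all add: gr_hom_def Let_def)

lemma dg_hom_simps [simp]:
  "add (dg_hom K M N) = (\<lambda>f g. \<lambda>x\<in>carrier M. f x \<oplus>\<^bsub>N\<^esub> g x)"
  "zero (dg_hom K M N) = (\<lambda>x\<in>carrier M. \<zero>\<^bsub>N\<^esub>)"
  "smult (dg_hom K M N) = (\<lambda>a f. \<lambda>x\<in>carrier M. a \<odot>\<^bsub>N\<^esub> f x)"
  "grade (dg_hom K M N) = hom_deg K M N"
  by (simp_all add: dg_hom_def Let_def)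

lemma carrier_dg_hom: "carrier (dg_hom K M N) = carrier (gr_hom K M N)"
  by (simp add: dg_hom_def Let_def)

context
  fixes K :: "'k ring" and M :: "('k, 'v) dgmod" and N :: "('k, 'w) dgmod"
  assumes M: "gr_module K M" and N: "gr_module K N"
begin

interpretation M: gr_module K M by (rule M)
interpretation N: gr_module K N by (rule N)

private abbreviation "P \<equiv> pi_mod K (carrier M) (\<lambda>_. N)"

lemma submodule_hom_deg: "submodule (hom_deg K M N n) K P"
proof (rule submoduleI')
  show "module K P" by (rule module_pi_mod[OF M.R.is_cring N.module_axioms])
  show "\<zero>\<^bsub>P\<^esub> \<in> hom_deg K M N n"
    by (auto intro!: hom_degI klinI simp: N.grade_zero M.grade_carrier)
  fix f assume f: "f \<in> hom_deg K M N n"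
  note fc = klin_closed[OF hom_degD(1)[OF f]]
  { fix g assume g: "g \<in> hom_deg K M N n"
    note gc = klin_closed[OF hom_degD(1)[OF g]]
    have "klin K M N (f \<oplus>\<^bsub>P\<^esub> g)"
      using klin_plus[OF M.module_axioms N.module_axioms hom_degD(1)[OF f] hom_degD(1)[OF g]]
      by (subst klin_cong[OF M.module_axioms]) auto
    then show "f \<oplus>\<^bsub>P\<^esub> g \<in> hom_deg K M N n"
      by (rule hom_degI)
        (auto simp: M.grade_carrier intro!: N.grade_add hom_degD(3)[OF f] hom_degD(3)[OF g]) }
  fix a assume a: "a \<in> carrier K"
  have "klin K M N (a \<odot>\<^bsub>P\<^esub> f)"
    by (rule klinI) (simp_all add: a fc klin_add[OF hom_degD(1)[OF f]] klin_smult[OF hom_degD(1)[OF f]]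
        N.smult_r_distr smult_comm[OF N.module_axioms a])
  then show "a \<odot>\<^bsub>P\<^esub> f \<in> hom_deg K M N n"
    by (rule hom_degI) (auto simp: M.grade_carrier intro!: N.grade_smult a hom_degD(3)[OF f])
qed (auto simp: hom_deg_def)

text \<open>A map of degree n sends degree p to degree p + n. The test for degree m at a homogeneous
  x of degree p is therefore the component of f x in degree p + m, which vanishes for maps of any
  other degree.\<close>

lemma gr_module_gr_hom: "gr_module K (gr_hom K M N)"
proof (rule gr_module_fin_sumsI(1)[where P = P and I = "\<lambda>m. {(p, x). x \<in> grade M p}" and Q = "\<lambda>_ _. N"
        and ev = "\<lambda>m (p, x) f. hcomp N (f x) (p + m)"])
  show "module K P" by (rule module_pi_mod[OF M.R.is_cring N.module_axioms])
  fix m :: int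
  { fix i assume i: "i \<in> {(p, x). x \<in> grade M p}"
    { fix f assume f: "f \<in> carrier P"
      show "(case i of (p, x) \<Rightarrow> \<lambda>f. hcomp N (f x) (p + m)) f \<in> carrier N"
        using i f M.grade_carrier by (force intro: N.hcomp_closed)
      fix g assume "g \<in> carrier P"
      then show "(case i of (p, x) \<Rightarrow> \<lambda>f. hcomp N (f x) (p + m)) (f \<oplus>\<^bsub>P\<^esub> g) =
          (case i of (p, x) \<Rightarrow> \<lambda>f. hcomp N (f x) (p + m)) f \<oplus>\<^bsub>N\<^esub> (case i of (p, x) \<Rightarrow> \<lambda>f. hcomp N (f x) (p + m)) g"
        using i f M.grade_carrier by (force simp: PiE_iff intro!: N.hcomp_add) }
    fix n f assume "n \<noteq> m" "f \<in> grade (gr_hom K M N) n"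
    then show "(case i of (p, x) \<Rightarrow> \<lambda>f. hcomp N (f x) (p + m)) f = \<zero>\<^bsub>N\<^esub>"
      using i by (auto simp: N.hcomp_homog[OF hom_degD(3)]) }
  fix f assume "f \<in> grade (gr_hom K M N) m"
    and z: "\<And>i. i \<in> {(p, x). x \<in> grade M p} \<Longrightarrow> (case i of (p, x) \<Rightarrow> \<lambda>f. hcomp N (f x) (p + m)) f = \<zero>\<^bsub>N\<^esub>"
  then have f: "f \<in> hom_deg K M N m" by simp
  have "f x = \<zero>\<^bsub>N\<^esub>" if "x \<in> grade M p" for p x
    using z[of "(p, x)"] that by (simp add: N.hcomp_homog[OF hom_degD(3)[OF f that]])
  then have "f x = \<zero>\<^bsub>N\<^esub>" if "x \<in> carrier M" for x
    using M.klin_eqI[OF N.module_axioms hom_degD(1)[OF f], of "\<lambda>_. \<zero>\<^bsub>N\<^esub>"] that by (simp add: klin_def)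
  then show "f = \<zero>\<^bsub>P\<^esub>"
    using hom_degD(2)[OF f] by (auto intro!: extensionalityI[of _ "carrier M"])
qed (simp_all add: submodule_hom_deg module_abelian_group[OF N.module_axioms])

lemma dg_hom_carrierD:
  assumes "f \<in> carrier (dg_hom K M N)"
  shows "klin K M N f" and "f \<in> extensional (carrier M)"
proof -
  have "f \<in> fin_sums (\<lambda>x\<in>carrier M. \<zero>\<^bsub>N\<^esub>) (\<lambda>f g. \<lambda>x\<in>carrier M. f x \<oplus>\<^bsub>N\<^esub> g x) (\<Union>n. hom_deg K M N n)"
    using assms by (simp add: carrier_dg_hom)
  then have "klin K M N f \<and> f \<in> extensional (carrier M)"
  proof induction
    case fin_sums_zero
    then show ?case by (simp add: klin_def extensional_def)
  next
    case (fin_sums_add f g)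
    then have "klin K M N (\<lambda>x. f x \<oplus>\<^bsub>N\<^esub> g x)"
      using klin_plus[OF M.module_axioms N.module_axioms] hom_degD(1) by blast
    then show ?case by (subst klin_cong[OF M.module_axioms, of _ "\<lambda>x. f x \<oplus>\<^bsub>N\<^esub> g x"]) auto
  qed
  then show "klin K M N f" and "f \<in> extensional (carrier M)" by auto
qed

end

lemma gr_module_transfer:
  fixes A B :: "('k, 'v) dgmod"
  assumes "gr_module K A" "carrier B = carrier A" "add B = add A" "zero B = zero A" "smult B = smult A" "grade B = grade A"
  shows "gr_module K B"
proof -
  interpret A: gr_module K A by fact
  have mB: "module K B" by (rule module_transfer[OF A.module_axioms assms(2-5)])
  have am: "add_monoid B = add_monoid A" by (simp add: assms(2-4))
  have "submodule (grade B n) K B" for n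
    using A.submoduleE[OF A.grade_submodule[of n]] A.grade_zero
    by (intro submoduleI'[OF mB]) (simp_all add: assms)
  moreover have "finsum B c S = finsum A c S" for c and S :: "int set"
    by (simp add: finsum_def am)
  ultimately show ?thesis
    using A.direct_sum by (intro gr_module.intro gr_module_axioms.intro mB) (simp_all add: assms)
qed

lemmas dif_carrier = dg_module.dif_closed
lemmas dif_grade = dg_module.dif_grade

context
  fixes K :: "'k ring" and M :: "('k, 'v) dgmod" and N :: "('k, 'w) dgmod"
  assumes M: "dg_module K M" and N: "dg_module K N"
begin

interpretation M: gr_module K M by (rule dg_module_gr_module[OF M])
interpretation N: gr_module K N by (rule dg_module_gr_module[OF N])

private abbreviation "\<delta> n \<alpha> \<equiv> (\<lambda>x\<in>carrier M. dif N (\<alpha> x) \<ominus>\<^bsub>N\<^esub> sg N n (\<alpha> (dif M x)))"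

lemma klin_commutator:
  assumes "klin K M N f"
  shows "klin K M N (\<lambda>x. dif N (f x) \<ominus>\<^bsub>N\<^esub> sg N n (f (dif M x)))"
proof -
  have "klin K M N (\<lambda>x. dif N (f x) \<oplus>\<^bsub>N\<^esub> sg N (n + 1) (f (dif M x)))"
    by (intro klin_plus[OF M.module_axioms N.module_axioms] klin_comp[OF assms] klin_sg_fun[OF N.module_axioms]
        klin_comp[OF dg_module_klin_dif[OF M] assms] dg_module_klin_dif[OF N])
  \<comment> \<open>Raising the exponent of the sign by one absorbs the subtraction, so the
    commutator is a sum of two linear maps.\<close>
  moreover have "(\<ominus>\<^bsub>N\<^esub> sg N n (f (dif M x))) = sg N (n + 1) (f (dif M x))" if "x \<in> carrier M" for x
    using that by (simp add: sg_def klin_closed[OF assms] dif_carrier[OF M])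
  ultimately show ?thesis by (subst klin_cong[OF M.module_axioms]) (auto simp: a_minus_def)
qed

lemma commutator_hom_deg:
  assumes "f \<in> hom_deg K M N n"
  shows "\<delta> n f \<in> hom_deg K M N (n + 1)"
proof (rule hom_degI)
  show "klin K M N (\<delta> n f)"
    using klin_commutator[OF hom_degD(1)[OF assms]] by (subst klin_cong[OF M.module_axioms]) auto
  fix p x assume x: "x \<in> grade M p"
  have "dif N (f x) \<in> grade N (p + (n + 1))" "sg N n (f (dif M x)) \<in> grade N (p + (n + 1))"
    using dif_grade[OF N hom_degD(3)[OF assms x]]
      N.grade_sg[OF hom_degD(3)[OF assms dif_grade[OF M x]]] by (simp_all add: ac_simps)
  then show "\<delta> n f x \<in> grade N (p + (n + 1))"
    using M.grade_carrier[OF x] by (simp add: a_minus_def N.grade_add N.grade_minus)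
qed auto

private lemma H: "gr_module K (gr_hom K M N)"
  by (rule gr_module_gr_hom[OF M.gr_module_axioms N.gr_module_axioms])

lemma gr_lin_commutator: "gr_lin K (gr_hom K M N) (gr_hom K M N) \<delta>"
proof (rule gr_linI)
  interpret H: gr_module K "gr_hom K M N" by (rule H)
  fix n f assume "f \<in> grade (gr_hom K M N) n"
  then have f: "f \<in> hom_deg K M N n" by simp
  have cl: "f x \<in> carrier N" if "x \<in> carrier M" for x using klin_closed[OF hom_degD(1)[OF f] that] .
  show "\<delta> n f \<in> carrier (gr_hom K M N)"
    by (rule H.grade_carrier[of _ "n + 1"]) (simp add: commutator_hom_deg[OF f])
  { fix g assume "g \<in> grade (gr_hom K M N) n"
    then have g: "g \<in> hom_deg K M N n" by simp
    have clg: "g x \<in> carrier N" if "x \<in> carrier M" for x using klin_closed[OF hom_degD(1)[OF g] that] .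
    have "dif N (f x \<oplus>\<^bsub>N\<^esub> g x) \<ominus>\<^bsub>N\<^esub> sg N n (f (dif M x) \<oplus>\<^bsub>N\<^esub> g (dif M x)) =
      dif N (f x) \<ominus>\<^bsub>N\<^esub> sg N n (f (dif M x)) \<oplus>\<^bsub>N\<^esub> (dif N (g x) \<ominus>\<^bsub>N\<^esub> sg N n (g (dif M x)))" if x: "x \<in> carrier M" for x
    proof -
      note [simp] = cl[OF x] cl[OF dif_carrier[OF M x]] clg[OF x] clg[OF dif_carrier[OF M x]] dif_carrier[OF N]
      show ?thesis by (simp add: klin_add[OF dg_module_klin_dif[OF N]] sg_def a_minus_def N.minus_add N.a_ac)
    qed
    then show "\<delta> n (f \<oplus>\<^bsub>gr_hom K M N\<^esub> g) = \<delta> n f \<oplus>\<^bsub>gr_hom K M N\<^esub> \<delta> n g"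
      by (auto simp: dif_carrier[OF M] intro!: restrict_ext) }
  fix a assume a: "a \<in> carrier K"
  have "dif N (a \<odot>\<^bsub>N\<^esub> f x) \<ominus>\<^bsub>N\<^esub> sg N n (a \<odot>\<^bsub>N\<^esub> f (dif M x)) =
    a \<odot>\<^bsub>N\<^esub> (dif N (f x) \<ominus>\<^bsub>N\<^esub> sg N n (f (dif M x)))" if x: "x \<in> carrier M" for x
  proof -
    note [simp] = cl[OF x] cl[OF dif_carrier[OF M x]] dif_carrier[OF N]
    show ?thesis by (simp add: a klin_smult[OF dg_module_klin_dif[OF N]] sg_def a_minus_def
          N.smult_r_distr N.smult_r_minus)
  qed
  then show "\<delta> n (a \<odot>\<^bsub>gr_hom K M N\<^esub> f) = a \<odot>\<^bsub>gr_hom K M N\<^esub> \<delta> n f"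
    by (auto simp: dif_carrier[OF M] intro!: restrict_ext)
qed

lemma dif_dg_hom: "dif (dg_hom K M N) = lin_ext (gr_hom K M N) (gr_hom K M N) \<delta>"
  by (simp add: dg_hom_def Let_def)

lemma dif_dg_hom_homog: "f \<in> hom_deg K M N n \<Longrightarrow> dif (dg_hom K M N) f = \<delta> n f"
  unfolding dif_dg_hom
  by (rule lin_ext_homog[OF H gr_module_module[OF H] gr_lin_commutator]) simp

lemma dg_module_dg_hom: "dg_module K (dg_hom K M N)"
proof (rule dg_moduleI)
  interpret H: gr_module K "gr_hom K M N" by (rule H)
  show gm: "gr_module K (dg_hom K M N)"
    by (rule gr_module_transfer[OF H]) (simp_all only: carrier_dg_hom gr_hom_simps dg_hom_simps)
  have "klin K (gr_hom K M N) (gr_hom K M N) (dif (dg_hom K M N))"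
    unfolding dif_dg_hom by (rule klin_lin_ext[OF H H.module_axioms gr_lin_commutator])
  then show "klin K (dg_hom K M N) (dg_hom K M N) (dif (dg_hom K M N))"
    unfolding klin_def carrier_dg_hom by simp
  fix n f assume "f \<in> grade (dg_hom K M N) n"
  then have f: "f \<in> hom_deg K M N n" by simp
  have cl: "f x \<in> carrier N" if "x \<in> carrier M" for x using klin_closed[OF hom_degD(1)[OF f] that] .
  show "dif (dg_hom K M N) f \<in> grade (dg_hom K M N) (n + 1)"
    using commutator_hom_deg[OF f] by (simp add: dif_dg_hom_homog[OF f])
  \<comment> \<open>Expanding gives d(d(f x)) and f(d(d x)), which vanish, and two copies of d(f(d
    x)) whose signs, governed by n and n + 1, are opposite.\<close>
  have "\<delta> (n + 1) (\<delta> n f) x = \<zero>\<^bsub>N\<^esub>" if x: "x \<in> carrier M" for x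
  proof -
    note [simp] = cl[OF x] cl[OF dif_carrier[OF M x]] dif_carrier[OF N] dif_carrier[OF M x]
    have z: "dif N \<zero>\<^bsub>N\<^esub> = \<zero>\<^bsub>N\<^esub>" "f \<zero>\<^bsub>M\<^esub> = \<zero>\<^bsub>N\<^esub>"
      using klin_zero[OF _ _ dg_module_klin_dif[OF N]] klin_zero[OF _ _ hom_degD(1)[OF f]]
        M.module_axioms N.module_axioms by auto
    have n0: "\<ominus>\<^bsub>N\<^esub> \<zero>\<^bsub>N\<^esub> = \<zero>\<^bsub>N\<^esub>" by (rule N.minus_equality) simp_all
    show ?thesis
      by (simp add: x dg_module.dif_dif[OF M] dg_module.dif_dif[OF N] a_minus_def z n0 sg_def
          klin_add[OF dg_module_klin_dif[OF N]] klin_minus[OF N.module_axioms N.module_axioms dg_module_klin_dif[OF N]]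
          N.r_neg N.l_neg)
  qed
  then show "dif (dg_hom K M N) (dif (dg_hom K M N) f) = \<zero>\<^bsub>dg_hom K M N\<^esub>"
    by (auto simp: dif_dg_hom_homog[OF f] dif_dg_hom_homog[OF commutator_hom_deg[OF f]] intro!: restrict_ext)
qed

interpretation MN: dg_module K "dg_hom K M N" by (rule dg_module_dg_hom)

lemma hom_deg_carrier: "f \<in> hom_deg K M N n \<Longrightarrow> f \<in> carrier (dg_hom K M N)"
  using gr_module.grade_carrier[OF dg_module_gr_module[OF dg_module_dg_hom]] by fastforce

text \<open>The additive inverse of a Hom module is defined by a description, not pointwise. Writing
  it as multiplication by -1, an operation given by a formula, makes the sign pointwise.\<close>

lemma sg_dg_hom:
  assumes "f \<in> carrier (dg_hom K M N)"
  shows "sg (dg_hom K M N) n f = (\<lambda>x\<in>carrier M. sg N n (f x))"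
proof -
  note f = dg_hom_carrierD[OF M.gr_module_axioms N.gr_module_axioms assms]
  have "\<ominus>\<^bsub>dg_hom K M N\<^esub> f = (\<ominus>\<^bsub>K\<^esub> \<one>\<^bsub>K\<^esub>) \<odot>\<^bsub>dg_hom K M N\<^esub> f"
    using assms by (simp only: MN.smult_l_minus M.R.one_closed MN.smult_one)
  also have "\<dots> = (\<lambda>x\<in>carrier M. \<ominus>\<^bsub>N\<^esub> f x)"
    using klin_closed[OF f(1)] by (auto simp: N.smult_l_minus intro!: restrict_ext)
  finally show ?thesis using f(2) by (auto simp: sg_def extensional_restrict)
qed

text \<open>The definition of d(f) solved for d(f x): a Leibniz rule for evaluation, without
  subtraction.\<close>

lemma dif_eval:
  assumes f: "f \<in> hom_deg K M N n" and x: "x \<in> carrier M"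
  shows "dif N (f x) = dif (dg_hom K M N) f x \<oplus>\<^bsub>N\<^esub> sg N n (f (dif M x))"
proof -
  note [simp] = klin_closed[OF hom_degD(1)[OF f]]
  show ?thesis
    using x by (simp add: dif_dg_hom_homog[OF f] a_minus_def sg_closed dif_carrier[OF M] dif_carrier[OF N]
        module_abelian_group[OF N.module_axioms] N.a_assoc N.l_neg)
qed

end

lemma hom_deg_compose:
  assumes "gr_module K M" "f \<in> hom_deg K M N p" "g \<in> hom_deg K N P q"
  shows "compose (carrier M) g f \<in> hom_deg K M P (q + p)"
proof (rule hom_degI)
  interpret M: gr_module K M by fact
  show "klin K M P (compose (carrier M) g f)"
    using klin_comp[OF hom_degD(1)[OF assms(2)] hom_degD(1)[OF assms(3)]]
    by (subst klin_cong[OF M.module_axioms]) (auto simp: compose_def)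
  fix r x assume x: "x \<in> grade M r"
  then have "g (f x) \<in> grade P (r + p + q)"
    using hom_degD(3)[OF assms(2)] hom_degD(3)[OF assms(3)] by blast
  then show "compose (carrier M) g f x \<in> grade P (r + (q + p))"
    using M.grade_carrier[OF x] by (simp add: compose_def ac_simps)
qed (simp add: compose_def)

section \<open>Modules over a dg category, elementwise\<close>

lemma DgModK_simps [simp]:
  "Ob (DgModK K) = {M. dg_module K M}" "Hom (DgModK K) = dg_hom K"
  "Id (DgModK K) = (\<lambda>M. \<lambda>x\<in>carrier M. x)" "Comp (DgModK K) = (\<lambda>M N P g f. compose (carrier M) g f)"
  by (simp_all add: DgModK_def)

text \<open>A functor into \<open>DgModK\<close> rewritten in terms of elements: commuting with
  differentials turns into a Leibniz rule for the action on x, and grading and Leibniz rule are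
  asked for homogeneous f and x only.\<close>

lemma dg_mod_functorI:
  assumes C: "\<And>X Y. X \<in> Ob C \<Longrightarrow> Y \<in> Ob C \<Longrightarrow> dg_module K (Hom C X Y)"
    and F: "\<And>X. X \<in> Ob C \<Longrightarrow> dg_module K (FOb F X)"
    and lin: "\<And>X Y f. X \<in> Ob C \<Longrightarrow> Y \<in> Ob C \<Longrightarrow> f \<in> carrier (Hom C X Y) \<Longrightarrow> klin K (FOb F X) (FOb F Y) (FMor F X Y f)"
    and ext: "\<And>X Y f. X \<in> Ob C \<Longrightarrow> Y \<in> Ob C \<Longrightarrow> f \<in> carrier (Hom C X Y) \<Longrightarrow> FMor F X Y f \<in> extensional (carrier (FOb F X))"
    and lin': "\<And>X Y x. X \<in> Ob C \<Longrightarrow> Y \<in> Ob C \<Longrightarrow> x \<in> carrier (FOb F X) \<Longrightarrow> klin K (Hom C X Y) (FOb F Y) (\<lambda>f. FMor F X Y f x)"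
    and id: "\<And>X x. X \<in> Ob C \<Longrightarrow> x \<in> carrier (FOb F X) \<Longrightarrow> FMor F X X (Id C X) x = x"
      "\<And>X. X \<in> Ob C \<Longrightarrow> Id C X \<in> carrier (Hom C X X)"
    and comp: "\<And>X Y Z f g x. X \<in> Ob C \<Longrightarrow> Y \<in> Ob C \<Longrightarrow> Z \<in> Ob C \<Longrightarrow> g \<in> carrier (Hom C Y Z) \<Longrightarrow>
      f \<in> carrier (Hom C X Y) \<Longrightarrow> x \<in> carrier (FOb F X) \<Longrightarrow>
      FMor F X Z (Comp C X Y Z g f) x = FMor F Y Z g (FMor F X Y f x)"
      "\<And>X Y Z f g. X \<in> Ob C \<Longrightarrow> Y \<in> Ob C \<Longrightarrow> Z \<in> Ob C \<Longrightarrow> g \<in> carrier (Hom C Y Z) \<Longrightarrow>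
      f \<in> carrier (Hom C X Y) \<Longrightarrow> Comp C X Y Z g f \<in> carrier (Hom C X Z)"
    and grade: "\<And>X Y f x p q. X \<in> Ob C \<Longrightarrow> Y \<in> Ob C \<Longrightarrow> f \<in> grade (Hom C X Y) p \<Longrightarrow> x \<in> grade (FOb F X) q \<Longrightarrow>
      FMor F X Y f x \<in> grade (FOb F Y) (q + p)"
    and dif: "\<And>X Y f x p q. X \<in> Ob C \<Longrightarrow> Y \<in> Ob C \<Longrightarrow> f \<in> grade (Hom C X Y) p \<Longrightarrow> x \<in> grade (FOb F X) q \<Longrightarrow>
      dif (FOb F Y) (FMor F X Y f x) =
        FMor F X Y (dif (Hom C X Y) f) x \<oplus>\<^bsub>FOb F Y\<^esub> sg (FOb F Y) p (FMor F X Y f (dif (FOb F X) x))"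
  shows "dg_functor K C (DgModK K) F"
proof
  fix X Y assume X: "X \<in> Ob C" and Y: "Y \<in> Ob C"
  interpret H: dg_module K "Hom C X Y" by (rule C[OF X Y])
  interpret HG: gr_module K "Hom C X Y" by (rule dg_module_gr_module[OF C[OF X Y]])
  interpret FX: gr_module K "FOb F X" by (rule dg_module_gr_module[OF F[OF X]])
  interpret FY: gr_module K "FOb F Y" by (rule dg_module_gr_module[OF F[OF Y]])
  interpret D: dg_module K "dg_hom K (FOb F X) (FOb F Y)" by (rule dg_module_dg_hom[OF F[OF X] F[OF Y]])
  show "FOb F X \<in> Ob (DgModK K)" using F[OF X] by simp
  show gr: "FMor F X Y f \<in> grade (Hom (DgModK K) (FOb F X) (FOb F Y)) n" if "f \<in> grade (Hom C X Y) n" for f n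
    using that HG.grade_carrier[OF that] by (auto intro!: hom_degI lin ext grade X Y)
  show add: "FMor F X Y (f \<oplus>\<^bsub>Hom C X Y\<^esub> g) = FMor F X Y f \<oplus>\<^bsub>Hom (DgModK K) (FOb F X) (FOb F Y)\<^esub> FMor F X Y g"
    if "f \<in> carrier (Hom C X Y)" "g \<in> carrier (Hom C X Y)" for f g
    using that ext[OF X Y, of "f \<oplus>\<^bsub>Hom C X Y\<^esub> g"]
    by (auto simp: klin_add[OF lin'[OF X Y]] intro!: extensionalityI[of _ "carrier (FOb F X)"])
  show smult: "FMor F X Y (a \<odot>\<^bsub>Hom C X Y\<^esub> f) = a \<odot>\<^bsub>Hom (DgModK K) (FOb F X) (FOb F Y)\<^esub> FMor F X Y f"
    if "a \<in> carrier K" "f \<in> carrier (Hom C X Y)" for a f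
    using that ext[OF X Y, of "a \<odot>\<^bsub>Hom C X Y\<^esub> f"]
    by (auto simp: klin_smult[OF lin'[OF X Y]] intro!: extensionalityI[of _ "carrier (FOb F X)"])
  \<comment> \<open>The carrier of \<open>dg_hom\<close> consists of finite sums of maps of fixed
    degrees, so membership cannot be checked pointwise; it is obtained by decomposing f.\<close>
  show cl: "FMor F X Y f \<in> carrier (Hom (DgModK K) (FOb F X) (FOb F Y))" if "f \<in> carrier (Hom C X Y)" for f
    using that
  proof (induction rule: HG.homog_induct)
    case (homog n f)
    then show ?case using gr[OF homog] hom_deg_carrier[OF F[OF X] F[OF Y]] by simp
  next
    case (add f g)
    then show ?case
      using D.a_closed by (simp only: \<open>\<And>g f. f \<in> carrier (Hom C X Y) \<Longrightarrow> g \<in> carrier (Hom C X Y) \<Longrightarrow>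
        FMor F X Y (f \<oplus>\<^bsub>Hom C X Y\<^esub> g) = FMor F X Y f \<oplus>\<^bsub>Hom (DgModK K) (FOb F X) (FOb F Y)\<^esub> FMor F X Y g\<close> DgModK_simps)
  qed
  have "klin K (Hom C X Y) (dg_hom K (FOb F X) (FOb F Y)) (FMor F X Y)"
    using cl add smult by (intro klinI) auto
  note k = klin_comp[OF dg_module_klin_dif[OF C[OF X Y]] this] klin_comp[OF this dg_module_klin_dif[OF dg_module_dg_hom[OF F[OF X] F[OF Y]]]]
  show "FMor F X Y (dif (Hom C X Y) f) = dif (Hom (DgModK K) (FOb F X) (FOb F Y)) (FMor F X Y f)"
    if "f \<in> carrier (Hom C X Y)" for f
  proof (simp only: DgModK_simps, rule HG.klin_eqI[OF D.module_axioms k _ that])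
    fix n f assume f: "f \<in> grade (Hom C X Y) n"
    then have fh: "FMor F X Y f \<in> hom_deg K (FOb F X) (FOb F Y) n" using gr by simp
    have df: "dif (Hom C X Y) f \<in> grade (Hom C X Y) (n + 1)" by (rule dif_grade[OF C[OF X Y] f])
    then have dfh: "FMor F X Y (dif (Hom C X Y) f) \<in> hom_deg K (FOb F X) (FOb F Y) (n + 1)" using gr by simp
    have ddh: "dif (dg_hom K (FOb F X) (FOb F Y)) (FMor F X Y f) \<in> hom_deg K (FOb F X) (FOb F Y) (n + 1)"
      using D.dif_grade[of _ n] fh by simp
    show "FMor F X Y (dif (Hom C X Y) f) = dif (dg_hom K (FOb F X) (FOb F Y)) (FMor F X Y f)"
    proof (rule extensionalityI[OF hom_degD(2)[OF dfh] hom_degD(2)[OF ddh]])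
      fix x assume hx: "x \<in> carrier (FOb F X)"
      show "FMor F X Y (dif (Hom C X Y) f) x = dif (dg_hom K (FOb F X) (FOb F Y)) (FMor F X Y f) x"
      proof (rule FX.klin_eqI[OF FY.module_axioms hom_degD(1)[OF dfh] hom_degD(1)[OF ddh] _ hx])
        fix q x assume x: "x \<in> grade (FOb F X) q"
        note xc = FX.grade_carrier[OF x]
        note cl' = klin_closed[OF hom_degD(1)[OF fh]] klin_closed[OF hom_degD(1)[OF dfh] xc] klin_closed[OF hom_degD(1)[OF ddh] xc]
        have "sg (FOb F Y) n (FMor F X Y f (dif (FOb F X) x)) \<in> carrier (FOb F Y)"
          by (intro sg_closed module_abelian_group[OF FY.module_axioms] cl' dif_carrier[OF F[OF X] xc])
        then show "FMor F X Y (dif (Hom C X Y) f) x = dif (dg_hom K (FOb F X) (FOb F Y)) (FMor F X Y f) x"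
          using dif[OF X Y f x] dif_eval[OF F[OF X] F[OF Y] fh xc] cl' by simp
      qed
    qed
  qed
next
  fix X assume X: "X \<in> Ob C"
  show "FMor F X X (Id C X) = Id (DgModK K) (FOb F X)"
    using id[OF X] ext[OF X X] by (auto intro!: extensionalityI[of _ "carrier (FOb F X)"])
next
  fix X Y Z g f assume *: "X \<in> Ob C" "Y \<in> Ob C" "Z \<in> Ob C" "g \<in> carrier (Hom C Y Z)" "f \<in> carrier (Hom C X Y)"
  show "FMor F X Z (Comp C X Y Z g f) = Comp (DgModK K) (FOb F X) (FOb F Y) (FOb F Z) (FMor F Y Z g) (FMor F X Y f)"
    using comp[OF *] ext[OF *(1,3)] by (auto simp: compose_def intro!: extensionalityI[of _ "carrier (FOb F X)"])
qed

context
  fixes K :: "'k ring" and C :: "('k, 'o, 'h) dgcat" and F :: "('k, 'o, 'h, 'v) dgm"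
  assumes F: "dg_functor K C (DgModK K) F"
begin

lemma dg_mod_ob: "X \<in> Ob C \<Longrightarrow> dg_module K (FOb F X)"
  using dg_functor.F_ob[OF F] by simp

lemma dg_mod_hom: "X \<in> Ob C \<Longrightarrow> Y \<in> Ob C \<Longrightarrow> f \<in> carrier (Hom C X Y) \<Longrightarrow>
    FMor F X Y f \<in> carrier (dg_hom K (FOb F X) (FOb F Y))"
  using dg_functor.F_closed[OF F] by simp

lemma dg_mod_klin:
  assumes "X \<in> Ob C" "Y \<in> Ob C" "f \<in> carrier (Hom C X Y)"
  shows "klin K (FOb F X) (FOb F Y) (FMor F X Y f)" "FMor F X Y f \<in> extensional (carrier (FOb F X))"
  using dg_hom_carrierD[OF dg_module_gr_module[OF dg_mod_ob[OF assms(1)]] dg_module_gr_module[OF dg_mod_ob[OF assms(2)]]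
      dg_mod_hom[OF assms]] by auto

lemma dg_mod_closed: "X \<in> Ob C \<Longrightarrow> Y \<in> Ob C \<Longrightarrow> f \<in> carrier (Hom C X Y) \<Longrightarrow> x \<in> carrier (FOb F X) \<Longrightarrow>
    FMor F X Y f x \<in> carrier (FOb F Y)"
  using klin_closed[OF dg_mod_klin(1)] .

lemma dg_mod_klin':
  assumes "X \<in> Ob C" "Y \<in> Ob C" "x \<in> carrier (FOb F X)"
  shows "klin K (Hom C X Y) (FOb F Y) (\<lambda>f. FMor F X Y f x)"
  using assms dg_functor.F_add[OF F assms(1,2)] dg_functor.F_smult[OF F assms(1,2)]
  by (intro klinI) (simp_all add: dg_mod_closed)

lemma dg_mod_id: "X \<in> Ob C \<Longrightarrow> x \<in> carrier (FOb F X) \<Longrightarrow> FMor F X X (Id C X) x = x"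
  using dg_functor.F_id[OF F] by simp

lemma dg_mod_comp:
  assumes "X \<in> Ob C" "Y \<in> Ob C" "Z \<in> Ob C" "g \<in> carrier (Hom C Y Z)" "f \<in> carrier (Hom C X Y)" "x \<in> carrier (FOb F X)"
  shows "FMor F X Z (Comp C X Y Z g f) x = FMor F Y Z g (FMor F X Y f x)"
  using dg_functor.F_comp[OF F assms(1-5)] assms(6) by (simp add: compose_def)

lemma dg_mod_hom_deg: "X \<in> Ob C \<Longrightarrow> Y \<in> Ob C \<Longrightarrow> f \<in> grade (Hom C X Y) p \<Longrightarrow>
    FMor F X Y f \<in> hom_deg K (FOb F X) (FOb F Y) p"
  using dg_functor.F_grade[OF F] by simp

lemma dg_mod_grade: "X \<in> Ob C \<Longrightarrow> Y \<in> Ob C \<Longrightarrow> f \<in> grade (Hom C X Y) p \<Longrightarrow> x \<in> grade (FOb F X) q \<Longrightarrow>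
    FMor F X Y f x \<in> grade (FOb F Y) (q + p)"
  using hom_degD(3)[OF dg_mod_hom_deg] .

lemma dg_mod_dif:
  assumes "X \<in> Ob C" "Y \<in> Ob C" "f \<in> carrier (Hom C X Y)" "f \<in> grade (Hom C X Y) p" "x \<in> carrier (FOb F X)"
  shows "dif (FOb F Y) (FMor F X Y f x) =
    FMor F X Y (dif (Hom C X Y) f) x \<oplus>\<^bsub>FOb F Y\<^esub> sg (FOb F Y) p (FMor F X Y f (dif (FOb F X) x))"
  using dif_eval[OF dg_mod_ob[OF assms(1)] dg_mod_ob[OF assms(2)] dg_mod_hom_deg[OF assms(1,2,4)] assms(5)]
    dg_functor.F_dif[OF F assms(1-3)] by simp

end

section \<open>Transformations of modules\<close>

lemma mnat_simps [simp]:
  "grade (mnat K C F G) = mnat_deg K C F G"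
  "add (mnat K C F G) = (\<lambda>\<eta> \<theta>. \<lambda>X\<in>Ob C. \<lambda>x\<in>carrier (FOb F X). \<eta> X x \<oplus>\<^bsub>FOb G X\<^esub> \<theta> X x)"
  "zero (mnat K C F G) = (\<lambda>X\<in>Ob C. \<lambda>x\<in>carrier (FOb F X). \<zero>\<^bsub>FOb G X\<^esub>)"
  "smult (mnat K C F G) = (\<lambda>a \<eta>. \<lambda>X\<in>Ob C. \<lambda>x\<in>carrier (FOb F X). a \<odot>\<^bsub>FOb G X\<^esub> \<eta> X x)"
  "dif (mnat K C F G) = (\<lambda>\<eta>. \<lambda>X\<in>Ob C. dif (dg_hom K (FOb F X) (FOb G X)) (\<eta> X))"
  by (simp_all add: mnat_def Let_def)

context
  fixes K :: "'k ring" and C :: "('k, 'o, 'h) dgcat" and F :: "('k, 'o, 'h, 'v) dgm" and G :: "('k, 'o, 'h, 'w) dgm"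
  assumes F: "dg_functor K C (DgModK K) F" and G: "dg_functor K C (DgModK K) G"
begin

text \<open>Functoriality of F and G puts the composite in the carrier of \<open>dg_hom\<close>,
  where the sign is pointwise by \<open>sg_dg_hom\<close>; naturality then becomes a condition on
  elements.\<close>

lemma mnat_deg_iff:
  "\<eta> \<in> mnat_deg K C F G n \<longleftrightarrow> \<eta> \<in> extensional (Ob C) \<and> (\<forall>X\<in>Ob C. \<eta> X \<in> hom_deg K (FOb F X) (FOb G X) n) \<and>
    (\<forall>X\<in>Ob C. \<forall>Y\<in>Ob C. \<forall>p. \<forall>f\<in>grade (Hom C X Y) p. \<forall>x\<in>carrier (FOb F X).
      FMor G X Y f (\<eta> X x) = sg (FOb G Y) (n * p) (\<eta> Y (FMor F X Y f x)))"
proof -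
  have "(compose (carrier (FOb F X)) (FMor G X Y f) (\<eta> X) =
        sg (dg_hom K (FOb F X) (FOb G Y)) (n * p) (compose (carrier (FOb F X)) (\<eta> Y) (FMor F X Y f))) \<longleftrightarrow>
      (\<forall>x\<in>carrier (FOb F X). FMor G X Y f (\<eta> X x) = sg (FOb G Y) (n * p) (\<eta> Y (FMor F X Y f x)))"
    if "\<forall>X\<in>Ob C. \<eta> X \<in> hom_deg K (FOb F X) (FOb G X) n" "X \<in> Ob C" "Y \<in> Ob C" "f \<in> grade (Hom C X Y) p" for X Y p f
  proof -
    have "compose (carrier (FOb F X)) (\<eta> Y) (FMor F X Y f) \<in> hom_deg K (FOb F X) (FOb G Y) (n + p)"
      using that by (intro hom_deg_compose[OF dg_module_gr_module[OF dg_mod_ob[OF F]] dg_mod_hom_deg[OF F]]) auto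
    from hom_deg_carrier[OF dg_mod_ob[OF F] dg_mod_ob[OF G] this] that
    have "sg (dg_hom K (FOb F X) (FOb G Y)) (n * p) (compose (carrier (FOb F X)) (\<eta> Y) (FMor F X Y f)) =
      (\<lambda>x\<in>carrier (FOb F X). sg (FOb G Y) (n * p) (compose (carrier (FOb F X)) (\<eta> Y) (FMor F X Y f) x))"
      by (intro sg_dg_hom dg_mod_ob[OF F] dg_mod_ob[OF G]) auto
    then show ?thesis by (auto simp: compose_def fun_eq_iff restrict_def)
  qed
  then show ?thesis
    unfolding mnat_deg_def by (auto simp: PiE_iff)
qed

lemma mnat_degD:
  assumes "\<eta> \<in> mnat_deg K C F G n"
  shows "\<eta> \<in> extensional (Ob C)" "X \<in> Ob C \<Longrightarrow> \<eta> X \<in> hom_deg K (FOb F X) (FOb G X) n"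
    "X \<in> Ob C \<Longrightarrow> Y \<in> Ob C \<Longrightarrow> f \<in> grade (Hom C X Y) p \<Longrightarrow> x \<in> carrier (FOb F X) \<Longrightarrow>
      FMor G X Y f (\<eta> X x) = sg (FOb G Y) (n * p) (\<eta> Y (FMor F X Y f x))"
  using assms by (simp_all add: mnat_deg_iff)

lemma mnat_degI:
  assumes "\<eta> \<in> extensional (Ob C)" "\<And>X. X \<in> Ob C \<Longrightarrow> \<eta> X \<in> hom_deg K (FOb F X) (FOb G X) n"
    "\<And>X Y f p x. X \<in> Ob C \<Longrightarrow> Y \<in> Ob C \<Longrightarrow> f \<in> grade (Hom C X Y) p \<Longrightarrow> x \<in> carrier (FOb F X) \<Longrightarrow>
      FMor G X Y f (\<eta> X x) = sg (FOb G Y) (n * p) (\<eta> Y (FMor F X Y f x))"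
  shows "\<eta> \<in> mnat_deg K C F G n"
  using assms by (simp add: mnat_deg_iff)

end

text \<open>The sign computation for naturality of d(\<eta>), detached from functors: A, z, v, w
  stand for G(f)(d(\<eta> x)), d(\<eta>(F(f) x)), \<eta>(F(df) x) and \<eta>(F(f)(dx)). The last
  hypothesis is the differentiated naturality of \<eta>; the four parities of n and p are
  checked.\<close>

lemma signed_natural_dif:
  fixes Q :: "('k, 'v) dgmod"
  assumes "abelian_group Q" "A \<in> carrier Q" "z \<in> carrier Q" "v \<in> carrier Q" "w \<in> carrier Q"
    and "sg Q (n * p) z = sg Q (n * (p + 1)) v \<oplus>\<^bsub>Q\<^esub> sg Q p A"
  shows "A \<oplus>\<^bsub>Q\<^esub> sg Q (n + 1) (sg Q (n * p) w) =
    sg Q ((n + 1) * p) (z \<oplus>\<^bsub>Q\<^esub> sg Q (n + 1) (v \<oplus>\<^bsub>Q\<^esub> sg Q p w))"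
proof -
  interpret Q: abelian_group Q by fact
  note [simp] = assms(2-5)
  have n: "\<ominus>\<^bsub>Q\<^esub> z = x \<longleftrightarrow> z = \<ominus>\<^bsub>Q\<^esub> x" if "x \<in> carrier Q" for x
    using that by auto
  have c: "x \<oplus>\<^bsub>Q\<^esub> (y \<oplus>\<^bsub>Q\<^esub> \<ominus>\<^bsub>Q\<^esub> x) = y" if "x \<in> carrier Q" "y \<in> carrier Q" for x y
    using that by (simp add: Q.a_lcomm[of x y] Q.r_neg)
  show ?thesis using assms(6)
    by (cases "even n"; cases "even p")
      (simp_all add: sg_def Q.minus_add Q.a_ac Q.r_neg Q.l_neg n Q.r_neg1 Q.r_neg2 c)
qed

text \<open>What the construction of transformations draws on: the base ring and the Hom modules.
  For \<open>Lam\<close> these are direct sums of modules already at hand.\<close>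

definition dg_quiver :: "'k ring \<Rightarrow> ('k, 'o, 'h) dgcat \<Rightarrow> bool" where
  "dg_quiver K C \<longleftrightarrow> cring K \<and> (\<forall>X\<in>Ob C. \<forall>Y\<in>Ob C. dg_module K (Hom C X Y))"

lemma dg_quiver_cring: "dg_quiver K C \<Longrightarrow> cring K"
  and dg_quiver_hom: "dg_quiver K C \<Longrightarrow> X \<in> Ob C \<Longrightarrow> Y \<in> Ob C \<Longrightarrow> dg_module K (Hom C X Y)"
  by (simp_all add: dg_quiver_def)

lemma dg_category_quiver: "dg_category K C \<Longrightarrow> dg_quiver K C"
  by (simp add: dg_category_def dg_category_axioms_def dg_quiver_def)

context
  fixes K :: "'k ring" and C :: "('k, 'o, 'h) dgcat" and F :: "('k, 'o, 'h, 'v) dgm" and G :: "('k, 'o, 'h, 'w) dgm"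
  assumes F: "dg_functor K C (DgModK K) F" and G: "dg_functor K C (DgModK K) G"
    and Q: "dg_quiver K C"
begin

private lemmas K = dg_quiver_cring[OF Q]
private lemmas C = dg_quiver_hom[OF Q]


private abbreviation "PH \<equiv> pi_mod K (Ob C) (\<lambda>X. dg_hom K (FOb F X) (FOb G X))"

private lemma dgH: "X \<in> Ob C \<Longrightarrow> dg_module K (dg_hom K (FOb F X) (FOb G X))"
  by (rule dg_module_dg_hom[OF dg_mod_ob[OF F] dg_mod_ob[OF G]])

private lemma PH: "module K PH"
  by (rule module_pi_mod[OF K dg_module_module[OF dgH]])

private lemma submodule_mnat_deg: "submodule (mnat_deg K C F G n) K PH"
proof (rule submoduleI'[OF PH])
  show "mnat_deg K C F G n \<subseteq> carrier PH"
  proof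
    fix \<eta> assume \<eta>: "\<eta> \<in> mnat_deg K C F G n"
    then show "\<eta> \<in> carrier PH"
      using mnat_degD(1)[OF F G \<eta>] hom_deg_carrier[OF dg_mod_ob[OF F] dg_mod_ob[OF G] mnat_degD(2)[OF F G \<eta>]]
      by (simp add: PiE_iff)
  qed
  show "\<zero>\<^bsub>PH\<^esub> \<in> mnat_deg K C F G n"
  proof (rule mnat_degI[OF F G])
    fix X Y p f x assume *: "X \<in> Ob C" "Y \<in> Ob C" "f \<in> grade (Hom C X Y) p" "x \<in> carrier (FOb F X)"
    note fc = gr_module.grade_carrier[OF dg_module_gr_module[OF C] *(3)] and m = dg_module_module[OF dg_mod_ob[OF G]]
    show "FMor G X Y f (\<zero>\<^bsub>PH\<^esub> X x) = sg (FOb G Y) (n * p) (\<zero>\<^bsub>PH\<^esub> Y (FMor F X Y f x))"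
      using * fc by (simp add: dg_mod_closed[OF F] sg_zero[OF module_abelian_group[OF m]]
          klin_zero[OF m m dg_mod_klin(1)[OF G]])
  next
    fix X assume X: "X \<in> Ob C"
    show "\<zero>\<^bsub>PH\<^esub> X \<in> hom_deg K (FOb F X) (FOb G X) n"
      using gr_module.grade_zero[OF dg_module_gr_module[OF dgH[OF X]]] X by simp
  qed simp
  fix \<eta> assume \<eta>: "\<eta> \<in> mnat_deg K C F G n"
  note \<eta>D = mnat_degD[OF F G \<eta>]
  { fix \<theta> assume \<theta>: "\<theta> \<in> mnat_deg K C F G n"
    note \<theta>D = mnat_degD[OF F G \<theta>]
    show "\<eta> \<oplus>\<^bsub>PH\<^esub> \<theta> \<in> mnat_deg K C F G n"
    proof (rule mnat_degI[OF F G])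
      fix X Y p f x assume *: "X \<in> Ob C" "Y \<in> Ob C" "f \<in> grade (Hom C X Y) p" "x \<in> carrier (FOb F X)"
      note fc = gr_module.grade_carrier[OF dg_module_gr_module[OF C] *(3)]
      note cl = klin_closed[OF hom_degD(1)[OF \<eta>D(2)]] klin_closed[OF hom_degD(1)[OF \<theta>D(2)]] dg_mod_closed[OF F]
      show "FMor G X Y f ((\<eta> \<oplus>\<^bsub>PH\<^esub> \<theta>) X x) = sg (FOb G Y) (n * p) ((\<eta> \<oplus>\<^bsub>PH\<^esub> \<theta>) Y (FMor F X Y f x))"
        using * fc
        by (simp add: cl klin_add[OF dg_mod_klin(1)[OF G]] \<eta>D(3) \<theta>D(3)
            sg_add[OF module_abelian_group[OF dg_module_module[OF dg_mod_ob[OF G]]]])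
    next
      fix X assume X: "X \<in> Ob C"
      show "(\<eta> \<oplus>\<^bsub>PH\<^esub> \<theta>) X \<in> hom_deg K (FOb F X) (FOb G X) n"
        using gr_module.grade_add[OF dg_module_gr_module[OF dgH[OF X]]] \<eta>D(2) \<theta>D(2) X by simp
    qed simp }
  fix a assume a: "a \<in> carrier K"
  show "a \<odot>\<^bsub>PH\<^esub> \<eta> \<in> mnat_deg K C F G n"
  proof (rule mnat_degI[OF F G])
    fix X Y p f x assume *: "X \<in> Ob C" "Y \<in> Ob C" "f \<in> grade (Hom C X Y) p" "x \<in> carrier (FOb F X)"
    note fc = gr_module.grade_carrier[OF dg_module_gr_module[OF C] *(3)]
    note cl = klin_closed[OF hom_degD(1)[OF \<eta>D(2)]] dg_mod_closed[OF F]
    show "FMor G X Y f ((a \<odot>\<^bsub>PH\<^esub> \<eta>) X x) = sg (FOb G Y) (n * p) ((a \<odot>\<^bsub>PH\<^esub> \<eta>) Y (FMor F X Y f x))"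
      using * fc a
      by (simp add: cl klin_smult[OF dg_mod_klin(1)[OF G]] \<eta>D(3) sg_smult[OF dg_module_module[OF dg_mod_ob[OF G]]])
  next
    fix X assume X: "X \<in> Ob C"
    show "(a \<odot>\<^bsub>PH\<^esub> \<eta>) X \<in> hom_deg K (FOb F X) (FOb G X) n"
      using gr_module.grade_smult[OF dg_module_gr_module[OF dgH[OF X]]] \<eta>D(2) X a by simp
  qed simp
qed

private lemma mnat_eq_pi: "add (mnat K C F G) = add PH" "zero (mnat K C F G) = zero PH" "smult (mnat K C F G) = smult PH"
  by (simp_all add: mnat_def Let_def)

text \<open>The tests for degree m are the degree m components of the maps \<eta> X, one for each
  object X.\<close>

private lemma gr_mnat: "gr_module K (mnat K C F G)" "carrier (mnat K C F G) \<subseteq> carrier PH"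
proof -
  have *: "abelian_group (dg_hom K (FOb F X) (FOb G X))" "gr_module K (dg_hom K (FOb F X) (FOb G X))" if "X \<in> Ob C" for X
    using module_abelian_group[OF dg_module_module[OF dgH[OF that]]] dg_module_gr_module[OF dgH[OF that]] by auto
  have "carrier (mnat K C F G) = fin_sums \<zero>\<^bsub>PH\<^esub> (add PH) (\<Union>n. mnat_deg K C F G n)"
    by (simp add: mnat_def Let_def)
  then show "carrier (mnat K C F G) \<subseteq> carrier PH"
    using module.submoduleE(1)[OF PH module.submodule_fin_sums(1)[OF PH submodule_mnat_deg]] by simp
  show "gr_module K (mnat K C F G)"
  proof (rule gr_module_fin_sumsI(1)[where P = PH and I = "\<lambda>m. Ob C" and Q = "\<lambda>m X. dg_hom K (FOb F X) (FOb G X)"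
          and ev = "\<lambda>m X \<eta>. hcomp (dg_hom K (FOb F X) (FOb G X)) (\<eta> X) m"])
    fix m \<eta> X assume X: "X \<in> Ob C" and \<eta>: "\<eta> \<in> carrier PH"
    interpret HX: gr_module K "dg_hom K (FOb F X) (FOb G X)" by (rule *(2)[OF X])
    have \<eta>X: "\<eta> X \<in> carrier (dg_hom K (FOb F X) (FOb G X))" using \<eta> X by (auto simp: PiE_iff)
    then show "hcomp (dg_hom K (FOb F X) (FOb G X)) (\<eta> X) m \<in> carrier (dg_hom K (FOb F X) (FOb G X))"
      by (rule HX.hcomp_closed)
    fix \<theta> assume "\<theta> \<in> carrier PH"
    then have \<theta>X: "\<theta> X \<in> carrier (dg_hom K (FOb F X) (FOb G X))" using X by (auto simp: PiE_iff)
    have "(\<eta> \<oplus>\<^bsub>PH\<^esub> \<theta>) X = \<eta> X \<oplus>\<^bsub>dg_hom K (FOb F X) (FOb G X)\<^esub> \<theta> X" using X by simp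
    then show "hcomp (dg_hom K (FOb F X) (FOb G X)) ((\<eta> \<oplus>\<^bsub>PH\<^esub> \<theta>) X) m =
        hcomp (dg_hom K (FOb F X) (FOb G X)) (\<eta> X) m \<oplus>\<^bsub>dg_hom K (FOb F X) (FOb G X)\<^esub> hcomp (dg_hom K (FOb F X) (FOb G X)) (\<theta> X) m"
      by (simp only: HX.hcomp_add[OF \<eta>X \<theta>X])
  next
    fix m n \<eta> X assume X: "X \<in> Ob C" and "n \<noteq> m" "\<eta> \<in> grade (mnat K C F G) n"
    moreover from this have "\<eta> X \<in> grade (dg_hom K (FOb F X) (FOb G X)) n"
      using mnat_degD(2)[OF F G] by simp
    ultimately show "hcomp (dg_hom K (FOb F X) (FOb G X)) (\<eta> X) m = \<zero>\<^bsub>dg_hom K (FOb F X) (FOb G X)\<^esub>"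
      using gr_module.hcomp_homog[OF *(2)[OF X], of "\<eta> X" n m] by auto
  next
    fix m \<eta> assume \<eta>: "\<eta> \<in> grade (mnat K C F G) m"
      and z: "\<And>X. X \<in> Ob C \<Longrightarrow> hcomp (dg_hom K (FOb F X) (FOb G X)) (\<eta> X) m = \<zero>\<^bsub>dg_hom K (FOb F X) (FOb G X)\<^esub>"
    have "\<eta> X = \<zero>\<^bsub>dg_hom K (FOb F X) (FOb G X)\<^esub>" if X: "X \<in> Ob C" for X
    proof -
      have "\<eta> X \<in> grade (dg_hom K (FOb F X) (FOb G X)) m"
        using mnat_degD(2)[OF F G] \<eta> X by simp
      then show ?thesis
        using z[OF X] gr_module.hcomp_homog[OF *(2)[OF X], of "\<eta> X" m m] by simp
    qed
    then show "\<eta> = \<zero>\<^bsub>PH\<^esub>"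
      using mnat_degD(1)[OF F G] \<eta> by (auto intro!: extensionalityI[of _ "Ob C"])
  qed (simp_all only: mnat_eq_pi mnat_simps submodule_mnat_deg PH *, simp_all add: mnat_def Let_def)
qed

lemma mnat_carrierD:
  assumes "\<eta> \<in> carrier (mnat K C F G)"
  shows "\<eta> \<in> extensional (Ob C)" and "X \<in> Ob C \<Longrightarrow> \<eta> X \<in> carrier (dg_hom K (FOb F X) (FOb G X))"
    and "X \<in> Ob C \<Longrightarrow> klin K (FOb F X) (FOb G X) (\<eta> X)" "X \<in> Ob C \<Longrightarrow> \<eta> X \<in> extensional (carrier (FOb F X))"
proof -
  have "\<eta> \<in> (\<Pi>\<^sub>E X\<in>Ob C. carrier (dg_hom K (FOb F X) (FOb G X)))"
    using gr_mnat(2) assms by auto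
  then show "\<eta> \<in> extensional (Ob C)" and *: "X \<in> Ob C \<Longrightarrow> \<eta> X \<in> carrier (dg_hom K (FOb F X) (FOb G X))" for X
    by (auto simp: PiE_iff)
  show "X \<in> Ob C \<Longrightarrow> klin K (FOb F X) (FOb G X) (\<eta> X)" "X \<in> Ob C \<Longrightarrow> \<eta> X \<in> extensional (carrier (FOb F X))"
    using dg_hom_carrierD[OF dg_module_gr_module[OF dg_mod_ob[OF F]] dg_module_gr_module[OF dg_mod_ob[OF G]] *] by auto
qed

lemma mnat_closed: "\<eta> \<in> carrier (mnat K C F G) \<Longrightarrow> X \<in> Ob C \<Longrightarrow> x \<in> carrier (FOb F X) \<Longrightarrow> \<eta> X x \<in> carrier (FOb G X)"
  using klin_closed[OF mnat_carrierD(3)] .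

lemma mnat_eqI:
  assumes "\<eta> \<in> carrier (mnat K C F G)" "\<theta> \<in> carrier (mnat K C F G)"
    "\<And>X x. X \<in> Ob C \<Longrightarrow> x \<in> carrier (FOb F X) \<Longrightarrow> \<eta> X x = \<theta> X x"
  shows "\<eta> = \<theta>"
proof (rule extensionalityI[OF mnat_carrierD(1)[OF assms(1)] mnat_carrierD(1)[OF assms(2)]])
  fix X assume "X \<in> Ob C"
  then show "\<eta> X = \<theta> X"
    using mnat_carrierD(4)[OF assms(1)] mnat_carrierD(4)[OF assms(2)] assms(3) by (blast intro: extensionalityI)
qed

text \<open>The subtraction in the commutator is absorbed into the exponent n + 1, which leaves only
  sums.\<close>

lemma mnat_dif_eval:
  assumes "\<eta> \<in> mnat_deg K C F G n" "X \<in> Ob C" "x \<in> carrier (FOb F X)"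
  shows "dif (mnat K C F G) \<eta> X x = dif (FOb G X) (\<eta> X x) \<oplus>\<^bsub>FOb G X\<^esub> sg (FOb G X) (n + 1) (\<eta> X (dif (FOb F X) x))"
proof -
  note \<eta> = mnat_degD(2)[OF F G assms(1,2)]
  interpret GX: dg_module K "FOb G X" by (rule dg_mod_ob[OF G assms(2)])
  have "\<ominus>\<^bsub>FOb G X\<^esub> sg (FOb G X) n (\<eta> X (dif (FOb F X) x)) = sg (FOb G X) (n + 1) (\<eta> X (dif (FOb F X) x))"
    using klin_closed[OF hom_degD(1)[OF \<eta>] dif_carrier[OF dg_mod_ob[OF F assms(2)] assms(3)]]
    by (simp add: sg_def)
  then show ?thesis
    using assms(2,3) by (simp add: dif_dg_hom_homog[OF dg_mod_ob[OF F] dg_mod_ob[OF G] \<eta>] a_minus_def)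
qed

lemma dg_module_mnat: "dg_module K (mnat K C F G)"
proof (rule dg_moduleI[OF gr_mnat(1)])
  interpret M: gr_module K "mnat K C F G" by (rule gr_mnat(1))
  have dif_deg: "dif (mnat K C F G) \<eta> \<in> mnat_deg K C F G (n + 1)" if \<eta>: "\<eta> \<in> mnat_deg K C F G n" for n \<eta>
  proof (rule mnat_degI[OF F G])
    note \<eta>D = mnat_degD[OF F G \<eta>]
    show "dif (mnat K C F G) \<eta> \<in> extensional (Ob C)" by simp
    show "dif (mnat K C F G) \<eta> X \<in> hom_deg K (FOb F X) (FOb G X) (n + 1)" if "X \<in> Ob C" for X
      using that dg_module.dif_grade[OF dgH[OF that]] \<eta>D(2)[OF that] by (simp only: mnat_simps dg_hom_simps restrict_apply if_True)
    fix X Y p f x assume *: "X \<in> Ob C" "Y \<in> Ob C" "f \<in> grade (Hom C X Y) p" "x \<in> carrier (FOb F X)"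
    note fc = gr_module.grade_carrier[OF dg_module_gr_module[OF C[OF *(1,2)]] *(3)]
    note df = dif_grade[OF C[OF *(1,2)] *(3)]
    note dfc = gr_module.grade_carrier[OF dg_module_gr_module[OF C[OF *(1,2)]] df]
    note dx = dif_carrier[OF dg_mod_ob[OF F *(1)] *(4)]
    note \<eta>X = klin_closed[OF hom_degD(1)[OF \<eta>D(2)]] and Ff = dg_mod_closed[OF F *(1,2) fc] and Gf = dg_mod_closed[OF G *(1,2) fc]
    note Fdf = dg_mod_closed[OF F *(1,2) dfc]
    interpret GX: dg_module K "FOb G X" by (rule dg_mod_ob[OF G *(1)])
    interpret GY: dg_module K "FOb G Y" by (rule dg_mod_ob[OF G *(2)])
    have agX: "abelian_group (FOb G X)" and agY: "abelian_group (FOb G Y)"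
      by (auto intro: module_abelian_group GX.module_axioms GY.module_axioms)
    \<comment> \<open>Apply d to the naturality identity of f at x. The left side is expanded by the
      Leibniz rule of G, and its term with df is rewritten by naturality for df, which has degree p
      + 1.\<close>
    have "dif (FOb G Y) (FMor G X Y f (\<eta> X x)) = dif (FOb G Y) (sg (FOb G Y) (n * p) (\<eta> Y (FMor F X Y f x)))"
      using \<eta>D(3)[OF *] by simp
    also have "\<dots> = sg (FOb G Y) (n * p) (dif (FOb G Y) (\<eta> Y (FMor F X Y f x)))"
      using * by (intro klin_sg[OF _ _ dg_module_klin_dif[OF dg_mod_ob[OF G *(2)]]] \<eta>X Ff GY.module_axioms) auto
    finally have eq: "sg (FOb G Y) (n * p) (dif (FOb G Y) (\<eta> Y (FMor F X Y f x))) =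
      sg (FOb G Y) (n * (p + 1)) (\<eta> Y (FMor F X Y (dif (Hom C X Y) f) x)) \<oplus>\<^bsub>FOb G Y\<^esub> sg (FOb G Y) p (FMor G X Y f (dif (FOb G X) (\<eta> X x)))"
      using dg_mod_dif[OF G *(1,2) fc *(3) \<eta>X[OF *(1,4)]] \<eta>D(3)[OF *(1,2) df *(4)] by simp
    have "FMor G X Y f (dif (mnat K C F G) \<eta> X x) =
        FMor G X Y f (dif (FOb G X) (\<eta> X x)) \<oplus>\<^bsub>FOb G Y\<^esub> sg (FOb G Y) (n + 1) (FMor G X Y f (\<eta> X (dif (FOb F X) x)))"
      using * dx by (simp only: mnat_dif_eval[OF \<eta>] klin_add[OF dg_mod_klin(1)[OF G *(1,2) fc]]
          klin_sg[OF GX.module_axioms GY.module_axioms dg_mod_klin(1)[OF G *(1,2) fc]]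
          GX.dif_closed \<eta>X sg_closed[OF agX])
    also have "\<dots> = FMor G X Y f (dif (FOb G X) (\<eta> X x)) \<oplus>\<^bsub>FOb G Y\<^esub>
        sg (FOb G Y) (n + 1) (sg (FOb G Y) (n * p) (\<eta> Y (FMor F X Y f (dif (FOb F X) x))))"
      by (simp only: \<eta>D(3)[OF *(1-3) dx])
    also have "\<dots> = sg (FOb G Y) ((n + 1) * p) (dif (FOb G Y) (\<eta> Y (FMor F X Y f x)) \<oplus>\<^bsub>FOb G Y\<^esub>
        sg (FOb G Y) (n + 1) (\<eta> Y (FMor F X Y (dif (Hom C X Y) f) x) \<oplus>\<^bsub>FOb G Y\<^esub> sg (FOb G Y) p (\<eta> Y (FMor F X Y f (dif (FOb F X) x)))))"
      using * by (intro signed_natural_dif agY eq Gf GX.dif_closed GY.dif_closed \<eta>X Ff Fdf dx)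
    also have "\<eta> Y (FMor F X Y (dif (Hom C X Y) f) x) \<oplus>\<^bsub>FOb G Y\<^esub> sg (FOb G Y) p (\<eta> Y (FMor F X Y f (dif (FOb F X) x))) =
        \<eta> Y (dif (FOb F Y) (FMor F X Y f x))"
      using * dx
      by (simp only: dg_mod_dif[OF F *(1,2) fc *(3,4)] klin_add[OF hom_degD(1)[OF \<eta>D(2)[OF *(2)]]]
          klin_sg[OF dg_module_module[OF dg_mod_ob[OF F]] GY.module_axioms hom_degD(1)[OF \<eta>D(2)[OF *(2)]]]
          Fdf Ff sg_closed[OF module_abelian_group[OF dg_module_module[OF dg_mod_ob[OF F]]]])
    finally show "FMor G X Y f (dif (mnat K C F G) \<eta> X x) = sg (FOb G Y) ((n + 1) * p) (dif (mnat K C F G) \<eta> Y (FMor F X Y f x))"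
      using * by (simp only: mnat_dif_eval[OF \<eta> *(2) Ff])
  qed
  then show "dif (mnat K C F G) \<eta> \<in> grade (mnat K C F G) (n + 1)" if "\<eta> \<in> grade (mnat K C F G) n" for n \<eta>
    using that by (simp del: mnat_simps(5))
  have dcl: "dif (mnat K C F G) \<eta> \<in> carrier (mnat K C F G)" if "\<eta> \<in> carrier (mnat K C F G)" for \<eta>
    using that
  proof (induction rule: M.homog_induct)
    case (homog n \<eta>)
    then show ?case using dif_deg M.grade_carrier[of _ "n + 1"] by (simp del: mnat_simps(5))
  next
    case (add \<eta> \<theta>)
    have "dif (mnat K C F G) (\<eta> \<oplus>\<^bsub>mnat K C F G\<^esub> \<theta>) = dif (mnat K C F G) \<eta> \<oplus>\<^bsub>mnat K C F G\<^esub> dif (mnat K C F G) \<theta>"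
      using dg_module.dif_add[OF dgH mnat_carrierD(2)[OF add(1)] mnat_carrierD(2)[OF add(2)]]
      by (auto simp: fun_eq_iff mnat_eq_pi)
    then show ?case using add M.a_closed by (simp del: mnat_simps)
  qed
  show "klin K (mnat K C F G) (mnat K C F G) (dif (mnat K C F G))"
  proof (rule klinI[OF dcl])
    fix \<eta> \<theta> assume *: "\<eta> \<in> carrier (mnat K C F G)" "\<theta> \<in> carrier (mnat K C F G)"
    show "dif (mnat K C F G) (\<eta> \<oplus>\<^bsub>mnat K C F G\<^esub> \<theta>) = dif (mnat K C F G) \<eta> \<oplus>\<^bsub>mnat K C F G\<^esub> dif (mnat K C F G) \<theta>"
      using dg_module.dif_add[OF dgH mnat_carrierD(2)[OF *(1)] mnat_carrierD(2)[OF *(2)]]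
      by (auto simp: fun_eq_iff mnat_eq_pi)
  next
    fix a \<eta> assume *: "a \<in> carrier K" "\<eta> \<in> carrier (mnat K C F G)"
    show "dif (mnat K C F G) (a \<odot>\<^bsub>mnat K C F G\<^esub> \<eta>) = a \<odot>\<^bsub>mnat K C F G\<^esub> dif (mnat K C F G) \<eta>"
      using dg_module.dif_smult[OF dgH *(1) mnat_carrierD(2)[OF *(2)]]
      by (auto simp: fun_eq_iff mnat_eq_pi)
  qed
  show "dif (mnat K C F G) (dif (mnat K C F G) \<eta>) = \<zero>\<^bsub>mnat K C F G\<^esub>" if "\<eta> \<in> grade (mnat K C F G) n" for n \<eta>
    using dg_module.dif_dif[OF dgH mnat_carrierD(2)[OF M.grade_carrier[OF that]]]
    by (auto simp: fun_eq_iff)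
qed

end

lemma mnat_comp_apply: "X \<in> Ob C \<Longrightarrow> x \<in> carrier (FOb F X) \<Longrightarrow> mnat_comp C F \<theta> \<eta> X x = \<theta> X (\<eta> X x)"
  by (simp add: mnat_comp_def compose_def)

context
  fixes K :: "'k ring" and C :: "('k, 'o, 'h) dgcat" and F :: "('k, 'o, 'h, 'v) dgm" and G :: "('k, 'o, 'h, 'w) dgm"
    and H :: "('k, 'o, 'h, 'x) dgm"
  assumes F: "dg_functor K C (DgModK K) F" and G: "dg_functor K C (DgModK K) G" and H: "dg_functor K C (DgModK K) H"
    and Q: "dg_quiver K C"
begin

lemma mnat_comp_deg:
  assumes \<theta>: "\<theta> \<in> mnat_deg K C G H p" and \<eta>: "\<eta> \<in> mnat_deg K C F G q"
  shows "mnat_comp C F \<theta> \<eta> \<in> mnat_deg K C F H (p + q)"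
proof (rule mnat_degI[OF F H])
  note \<theta>D = mnat_degD[OF G H \<theta>] and \<eta>D = mnat_degD[OF F G \<eta>]
  show "mnat_comp C F \<theta> \<eta> \<in> extensional (Ob C)" by (simp add: mnat_comp_def)
  show "mnat_comp C F \<theta> \<eta> X \<in> hom_deg K (FOb F X) (FOb H X) (p + q)" if "X \<in> Ob C" for X
    using that hom_deg_compose[OF dg_module_gr_module[OF dg_mod_ob[OF F]] \<eta>D(2) \<theta>D(2)] by (simp add: mnat_comp_def)
  fix X Y r f x assume *: "X \<in> Ob C" "Y \<in> Ob C" "f \<in> grade (Hom C X Y) r" "x \<in> carrier (FOb F X)"
  note fc = gr_module.grade_carrier[OF dg_module_gr_module[OF dg_quiver_hom[OF Q *(1,2)]] *(3)]
  note mG = dg_module_module[OF dg_mod_ob[OF G]] and mH = dg_module_module[OF dg_mod_ob[OF H]]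
  note c = klin_closed[OF hom_degD(1)[OF \<eta>D(2)]] klin_closed[OF hom_degD(1)[OF \<theta>D(2)]] dg_mod_closed[OF F *(1,2) fc]
  show "FMor H X Y f (mnat_comp C F \<theta> \<eta> X x) = sg (FOb H Y) ((p + q) * r) (mnat_comp C F \<theta> \<eta> Y (FMor F X Y f x))"
    using * c by (simp add: mnat_comp_apply \<theta>D(3)[OF *(1-3)] \<eta>D(3)[OF *]
        klin_sg[OF mG mH hom_degD(1)[OF \<theta>D(2)]] sg_sg[OF module_abelian_group[OF mH]] algebra_simps)
qed

lemma mnat_comp_add_left:
  assumes "\<eta> \<in> carrier (mnat K C F G)"
  shows "mnat_comp C F (\<theta> \<oplus>\<^bsub>mnat K C G H\<^esub> \<theta>') \<eta> = mnat_comp C F \<theta> \<eta> \<oplus>\<^bsub>mnat K C F H\<^esub> mnat_comp C F \<theta>' \<eta>"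
  using mnat_closed[OF F G Q assms] by (auto simp: mnat_comp_def compose_def fun_eq_iff)

lemma mnat_comp_smult_left:
  assumes "\<eta> \<in> carrier (mnat K C F G)"
  shows "mnat_comp C F (a \<odot>\<^bsub>mnat K C G H\<^esub> \<theta>) \<eta> = a \<odot>\<^bsub>mnat K C F H\<^esub> mnat_comp C F \<theta> \<eta>"
  using mnat_closed[OF F G Q assms] by (auto simp: mnat_comp_def compose_def fun_eq_iff)

lemma mnat_comp_add_right:
  assumes "\<theta> \<in> carrier (mnat K C G H)" "\<eta> \<in> carrier (mnat K C F G)" "\<eta>' \<in> carrier (mnat K C F G)"
  shows "mnat_comp C F \<theta> (\<eta> \<oplus>\<^bsub>mnat K C F G\<^esub> \<eta>') = mnat_comp C F \<theta> \<eta> \<oplus>\<^bsub>mnat K C F H\<^esub> mnat_comp C F \<theta> \<eta>'"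
  using mnat_closed[OF F G Q assms(2)] mnat_closed[OF F G Q assms(3)] klin_add[OF mnat_carrierD(3)[OF G H Q assms(1)]]
  by (auto simp: mnat_comp_def compose_def fun_eq_iff)

lemma mnat_comp_smult_right:
  assumes "a \<in> carrier K" "\<theta> \<in> carrier (mnat K C G H)" "\<eta> \<in> carrier (mnat K C F G)"
  shows "mnat_comp C F \<theta> (a \<odot>\<^bsub>mnat K C F G\<^esub> \<eta>) = a \<odot>\<^bsub>mnat K C F H\<^esub> mnat_comp C F \<theta> \<eta>"
  using mnat_closed[OF F G Q assms(3)] klin_smult[OF mnat_carrierD(3)[OF G H Q assms(2)] assms(1)]
  by (auto simp: mnat_comp_def compose_def fun_eq_iff)

text \<open>Carriers are generated by homogeneous transformations, so both arguments are reduced to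
  that case in turn by additivity.\<close>

lemma mnat_comp_closed:
  assumes "\<theta> \<in> carrier (mnat K C G H)" "\<eta> \<in> carrier (mnat K C F G)"
  shows "mnat_comp C F \<theta> \<eta> \<in> carrier (mnat K C F H)"
proof -
  interpret FG: gr_module K "mnat K C F G" by (rule dg_module_gr_module[OF dg_module_mnat[OF F G Q]])
  interpret GH: gr_module K "mnat K C G H" by (rule dg_module_gr_module[OF dg_module_mnat[OF G H Q]])
  interpret FH: gr_module K "mnat K C F H" by (rule dg_module_gr_module[OF dg_module_mnat[OF F H Q]])
  show ?thesis using assms(1)
  proof (induction rule: GH.homog_induct)
    case (homog p \<theta>)
    show ?case using assms(2)
    proof (induction rule: FG.homog_induct)
      case (homog q \<eta>)
      then show ?case
        using \<open>\<theta> \<in> grade _ p\<close> mnat_comp_deg FH.grade_carrier[of _ "p + q"] by simp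
    next
      case (add \<eta> \<eta>')
      then show ?case
        using mnat_comp_add_right[OF GH.grade_carrier[OF homog]] FH.a_closed by (simp del: mnat_simps)
    qed
  next
    case (add \<theta> \<theta>')
    then show ?case
      using mnat_comp_add_left[OF assms(2)] FH.a_closed by (simp del: mnat_simps)
  qed
qed

text \<open>Both sides are linear in \<eta>, so \<eta> may be taken homogeneous; then its
  differential has an explicit value at each x and the two sides are compared there.\<close>

lemma mnat_comp_dif:
  assumes \<theta>: "\<theta> \<in> mnat_deg K C G H p" and \<eta>: "\<eta> \<in> carrier (mnat K C F G)"
  shows "dif (mnat K C F H) (mnat_comp C F \<theta> \<eta>) =
    mnat_comp C F (dif (mnat K C G H) \<theta>) \<eta> \<oplus>\<^bsub>mnat K C F H\<^esub>
    sg (mnat K C F H) p (mnat_comp C F \<theta> (dif (mnat K C F G) \<eta>))"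
proof -
  note mFG = dg_module_mnat[OF F G Q] and mGH = dg_module_mnat[OF G H Q] and mFH = dg_module_mnat[OF F H Q]
  interpret FG: gr_module K "mnat K C F G" by (rule dg_module_gr_module[OF mFG])
  interpret GH: gr_module K "mnat K C G H" by (rule dg_module_gr_module[OF mGH])
  interpret FH: gr_module K "mnat K C F H" by (rule dg_module_gr_module[OF mFH])
  have \<theta>c: "\<theta> \<in> carrier (mnat K C G H)" using \<theta> GH.grade_carrier by simp
  have k: "klin K (mnat K C F G) (mnat K C F H) (mnat_comp C F \<theta>')" if "\<theta>' \<in> carrier (mnat K C G H)" for \<theta>'
    by (intro klinI mnat_comp_closed mnat_comp_add_right mnat_comp_smult_right that)
  note k1 = klin_comp[OF k[OF \<theta>c] dg_module_klin_dif[OF mFH]]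
  note k2 = klin_plus[OF FG.module_axioms FH.module_axioms k[OF dif_carrier[OF mGH \<theta>c]]
      klin_sg_fun[OF FH.module_axioms klin_comp[OF dg_module_klin_dif[OF mFG] k[OF \<theta>c]]]]
  show ?thesis
  proof (rule FG.klin_eqI[OF FH.module_axioms k1 k2 _ \<eta>])
    fix q \<eta> assume "\<eta> \<in> grade (mnat K C F G) q"
    then have \<eta>: "\<eta> \<in> mnat_deg K C F G q" and \<eta>c: "\<eta> \<in> carrier (mnat K C F G)" using FG.grade_carrier by auto
    note d\<eta> = dif_carrier[OF mFG \<eta>c] and d\<theta> = dif_carrier[OF mGH \<theta>c]
    let ?s = "mnat_comp C F \<theta> (dif (mnat K C F G) \<eta>)"
    have sdeg: "?s \<in> mnat_deg K C F H (p + (q + 1))"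
      using mnat_comp_deg[OF \<theta>] dif_grade[OF mFG, of \<eta> q] \<eta> by (simp del: mnat_simps(5))
    have s: "?s \<in> carrier (mnat K C F H)" using mnat_comp_closed[OF \<theta>c d\<eta>] .
    have "sg (mnat K C F H) p ?s X x = sg (FOb H X) p (?s X x)" if "X \<in> Ob C" "x \<in> carrier (FOb F X)" for X x
    proof -
      have "\<ominus>\<^bsub>mnat K C F H\<^esub> ?s = (\<ominus>\<^bsub>K\<^esub> \<one>\<^bsub>K\<^esub>) \<odot>\<^bsub>mnat K C F H\<^esub> ?s"
        using s by (simp only: FH.smult_l_minus FG.R.one_closed FH.smult_one)
      moreover interpret HX: module K "FOb H X" by (rule dg_module_module[OF dg_mod_ob[OF H that(1)]])
      have "?s X x \<in> carrier (FOb H X)" by (rule mnat_closed[OF F H Q s that])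
      ultimately show ?thesis using that by (simp add: sg_def HX.smult_l_minus)
    qed
    note sgp = this
    show "dif (mnat K C F H) (mnat_comp C F \<theta> \<eta>) = mnat_comp C F (dif (mnat K C G H) \<theta>) \<eta> \<oplus>\<^bsub>mnat K C F H\<^esub>
        sg (mnat K C F H) p ?s"
    proof (rule mnat_eqI[OF F H Q])
      show "dif (mnat K C F H) (mnat_comp C F \<theta> \<eta>) \<in> carrier (mnat K C F H)"
        by (intro dif_carrier[OF mFH] mnat_comp_closed \<theta>c \<eta>c)
      show "mnat_comp C F (dif (mnat K C G H) \<theta>) \<eta> \<oplus>\<^bsub>mnat K C F H\<^esub> sg (mnat K C F H) p ?s \<in> carrier (mnat K C F H)"
        by (intro FH.a_closed mnat_comp_closed \<theta>c \<eta>c d\<theta> sg_closed s module_abelian_group[OF FH.module_axioms])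
      fix X x assume *: "X \<in> Ob C" "x \<in> carrier (FOb F X)"
      interpret FX: dg_module K "FOb F X" by (rule dg_mod_ob[OF F *(1)])
      interpret GX: dg_module K "FOb G X" by (rule dg_mod_ob[OF G *(1)])
      interpret HX: dg_module K "FOb H X" by (rule dg_mod_ob[OF H *(1)])
      have \<eta>cl: "\<eta> X y \<in> carrier (FOb G X)" if "y \<in> carrier (FOb F X)" for y
        by (rule mnat_closed[OF F G Q \<eta>c *(1) that])
      have \<theta>cl: "\<theta> X y \<in> carrier (FOb H X)" if "y \<in> carrier (FOb G X)" for y
        by (rule mnat_closed[OF G H Q \<theta>c *(1) that])
      note \<theta>X = mnat_carrierD(3)[OF G H Q \<theta>c *(1)]
      \<comment> \<open>Of the terms below, \<theta>(d(\<eta> x)) occurs with exponent p + 1 in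
        \<open>e2\<close> and with p in the signed \<open>e3\<close>, hence cancels; the exponents p
        and q + 1 of the last term add up to that of \<open>e1\<close>.\<close>
      have e1: "dif (mnat K C F H) (mnat_comp C F \<theta> \<eta>) X x =
          dif (FOb H X) (\<theta> X (\<eta> X x)) \<oplus>\<^bsub>FOb H X\<^esub> sg (FOb H X) (p + q + 1) (\<theta> X (\<eta> X (dif (FOb F X) x)))"
        using * by (simp only: mnat_dif_eval[OF F H Q mnat_comp_deg[OF \<theta> \<eta>]] mnat_comp_apply FX.dif_closed)
      have e2: "mnat_comp C F (dif (mnat K C G H) \<theta>) \<eta> X x =
          dif (FOb H X) (\<theta> X (\<eta> X x)) \<oplus>\<^bsub>FOb H X\<^esub> sg (FOb H X) (p + 1) (\<theta> X (dif (FOb G X) (\<eta> X x)))"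
        using * by (simp only: mnat_dif_eval[OF G H Q \<theta>] mnat_comp_apply \<eta>cl)
      have e3: "?s X x = \<theta> X (dif (FOb G X) (\<eta> X x)) \<oplus>\<^bsub>FOb H X\<^esub> sg (FOb H X) (q + 1) (\<theta> X (\<eta> X (dif (FOb F X) x)))"
        using * by (simp only: mnat_dif_eval[OF F G Q \<eta>] mnat_comp_apply klin_add[OF \<theta>X]
            klin_sg[OF GX.module_axioms HX.module_axioms \<theta>X] \<eta>cl FX.dif_closed GX.dif_closed
            sg_closed[OF module_abelian_group[OF GX.module_axioms]])
      note [simp] = \<theta>cl \<eta>cl * FX.dif_closed GX.dif_closed HX.dif_closed
      have c: "y \<oplus>\<^bsub>FOb H X\<^esub> (z \<oplus>\<^bsub>FOb H X\<^esub> \<ominus>\<^bsub>FOb H X\<^esub> y) = z" "\<ominus>\<^bsub>FOb H X\<^esub> y \<oplus>\<^bsub>FOb H X\<^esub> (z \<oplus>\<^bsub>FOb H X\<^esub> y) = z"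
        if "y \<in> carrier (FOb H X)" "z \<in> carrier (FOb H X)" for y z
        using that by (simp_all add: HX.a_lcomm[of _ z] HX.r_neg HX.l_neg)
      show "dif (mnat K C F H) (mnat_comp C F \<theta> \<eta>) X x =
          (mnat_comp C F (dif (mnat K C G H) \<theta>) \<eta> \<oplus>\<^bsub>mnat K C F H\<^esub> sg (mnat K C F H) p ?s) X x"
        unfolding mnat_simps(2) by (simp del: mnat_simps add: sgp e1 e2 e3, simp add: sg_def HX.minus_add HX.a_ac HX.r_neg1 HX.r_neg2 HX.r_neg HX.l_neg c)
    qed
  qed
qed

end

lemma mnat_id_deg:
  assumes "dg_functor K C (DgModK K) F" "dg_quiver K C"
  shows "mnat_id C F \<in> mnat_deg K C F F 0"
proof (rule mnat_degI[OF assms(1,1)])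
  show "mnat_id C F X \<in> hom_deg K (FOb F X) (FOb F X) 0" if X: "X \<in> Ob C" for X
  proof -
    interpret FX: gr_module K "FOb F X" by (rule dg_module_gr_module[OF dg_mod_ob[OF assms(1) X]])
    show ?thesis using X by (auto simp: mnat_id_def FX.grade_carrier intro!: hom_degI klinI)
  qed
  fix X Y p f x assume *: "X \<in> Ob C" "Y \<in> Ob C" "f \<in> grade (Hom C X Y) p" "x \<in> carrier (FOb F X)"
  have "dg_module K (Hom C X Y)" using assms(2) * by (simp add: dg_quiver_def)
  from gr_module.grade_carrier[OF dg_module_gr_module[OF this] *(3)]
  show "FMor F X Y f (mnat_id C F X x) = sg (FOb F Y) (0 * p) (mnat_id C F Y (FMor F X Y f x))"
    using * by (simp add: mnat_id_def dg_mod_closed[OF assms(1)])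
qed (simp add: mnat_id_def)

lemma DgMod_simps [simp]:
  "Ob (DgMod K C) = {F. dg_functor K C (DgModK K) F}" "Hom (DgMod K C) = mnat K C" "Id (DgMod K C) = mnat_id C"
  "Comp (DgMod K C) = (\<lambda>F G H \<theta> \<eta>. mnat_comp C F \<theta> \<eta>)"
  by (simp_all add: DgMod_def)

theorem dg_category_DgMod:
  assumes Q: "dg_quiver K C"
  shows "dg_category K (DgMod K C :: ('k, ('k, 'o, 'h, 'v) dgm, 'o \<Rightarrow> 'v \<Rightarrow> 'v) dgcat)"
proof (intro dg_category.intro dg_category_axioms.intro)
  show "cring K" using Q by (simp add: dg_quiver_def)
next
  fix F G :: "('k, 'o, 'h, 'v) dgm" assume FG: "F \<in> Ob (DgMod K C)" "G \<in> Ob (DgMod K C)"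
  then show "dg_module K (Hom (DgMod K C) F G)" by (simp add: dg_module_mnat Q)
  have Fid: "mnat_id C H \<in> carrier (mnat K C H H)" if "H \<in> Ob (DgMod K C)" for H :: "('k, 'o, 'h, 'v) dgm"
    using gr_module.grade_carrier[OF dg_module_gr_module[OF dg_module_mnat], of K C H H "mnat_id C H" 0] that
    by (simp add: mnat_id_deg Q)
  show "Id (DgMod K C) F \<in> carrier (Hom (DgMod K C) F F)" using Fid[OF FG(1)] by simp
  fix \<eta> assume \<eta>: "\<eta> \<in> carrier (Hom (DgMod K C) F G)"
  show "Comp (DgMod K C) F G G (Id (DgMod K C) G) \<eta> = \<eta>"
  proof (rule mnat_eqI[of K C F G])
    show "Comp (DgMod K C) F G G (Id (DgMod K C) G) \<eta> \<in> carrier (mnat K C F G)"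
      using mnat_comp_closed[of K C F G G] Fid FG \<eta> Q by simp
  qed (use FG \<eta> Q in \<open>auto simp: mnat_comp_apply mnat_id_def mnat_closed\<close>)
  show "Comp (DgMod K C) F F G \<eta> (Id (DgMod K C) F) = \<eta>"
  proof (rule mnat_eqI[of K C F G])
    show "Comp (DgMod K C) F F G \<eta> (Id (DgMod K C) F) \<in> carrier (mnat K C F G)"
      using mnat_comp_closed[of K C F F G] Fid FG \<eta> Q by simp
  qed (use FG \<eta> Q in \<open>auto simp: mnat_comp_apply mnat_id_def mnat_closed\<close>)
next
  fix E F G H :: "('k, 'o, 'h, 'v) dgm" and \<kappa> \<theta> \<eta>
  assume *: "E \<in> Ob (DgMod K C)" "F \<in> Ob (DgMod K C)" "G \<in> Ob (DgMod K C)" "H \<in> Ob (DgMod K C)"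
    "\<kappa> \<in> carrier (Hom (DgMod K C) G H)" "\<theta> \<in> carrier (Hom (DgMod K C) F G)" "\<eta> \<in> carrier (Hom (DgMod K C) E F)"
  show "Comp (DgMod K C) E F H (Comp (DgMod K C) F G H \<kappa> \<theta>) \<eta> = Comp (DgMod K C) E G H \<kappa> (Comp (DgMod K C) E F G \<theta> \<eta>)"
    using * mnat_closed[of K C E F \<eta>] Q by (auto simp: mnat_comp_def compose_def fun_eq_iff)
qed (simp_all add: mnat_comp_closed mnat_comp_add_left mnat_comp_add_right mnat_comp_smult_left mnat_comp_smult_right
    mnat_comp_deg mnat_comp_dif Q del: mnat_simps(2-))

section \<open>Identities and the opposite category\<close>

context dg_category
begin

lemma gr_hom_module: "X \<in> Ob C \<Longrightarrow> Y \<in> Ob C \<Longrightarrow> gr_module K (Hom C X Y)"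
  by (rule dg_module_gr_module[OF hom_dg_module])

lemma mod_hom: "X \<in> Ob C \<Longrightarrow> Y \<in> Ob C \<Longrightarrow> module K (Hom C X Y)"
  by (rule dg_module_module[OF hom_dg_module])

lemma kbilin_comp: "X \<in> Ob C \<Longrightarrow> Y \<in> Ob C \<Longrightarrow> Z \<in> Ob C \<Longrightarrow>
    kbilin K (Hom C Y Z) (Hom C X Y) (Hom C X Z) (Comp C X Y Z)"
  by (simp add: kbilin_def klin_def comp_closed comp_add_left comp_add_right comp_smult_left comp_smult_right)

lemma klin_comp_left: "X \<in> Ob C \<Longrightarrow> Y \<in> Ob C \<Longrightarrow> Z \<in> Ob C \<Longrightarrow> g \<in> carrier (Hom C Y Z) \<Longrightarrow>
    klin K (Hom C X Y) (Hom C X Z) (Comp C X Y Z g)"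
  using kbilinD2[OF kbilin_comp] .

lemma klin_comp_right: "X \<in> Ob C \<Longrightarrow> Y \<in> Ob C \<Longrightarrow> Z \<in> Ob C \<Longrightarrow> f \<in> carrier (Hom C X Y) \<Longrightarrow>
    klin K (Hom C Y Z) (Hom C X Z) (\<lambda>g. Comp C X Y Z g f)"
  using kbilinD1[OF kbilin_comp] .

text \<open>Comparing degrees in \<open>e \<circ> f = f\<close> shows that the degree zero component of an identity
  is again a left identity.\<close>

lemma id_grade:
  assumes X: "X \<in> Ob C"
  shows "Id C X \<in> grade (Hom C X X) 0"
proof -
  interpret H: gr_module K "Hom C X X" by (rule gr_hom_module[OF X X])
  let ?e = "hcomp (Hom C X X) (Id C X) 0"
  note ic = id_closed[OF X]
  have ec: "?e \<in> carrier (Hom C X X)" by (rule H.hcomp_closed[OF ic])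
  have "Comp C X X X ?e (Id C X) = Id C X"
  proof (rule H.klin_eqI[OF H.module_axioms klin_comp_left[OF X X X ec], of "\<lambda>f. f"])
    show "klin K (Hom C X X) (Hom C X X) (\<lambda>f. f)" by (simp add: klin_def)
    show "Id C X \<in> carrier (Hom C X X)" by (rule ic)
    fix n f assume f: "f \<in> grade (Hom C X X) n"
    note fc = H.grade_carrier[OF f]
    have k1: "klin K (Hom C X X) (Hom C X X) (\<lambda>g. Comp C X X X (hcomp (Hom C X X) g 0) f)"
      by (rule klin_comp[OF H.klin_hcomp klin_comp_right[OF X X X fc]])
    have k2: "klin K (Hom C X X) (Hom C X X) (\<lambda>g. hcomp (Hom C X X) (Comp C X X X g f) n)"
      by (rule klin_comp[OF klin_comp_right[OF X X X fc] H.klin_hcomp])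
    \<comment> \<open>For f of degree n, cutting g to degree zero before composing is cutting g
      \<circ> f to degree n afterwards; at g the identity the right side is f.\<close>
    have "Comp C X X X (hcomp (Hom C X X) g 0) f = hcomp (Hom C X X) (Comp C X X X g f) n"
      if "g \<in> carrier (Hom C X X)" for g
    proof (rule H.klin_eqI[OF H.module_axioms k1 k2 _ that])
      fix m g assume g: "g \<in> grade (Hom C X X) m"
      show "Comp C X X X (hcomp (Hom C X X) g 0) f = hcomp (Hom C X X) (Comp C X X X g f) n"
        using comp_grade[OF X X X g f] klin_zero[OF H.module_axioms H.module_axioms klin_comp_right[OF X X X fc]]
        by (auto simp: H.hcomp_homog[OF g] H.hcomp_homog)
    qed
    from this[OF ic] show "Comp C X X X ?e f = f"
      by (simp add: id_left[OF X X fc] H.hcomp_homog[OF f])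
  qed
  \<comment> \<open>e \<circ> id is id by what precedes and e by the right unit law.\<close>
  then have "?e = Id C X" using id_right[OF X X ec] by simp
  then show ?thesis using H.hcomp_grade[OF ic, of 0] by simp
qed

text \<open>The Leibniz rule for id \<circ> id, with id of degree zero, gives d(id) = d(id) +
  d(id).\<close>

lemma dif_id:
  assumes X: "X \<in> Ob C"
  shows "dif (Hom C X X) (Id C X) = \<zero>\<^bsub>Hom C X X\<^esub>"
proof -
  interpret H: dg_module K "Hom C X X" by (rule hom_dg_module[OF X X])
  have d: "dif (Hom C X X) (Id C X) \<in> carrier (Hom C X X)" by (rule H.dif_closed[OF id_closed[OF X]])
  have "dif (Hom C X X) (Id C X) = dif (Hom C X X) (Id C X) \<oplus>\<^bsub>Hom C X X\<^esub> dif (Hom C X X) (Id C X)"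
    using comp_dif[OF X X X id_grade[OF X] id_closed[OF X]] by (simp add: id_left id_right X id_closed d)
  then show ?thesis using d by (metis H.add.r_cancel_one)
qed

end

lemma dg_op_simps [simp]:
  "Ob (dg_op C) = Ob C" "Hom (dg_op C) = (\<lambda>X Y. Hom C Y X)" "Id (dg_op C) = Id C"
  by (simp_all add: dg_op_def)

context dg_category
begin

lemma gr_bilin_op: "X \<in> Ob C \<Longrightarrow> Y \<in> Ob C \<Longrightarrow> Z \<in> Ob C \<Longrightarrow>
    gr_bilin K (Hom C Z Y) (Hom C Y X) (Hom C Z X) (\<lambda>p q g f. sg (Hom C Z X) (p * q) (Comp C Z Y X f g))"
proof (rule kbilin_gr_bilin[OF gr_hom_module gr_hom_module])
  fix p q assume *: "X \<in> Ob C" "Y \<in> Ob C" "Z \<in> Ob C"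
  show "kbilin K (Hom C Z Y) (Hom C Y X) (Hom C Z X) (\<lambda>g f. sg (Hom C Z X) (p * q) (Comp C Z Y X f g))"
    unfolding kbilin_def using * klin_comp_left klin_comp_right mod_hom by (auto intro!: klin_sg_fun)
qed

lemma kbilin_op: "X \<in> Ob C \<Longrightarrow> Y \<in> Ob C \<Longrightarrow> Z \<in> Ob C \<Longrightarrow>
    kbilin K (Hom C Z Y) (Hom C Y X) (Hom C Z X) (Comp (dg_op C) X Y Z)"
  using kbilin_bilin_ext[OF gr_hom_module gr_hom_module mod_hom gr_bilin_op] by (simp add: dg_op_def)

lemma op_homog: "X \<in> Ob C \<Longrightarrow> Y \<in> Ob C \<Longrightarrow> Z \<in> Ob C \<Longrightarrow> g \<in> grade (Hom C Z Y) p \<Longrightarrow> f \<in> grade (Hom C Y X) q \<Longrightarrow>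
    Comp (dg_op C) X Y Z g f = sg (Hom C Z X) (p * q) (Comp C Z Y X f g)"
  using bilin_ext_homog[OF gr_hom_module gr_hom_module mod_hom gr_bilin_op] by (simp add: dg_op_def)

lemma grade_op: "X \<in> Ob C \<Longrightarrow> Y \<in> Ob C \<Longrightarrow> Z \<in> Ob C \<Longrightarrow> g \<in> grade (Hom C Z Y) p \<Longrightarrow> f \<in> grade (Hom C Y X) q \<Longrightarrow>
    Comp (dg_op C) X Y Z g f \<in> grade (Hom C Z X) (p + q)"
  using gr_module.grade_sg[OF gr_hom_module comp_grade[of Z Y X f q g p]] by (simp add: op_homog add.commute)

end

text \<open>Associativity holds because both bracketings collect the exponent pq + pn + qn for
  degrees p, q, n. The composition is a bilinear extension, so the signed laws are verified for
  homogeneous morphisms first.\<close>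

theorem dg_category_op:
  assumes "dg_category K C"
  shows "dg_category K (dg_op C)"
proof -
  interpret C: dg_category K C by fact
  note cl = kbilin_closed[OF C.kbilin_op] and gc = gr_module.grade_carrier[OF C.gr_hom_module]
  note l = kbilinD1[OF C.kbilin_op] and r = kbilinD2[OF C.kbilin_op]
  note ag = module_abelian_group[OF C.mod_hom]
  show ?thesis
  proof (intro dg_category.intro dg_category_axioms.intro, unfold dg_op_simps)
    show "cring K" by (rule C.is_cring)
  next
    fix X Y assume *: "X \<in> Ob C" "Y \<in> Ob C"
    show "dg_module K (Hom C Y X)" by (rule C.hom_dg_module[OF *(2,1)])
    show "Id C X \<in> carrier (Hom C X X)" by (rule C.id_closed[OF *(1)])
    interpret H: gr_module K "Hom C Y X" by (rule C.gr_hom_module[OF *(2,1)])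
    have k: "klin K (Hom C Y X) (Hom C Y X) (\<lambda>f. f)" by (simp add: klin_def)
    fix f assume f: "f \<in> carrier (Hom C Y X)"
    show "Comp (dg_op C) X Y Y (Id C Y) f = f"
      by (rule H.klin_eqI[OF H.module_axioms r[OF *(1,2,2) C.id_closed[OF *(2)]] k _ f])
        (simp add: * C.op_homog[OF *(1,2,2) C.id_grade[OF *(2)]] C.id_right H.grade_carrier)
    show "Comp (dg_op C) X X Y f (Id C X) = f"
      by (rule H.klin_eqI[OF H.module_axioms l[OF *(1,1,2) C.id_closed[OF *(1)]] k _ f])
        (simp add: * C.op_homog[OF *(1,1,2) _ C.id_grade[OF *(1)]] C.id_left H.grade_carrier)
  next
    fix W X Y Z h g f assume *: "W \<in> Ob C" "X \<in> Ob C" "Y \<in> Ob C" "Z \<in> Ob C"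
      and h: "h \<in> carrier (Hom C Z Y)" and g: "g \<in> carrier (Hom C Y X)" and f: "f \<in> carrier (Hom C X W)"
    interpret ZY: gr_module K "Hom C Z Y" by (rule C.gr_hom_module[OF *(4,3)])
    interpret YX: gr_module K "Hom C Y X" by (rule C.gr_hom_module[OF *(3,2)])
    interpret XW: gr_module K "Hom C X W" by (rule C.gr_hom_module[OF *(2,1)])
    note m = C.mod_hom[OF *(4,1)]
    let ?l = "\<lambda>h g f. Comp (dg_op C) W X Z (Comp (dg_op C) X Y Z h g) f"
      and ?r = "\<lambda>h g f. Comp (dg_op C) W Y Z h (Comp (dg_op C) W X Y g f)"
    \<comment> \<open>The arguments are freed from homogeneity one at a time: \<open>3\<close>
      leaves f arbitrary, \<open>2\<close> also g, and the final step also h.\<close>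
    have 3: "?l h g f = ?r h g f" if hg: "h \<in> grade (Hom C Z Y) p" "g \<in> grade (Hom C Y X) q" and "f \<in> carrier (Hom C X W)" for h g f p q
    proof (rule XW.klin_eqI[OF m _ _ _ that(3)])
      show "klin K (Hom C X W) (Hom C Z W) (?l h g)"
        using hg * by (intro r cl gc[OF _ _ hg(1)] gc[OF _ _ hg(2)])
      show "klin K (Hom C X W) (Hom C Z W) (?r h g)"
        using hg * by (intro klin_comp[OF r r] gc[OF _ _ hg(1)] gc[OF _ _ hg(2)])
      fix n f assume f: "f \<in> grade (Hom C X W) n"
      note hc = ZY.grade_carrier[OF hg(1)] and gc' = YX.grade_carrier[OF hg(2)] and fc = XW.grade_carrier[OF f]
      have hgd: "sg (Hom C Z X) (p * q) (Comp C Z Y X g h) \<in> grade (Hom C Z X) (q + p)"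
        by (rule gr_module.grade_sg[OF C.gr_hom_module[OF *(4,2)] C.comp_grade[OF *(4,3,2) hg(2,1)]])
      have gfd: "sg (Hom C Y W) (q * n) (Comp C Y X W f g) \<in> grade (Hom C Y W) (n + q)"
        by (rule gr_module.grade_sg[OF C.gr_hom_module[OF *(3,1)] C.comp_grade[OF *(3,2,1) f hg(2)]])
      show "?l h g f = ?r h g f"
        unfolding C.op_homog[OF *(2-4) hg] C.op_homog[OF *(1,2,4) hgd f] C.op_homog[OF *(1-3) hg(2) f] C.op_homog[OF *(1,3,4) hg(1) gfd]
        using * hc gc' fc
        by (simp add: klin_sg[OF C.mod_hom C.mod_hom C.klin_comp_left] klin_sg[OF C.mod_hom C.mod_hom C.klin_comp_right]
            sg_sg[OF ag] C.comp_closed C.comp_assoc algebra_simps)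
    qed
    have 2: "?l h g f = ?r h g f" if h: "h \<in> grade (Hom C Z Y) p" and g: "g \<in> carrier (Hom C Y X)" and f: "f \<in> carrier (Hom C X W)" for h g f p
    proof (rule YX.klin_eqI[OF m _ _ _ g])
      show "klin K (Hom C Y X) (Hom C Z W) (\<lambda>g. ?l h g f)"
        by (rule klin_comp[OF r[OF *(2-4) gc[OF *(4,3) h]] l[OF *(1,2,4) f]])
      show "klin K (Hom C Y X) (Hom C Z W) (\<lambda>g. ?r h g f)"
        by (rule klin_comp[OF l[OF *(1-3) f] r[OF *(1,3,4) gc[OF *(4,3) h]]])
    qed (rule 3[OF h _ f])
    show "?l h g f = ?r h g f"
    proof (rule ZY.klin_eqI[OF m _ _ _ h])
      show "klin K (Hom C Z Y) (Hom C Z W) (\<lambda>h. ?l h g f)"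
        by (rule klin_comp[OF l[OF *(2-4) g] l[OF *(1,2,4) f]])
      show "klin K (Hom C Z Y) (Hom C Z W) (\<lambda>h. ?r h g f)"
        by (rule l[OF *(1,3,4) cl[OF *(1-3) g f]])
    qed (rule 2[OF _ g f])
  next
    fix X Y Z p g f assume *: "X \<in> Ob C" "Y \<in> Ob C" "Z \<in> Ob C"
      and g: "g \<in> grade (Hom C Z Y) p" and f: "f \<in> carrier (Hom C Y X)"
    interpret YX: gr_module K "Hom C Y X" by (rule C.gr_hom_module[OF *(2,1)])
    note gcar = gc[OF *(3,2) g]
    note dg = dif_grade[OF C.hom_dg_module[OF *(3,2)] g]
    note m = C.mod_hom[OF *(3,1)]
    note dl = dg_module_klin_dif[OF C.hom_dg_module]
    show "dif (Hom C Z X) (Comp (dg_op C) X Y Z g f) = Comp (dg_op C) X Y Z (dif (Hom C Z Y) g) f \<oplus>\<^bsub>Hom C Z X\<^esub>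
        sg (Hom C Z X) p (Comp (dg_op C) X Y Z g (dif (Hom C Y X) f))"
    proof (rule YX.klin_eqI[OF m _ _ _ f])
      show "klin K (Hom C Y X) (Hom C Z X) (\<lambda>f. dif (Hom C Z X) (Comp (dg_op C) X Y Z g f))"
        by (rule klin_comp[OF r[OF * gcar] dl[OF *(3,1)]])
      show "klin K (Hom C Y X) (Hom C Z X) (\<lambda>f. Comp (dg_op C) X Y Z (dif (Hom C Z Y) g) f \<oplus>\<^bsub>Hom C Z X\<^esub>
          sg (Hom C Z X) p (Comp (dg_op C) X Y Z g (dif (Hom C Y X) f)))"
        by (intro klin_plus[OF YX.module_axioms m] r[OF *] gc[OF *(3,2) dg] klin_sg_fun[OF m] klin_comp[OF dl[OF *(2,1)] r[OF * gcar]])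
      fix n f assume f: "f \<in> grade (Hom C Y X) n"
      note fcar = YX.grade_carrier[OF f]
      note df = dif_grade[OF C.hom_dg_module[OF *(2,1)] f]
      note dfc = YX.grade_carrier[OF df] and dgc = gc[OF *(3,2) dg]
      note c = C.comp_closed[OF *(3,2,1)]
      interpret ZX: dg_module K "Hom C Z X" by (rule C.hom_dg_module[OF *(3,1)])
      show "dif (Hom C Z X) (Comp (dg_op C) X Y Z g f) = Comp (dg_op C) X Y Z (dif (Hom C Z Y) g) f \<oplus>\<^bsub>Hom C Z X\<^esub>
          sg (Hom C Z X) p (Comp (dg_op C) X Y Z g (dif (Hom C Y X) f))"
        \<comment> \<open>The Leibniz rule of f \<circ> g yields its summands in the opposite order.
          Modulo 2, pn + n is the exponent (p + 1) n of the term with dg, and pn agrees with p + p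
          (n + 1), that of the term with df.\<close>
        unfolding C.op_homog[OF * g f] C.op_homog[OF * dg f] C.op_homog[OF * g df]
        using c[OF fcar gcar] c[OF dfc gcar] c[OF fcar dgc]
        by (simp add: klin_sg[OF m m dl[OF *(3,1)]] C.comp_dif[OF *(3,2,1) f gcar] sg_sg[OF ag[OF *(3,1)]] sg_add[OF ag[OF *(3,1)]]
            sg_closed[OF ag[OF *(3,1)]] ZX.a_comm algebra_simps sg_cong[of "p * n + n"])
          (simp add: sg_def algebra_simps ZX.a_comm)
    qed
  qed (auto simp: cl klin_add[OF l] klin_add[OF r] klin_smult[OF l] klin_smult[OF r] C.grade_op)
qed

section \<open>Tensor products\<close>

text \<open>Linearity in a parameter of the formula, as opposed to the argument that is extended.
  Maps on tensor products need it: their signs are extended in some variables while the others must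
  stay linear.\<close>

lemma klin_lin_ext_param:
  assumes M: "gr_module K M" and P: "module K P" and R: "module K R"
    and g: "\<And>r. r \<in> carrier R \<Longrightarrow> gr_lin K M P (\<phi> r)"
    and k: "\<And>n x. x \<in> grade M n \<Longrightarrow> klin K R P (\<lambda>r. \<phi> r n x)" and x: "x \<in> carrier M"
  shows "klin K R P (\<lambda>r. lin_ext M P (\<phi> r) x)"
proof -
  interpret M: gr_module K M by (rule M)
  show ?thesis using x
  proof (induction rule: M.homog_induct)
    case (homog n x)
    then show ?case using k[OF homog] by (subst klin_cong[OF R lin_ext_homog[OF M P g homog]])
  next
    case (add x y)
    show ?case
      by (subst klin_cong[OF R klin_add[OF klin_lin_ext[OF M P g] add(1,2)]]) (auto intro: klin_plus[OF R P add(3,4)])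
  qed
qed

lemma klin_bilin_ext_param:
  assumes M: "gr_module K M" and N: "gr_module K N" and P: "module K P" and R: "module K R"
    and g: "\<And>r. r \<in> carrier R \<Longrightarrow> gr_bilin K M N P (\<phi> r)"
    and k: "\<And>p q x y. x \<in> grade M p \<Longrightarrow> y \<in> grade N q \<Longrightarrow> klin K R P (\<lambda>r. \<phi> r p q x y)"
    and x: "x \<in> carrier M" and y: "y \<in> carrier N"
  shows "klin K R P (\<lambda>r. bilin_ext M N P (\<phi> r) x y)"
  unfolding bilin_ext_def
proof (rule klin_lin_ext_param[OF M P R _ _ x])
  show "gr_lin K M P (\<lambda>p x'. lin_ext N P (\<lambda>q y'. \<phi> r p q x' y') y)" if "r \<in> carrier R" for r
    by (rule gr_bilin_ext_aux[OF M N P g[OF that] y])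
  show "klin K R P (\<lambda>r. lin_ext N P (\<lambda>q y'. \<phi> r p q x y') y)" if "x \<in> grade M p" for p x
    by (rule klin_lin_ext_param[OF N P R _ k[OF that] y]) (use g that in \<open>auto simp: gr_bilin_def\<close>)
qed

lemma free_mod_simps [simp]:
  "carrier (free_mod K S) = {c. finite {z. c z \<noteq> \<zero>\<^bsub>K\<^esub>} \<and> (\<forall>z. c z \<in> carrier K) \<and> (\<forall>z. z \<notin> S \<longrightarrow> c z = \<zero>\<^bsub>K\<^esub>)}"
  "zero (free_mod K S) = (\<lambda>z. \<zero>\<^bsub>K\<^esub>)" "add (free_mod K S) = (\<lambda>c c'. \<lambda>z. c z \<oplus>\<^bsub>K\<^esub> c' z)"
  "smult (free_mod K S) = (\<lambda>a c. \<lambda>z. a \<otimes>\<^bsub>K\<^esub> c z)"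
  by (simp_all add: free_mod_def)

lemma module_free_mod:
  fixes S :: "'a set"
  assumes "cring K"
  shows "module K (free_mod K S)"
proof -
  interpret K: cring K by fact
  have fin: "finite {z. f z \<oplus>\<^bsub>K\<^esub> g z \<noteq> \<zero>\<^bsub>K\<^esub>}"
    if "finite {z. f z \<noteq> \<zero>\<^bsub>K\<^esub>}" "finite {z. g z \<noteq> \<zero>\<^bsub>K\<^esub>}" for f g :: "'a \<Rightarrow> _"
    by (rule finite_subset[OF _ finite_UnI[OF that]]) auto
  have fin': "finite {z. a \<otimes>\<^bsub>K\<^esub> f z \<noteq> \<zero>\<^bsub>K\<^esub>}"
    if "finite {z. f z \<noteq> \<zero>\<^bsub>K\<^esub>}" "a \<in> carrier K" for f :: "'a \<Rightarrow> _" and a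
    by (rule finite_subset[OF _ that(1)]) (use that in auto)
  have "abelian_group (free_mod K S)"
  proof (rule abelian_groupI)
    fix f assume f: "f \<in> carrier (free_mod K S)"
    then have "{z. \<ominus>\<^bsub>K\<^esub> f z \<noteq> \<zero>\<^bsub>K\<^esub>} \<subseteq> {z. f z \<noteq> \<zero>\<^bsub>K\<^esub>}" by auto
    with f have "(\<lambda>z. \<ominus>\<^bsub>K\<^esub> f z) \<in> carrier (free_mod K S)" using finite_subset by auto
    then show "\<exists>g\<in>carrier (free_mod K S). g \<oplus>\<^bsub>free_mod K S\<^esub> f = \<zero>\<^bsub>free_mod K S\<^esub>"
      using f by (intro bexI[of _ "\<lambda>z. \<ominus>\<^bsub>K\<^esub> f z"]) (auto simp: K.l_neg)
  qed (auto simp: K.a_ac fin)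
  then show ?thesis
    by (intro moduleI assms) (auto simp: fin fin' K.l_distr K.r_distr K.m_assoc)
qed

lemma free_gen_carrier: "cring K \<Longrightarrow> z \<in> S \<Longrightarrow> free_gen K z \<in> carrier (free_mod K S)"
proof -
  assume K: "cring K" and z: "z \<in> S"
  interpret K: cring K by fact
  have "finite {w. free_gen K z w \<noteq> \<zero>\<^bsub>K\<^esub>}"
    by (rule finite_subset[of _ "{z}"]) (auto simp: free_gen_def)
  then show ?thesis using z by (auto simp: free_gen_def)
qed

section \<open>The tensor product of modules and its universal property\<close>

context
  fixes K :: "'k ring" and M :: "('k, 'v) dgmod" and N :: "('k, 'w) dgmod"
  assumes M: "module K M" and N: "module K N"
begin

interpretation M: module K M by (rule M)
interpretation N: module K N by (rule N)

private abbreviation "F \<equiv> tens_free K M N"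
private abbreviation "R \<equiv> tens_null K M N"
private abbreviation "e \<equiv> free_gen K"

lemma module_tens_free: "module K F"
  unfolding tens_free_def by (rule module_free_mod[OF M.R.is_cring])

interpretation F: module K F by (rule module_tens_free)

lemma free_gen_tens: "x \<in> carrier M \<Longrightarrow> y \<in> carrier N \<Longrightarrow> e (x, y) \<in> carrier F"
  unfolding tens_free_def by (rule free_gen_carrier[OF M.R.is_cring]) simp

lemma tens_rels_carrier: "tens_rels K M N \<subseteq> carrier F"
  unfolding tens_rels_def Let_def
  by (auto intro!: F.minus_closed F.a_closed F.smult_closed free_gen_tens)

lemma submodule_tens_null: "submodule R K F"
proof -
  have c: "submodule (carrier F) K F" by (rule F.carrier_is_submodule)
  \<comment> \<open>The whole carrier is itself one of the submodules intersected.\<close>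
  have "R \<subseteq> carrier F" unfolding tens_null_def using c tens_rels_carrier by auto
  moreover have "\<zero>\<^bsub>F\<^esub> \<in> R"
    using subgroup.one_closed[OF submodule.axioms(1)] by (force simp: tens_null_def)
  ultimately show ?thesis
    by (intro submoduleI'[OF module_tens_free]) (auto simp: tens_null_def F.submoduleE)
qed

lemma tens_rels_null: "tens_rels K M N \<subseteq> R"
  by (auto simp: tens_null_def)

interpretation R: abelian_subgroup R F
  by (intro abelian_subgroupI3 additive_subgroupI submodule.axioms(1)[OF submodule_tens_null] module.axioms(2)[OF module_tens_free])

lemma gr_tensor_simps:
  "carrier (gr_tensor K M N) = a_rcosets\<^bsub>F\<^esub> R" "zero (gr_tensor K M N) = R" "add (gr_tensor K M N) = set_add F"
  "smult (gr_tensor K M N) = (\<lambda>a C. \<Union>c\<in>C. R +>\<^bsub>F\<^esub> (a \<odot>\<^bsub>F\<^esub> c))"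
  "grade (gr_tensor K M N) = (\<lambda>n. fin_sums R (set_add F) {tens K M N x y | x y p q. x \<in> grade M p \<and> y \<in> grade N q \<and> p + q = n})"
  by (simp_all add: gr_tensor_def Let_def)

lemma carrier_gr_tensor: "carrier (gr_tensor K M N) = {R +>\<^bsub>F\<^esub> c |c. c \<in> carrier F}"
  by (auto simp: gr_tensor_simps A_RCOSETS_def')

lemma coset_add: "c \<in> carrier F \<Longrightarrow> c' \<in> carrier F \<Longrightarrow>
    (R +>\<^bsub>F\<^esub> c) \<oplus>\<^bsub>gr_tensor K M N\<^esub> (R +>\<^bsub>F\<^esub> c') = R +>\<^bsub>F\<^esub> (c \<oplus>\<^bsub>F\<^esub> c')"
  by (simp add: gr_tensor_simps R.a_rcos_sum)

lemma coset_mem: "c \<in> carrier F \<Longrightarrow> c' \<in> R +>\<^bsub>F\<^esub> c \<longleftrightarrow> (\<exists>r\<in>R. c' = r \<oplus>\<^bsub>F\<^esub> c)"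
  by (auto simp: a_r_coset_def')

lemma coset_eqI: "c \<in> carrier F \<Longrightarrow> r \<in> R \<Longrightarrow> R +>\<^bsub>F\<^esub> (r \<oplus>\<^bsub>F\<^esub> c) = R +>\<^bsub>F\<^esub> c"
  by (rule F.a_repr_independence[symmetric]) (auto simp: coset_mem R.a_subgroup)

lemma coset_smult:
  assumes "a \<in> carrier K" "c \<in> carrier F"
  shows "a \<odot>\<^bsub>gr_tensor K M N\<^esub> (R +>\<^bsub>F\<^esub> c) = R +>\<^bsub>F\<^esub> (a \<odot>\<^bsub>F\<^esub> c)"
proof -
  have eq: "R +>\<^bsub>F\<^esub> (a \<odot>\<^bsub>F\<^esub> c') = R +>\<^bsub>F\<^esub> (a \<odot>\<^bsub>F\<^esub> c)" if "c' \<in> R +>\<^bsub>F\<^esub> c" for c'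
  proof -
    from iffD1[OF coset_mem[OF assms(2)] that] obtain r where r: "r \<in> R" "c' = r \<oplus>\<^bsub>F\<^esub> c" by (rule bexE)
    have rc: "r \<in> carrier F" by (rule subsetD[OF R.a_subset r(1)])
    have "a \<odot>\<^bsub>F\<^esub> c' = a \<odot>\<^bsub>F\<^esub> r \<oplus>\<^bsub>F\<^esub> a \<odot>\<^bsub>F\<^esub> c" unfolding r(2) by (rule F.smult_r_distr[OF assms(1) rc assms(2)])
    moreover have "a \<odot>\<^bsub>F\<^esub> r \<in> R" by (rule F.submoduleE(4)[OF submodule_tens_null assms(1) r(1)])
    ultimately show ?thesis by (simp only: coset_eqI[OF F.smult_closed[OF assms]])
  qed
  show ?thesis unfolding gr_tensor_simps
    by (rule UN_constant_eq[OF R.a_rcos_self[OF assms(2)] ballI[OF eq]])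
qed

lemma module_gr_tensor: "module K (gr_tensor K M N)"
proof (rule moduleI[OF M.R.is_cring])
  have zero: "\<zero>\<^bsub>gr_tensor K M N\<^esub> = R +>\<^bsub>F\<^esub> \<zero>\<^bsub>F\<^esub>"
    by (simp add: gr_tensor_simps F.a_coset_add_zero R.a_subset)
  show "abelian_group (gr_tensor K M N)"
  proof (rule abelian_groupI)
    fix C assume "C \<in> carrier (gr_tensor K M N)"
    then obtain c where c: "c \<in> carrier F" "C = R +>\<^bsub>F\<^esub> c" by (auto simp: carrier_gr_tensor)
    show "\<exists>D\<in>carrier (gr_tensor K M N). D \<oplus>\<^bsub>gr_tensor K M N\<^esub> C = \<zero>\<^bsub>gr_tensor K M N\<^esub>"
      using c F.a_inv_closed[OF c(1)] F.l_neg[OF c(1)]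
      by (intro bexI[of _ "R +>\<^bsub>F\<^esub> (\<ominus>\<^bsub>F\<^esub> c)"]) (auto simp: zero coset_add carrier_gr_tensor)
  qed (auto simp: carrier_gr_tensor coset_add zero F.a_ac)
next
  fix a C assume a: "a \<in> carrier K" and C: "C \<in> carrier (gr_tensor K M N)"
  then obtain c where c: "c \<in> carrier F" "C = R +>\<^bsub>F\<^esub> c" by (auto simp: carrier_gr_tensor)
  show "a \<odot>\<^bsub>gr_tensor K M N\<^esub> C \<in> carrier (gr_tensor K M N)"
    unfolding c(2) coset_smult[OF a c(1)] carrier_gr_tensor using F.smult_closed[OF a c(1)] by blast
  { fix b assume b: "b \<in> carrier K"
    note ab = F.smult_closed[OF a c(1)] F.smult_closed[OF b c(1)]
    show "(a \<oplus>\<^bsub>K\<^esub> b) \<odot>\<^bsub>gr_tensor K M N\<^esub> C = a \<odot>\<^bsub>gr_tensor K M N\<^esub> C \<oplus>\<^bsub>gr_tensor K M N\<^esub> b \<odot>\<^bsub>gr_tensor K M N\<^esub> C"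
      unfolding c(2) coset_smult[OF a c(1)] coset_smult[OF b c(1)] coset_smult[OF M.R.a_closed[OF a b] c(1)] coset_add[OF ab]
        F.smult_l_distr[OF a b c(1)] ..
    show "(a \<otimes>\<^bsub>K\<^esub> b) \<odot>\<^bsub>gr_tensor K M N\<^esub> C = a \<odot>\<^bsub>gr_tensor K M N\<^esub> (b \<odot>\<^bsub>gr_tensor K M N\<^esub> C)"
      unfolding c(2) coset_smult[OF b c(1)] coset_smult[OF a ab(2)] coset_smult[OF M.R.m_closed[OF a b] c(1)]
        F.smult_assoc1[OF a b c(1)] .. }
  { fix D assume "D \<in> carrier (gr_tensor K M N)"
    then obtain d where d: "d \<in> carrier F" "D = R +>\<^bsub>F\<^esub> d" by (auto simp: carrier_gr_tensor)
    show "a \<odot>\<^bsub>gr_tensor K M N\<^esub> (C \<oplus>\<^bsub>gr_tensor K M N\<^esub> D) = a \<odot>\<^bsub>gr_tensor K M N\<^esub> C \<oplus>\<^bsub>gr_tensor K M N\<^esub> a \<odot>\<^bsub>gr_tensor K M N\<^esub> D"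
      unfolding c(2) d(2) coset_add[OF c(1) d(1)] coset_smult[OF a c(1)] coset_smult[OF a d(1)]
        coset_smult[OF a F.a_closed[OF c(1) d(1)]] coset_add[OF F.smult_closed[OF a c(1)] F.smult_closed[OF a d(1)]]
        F.smult_r_distr[OF a c(1) d(1)] .. }
next
  fix C assume "C \<in> carrier (gr_tensor K M N)"
  then obtain c where c: "c \<in> carrier F" "C = R +>\<^bsub>F\<^esub> c" by (auto simp: carrier_gr_tensor)
  show "\<one>\<^bsub>K\<^esub> \<odot>\<^bsub>gr_tensor K M N\<^esub> C = C"
    unfolding c(2) coset_smult[OF M.R.one_closed c(1)] F.smult_one[OF c(1)] ..
qed

lemma tens_closed: "x \<in> carrier M \<Longrightarrow> y \<in> carrier N \<Longrightarrow> tens K M N x y \<in> carrier (gr_tensor K M N)"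
  unfolding tens_def carrier_gr_tensor using free_gen_tens by blast

text \<open>The generating relations are differences of free elements; each becomes an equation
  between cosets, which is how bilinearity of \<open>tens\<close> is read off.\<close>

lemma coset_diff_eq:
  assumes "c \<in> carrier F" "d \<in> carrier F" "c \<ominus>\<^bsub>F\<^esub> d \<in> tens_rels K M N"
  shows "R +>\<^bsub>F\<^esub> c = R +>\<^bsub>F\<^esub> d"
proof -
  have "c = (c \<ominus>\<^bsub>F\<^esub> d) \<oplus>\<^bsub>F\<^esub> d"
    using assms(1,2) F.a_inv_closed[OF assms(2)] by (simp only: a_minus_def F.a_assoc F.l_neg F.r_zero)
  then show ?thesis
    using coset_eqI[OF assms(2) subsetD[OF tens_rels_null assms(3)]] by simp
qed

lemma kbilin_tens_gr: "kbilin K M N (gr_tensor K M N) (tens K M N)"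
  unfolding kbilin_def
proof (intro conjI ballI klinI tens_closed)
  fix x y assume x: "x \<in> carrier M" and y: "y \<in> carrier N"
  note e = free_gen_tens[OF x y]
  { fix x' assume x': "x' \<in> carrier M"
    show "tens K M N (x \<oplus>\<^bsub>M\<^esub> x') y = tens K M N x y \<oplus>\<^bsub>gr_tensor K M N\<^esub> tens K M N x' y"
      unfolding tens_def coset_add[OF e free_gen_tens[OF x' y]]
      by (rule coset_diff_eq[OF free_gen_tens[OF M.a_closed[OF x x'] y] F.a_closed[OF e free_gen_tens[OF x' y]]])
        (use x x' y in \<open>unfold tens_rels_def Let_def, blast\<close>) }
  { fix y' assume y': "y' \<in> carrier N"
    show "tens K M N x (y \<oplus>\<^bsub>N\<^esub> y') = tens K M N x y \<oplus>\<^bsub>gr_tensor K M N\<^esub> tens K M N x y'"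
      unfolding tens_def coset_add[OF e free_gen_tens[OF x y']]
      by (rule coset_diff_eq[OF free_gen_tens[OF x N.a_closed[OF y y']] F.a_closed[OF e free_gen_tens[OF x y']]])
        (use x y y' in \<open>unfold tens_rels_def Let_def, blast\<close>) }
  fix a assume a: "a \<in> carrier K"
  show "tens K M N (a \<odot>\<^bsub>M\<^esub> x) y = a \<odot>\<^bsub>gr_tensor K M N\<^esub> tens K M N x y"
    unfolding tens_def coset_smult[OF a e]
    by (rule coset_diff_eq[OF free_gen_tens[OF M.smult_closed[OF a x] y] F.smult_closed[OF a e]])
      (use x y a in \<open>unfold tens_rels_def Let_def, blast\<close>)
  show "tens K M N x (a \<odot>\<^bsub>N\<^esub> y) = a \<odot>\<^bsub>gr_tensor K M N\<^esub> tens K M N x y"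
    unfolding tens_def coset_smult[OF a e]
    by (rule coset_diff_eq[OF free_gen_tens[OF x N.smult_closed[OF a y]] F.smult_closed[OF a e]])
      (use x y a in \<open>unfold tens_rels_def Let_def, blast\<close>)
qed

context
  fixes Q :: "('k, 'p) dgmod" and \<phi> :: "'v \<Rightarrow> 'w \<Rightarrow> 'p"
  assumes Q: "module K Q" and \<phi>: "kbilin K M N Q \<phi>"
begin

interpretation Q: module K Q by (rule Q)

text \<open>The linear map on the free module that extends \<phi>; \<open>tens_ext\<close> evaluates
  it at some representative.\<close>

private abbreviation "L c \<equiv> (\<Oplus>\<^bsub>Q\<^esub>z\<in>{z. c z \<noteq> \<zero>\<^bsub>K\<^esub>}. c z \<odot>\<^bsub>Q\<^esub> \<phi> (fst z) (snd z))"

private lemma Lterm: "c \<in> carrier F \<Longrightarrow> z \<in> carrier M \<times> carrier N \<Longrightarrow> c z \<odot>\<^bsub>Q\<^esub> \<phi> (fst z) (snd z) \<in> carrier Q"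
  using kbilin_closed[OF \<phi>] by (auto simp: tens_free_def)

private lemma L_superset:
  assumes c: "c \<in> carrier F" and A: "finite A" "{z. c z \<noteq> \<zero>\<^bsub>K\<^esub>} \<subseteq> A" "A \<subseteq> carrier M \<times> carrier N"
  shows "L c = (\<Oplus>\<^bsub>Q\<^esub>z\<in>A. c z \<odot>\<^bsub>Q\<^esub> \<phi> (fst z) (snd z))"
  using A kbilin_closed[OF \<phi>] Lterm[OF c] by (intro Q.add.finprod_mono_neutral_cong_left) auto

private lemma supp_sub: "c \<in> carrier F \<Longrightarrow> {z. c z \<noteq> \<zero>\<^bsub>K\<^esub>} \<subseteq> carrier M \<times> carrier N"
  and supp_fin: "c \<in> carrier F \<Longrightarrow> finite {z. c z \<noteq> \<zero>\<^bsub>K\<^esub>}"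
  by (auto simp: tens_free_def)

private lemma L_add:
  assumes c: "c \<in> carrier F" and d: "d \<in> carrier F"
  shows "L (c \<oplus>\<^bsub>F\<^esub> d) = L c \<oplus>\<^bsub>Q\<^esub> L d"
proof -
  let ?A = "{z. c z \<noteq> \<zero>\<^bsub>K\<^esub>} \<union> {z. d z \<noteq> \<zero>\<^bsub>K\<^esub>}"
  have A: "finite ?A" "?A \<subseteq> carrier M \<times> carrier N" using c d supp_sub supp_fin by auto
  have ck: "c z \<in> carrier K" "d z \<in> carrier K" for z using c d by (simp_all add: tens_free_def del: split_paired_All)
  have cd: "(c \<oplus>\<^bsub>F\<^esub> d) z = c z \<oplus>\<^bsub>K\<^esub> d z" for z by (simp add: tens_free_def)
  have "L (c \<oplus>\<^bsub>F\<^esub> d) = (\<Oplus>\<^bsub>Q\<^esub>z\<in>?A. (c \<oplus>\<^bsub>F\<^esub> d) z \<odot>\<^bsub>Q\<^esub> \<phi> (fst z) (snd z))"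
    by (rule L_superset[OF F.a_closed[OF c d] A(1) _ A(2)]) (auto simp: cd)
  also have "\<dots> = (\<Oplus>\<^bsub>Q\<^esub>z\<in>?A. c z \<odot>\<^bsub>Q\<^esub> \<phi> (fst z) (snd z) \<oplus>\<^bsub>Q\<^esub> d z \<odot>\<^bsub>Q\<^esub> \<phi> (fst z) (snd z))"
    using A(2) Lterm[OF c] Lterm[OF d] kbilin_closed[OF \<phi>] ck
    by (intro Q.finsum_cong') (auto simp: cd Q.smult_l_distr)
  also have "\<dots> = (\<Oplus>\<^bsub>Q\<^esub>z\<in>?A. c z \<odot>\<^bsub>Q\<^esub> \<phi> (fst z) (snd z)) \<oplus>\<^bsub>Q\<^esub> (\<Oplus>\<^bsub>Q\<^esub>z\<in>?A. d z \<odot>\<^bsub>Q\<^esub> \<phi> (fst z) (snd z))"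
    using A(2) Lterm[OF c] Lterm[OF d] by (intro Q.add.finprod_multf) blast+
  also have "\<dots> = L c \<oplus>\<^bsub>Q\<^esub> L d"
    using L_superset[OF c A(1) _ A(2)] L_superset[OF d A(1) _ A(2)] by simp
  finally show ?thesis .
qed

private lemma L_smult:
  assumes a: "a \<in> carrier K" and c: "c \<in> carrier F"
  shows "L (a \<odot>\<^bsub>F\<^esub> c) = a \<odot>\<^bsub>Q\<^esub> L c"
proof -
  let ?A = "{z. c z \<noteq> \<zero>\<^bsub>K\<^esub>}"
  have ck: "c z \<in> carrier K" for z using c by (simp add: tens_free_def del: split_paired_All)
  have ac: "(a \<odot>\<^bsub>F\<^esub> c) z = a \<otimes>\<^bsub>K\<^esub> c z" for z by (simp add: tens_free_def)
  have "L (a \<odot>\<^bsub>F\<^esub> c) = (\<Oplus>\<^bsub>Q\<^esub>z\<in>?A. (a \<odot>\<^bsub>F\<^esub> c) z \<odot>\<^bsub>Q\<^esub> \<phi> (fst z) (snd z))"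
    by (rule L_superset[OF F.smult_closed[OF a c] supp_fin[OF c] _ supp_sub[OF c]]) (use a in \<open>auto simp: ac\<close>)
  also have "\<dots> = (\<Oplus>\<^bsub>Q\<^esub>z\<in>?A. a \<odot>\<^bsub>Q\<^esub> (c z \<odot>\<^bsub>Q\<^esub> \<phi> (fst z) (snd z)))"
    using supp_sub[OF c] Lterm[OF c] kbilin_closed[OF \<phi>] ck a
    by (intro Q.finsum_cong') (auto simp: ac Q.smult_assoc1)
  also have "\<dots> = a \<odot>\<^bsub>Q\<^esub> L c"
    using supp_sub[OF c] Lterm[OF c] by (intro Q.finsum_smult_ldistr[symmetric] supp_fin[OF c] a) blast
  finally show ?thesis .
qed

private lemma L_gen:
  assumes "x \<in> carrier M" "y \<in> carrier N"
  shows "L (e (x, y)) = \<phi> x y"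
proof -
  have "L (e (x, y)) = (\<Oplus>\<^bsub>Q\<^esub>z\<in>{(x, y)}. e (x, y) z \<odot>\<^bsub>Q\<^esub> \<phi> (fst z) (snd z))"
    by (rule L_superset[OF free_gen_tens[OF assms]]) (use assms in \<open>auto simp: free_gen_def\<close>)
  then show ?thesis using kbilin_closed[OF \<phi> assms] by (simp add: free_gen_def)
qed

text \<open>The zeros of \<open>L\<close> form a submodule, and bilinearity of \<phi> puts the
  relations into it; \<open>tens_null\<close> is the smallest such submodule.\<close>

private lemma L_null:
  assumes "r \<in> R"
  shows "L r = \<zero>\<^bsub>Q\<^esub>"
proof -
  let ?H = "{c \<in> carrier F. L c = \<zero>\<^bsub>Q\<^esub>}"
  have "L \<zero>\<^bsub>F\<^esub> = \<zero>\<^bsub>Q\<^esub>" by (simp add: tens_free_def)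
  then have H: "submodule ?H K F"
    by (intro submoduleI'[OF module_tens_free]) (auto simp: L_add L_smult)
  have diff: "L (c \<ominus>\<^bsub>F\<^esub> d) = \<zero>\<^bsub>Q\<^esub>" if "c \<in> carrier F" "d \<in> carrier F" "L c = L d" for c d
  proof -
    have nd: "\<ominus>\<^bsub>F\<^esub> d \<in> carrier F" by (rule F.a_inv_closed[OF that(2)])
    have "L c \<oplus>\<^bsub>Q\<^esub> L (\<ominus>\<^bsub>F\<^esub> d) = L (d \<oplus>\<^bsub>F\<^esub> \<ominus>\<^bsub>F\<^esub> d)"
      by (simp only: that(3) L_add[OF that(2) nd])
    also have "\<dots> = \<zero>\<^bsub>Q\<^esub>" unfolding F.r_neg[OF that(2)] by fact
    finally show ?thesis by (simp only: a_minus_def L_add[OF that(1) nd])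
  qed
  have "tens_rels K M N \<subseteq> {c. L c = \<zero>\<^bsub>Q\<^esub>}"
    unfolding tens_rels_def Let_def
    using klin_add[OF kbilinD1[OF \<phi>]] klin_add[OF kbilinD2[OF \<phi>]] klin_smult[OF kbilinD1[OF \<phi>]] klin_smult[OF kbilinD2[OF \<phi>]]
    by (auto simp only: Un_iff mem_Collect_eq intro!: diff free_gen_tens F.a_closed F.smult_closed M.a_closed N.a_closed M.smult_closed N.smult_closed)
      (simp_all add: L_add L_smult L_gen free_gen_tens)
  then have "tens_rels K M N \<subseteq> ?H" using tens_rels_carrier by blast
  with H assms show ?thesis by (auto simp: tens_null_def)
qed

text \<open>The representative picked by \<open>SOME\<close> differs from the generator at (x, y) by
  an element of \<open>tens_null\<close>, which \<open>L\<close> sends to zero.\<close>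

lemma tens_ext_tens:
  assumes "x \<in> carrier M" "y \<in> carrier N"
  shows "tens_ext K Q \<phi> (tens K M N x y) = \<phi> x y"
proof -
  let ?c = "SOME c. c \<in> tens K M N x y"
  note e = free_gen_tens[OF assms]
  have "?c \<in> tens K M N x y"
    using R.a_rcos_self[OF e] someI[of "\<lambda>c. c \<in> tens K M N x y"] by (simp add: tens_def)
  then obtain r where r: "r \<in> R" "?c = r \<oplus>\<^bsub>F\<^esub> e (x, y)"
    unfolding tens_def coset_mem[OF e] by (rule bexE)
  then have "L ?c = \<phi> x y"
    using L_add[OF subsetD[OF R.a_subset r(1)] e] L_null[OF r(1)] L_gen[OF assms] kbilin_closed[OF \<phi> assms] by simp
  then show ?thesis by (simp add: tens_ext_def Let_def)
qed

end

end

lemma dg_tensor_simps: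
  "carrier (dg_tensor K M N) = carrier (gr_tensor K M N)" "zero (dg_tensor K M N) = zero (gr_tensor K M N)"
  "add (dg_tensor K M N) = add (gr_tensor K M N)" "smult (dg_tensor K M N) = smult (gr_tensor K M N)"
  "grade (dg_tensor K M N) = grade (gr_tensor K M N)"
  by (simp_all add: dg_tensor_def Let_def)

context
  fixes K :: "'k ring" and M :: "('k, 'v) dgmod" and N :: "('k, 'w) dgmod"
  assumes M: "gr_module K M" and N: "gr_module K N"
begin

private lemmas mM = gr_module_module[OF M]
private lemmas mN = gr_module_module[OF N]

lemma module_dg_tensor: "module K (dg_tensor K M N)"
  by (rule module_transfer[OF module_gr_tensor[OF mM mN]]) (simp_all add: dg_tensor_simps)

lemma kbilin_tens: "kbilin K M N (dg_tensor K M N) (tens K M N)"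
  using kbilin_tens_gr[OF mM mN] by (simp add: kbilin_def klin_def dg_tensor_simps)

lemma tens_grade:
  assumes "x \<in> grade M p" "y \<in> grade N q"
  shows "tens K M N x y \<in> grade (dg_tensor K M N) (p + q)"
proof -
  interpret T: module K "gr_tensor K M N" by (rule module_gr_tensor[OF mM mN])
  have "tens K M N x y \<in> carrier (gr_tensor K M N)"
    by (rule kbilin_closed[OF kbilin_tens_gr[OF mM mN]]) (use assms gr_module.grade_carrier[OF M] gr_module.grade_carrier[OF N] in auto)
  \<comment> \<open>\<open>fin_sums\<close> adds its summands to a final zero, so the pure tensor is
    written as itself plus zero.\<close>
  then have "tens K M N x y \<oplus>\<^bsub>gr_tensor K M N\<^esub> \<zero>\<^bsub>gr_tensor K M N\<^esub> = tens K M N x y" by simp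
  moreover have "tens K M N x y \<oplus>\<^bsub>gr_tensor K M N\<^esub> \<zero>\<^bsub>gr_tensor K M N\<^esub> \<in> grade (gr_tensor K M N) (p + q)"
    using assms unfolding gr_tensor_simps[OF mM mN] by (intro fin_sums.intros) blast
  ultimately show ?thesis by (simp add: dg_tensor_simps)
qed

end

text \<open>The value of \<open>tens_ext\<close> is known for bilinear formulas, so the formula for
  the differential, with its sign extended linearly from homogeneous x, must first be shown
  bilinear.\<close>

lemma dif_tens:
  assumes M: "dg_module K M" and N: "dg_module K N" and x: "x \<in> grade M p" and y: "y \<in> carrier N"
  shows "dif (dg_tensor K M N) (tens K M N x y) =
    tens K M N (dif M x) y \<oplus>\<^bsub>dg_tensor K M N\<^esub> sg (dg_tensor K M N) p (tens K M N x (dif N y))"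
proof -
  let ?P = "gr_tensor K M N" and ?\<psi> = "\<lambda>y p x'. sg (gr_tensor K M N) p (tens K M N x' (dif N y))"
  let ?\<phi> = "\<lambda>x y. tens K M N (dif M x) y \<oplus>\<^bsub>?P\<^esub> lin_ext M ?P (?\<psi> y) x"
  note mM = dg_module_module[OF M] and mN = dg_module_module[OF N] and gM = dg_module_gr_module[OF M] and gN = dg_module_gr_module[OF N]
  note mP = module_gr_tensor[OF mM mN] and b = kbilin_tens_gr[OF mM mN]
  have g: "gr_lin K M ?P (?\<psi> y)" if "y \<in> carrier N" for y
    by (intro klin_gr_lin[OF gM] klin_sg_fun[OF mP] kbilinD1[OF b] dif_carrier[OF N] that)
  have k: "klin K N ?P (\<lambda>y. ?\<psi> y n x)" if "x \<in> carrier M" for n x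
    by (intro klin_sg_fun[OF mP] klin_comp[OF dg_module_klin_dif[OF N] kbilinD2[OF b that]])
  have "kbilin K M N ?P ?\<phi>"
    unfolding kbilin_def
  proof (intro conjI ballI)
    fix x assume x: "x \<in> carrier M"
    show "klin K N ?P (?\<phi> x)"
      by (intro klin_plus[OF mN mP] kbilinD2[OF b] dif_carrier[OF M x] klin_lin_ext_param[OF gM mP mN g k x])
        (auto intro: gr_module.grade_carrier[OF gM])
  next
    fix y assume y: "y \<in> carrier N"
    show "klin K M ?P (\<lambda>x. ?\<phi> x y)"
      by (intro klin_plus[OF mM mP] klin_comp[OF dg_module_klin_dif[OF M] kbilinD1[OF b y]] klin_lin_ext[OF gM mP g[OF y]])
  qed
  from tens_ext_tens[OF mM mN mP this gr_module.grade_carrier[OF gM x] y]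
  have "dif (dg_tensor K M N) (tens K M N x y) = ?\<phi> x y"
    by (simp add: dg_tensor_def Let_def)
  also have "lin_ext M ?P (?\<psi> y) x = ?\<psi> y p x" by (rule lin_ext_homog[OF gM mP g[OF y] x])
  \<comment> \<open>One sign is formed in \<open>gr_tensor\<close>, the other in
    \<open>dg_tensor\<close>; these share carrier, addition and zero, and the inverse depends on
    nothing else.\<close>
  finally show ?thesis
    by (simp add: dg_tensor_simps sg_def a_inv_def m_inv_def)
qed

section \<open>Composition in the tensor product of two dg categories\<close>

context
  fixes K :: "'k ring" and A :: "('k, 'o, 'h) dgcat" and B :: "('k, 'o2, 'h2) dgcat"
  assumes A: "dg_category K A" and B: "dg_category K B"
begin

interpretation A: dg_category K A by (rule A)
interpretation B: dg_category K B by (rule B)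

context
  fixes X X' X'' Y Y' Y''
  assumes X: "X \<in> Ob A" "X' \<in> Ob A" "X'' \<in> Ob A" and Y: "Y \<in> Ob B" "Y' \<in> Ob B" "Y'' \<in> Ob B"
begin

private abbreviation "DT \<equiv> dg_tensor K (Hom A X X'') (Hom B Y Y'')"
private abbreviation "\<phi> \<alpha>\<^sub>2 \<beta>\<^sub>1 \<equiv> \<lambda>q p \<beta> \<alpha>. sg DT (q * p)
  (tens K (Hom A X X'') (Hom B Y Y'') (Comp A X X' X'' \<alpha>\<^sub>2 \<alpha>) (Comp B Y Y' Y'' \<beta> \<beta>\<^sub>1))"

private lemma mP: "module K DT"
  by (rule module_dg_tensor[OF A.gr_hom_module[OF X(1,3)] B.gr_hom_module[OF Y(1,3)]])

private lemma tP: "kbilin K (Hom A X X'') (Hom B Y Y'') DT (tens K (Hom A X X'') (Hom B Y Y''))"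
  by (rule kbilin_tens[OF A.gr_hom_module[OF X(1,3)] B.gr_hom_module[OF Y(1,3)]])

private lemma gb:
  assumes "\<alpha>\<^sub>2 \<in> carrier (Hom A X' X'')" "\<beta>\<^sub>1 \<in> carrier (Hom B Y Y')"
  shows "gr_bilin K (Hom B Y' Y'') (Hom A X X') DT (\<phi> \<alpha>\<^sub>2 \<beta>\<^sub>1)"
proof (rule kbilin_gr_bilin[OF B.gr_hom_module[OF Y(2,3)] A.gr_hom_module[OF X(1,2)]])
  fix p q
  show "kbilin K (Hom B Y' Y'') (Hom A X X') DT (\<phi> \<alpha>\<^sub>2 \<beta>\<^sub>1 q p)"
    unfolding kbilin_def
    using assms X Y
    by (auto intro!: klin_sg_fun[OF mP] klin_comp[OF B.klin_comp_right kbilinD2[OF tP]] klin_comp[OF A.klin_comp_left kbilinD1[OF tP]]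
        A.comp_closed B.comp_closed)
qed

text \<open>The Koszul sign exchanges \<beta>2 and \<alpha>1, so these two alone are taken
  homogeneous. Composition is a \<open>tens_ext\<close> inside a \<open>tens_ext\<close>, and
  evaluating both layers requires bilinearity in each pair of arguments.\<close>

lemma dg_tensor_cat_comp:
  assumes a2: "\<alpha>\<^sub>2 \<in> carrier (Hom A X' X'')" and b2: "\<beta>\<^sub>2 \<in> grade (Hom B Y' Y'') q"
    and a1: "\<alpha>\<^sub>1 \<in> grade (Hom A X X') p" and b1: "\<beta>\<^sub>1 \<in> carrier (Hom B Y Y')"
  shows "Comp (dg_tensor_cat K A B) (X, Y) (X', Y') (X'', Y'')
      (tens K (Hom A X' X'') (Hom B Y' Y'') \<alpha>\<^sub>2 \<beta>\<^sub>2) (tens K (Hom A X X') (Hom B Y Y') \<alpha>\<^sub>1 \<beta>\<^sub>1) =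
    sg DT (q * p) (tens K (Hom A X X'') (Hom B Y Y'') (Comp A X X' X'' \<alpha>\<^sub>2 \<alpha>\<^sub>1) (Comp B Y Y' Y'' \<beta>\<^sub>2 \<beta>\<^sub>1))"
proof -
  note mA = A.mod_hom[OF X(2,3)] A.mod_hom[OF X(1,2)] and mB = B.mod_hom[OF Y(2,3)] B.mod_hom[OF Y(1,2)]
  note gA = A.gr_hom_module[OF X(1,2)] and gB = B.gr_hom_module[OF Y(2,3)]
  note cA = gr_module.grade_carrier[OF gA] and cB = gr_module.grade_carrier[OF gB]
  let ?b = "\<lambda>\<alpha>\<^sub>2 \<beta>\<^sub>2 \<alpha>\<^sub>1 \<beta>\<^sub>1. bilin_ext (Hom B Y' Y'') (Hom A X X') DT (\<phi> \<alpha>\<^sub>2 \<beta>\<^sub>1) \<beta>\<^sub>2 \<alpha>\<^sub>1"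
  have kb: "kbilin K (Hom B Y' Y'') (Hom A X X') DT (bilin_ext (Hom B Y' Y'') (Hom A X X') DT (\<phi> \<alpha>\<^sub>2 \<beta>\<^sub>1))"
    if "\<alpha>\<^sub>2 \<in> carrier (Hom A X' X'')" "\<beta>\<^sub>1 \<in> carrier (Hom B Y Y')" for \<alpha>\<^sub>2 \<beta>\<^sub>1
    by (rule kbilin_bilin_ext[OF gB gA mP gb[OF that]])
  have inner: "kbilin K (Hom A X X') (Hom B Y Y') DT (?b \<alpha>\<^sub>2 \<beta>\<^sub>2)"
    if a2: "\<alpha>\<^sub>2 \<in> carrier (Hom A X' X'')" and b2: "\<beta>\<^sub>2 \<in> carrier (Hom B Y' Y'')" for \<alpha>\<^sub>2 \<beta>\<^sub>2
    unfolding kbilin_def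
  proof (intro conjI ballI)
    show "klin K (Hom A X X') DT (\<lambda>\<alpha>\<^sub>1. ?b \<alpha>\<^sub>2 \<beta>\<^sub>2 \<alpha>\<^sub>1 \<beta>\<^sub>1)" if "\<beta>\<^sub>1 \<in> carrier (Hom B Y Y')" for \<beta>\<^sub>1
      by (rule kbilinD2[OF kb[OF a2 that] b2])
    show "klin K (Hom B Y Y') DT (?b \<alpha>\<^sub>2 \<beta>\<^sub>2 \<alpha>\<^sub>1)" if "\<alpha>\<^sub>1 \<in> carrier (Hom A X X')" for \<alpha>\<^sub>1
      by (rule klin_bilin_ext_param[OF gB gA mP mB(2) gb[OF a2] _ b2 that])
        (use X Y a2 cA cB in \<open>auto intro!: klin_sg_fun[OF mP] klin_comp[OF B.klin_comp_left kbilinD2[OF tP]] A.comp_closed\<close>)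
  qed
  have ext: "tens_ext K DT (?b \<alpha>\<^sub>2 \<beta>\<^sub>2) (tens K (Hom A X X') (Hom B Y Y') \<alpha>\<^sub>1 \<beta>\<^sub>1) = ?b \<alpha>\<^sub>2 \<beta>\<^sub>2 \<alpha>\<^sub>1 \<beta>\<^sub>1"
    if "\<alpha>\<^sub>2 \<in> carrier (Hom A X' X'')" "\<beta>\<^sub>2 \<in> carrier (Hom B Y' Y'')" for \<alpha>\<^sub>2 \<beta>\<^sub>2
    by (rule tens_ext_tens[OF mA(2) mB(2) mP inner[OF that] cA[OF a1] b1])
  have "kbilin K (Hom A X' X'') (Hom B Y' Y'') DT (\<lambda>\<alpha>\<^sub>2 \<beta>\<^sub>2. ?b \<alpha>\<^sub>2 \<beta>\<^sub>2 \<alpha>\<^sub>1 \<beta>\<^sub>1)"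
    unfolding kbilin_def
  proof (intro conjI ballI)
    show "klin K (Hom B Y' Y'') DT (\<lambda>\<beta>\<^sub>2. ?b \<alpha>\<^sub>2 \<beta>\<^sub>2 \<alpha>\<^sub>1 \<beta>\<^sub>1)" if "\<alpha>\<^sub>2 \<in> carrier (Hom A X' X'')" for \<alpha>\<^sub>2
      by (rule kbilinD1[OF kb[OF that b1] cA[OF a1]])
    show "klin K (Hom A X' X'') DT (\<lambda>\<alpha>\<^sub>2. ?b \<alpha>\<^sub>2 \<beta>\<^sub>2 \<alpha>\<^sub>1 \<beta>\<^sub>1)" if "\<beta>\<^sub>2 \<in> carrier (Hom B Y' Y'')" for \<beta>\<^sub>2
      by (rule klin_bilin_ext_param[OF gB gA mP mA(1) gb[OF _ b1] _ that cA[OF a1]])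
        (use X Y b1 cA cB in \<open>auto intro!: klin_sg_fun[OF mP] klin_comp[OF A.klin_comp_right kbilinD1[OF tP]] B.comp_closed\<close>)
  qed
  \<comment> \<open>The outer \<open>tens_ext\<close> is applied to the unevaluated inner one, to
    which bilinearity is transferred along \<open>ext\<close>.\<close>
  then have "kbilin K (Hom A X' X'') (Hom B Y' Y'') DT
      (\<lambda>\<alpha>\<^sub>2 \<beta>\<^sub>2. tens_ext K DT (?b \<alpha>\<^sub>2 \<beta>\<^sub>2) (tens K (Hom A X X') (Hom B Y Y') \<alpha>\<^sub>1 \<beta>\<^sub>1))"
    using ext module.smult_closed[OF mA(1)] module.smult_closed[OF mB(1)]
      abelian_groupE(1)[OF module_abelian_group[OF mA(1)]] abelian_groupE(1)[OF module_abelian_group[OF mB(1)]]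
    by (simp add: kbilin_def klin_def)
  from tens_ext_tens[OF mA(1) mB(1) mP this a2 cB[OF b2]]
  have "Comp (dg_tensor_cat K A B) (X, Y) (X', Y') (X'', Y'')
      (tens K (Hom A X' X'') (Hom B Y' Y'') \<alpha>\<^sub>2 \<beta>\<^sub>2) (tens K (Hom A X X') (Hom B Y Y') \<alpha>\<^sub>1 \<beta>\<^sub>1) = ?b \<alpha>\<^sub>2 \<beta>\<^sub>2 \<alpha>\<^sub>1 \<beta>\<^sub>1"
    by (simp add: dg_tensor_cat_def Let_def ext[OF a2 cB[OF b2]])
  then show ?thesis
    using bilin_ext_homog[OF gB gA mP gb[OF a2 b1] b2 a1] by simp
qed

end

end

section \<open>Bimodules\<close>

locale dg_bimodule = T: dg_category K T + U: dg_category K U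
  for K :: "'k ring" and T :: "('k, 'to, 'th) dgcat" and U :: "('k, 'uo, 'uh) dgcat" +
  fixes M :: "('k, 'to, 'th, 'uo, 'uh, 'm) bimod"
  assumes M: "dg_functor K (dg_tensor_cat K U (dg_op T)) (DgModK K) M"
begin

abbreviation MM :: "'uo \<Rightarrow> 'to \<Rightarrow> ('k, 'm) dgmod" where "MM u t \<equiv> FOb M (u, t)"
abbreviation L where "L \<equiv> bi_left K T U M"
abbreviation R where "R \<equiv> bi_right K T U M"

lemma op: "dg_category K (dg_op T)" by (rule dg_category_op[OF T.dg_category_axioms])

lemma tensor_cat_simps:
  "Ob (dg_tensor_cat K U (dg_op T)) = Ob U \<times> Ob T"
  "Hom (dg_tensor_cat K U (dg_op T)) (u, t) (u', t') = dg_tensor K (Hom U u u') (Hom T t' t)"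
  "Id (dg_tensor_cat K U (dg_op T)) (u, t) = tens K (Hom U u u) (Hom T t t) (Id U u) (Id T t)"
  by (simp_all add: dg_tensor_cat_def)

lemma M_module: "u \<in> Ob U \<Longrightarrow> t \<in> Ob T \<Longrightarrow> dg_module K (MM u t)"
  by (rule dg_mod_ob[OF M]) (simp add: tensor_cat_simps)

lemma M_gr: "u \<in> Ob U \<Longrightarrow> t \<in> Ob T \<Longrightarrow> gr_module K (MM u t)"
  by (rule dg_module_gr_module[OF M_module])

lemma M_mod: "u \<in> Ob U \<Longrightarrow> t \<in> Ob T \<Longrightarrow> module K (MM u t)"
  by (rule dg_module_module[OF M_module])

text \<open>The two-sided action M(b \<otimes> a), with a regarded as a morphism of the opposite
  category. Its laws are proved once; the left and right actions arise by inserting an identity,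
  which has degree zero and differential zero.\<close>

definition act :: "'uo \<Rightarrow> 'to \<Rightarrow> 'uo \<Rightarrow> 'to \<Rightarrow> 'uh \<Rightarrow> 'th \<Rightarrow> 'm \<Rightarrow> 'm" where
  "act u t u' t' b a = FMor M (u, t) (u', t') (tens K (Hom U u u') (Hom T t' t) b a)"

lemma L_act: "L u u' t b = act u t u' t b (Id T t)" and R_act: "R u t t' a = act u t' u t (Id U u) a"
  by (simp_all add: bi_left_def bi_right_def act_def)

context
  fixes u t u' t' assumes ob: "u \<in> Ob U" "t \<in> Ob T" "u' \<in> Ob U" "t' \<in> Ob T"
begin

private lemmas tb = kbilin_tens[OF U.gr_hom_module[OF ob(1,3)] T.gr_hom_module[OF ob(4,2)]]
private lemmas tb_cl = kbilin_closed[OF tb]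

private lemma ob': "(u, t) \<in> Ob (dg_tensor_cat K U (dg_op T))" "(u', t') \<in> Ob (dg_tensor_cat K U (dg_op T))"
  using ob by (simp_all add: tensor_cat_simps)

lemma act_klin:
  assumes "b \<in> carrier (Hom U u u')" "a \<in> carrier (Hom T t' t)"
  shows "klin K (MM u t) (MM u' t') (act u t u' t' b a)" "act u t u' t' b a \<in> extensional (carrier (MM u t))"
  using dg_mod_klin[OF M ob'] tb_cl[OF assms] by (simp_all add: act_def tensor_cat_simps)

lemma act_klin_left:
  assumes "a \<in> carrier (Hom T t' t)" "m \<in> carrier (MM u t)"
  shows "klin K (Hom U u u') (MM u' t') (\<lambda>b. act u t u' t' b a m)"
  using klin_comp[OF kbilinD1[OF tb assms(1)]] dg_mod_klin'[OF M ob' assms(2)]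
  by (simp add: act_def tensor_cat_simps)

lemma act_klin_right:
  assumes "b \<in> carrier (Hom U u u')" "m \<in> carrier (MM u t)"
  shows "klin K (Hom T t' t) (MM u' t') (\<lambda>a. act u t u' t' b a m)"
  using klin_comp[OF kbilinD2[OF tb assms(1)]] dg_mod_klin'[OF M ob' assms(2)]
  by (simp add: act_def tensor_cat_simps)

lemma act_grade:
  assumes "b \<in> grade (Hom U u u') p" "a \<in> grade (Hom T t' t) q" "m \<in> grade (MM u t) n"
  shows "act u t u' t' b a m \<in> grade (MM u' t') (n + (p + q))"
  unfolding act_def using tens_grade[OF U.gr_hom_module[OF ob(1,3)] T.gr_hom_module[OF ob(4,2)] assms(1,2)]
  by (intro dg_mod_grade[OF M ob' _ assms(3)]) (simp add: tensor_cat_simps)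

text \<open>The Leibniz rule of the functor M at the pure tensor of b and a, whose own differential
  has two terms by \<open>dif_tens\<close>.\<close>

lemma act_dif:
  assumes b: "b \<in> grade (Hom U u u') p" and a: "a \<in> grade (Hom T t' t) q" and m: "m \<in> carrier (MM u t)"
  shows "dif (MM u' t') (act u t u' t' b a m) =
    act u t u' t' (dif (Hom U u u') b) a m \<oplus>\<^bsub>MM u' t'\<^esub> sg (MM u' t') p (act u t u' t' b (dif (Hom T t' t) a) m) \<oplus>\<^bsub>MM u' t'\<^esub>
    sg (MM u' t') (p + q) (act u t u' t' b a (dif (MM u t) m))"
proof -
  let ?D = "dg_tensor K (Hom U u u') (Hom T t' t)"
  note dU = U.hom_dg_module[OF ob(1,3)] and dT = T.hom_dg_module[OF ob(4,2)]
  note gU = dg_module_gr_module[OF dU] and gT = dg_module_gr_module[OF dT]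
  note bc = gr_module.grade_carrier[OF gU b] and ac = gr_module.grade_carrier[OF gT a]
  note mD = module_dg_tensor[OF gU gT] and mM = M_mod[OF ob(3,4)]
  have k: "klin K ?D (MM u' t') (\<lambda>f. FMor M (u, t) (u', t') f m)"
    using dg_mod_klin'[OF M ob' m] by (simp add: tensor_cat_simps)
  note c = tb_cl[OF dif_carrier[OF dU bc] ac] tb_cl[OF bc dif_carrier[OF dT ac]]
  show ?thesis
    using dg_mod_dif[OF M ob' _ _ m, of "tens K (Hom U u u') (Hom T t' t) b a" "p + q"] tens_grade[OF gU gT b a] tb_cl[OF bc ac]
    by (simp add: tensor_cat_simps act_def dif_tens[OF dU dT b ac] klin_add[OF k] c
        sg_closed[OF module_abelian_group[OF mD]] klin_sg[OF mD mM k])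
qed

end

text \<open>Functoriality of M on pure tensors. The sign comes from moving a2 past b1, so only these
  carry a degree.\<close>

lemma act_comp:
  assumes ob: "u \<in> Ob U" "t \<in> Ob T" "u' \<in> Ob U" "t' \<in> Ob T" "u'' \<in> Ob U" "t'' \<in> Ob T"
    and b2: "b\<^sub>2 \<in> carrier (Hom U u' u'')" and a2: "a\<^sub>2 \<in> grade (Hom T t'' t') q"
    and b1: "b\<^sub>1 \<in> grade (Hom U u u') p" and a1: "a\<^sub>1 \<in> carrier (Hom T t' t)" and m: "m \<in> carrier (MM u t)"
  shows "act u' t' u'' t'' b\<^sub>2 a\<^sub>2 (act u t u' t' b\<^sub>1 a\<^sub>1 m) =
    sg (MM u'' t'') (q * p) (act u t u'' t'' (Comp U u u' u'' b\<^sub>2 b\<^sub>1) (Comp (dg_op T) t t' t'' a\<^sub>2 a\<^sub>1) m)"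
proof -
  interpret op: dg_category K "dg_op T" by (rule op)
  let ?D = "dg_tensor K (Hom U u u'') (Hom T t'' t)"
  note g2 = U.gr_hom_module[OF ob(3,5)] T.gr_hom_module[OF ob(6,4)] and g1 = U.gr_hom_module[OF ob(1,3)] T.gr_hom_module[OF ob(4,2)]
    and g = U.gr_hom_module[OF ob(1,5)] T.gr_hom_module[OF ob(6,2)]
  note a2c = gr_module.grade_carrier[OF g2(2) a2] and b1c = gr_module.grade_carrier[OF g1(1) b1]
  have o: "(u, t) \<in> Ob (dg_tensor_cat K U (dg_op T))" "(u', t') \<in> Ob (dg_tensor_cat K U (dg_op T))"
    "(u'', t'') \<in> Ob (dg_tensor_cat K U (dg_op T))"
    using ob by (simp_all add: tensor_cat_simps)
  have k: "klin K ?D (MM u'' t'') (\<lambda>f. FMor M (u, t) (u'', t'') f m)"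
    using dg_mod_klin'[OF M o(1,3) m] by (simp add: tensor_cat_simps)
  have "Comp (dg_op T) t t' t'' a\<^sub>2 a\<^sub>1 \<in> carrier (Hom T t'' t)"
    using op.comp_closed[of t t' t'' a\<^sub>2 a\<^sub>1] ob a2c a1 by simp
  then have tc: "tens K (Hom U u u'') (Hom T t'' t) (Comp U u u' u'' b\<^sub>2 b\<^sub>1) (Comp (dg_op T) t t' t'' a\<^sub>2 a\<^sub>1) \<in> carrier ?D"
    by (intro kbilin_closed[OF kbilin_tens[OF g]] U.comp_closed ob b2 b1c)
  have "act u' t' u'' t'' b\<^sub>2 a\<^sub>2 (act u t u' t' b\<^sub>1 a\<^sub>1 m) =
    FMor M (u, t) (u'', t'') (Comp (dg_tensor_cat K U (dg_op T)) (u, t) (u', t') (u'', t'')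
      (tens K (Hom U u' u'') (Hom T t'' t') b\<^sub>2 a\<^sub>2) (tens K (Hom U u u') (Hom T t' t) b\<^sub>1 a\<^sub>1)) m"
    unfolding act_def
    by (rule dg_mod_comp[OF M o _ _ m, symmetric])
      (use kbilin_closed[OF kbilin_tens[OF g2] b2 a2c] kbilin_closed[OF kbilin_tens[OF g1] b1c a1] in \<open>simp_all add: tensor_cat_simps\<close>)
  also have "\<dots> = FMor M (u, t) (u'', t'') (sg ?D (q * p) (tens K (Hom U u u'') (Hom T t'' t)
      (Comp U u u' u'' b\<^sub>2 b\<^sub>1) (Comp (dg_op T) t t' t'' a\<^sub>2 a\<^sub>1))) m"
    using dg_tensor_cat_comp[OF U.dg_category_axioms op, of u u' u'' t t' t'' b\<^sub>2 a\<^sub>2 q b\<^sub>1 p a\<^sub>1] ob b2 a2 b1 a1 by simp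
  also have "\<dots> = sg (MM u'' t'') (q * p) (act u t u'' t'' (Comp U u u' u'' b\<^sub>2 b\<^sub>1) (Comp (dg_op T) t t' t'' a\<^sub>2 a\<^sub>1) m)"
    unfolding act_def by (rule klin_sg[OF module_dg_tensor[OF g] M_mod[OF ob(5,6)] k tc])
  finally show ?thesis .
qed

lemmas act_one = dg_mod_id[OF M, of "(_, _)", unfolded tensor_cat_simps mem_Times_iff fst_conv snd_conv, folded act_def]

context
  fixes u u' t assumes ob: "u \<in> Ob U" "u' \<in> Ob U" "t \<in> Ob T"
begin

lemma L_klin: "b \<in> carrier (Hom U u u') \<Longrightarrow> klin K (MM u t) (MM u' t) (L u u' t b)"
  and L_ext: "b \<in> carrier (Hom U u u') \<Longrightarrow> L u u' t b \<in> extensional (carrier (MM u t))"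
  unfolding L_act using act_klin[OF ob(1,3,2,3) _ T.id_closed[OF ob(3)]] by auto

lemma L_klin': "m \<in> carrier (MM u t) \<Longrightarrow> klin K (Hom U u u') (MM u' t) (\<lambda>b. L u u' t b m)"
  unfolding L_act by (rule act_klin_left[OF ob(1,3,2,3) T.id_closed[OF ob(3)]])

lemma L_grade: "b \<in> grade (Hom U u u') p \<Longrightarrow> m \<in> grade (MM u t) n \<Longrightarrow> L u u' t b m \<in> grade (MM u' t) (n + p)"
  unfolding L_act using act_grade[OF ob(1,3,2,3) _ T.id_grade[OF ob(3)]] by simp

lemma L_closed: "b \<in> carrier (Hom U u u') \<Longrightarrow> m \<in> carrier (MM u t) \<Longrightarrow> L u u' t b m \<in> carrier (MM u' t)"
  by (rule klin_closed[OF L_klin])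

lemma L_dif:
  assumes b: "b \<in> grade (Hom U u u') p" and m: "m \<in> carrier (MM u t)"
  shows "dif (MM u' t) (L u u' t b m) = L u u' t (dif (Hom U u u') b) m \<oplus>\<^bsub>MM u' t\<^esub> sg (MM u' t) p (L u u' t b (dif (MM u t) m))"
proof -
  interpret N: dg_module K "MM u' t" by (rule M_module[OF ob(2,3)])
  note bc = gr_module.grade_carrier[OF U.gr_hom_module[OF ob(1,2)] b]
  note dbc = dif_carrier[OF U.hom_dg_module[OF ob(1,2)] bc]
  \<comment> \<open>The differential of the identity of t is zero, so the middle term of
    \<open>act_dif\<close> vanishes.\<close>
  have "act u t u' t b \<zero>\<^bsub>Hom T t t\<^esub> m = \<zero>\<^bsub>MM u' t\<^esub>"
    by (rule klin_zero[OF T.mod_hom[OF ob(3,3)] N.module_axioms act_klin_right[OF ob(1,3,2,3) bc m]])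
  then show ?thesis
    using act_dif[OF ob(1,3,2,3) b T.id_grade[OF ob(3)] m] L_closed[OF dbc m]
    by (simp add: T.dif_id[OF ob(3)] L_act sg_zero[OF module_abelian_group[OF N.module_axioms]])
qed

end

lemma L_id: "u \<in> Ob U \<Longrightarrow> t \<in> Ob T \<Longrightarrow> m \<in> carrier (MM u t) \<Longrightarrow> L u u t (Id U u) m = m"
  unfolding L_act by (rule act_one) auto

text \<open>With an identity on the T side the sign of \<open>act_comp\<close> is trivial, but that
  rule still asks for a degree of b1; linearity removes it.\<close>

lemma L_comp:
  assumes ob: "u \<in> Ob U" "u' \<in> Ob U" "u'' \<in> Ob U" "t \<in> Ob T"
    and b2: "b\<^sub>2 \<in> carrier (Hom U u' u'')" and b1: "b\<^sub>1 \<in> carrier (Hom U u u')" and m: "m \<in> carrier (MM u t)"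
  shows "L u u'' t (Comp U u u' u'' b\<^sub>2 b\<^sub>1) m = L u' u'' t b\<^sub>2 (L u u' t b\<^sub>1 m)"
proof (rule gr_module.klin_eqI[OF U.gr_hom_module[OF ob(1,2)] M_mod[OF ob(3,4)] _ _ _ b1])
  show "klin K (Hom U u u') (MM u'' t) (\<lambda>b\<^sub>1. L u u'' t (Comp U u u' u'' b\<^sub>2 b\<^sub>1) m)"
    by (rule klin_comp[OF U.klin_comp_left[OF ob(1,2,3) b2] L_klin'[OF ob(1,3,4) m]])
  show "klin K (Hom U u u') (MM u'' t) (\<lambda>b\<^sub>1. L u' u'' t b\<^sub>2 (L u u' t b\<^sub>1 m))"
    by (rule klin_comp[OF L_klin'[OF ob(1,2,4) m] L_klin[OF ob(2,3,4) b2]])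
  fix p b\<^sub>1 assume b1: "b\<^sub>1 \<in> grade (Hom U u u') p"
  show "L u u'' t (Comp U u u' u'' b\<^sub>2 b\<^sub>1) m = L u' u'' t b\<^sub>2 (L u u' t b\<^sub>1 m)"
    unfolding L_act
    using act_comp[OF ob(1,4,2,4,3,4) b2 T.id_grade[OF ob(4)] b1 T.id_closed[OF ob(4)] m]
      dg_category.id_left[OF op, of t t "Id T t"] T.id_closed[OF ob(4)] ob(4) by simp
qed

lemma functor_M_at:
  assumes t: "t \<in> Ob T"
  shows "dg_functor K U (DgModK K) (M_at K T U M t)"
  by (rule dg_mod_functorI)
    (use t in \<open>auto simp: M_at_def U.hom_dg_module M_module L_klin L_ext L_klin' L_id U.id_closed L_comp U.comp_closed
      L_grade L_dif gr_module.grade_carrier[OF M_gr]\<close>)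

context
  fixes u t t' assumes ob: "u \<in> Ob U" "t \<in> Ob T" "t' \<in> Ob T"
begin

lemma R_klin: "a \<in> carrier (Hom T t t') \<Longrightarrow> klin K (MM u t') (MM u t) (R u t t' a)"
  and R_ext: "a \<in> carrier (Hom T t t') \<Longrightarrow> R u t t' a \<in> extensional (carrier (MM u t'))"
  unfolding R_act using act_klin[OF ob(1,3,1,2) U.id_closed[OF ob(1)]] by auto

lemma R_klin': "m \<in> carrier (MM u t') \<Longrightarrow> klin K (Hom T t t') (MM u t) (\<lambda>a. R u t t' a m)"
  unfolding R_act by (rule act_klin_right[OF ob(1,3,1,2) U.id_closed[OF ob(1)]])

lemma R_grade: "a \<in> grade (Hom T t t') p \<Longrightarrow> m \<in> grade (MM u t') n \<Longrightarrow> R u t t' a m \<in> grade (MM u t) (n + p)"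
  unfolding R_act using act_grade[OF ob(1,3,1,2) U.id_grade[OF ob(1)]] by simp

lemma R_closed: "a \<in> carrier (Hom T t t') \<Longrightarrow> m \<in> carrier (MM u t') \<Longrightarrow> R u t t' a m \<in> carrier (MM u t)"
  by (rule klin_closed[OF R_klin])

end

lemma R_id: "u \<in> Ob U \<Longrightarrow> t \<in> Ob T \<Longrightarrow> m \<in> carrier (MM u t) \<Longrightarrow> R u t t (Id T t) m = m"
  unfolding R_act by (rule act_one) auto

text \<open>Both composites are the two-sided action of b and a up to sign; only R after L moves a
  past b.\<close>

lemma L_R:
  assumes ob: "u \<in> Ob U" "u' \<in> Ob U" "t \<in> Ob T" "t' \<in> Ob T"
    and b: "b \<in> grade (Hom U u u') p" and a: "a \<in> grade (Hom T t t') q" and m: "m \<in> carrier (MM u t')"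
  shows "L u u' t b (R u t t' a m) = sg (MM u' t) (q * p) (R u' t t' a (L u u' t' b m))"
proof -
  note bc = gr_module.grade_carrier[OF U.gr_hom_module[OF ob(1,2)] b] and ac = gr_module.grade_carrier[OF T.gr_hom_module[OF ob(3,4)] a]
  have 1: "L u u' t b (R u t t' a m) = act u t' u' t b a m"
    unfolding L_act R_act
    using act_comp[OF ob(1,4,1,3,2,3) bc T.id_grade[OF ob(3)] U.id_grade[OF ob(1)] ac m]
      dg_category.id_left[OF op, of t' t a] U.id_right[OF ob(1,2) bc] ac ob by simp
  have 2: "R u' t t' a (L u u' t' b m) = sg (MM u' t) (q * p) (act u t' u' t b a m)"
    unfolding L_act R_act
    using act_comp[OF ob(1,4,2,4,2,3) U.id_closed[OF ob(2)] a b T.id_closed[OF ob(4)] m]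
      dg_category.id_right[OF op, of t' t a] U.id_left[OF ob(1,2) bc] ac ob by simp
  have "act u t' u' t b a m \<in> carrier (MM u' t)"
    by (rule klin_closed[OF act_klin(1)[OF ob(1,4,2,3) bc ac] m])
  then show ?thesis
    unfolding 1 2 by (simp add: sg_sg[OF module_abelian_group[OF M_mod[OF ob(2,3)]]])
qed

end

lemma kbilin_eqI:
  assumes M: "gr_module K M" and N: "gr_module K N" and P: "module K P" and f: "kbilin K M N P f" and g: "kbilin K M N P g"
    and eq: "\<And>p q x y. x \<in> grade M p \<Longrightarrow> y \<in> grade N q \<Longrightarrow> f x y = g x y" and x: "x \<in> carrier M" and y: "y \<in> carrier N"
  shows "f x y = g x y"
proof (rule gr_module.klin_eqI[OF M P kbilinD1[OF f y] kbilinD1[OF g y] _ x])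
  fix p x assume x: "x \<in> grade M p"
  note xc = gr_module.grade_carrier[OF M x]
  show "f x y = g x y"
    by (rule gr_module.klin_eqI[OF N P kbilinD2[OF f xc] kbilinD2[OF g xc] eq[OF x] y])
qed

lemma minus_eq_zero_iff:
  assumes "abelian_group G" "x \<in> carrier G" "y \<in> carrier G"
  shows "x \<ominus>\<^bsub>G\<^esub> y = \<zero>\<^bsub>G\<^esub> \<longleftrightarrow> x = y"
proof -
  interpret abelian_group G by fact
  show ?thesis using assms(2,3) minus_equality[of x "\<ominus>\<^bsub>G\<^esub> y"] by (auto simp: a_minus_def r_neg)
qed

lemma kbilin_sg: "module K P \<Longrightarrow> kbilin K M N P f \<Longrightarrow> kbilin K M N P (\<lambda>x y. sg P k (f x y))"
  by (simp add: kbilin_def klin_sg_fun)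

lemma kbilin_comp_left: "klin K M M' f \<Longrightarrow> kbilin K M' N P g \<Longrightarrow> kbilin K M N P (\<lambda>x. g (f x))"
proof -
  assume f: "klin K M M' f" and g: "kbilin K M' N P g"
  have "klin K M P (\<lambda>x. g (f x) y)" if "y \<in> carrier N" for y
    using klin_comp[of K M M' f P "\<lambda>x. g x y"] f kbilinD1[OF g that] by simp
  then show ?thesis using g klin_closed[OF f] by (simp add: kbilin_def)
qed

lemma kbilin_comp_right: "klin K N N' f \<Longrightarrow> kbilin K M N' P g \<Longrightarrow> kbilin K M N P (\<lambda>x y. g x (f y))"
  unfolding kbilin_def using klin_comp[of K N N' f P] klin_closed[of K N N' f] by simp

lemma kbilin_comp_out: "kbilin K M N P g \<Longrightarrow> klin K P Q f \<Longrightarrow> kbilin K M N Q (\<lambda>x y. f (g x y))"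
  unfolding kbilin_def using klin_comp[of K N P _ Q f] klin_comp[of K M P _ Q f] by simp

context dg_bimodule
begin

abbreviation bullet where "bullet \<equiv> m_bullet K T U M"

context
  fixes u t t' assumes ob: "u \<in> Ob U" "t \<in> Ob T" "t' \<in> Ob T"
begin

private lemma gr_bilin_bullet:
  "gr_bilin K (MM u t') (Hom T t t') (MM u t) (\<lambda>p q m a. sg (MM u t) (p * q) (R u t t' a m))"
proof (rule kbilin_gr_bilin[OF M_gr[OF ob(1,3)] T.gr_hom_module[OF ob(2,3)]], rule kbilin_sg[OF M_mod[OF ob(1,2)]])
  show "kbilin K (MM u t') (Hom T t t') (MM u t) (\<lambda>m a. R u t t' a m)"
    by (simp add: kbilin_def R_klin[OF ob] R_klin'[OF ob])
qed

lemma kbilin_bullet: "kbilin K (MM u t') (Hom T t t') (MM u t) (bullet u t t')"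
  using kbilin_bilin_ext[OF M_gr[OF ob(1,3)] T.gr_hom_module[OF ob(2,3)] M_mod[OF ob(1,2)] gr_bilin_bullet]
  by (simp add: kbilin_def klin_def m_bullet_def)

lemma bullet_homog: "m \<in> grade (MM u t') p \<Longrightarrow> a \<in> grade (Hom T t t') q \<Longrightarrow>
    bullet u t t' m a = sg (MM u t) (p * q) (R u t t' a m)"
  unfolding m_bullet_def
  by (rule bilin_ext_homog[OF M_gr[OF ob(1,3)] T.gr_hom_module[OF ob(2,3)] M_mod[OF ob(1,2)] gr_bilin_bullet])

lemma bullet_grade: "m \<in> grade (MM u t') p \<Longrightarrow> a \<in> grade (Hom T t t') q \<Longrightarrow> bullet u t t' m a \<in> grade (MM u t) (p + q)"
  by (simp add: bullet_homog gr_module.grade_sg[OF M_gr[OF ob(1,2)]] R_grade[OF ob])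

lemma bullet_closed: "m \<in> carrier (MM u t') \<Longrightarrow> a \<in> carrier (Hom T t t') \<Longrightarrow> bullet u t t' m a \<in> carrier (MM u t)"
  by (rule kbilin_closed[OF kbilin_bullet])

end

lemma bullet_id:
  assumes ob: "u \<in> Ob U" "t \<in> Ob T" and m: "m \<in> carrier (MM u t)"
  shows "bullet u t t m (Id T t) = m"
proof (rule gr_module.klin_eqI[OF M_gr[OF ob] M_mod[OF ob] kbilinD1[OF kbilin_bullet[OF ob ob(2)] T.id_closed[OF ob(2)]] _ _ m])
  show "klin K (MM u t) (MM u t) (\<lambda>m. m)" by (simp add: klin_def)
qed (simp add: bullet_homog[OF ob ob(2) _ T.id_grade[OF ob(2)]] R_id[OF ob] gr_module.grade_carrier[OF M_gr[OF ob]])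

end

text \<open>The products \<open>m \<cdot> x\<close> determine the transformation \<open>f\<close> of a comma object, and they
  are easier to handle: in terms of them the comma conditions carry no signs except in the
  Leibniz rule.\<close>

locale dg_pairing = dg_bimodule K T U M
  for K :: "'k ring" and T :: "('k, 'to, 'th) dgcat" and U :: "('k, 'uo, 'uh) dgcat"
    and M :: "('k, 'to, 'th, 'uo, 'uh, 'm) bimod" +
  fixes A :: "('k, 'to, 'th, 'v) dgm" and B :: "('k, 'uo, 'uh, 'v) dgm" and \<psi> :: "'uo \<Rightarrow> 'to \<Rightarrow> 'm \<Rightarrow> 'v \<Rightarrow> 'v"
  assumes A: "dg_functor K T (DgModK K) A" and B: "dg_functor K U (DgModK K) B"
    and bilin: "\<And>u t. u \<in> Ob U \<Longrightarrow> t \<in> Ob T \<Longrightarrow> kbilin K (MM u t) (FOb A t) (FOb B u) (\<psi> u t)"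
    and pair_grade: "\<And>u t p q m x. u \<in> Ob U \<Longrightarrow> t \<in> Ob T \<Longrightarrow> m \<in> grade (MM u t) p \<Longrightarrow> x \<in> grade (FOb A t) q \<Longrightarrow>
      \<psi> u t m x \<in> grade (FOb B u) (p + q)"
    and pair_dif_homog: "\<And>u t p q m x. u \<in> Ob U \<Longrightarrow> t \<in> Ob T \<Longrightarrow> m \<in> grade (MM u t) p \<Longrightarrow> x \<in> grade (FOb A t) q \<Longrightarrow>
      dif (FOb B u) (\<psi> u t m x) = \<psi> u t (dif (MM u t) m) x \<oplus>\<^bsub>FOb B u\<^esub> sg (FOb B u) p (\<psi> u t m (dif (FOb A t) x))"
    and pair_right_homog: "\<And>u t t' p q r m a x. u \<in> Ob U \<Longrightarrow> t \<in> Ob T \<Longrightarrow> t' \<in> Ob T \<Longrightarrow> m \<in> grade (MM u t') p \<Longrightarrow>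
      a \<in> grade (Hom T t t') r \<Longrightarrow> x \<in> grade (FOb A t) q \<Longrightarrow> \<psi> u t' m (FMor A t t' a x) = \<psi> u t (bullet u t t' m a) x"
    and pair_left_homog: "\<And>u u' t p q r m b x. u \<in> Ob U \<Longrightarrow> u' \<in> Ob U \<Longrightarrow> t \<in> Ob T \<Longrightarrow> m \<in> grade (MM u t) p \<Longrightarrow>
      b \<in> grade (Hom U u u') r \<Longrightarrow> x \<in> grade (FOb A t) q \<Longrightarrow> FMor B u u' b (\<psi> u t m x) = \<psi> u' t (L u u' t b m) x"
begin

lemma A_gr: "t \<in> Ob T \<Longrightarrow> gr_module K (FOb A t)" and B_gr: "u \<in> Ob U \<Longrightarrow> gr_module K (FOb B u)"
  by (simp_all add: dg_module_gr_module dg_mod_ob[OF A] dg_mod_ob[OF B])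

lemma A_mod: "t \<in> Ob T \<Longrightarrow> module K (FOb A t)" and B_mod: "u \<in> Ob U \<Longrightarrow> module K (FOb B u)"
  by (simp_all add: dg_module_module dg_mod_ob[OF A] dg_mod_ob[OF B])

lemmas pair_closed = kbilin_closed[OF bilin]

text \<open>The axioms speak of homogeneous elements, which keeps the verification for concrete
  pairings short; bilinearity of all maps involved gives the law in general.\<close>

lemma pair_right:
  assumes ob: "u \<in> Ob U" "t \<in> Ob T" "t' \<in> Ob T" and m: "m \<in> carrier (MM u t')" and a: "a \<in> carrier (Hom T t t')"
    and x: "x \<in> carrier (FOb A t)"
  shows "\<psi> u t' m (FMor A t t' a x) = \<psi> u t (bullet u t t' m a) x"
proof (rule gr_module.klin_eqI[OF T.gr_hom_module[OF ob(2,3)] B_mod[OF ob(1)] _ _ _ a])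
  show "klin K (Hom T t t') (FOb B u) (\<lambda>a. \<psi> u t' m (FMor A t t' a x))"
    by (rule klin_comp[OF dg_mod_klin'[OF A ob(2,3) x] kbilinD2[OF bilin[OF ob(1,3)] m]])
  show "klin K (Hom T t t') (FOb B u) (\<lambda>a. \<psi> u t (bullet u t t' m a) x)"
    by (rule klin_comp[OF kbilinD2[OF kbilin_bullet[OF ob] m] kbilinD1[OF bilin[OF ob(1,2)] x]])
  fix r a assume a: "a \<in> grade (Hom T t t') r"
  note ac = gr_module.grade_carrier[OF T.gr_hom_module[OF ob(2,3)] a]
  show "\<psi> u t' m (FMor A t t' a x) = \<psi> u t (bullet u t t' m a) x"
    by (rule kbilin_eqI[OF M_gr[OF ob(1,3)] A_gr[OF ob(2)] B_mod[OF ob(1)]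
        kbilin_comp_right[OF dg_mod_klin(1)[OF A ob(2,3) ac] bilin[OF ob(1,3)]]
        kbilin_comp_left[OF kbilinD1[OF kbilin_bullet[OF ob] ac] bilin[OF ob(1,2)]] pair_right_homog[OF ob _ a] m x])
qed

lemma pair_left:
  assumes ob: "u \<in> Ob U" "u' \<in> Ob U" "t \<in> Ob T" and m: "m \<in> carrier (MM u t)" and b: "b \<in> carrier (Hom U u u')"
    and x: "x \<in> carrier (FOb A t)"
  shows "FMor B u u' b (\<psi> u t m x) = \<psi> u' t (L u u' t b m) x"
proof (rule gr_module.klin_eqI[OF U.gr_hom_module[OF ob(1,2)] B_mod[OF ob(2)] _ _ _ b])
  show "klin K (Hom U u u') (FOb B u') (\<lambda>b. FMor B u u' b (\<psi> u t m x))"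
    by (rule dg_mod_klin'[OF B ob(1,2) pair_closed[OF ob(1,3) m x]])
  show "klin K (Hom U u u') (FOb B u') (\<lambda>b. \<psi> u' t (L u u' t b m) x)"
    by (rule klin_comp[OF L_klin'[OF ob m] kbilinD1[OF bilin[OF ob(2,3)] x]])
  fix r b assume b: "b \<in> grade (Hom U u u') r"
  note bc = gr_module.grade_carrier[OF U.gr_hom_module[OF ob(1,2)] b]
  show "FMor B u u' b (\<psi> u t m x) = \<psi> u' t (L u u' t b m) x"
    by (rule kbilin_eqI[OF M_gr[OF ob(1,3)] A_gr[OF ob(3)] B_mod[OF ob(2)]
        kbilin_comp_out[OF bilin[OF ob(1,3)] dg_mod_klin(1)[OF B ob(1,2) bc]]
        kbilin_comp_left[OF L_klin[OF ob bc] bilin[OF ob(2,3)]] pair_left_homog[OF ob _ b] m x])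
qed

lemma pair_dif:
  assumes ob: "u \<in> Ob U" "t \<in> Ob T" and m: "m \<in> grade (MM u t) p" and x: "x \<in> carrier (FOb A t)"
  shows "dif (FOb B u) (\<psi> u t m x) = \<psi> u t (dif (MM u t) m) x \<oplus>\<^bsub>FOb B u\<^esub> sg (FOb B u) p (\<psi> u t m (dif (FOb A t) x))"
proof (rule gr_module.klin_eqI[OF A_gr[OF ob(2)] B_mod[OF ob(1)] _ _ pair_dif_homog[OF ob m] x])
  note mc = gr_module.grade_carrier[OF M_gr[OF ob] m]
  note k = kbilinD2[OF bilin[OF ob] mc]
  show "klin K (FOb A t) (FOb B u) (\<lambda>x. dif (FOb B u) (\<psi> u t m x))"
    by (rule klin_comp[OF k dg_module_klin_dif[OF dg_mod_ob[OF B ob(1)]]])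
  show "klin K (FOb A t) (FOb B u) (\<lambda>x. \<psi> u t (dif (MM u t) m) x \<oplus>\<^bsub>FOb B u\<^esub> sg (FOb B u) p (\<psi> u t m (dif (FOb A t) x)))"
    by (intro klin_plus[OF A_mod[OF ob(2)] B_mod[OF ob(1)]] kbilinD2[OF bilin[OF ob]] dif_carrier[OF M_module[OF ob] mc]
        klin_sg_fun[OF B_mod[OF ob(1)]] klin_comp[OF dg_module_klin_dif[OF dg_mod_ob[OF A ob(2)]] k])
qed

end

section \<open>Objects of the comma category\<close>

context dg_bimodule
begin

lemma quiver_T: "dg_quiver K T" and quiver_U: "dg_quiver K U"
  by (simp_all add: dg_category_quiver T.dg_category_axioms U.dg_category_axioms)

abbreviation Mt where "Mt \<equiv> M_at K T U M"
abbreviation Mbar where "Mbar \<equiv> M_bar K T U M"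
abbreviation EE where "EE B t \<equiv> mnat K U (Mt t) B"

lemma M_at_simps [simp]: "FOb (Mt t) u = MM u t" "FMor (Mt t) u u' b = L u u' t b"
  by (simp_all add: M_at_def)

lemma GG_simps:
  "FOb (FOb (GG K T U M) B) t = EE B t"
  "FMor (FOb (GG K T U M) B) t t' a = (\<lambda>\<eta>\<in>carrier (EE B t). bilin_ext (EE B t) (Hom T t t') (EE B t')
     (\<lambda>p q \<eta>' a'. sg (EE B t') (p * q) (mnat_comp U (Mt t') \<eta>' (Mbar t t' a'))) \<eta> a)"
  "FMor (GG K T U M) B B' \<epsilon> = (\<lambda>t\<in>Ob T. \<lambda>\<eta>\<in>carrier (EE B t). mnat_comp U (Mt t) \<epsilon> \<eta>)"
  by (simp_all add: GG_def Let_def)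

lemma dg_module_EE: "dg_functor K U (DgModK K) B \<Longrightarrow> t \<in> Ob T \<Longrightarrow> dg_module K (EE B t)"
  by (rule dg_module_mnat[OF functor_M_at _ quiver_U])

text \<open>Negation is again replaced by multiplication by -1, which transformations carry out
  pointwise.\<close>

lemma sg_mnat_apply:
  assumes "dg_functor K U (DgModK K) C" "dg_functor K U (DgModK K) B" "\<eta> \<in> carrier (mnat K U C B)" "u \<in> Ob U" "m \<in> carrier (FOb C u)"
  shows "sg (mnat K U C B) n \<eta> u m = sg (FOb B u) n (\<eta> u m)"
proof -
  interpret E: module K "mnat K U C B" by (rule dg_module_module[OF dg_module_mnat[OF assms(1,2) quiver_U]])
  interpret Bu: module K "FOb B u" by (rule dg_module_module[OF dg_mod_ob[OF assms(2,4)]])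
  have "\<ominus>\<^bsub>mnat K U C B\<^esub> \<eta> = (\<ominus>\<^bsub>K\<^esub> \<one>\<^bsub>K\<^esub>) \<odot>\<^bsub>mnat K U C B\<^esub> \<eta>"
    using assms(3) by (simp only: E.smult_l_minus E.smult_one T.one_closed)
  then show ?thesis using assms(4,5) mnat_closed[OF assms(1,2) quiver_U assms(3-5)] by (simp add: sg_def Bu.smult_l_minus)
qed

context
  fixes t t' assumes ob: "t \<in> Ob T" "t' \<in> Ob T"
begin

private lemmas Mt = functor_M_at[OF ob(1)] functor_M_at[OF ob(2)]

text \<open>Naturality is the sign rule \<open>L_R\<close> for commuting the two actions.\<close>

lemma M_bar_deg:
  assumes a: "a \<in> grade (Hom T t t') p"
  shows "Mbar t t' a \<in> mnat_deg K U (Mt t') (Mt t) p"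
proof (rule mnat_degI[OF Mt(2,1)])
  note ac = gr_module.grade_carrier[OF T.gr_hom_module[OF ob] a]
  show "Mbar t t' a u \<in> hom_deg K (FOb (Mt t') u) (FOb (Mt t) u) p" if "u \<in> Ob U" for u
    using that R_klin[OF that ob ac] R_ext[OF that ob ac] R_grade[OF that ob a] by (auto simp: M_bar_def intro!: hom_degI)
  show "FMor (Mt t) u u' b (Mbar t t' a u m) = sg (FOb (Mt t) u') (p * q) (Mbar t t' a u' (FMor (Mt t') u u' b m))"
    if "u \<in> Ob U" "u' \<in> Ob U" "b \<in> grade (Hom U u u') q" "m \<in> carrier (FOb (Mt t') u)" for u u' q b m
    using that L_R[OF that(1,2) ob that(3) a] by (simp add: M_bar_def)
qed (simp add: M_bar_def)

lemma klin_M_bar: "klin K (Hom T t t') (mnat K U (Mt t') (Mt t)) (Mbar t t')"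
proof (rule klinI)
  interpret H: gr_module K "Hom T t t'" by (rule T.gr_hom_module[OF ob])
  interpret E: gr_module K "mnat K U (Mt t') (Mt t)" by (rule dg_module_gr_module[OF dg_module_mnat[OF Mt(2,1) quiver_U]])
  show add: "Mbar t t' (a \<oplus>\<^bsub>Hom T t t'\<^esub> a') = Mbar t t' a \<oplus>\<^bsub>mnat K U (Mt t') (Mt t)\<^esub> Mbar t t' a'"
    if aa: "a \<in> carrier (Hom T t t')" "a' \<in> carrier (Hom T t t')" for a a'
  proof -
    have "R u t t' (a \<oplus>\<^bsub>Hom T t t'\<^esub> a') = (\<lambda>m\<in>carrier (MM u t'). R u t t' a m \<oplus>\<^bsub>MM u t\<^esub> R u t t' a' m)" if u: "u \<in> Ob U" for u
      using R_ext[OF u ob H.a_closed[OF aa]] klin_add[OF R_klin'[OF u ob] aa]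
      by (auto intro!: extensionalityI[of _ "carrier (MM u t')"])
    then show ?thesis by (auto simp: M_bar_def fun_eq_iff)
  qed
  show "Mbar t t' (k \<odot>\<^bsub>Hom T t t'\<^esub> a) = k \<odot>\<^bsub>mnat K U (Mt t') (Mt t)\<^esub> Mbar t t' a"
    if ka: "k \<in> carrier K" "a \<in> carrier (Hom T t t')" for k a
  proof -
    have "R u t t' (k \<odot>\<^bsub>Hom T t t'\<^esub> a) = (\<lambda>m\<in>carrier (MM u t'). k \<odot>\<^bsub>MM u t\<^esub> R u t t' a m)" if u: "u \<in> Ob U" for u
      using R_ext[OF u ob H.smult_closed[OF ka]] klin_smult[OF R_klin'[OF u ob] ka]
      by (auto intro!: extensionalityI[of _ "carrier (MM u t')"])
    then show ?thesis by (auto simp: M_bar_def fun_eq_iff)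
  qed
  show "Mbar t t' a \<in> carrier (mnat K U (Mt t') (Mt t))" if "a \<in> carrier (Hom T t t')" for a
    using that
  proof (induction rule: H.homog_induct)
    case (homog p a)
    then show ?case using E.grade_carrier[of _ p] M_bar_deg[OF homog] by simp
  next
    case (add a a')
    then show ?case using \<open>\<And>a' a. _ \<Longrightarrow> _ \<Longrightarrow> Mbar t t' (a \<oplus>\<^bsub>Hom T t t'\<^esub> a') = _\<close> E.a_closed by (simp del: mnat_simps)
  qed
qed

context
  fixes B :: "('k, 'uo, 'uh, 'v) dgm" assumes B: "dg_functor K U (DgModK K) B"
begin

private lemmas E = dg_module_EE[OF B ob(1)] dg_module_EE[OF B ob(2)]

private lemma gr_bilin_GG:
  "gr_bilin K (EE B t) (Hom T t t') (EE B t') (\<lambda>p q \<eta>' a'. sg (EE B t') (p * q) (mnat_comp U (Mt t') \<eta>' (Mbar t t' a')))"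
proof (rule kbilin_gr_bilin[OF dg_module_gr_module[OF E(1)] T.gr_hom_module[OF ob]], rule kbilin_sg[OF dg_module_module[OF E(2)]])
  have "kbilin K (EE B t) (mnat K U (Mt t') (Mt t)) (EE B t') (mnat_comp U (Mt t'))"
    unfolding kbilin_def
    by (intro conjI ballI klinI mnat_comp_closed[OF Mt(2,1) B quiver_U] mnat_comp_add_left[OF Mt(2,1) B quiver_U]
        mnat_comp_smult_left[OF Mt(2,1) B quiver_U] mnat_comp_add_right[OF Mt(2,1) B quiver_U]
        mnat_comp_smult_right[OF Mt(2,1) B quiver_U])
  then show "kbilin K (EE B t) (Hom T t t') (EE B t') (\<lambda>\<eta>' a'. mnat_comp U (Mt t') \<eta>' (Mbar t t' a'))"
    by (rule kbilin_comp_right[OF klin_M_bar])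
qed

lemma klin_GG: "a \<in> carrier (Hom T t t') \<Longrightarrow> klin K (EE B t) (EE B t') (FMor (FOb (GG K T U M) B) t t' a)"
  using kbilinD1[OF kbilin_bilin_ext[OF dg_module_gr_module[OF E(1)] T.gr_hom_module[OF ob] dg_module_module[OF E(2)] gr_bilin_GG]]
  by (subst klin_cong[OF dg_module_module[OF E(1)]]) (auto simp: GG_simps)

text \<open>On homogeneous arguments the bilinear extension disappears, and what remains of the
  action of \<open>GG\<close> is precomposition with the right action, up to sign.\<close>

lemma GG_apply:
  assumes \<eta>: "\<eta> \<in> mnat_deg K U (Mt t) B q" and a: "a \<in> grade (Hom T t t') p" and u: "u \<in> Ob U" and m: "m \<in> carrier (MM u t')"
  shows "FMor (FOb (GG K T U M) B) t t' a \<eta> u m = sg (FOb B u) (q * p) (\<eta> u (R u t t' a m))"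
proof -
  have \<eta>g: "\<eta> \<in> grade (EE B t) q" using \<eta> by simp
  note \<eta>c = gr_module.grade_carrier[OF dg_module_gr_module[OF E(1)] \<eta>g]
  note ac = gr_module.grade_carrier[OF T.gr_hom_module[OF ob] a]
  have c: "mnat_comp U (Mt t') \<eta> (Mbar t t' a) \<in> carrier (EE B t')"
    by (rule mnat_comp_closed[OF Mt(2,1) B quiver_U \<eta>c klin_closed[OF klin_M_bar ac]])
  have "FMor (FOb (GG K T U M) B) t t' a \<eta> = sg (EE B t') (q * p) (mnat_comp U (Mt t') \<eta> (Mbar t t' a))"
    using bilin_ext_homog[OF dg_module_gr_module[OF E(1)] T.gr_hom_module[OF ob] dg_module_module[OF E(2)] gr_bilin_GG \<eta>g a] \<eta>c
    by (simp add: GG_simps)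
  then show ?thesis
    using sg_mnat_apply[OF Mt(2) B c u, of m "q * p"] u m by (simp add: mnat_comp_apply M_bar_def)
qed

end

end

text \<open>Since f has degree zero, its naturality carries no sign, and d(f) = 0 says that each f t
  commutes with the differentials.\<close>

lemma comma_ob_iff:
  "(A, f, B) \<in> Ob (comma K T U M) \<longleftrightarrow> dg_functor K T (DgModK K) A \<and> dg_functor K U (DgModK K) B \<and>
    f \<in> extensional (Ob T) \<and> (\<forall>t\<in>Ob T. f t \<in> hom_deg K (FOb A t) (EE B t) 0) \<and>
    (\<forall>t\<in>Ob T. \<forall>t'\<in>Ob T. \<forall>p. \<forall>a\<in>grade (Hom T t t') p. \<forall>x\<in>carrier (FOb A t).
      FMor (FOb (GG K T U M) B) t t' a (f t x) = f t' (FMor A t t' a x)) \<and>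
    (\<forall>t\<in>Ob T. \<forall>x\<in>carrier (FOb A t). dif (EE B t) (f t x) = f t (dif (FOb A t) x))"
proof -
  have "dif (mnat K T A (FOb (GG K T U M) B)) f = \<zero>\<^bsub>mnat K T A (FOb (GG K T U M) B)\<^esub> \<longleftrightarrow>
      (\<forall>t\<in>Ob T. \<forall>x\<in>carrier (FOb A t). dif (EE B t) (f t x) = f t (dif (FOb A t) x))"
    if A: "dg_functor K T (DgModK K) A" and B: "dg_functor K U (DgModK K) B"
      and f: "\<forall>t\<in>Ob T. f t \<in> hom_deg K (FOb A t) (EE B t) 0"
  proof -
    have "dif (dg_hom K (FOb A t) (EE B t)) (f t) = (\<lambda>x\<in>carrier (FOb A t). \<zero>\<^bsub>EE B t\<^esub>) \<longleftrightarrow>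
        (\<forall>x\<in>carrier (FOb A t). dif (EE B t) (f t x) = f t (dif (FOb A t) x))" if t: "t \<in> Ob T" for t
    proof -
      note AE = dg_mod_ob[OF A t] dg_module_EE[OF B t]
      interpret E: dg_module K "EE B t" by (rule AE(2))
      have "f t x \<in> carrier (EE B t)" if "x \<in> carrier (FOb A t)" for x
        using f t klin_closed[OF hom_degD(1) that] by blast
      then have "dif (EE B t) (f t x) \<ominus>\<^bsub>EE B t\<^esub> f t (dif (FOb A t) x) = \<zero>\<^bsub>EE B t\<^esub> \<longleftrightarrow>
          dif (EE B t) (f t x) = f t (dif (FOb A t) x)" if "x \<in> carrier (FOb A t)" for x
        using that dif_carrier[OF AE(1)] E.dif_closed minus_eq_zero_iff[OF module_abelian_group[OF E.module_axioms]] by blast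
      then show ?thesis
        using dif_dg_hom_homog[OF AE bspec[OF f t]] by (auto simp: fun_eq_iff restrict_def simp del: mnat_simps)
    qed
    then show ?thesis
      by (simp only: mnat_simps(3,5) GG_simps(1)) (auto simp: fun_eq_iff restrict_def simp del: mnat_simps)
  qed
  \<comment> \<open>In degree zero unfolding \<open>mnat_deg\<close> suffices, as no sign has to be
    evaluated; \<open>mnat_deg_iff\<close> would presuppose that \<open>GG\<close> sends B to a
    functor.\<close>
  moreover have "f \<in> grade (mnat K T A (FOb (GG K T U M) B)) 0 \<longleftrightarrow>
      f \<in> extensional (Ob T) \<and> (\<forall>t\<in>Ob T. f t \<in> hom_deg K (FOb A t) (EE B t) 0) \<and>
      (\<forall>t\<in>Ob T. \<forall>t'\<in>Ob T. \<forall>p. \<forall>a\<in>grade (Hom T t t') p. \<forall>x\<in>carrier (FOb A t).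
        FMor (FOb (GG K T U M) B) t t' a (f t x) = f t' (FMor A t t' a x))"
    by (simp add: mnat_deg_def GG_simps(1) PiE_iff del: mnat_simps(2-)) (auto simp: compose_def fun_eq_iff restrict_def)
  ultimately show ?thesis
    by (auto simp: comma_def simp del: mnat_simps)
qed

context
  fixes A :: "('k, 'to, 'th, 'v) dgm" and f and B :: "('k, 'uo, 'uh, 'v) dgm"
  assumes X: "(A, f, B) \<in> Ob (comma K T U M)"
begin

private lemma A: "dg_functor K T (DgModK K) A" and B: "dg_functor K U (DgModK K) B"
  and f_hom: "t \<in> Ob T \<Longrightarrow> f t \<in> hom_deg K (FOb A t) (EE B t) 0"
  and f_nat: "t \<in> Ob T \<Longrightarrow> t' \<in> Ob T \<Longrightarrow> a \<in> grade (Hom T t t') p \<Longrightarrow> x \<in> carrier (FOb A t) \<Longrightarrow>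
      FMor (FOb (GG K T U M) B) t t' a (f t x) = f t' (FMor A t t' a x)"
  and f_dif: "t \<in> Ob T \<Longrightarrow> x \<in> carrier (FOb A t) \<Longrightarrow> dif (EE B t) (f t x) = f t (dif (FOb A t) x)"
  using X unfolding comma_ob_iff by blast+

lemma comma_klin: "t \<in> Ob T \<Longrightarrow> klin K (FOb A t) (EE B t) (f t)"
  by (rule hom_degD(1)[OF f_hom])

lemma comma_deg_f: "t \<in> Ob T \<Longrightarrow> x \<in> grade (FOb A t) q \<Longrightarrow> f t x \<in> mnat_deg K U (Mt t) B q"
  using hom_degD(3)[OF f_hom] by fastforce

lemma comma_kbilin:
  assumes u: "u \<in> Ob U" and t: "t \<in> Ob T"
  shows "kbilin K (MM u t) (FOb A t) (FOb B u) (\<lambda>m x. f t x u m)"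
  unfolding kbilin_def
proof (intro conjI ballI)
  show "klin K (MM u t) (FOb B u) (\<lambda>m. f t x u m)" if "x \<in> carrier (FOb A t)" for x
    using mnat_carrierD(3)[OF functor_M_at[OF t] B quiver_U klin_closed[OF comma_klin[OF t] that] u] by simp
  show "klin K (FOb A t) (FOb B u) (\<lambda>x. f t x u m)" if "m \<in> carrier (MM u t)" for m
    using klin_add[OF comma_klin[OF t]] klin_smult[OF comma_klin[OF t]] that u
      mnat_closed[OF functor_M_at[OF t] B quiver_U klin_closed[OF comma_klin[OF t]] u]
    by (intro klinI) auto
qed

private lemma gr_bilin_dot: "u \<in> Ob U \<Longrightarrow> t \<in> Ob T \<Longrightarrow>
    gr_bilin K (MM u t) (FOb A t) (FOb B u) (\<lambda>p q m' x'. sg (FOb B u) (q * p) (f t x' u m'))"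
  by (intro kbilin_gr_bilin kbilin_sg M_gr comma_kbilin dg_module_gr_module dg_module_module dg_mod_ob[OF A] dg_mod_ob[OF B])

lemma dot_homog:
  assumes "u \<in> Ob U" "t \<in> Ob T" "m \<in> grade (MM u t) p" "x \<in> grade (FOb A t) q"
  shows "dot M (A, f, B) u t m x = sg (FOb B u) (q * p) (f t x u m)"
  using bilin_ext_homog[OF M_gr[OF assms(1,2)] dg_module_gr_module[OF dg_mod_ob[OF A assms(2)]]
      dg_module_module[OF dg_mod_ob[OF B assms(1)]] gr_bilin_dot[OF assms(1,2)] assms(3,4)]
  by (simp add: dot_def)

lemma kbilin_dot: "u \<in> Ob U \<Longrightarrow> t \<in> Ob T \<Longrightarrow> kbilin K (MM u t) (FOb A t) (FOb B u) (dot M (A, f, B) u t)"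
  using kbilin_bilin_ext[OF M_gr dg_module_gr_module[OF dg_mod_ob[OF A]] dg_module_module[OF dg_mod_ob[OF B]] gr_bilin_dot]
  by (simp add: kbilin_def klin_def dot_def)

text \<open>The sign (-1)^(|x||m|) of m \<cdot> x absorbs the signs in the naturality of f t x and
  in the action of \<open>GG\<close>: for degrees p, q, r of m, x and the acting morphism, both
  sides of each compatibility carry the same exponent. Closedness of f gives the Leibniz
  rule.\<close>

theorem dg_pairing_dot: "dg_pairing K T U M A B (dot M (A, f, B))"
proof (intro dg_pairing.intro dg_pairing_axioms.intro dg_bimodule_axioms A B kbilin_dot)
  fix u t p q m x assume ob: "u \<in> Ob U" "t \<in> Ob T" and m: "m \<in> grade (MM u t) p" and x: "x \<in> grade (FOb A t) q"
  interpret Bu: dg_module K "FOb B u" by (rule dg_mod_ob[OF B ob(1)])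
  interpret Bg: gr_module K "FOb B u" by (rule dg_module_gr_module[OF dg_mod_ob[OF B ob(1)]])
  have ag: "abelian_group (FOb B u)" by (rule module_abelian_group[OF Bu.module_axioms])
  note fd = mnat_degD[OF functor_M_at[OF ob(2)] B comma_deg_f[OF ob(2) x]]
  note mc = gr_module.grade_carrier[OF M_gr[OF ob] m] and xc = gr_module.grade_carrier[OF dg_module_gr_module[OF dg_mod_ob[OF A ob(2)]] x]
  show "dot M (A, f, B) u t m x \<in> grade (FOb B u) (p + q)"
    using hom_degD(3)[OF fd(2)[OF ob(1)], of m p] m by (simp add: dot_homog[OF ob m x] Bg.grade_sg)
  note dm = dif_grade[OF M_module[OF ob] m] and dx = dif_grade[OF dg_mod_ob[OF A ob(2)] x]
  note dmc = dif_carrier[OF M_module[OF ob] mc] and dxc = dif_carrier[OF dg_mod_ob[OF A ob(2)] xc]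
  note cl = kbilin_closed[OF comma_kbilin[OF ob]]
  have "dif (FOb B u) (f t x u m) = f t (dif (FOb A t) x) u m \<oplus>\<^bsub>FOb B u\<^esub> sg (FOb B u) q (f t x u (dif (MM u t) m))"
    using dif_eval[OF M_module[OF ob] dg_mod_ob[OF B ob(1)], of "f t x u" q m] fd(2)[OF ob(1)] mc ob(1)
      fun_cong[OF fun_cong[OF f_dif[OF ob(2) xc], of u], of m] by simp
  then have "dif (FOb B u) (dot M (A, f, B) u t m x) =
      sg (FOb B u) (q * p) (f t (dif (FOb A t) x) u m) \<oplus>\<^bsub>FOb B u\<^esub> sg (FOb B u) (q * p + q) (f t x u (dif (MM u t) m))"
    by (simp add: dot_homog[OF ob m x] klin_sg[OF Bu.module_axioms Bu.module_axioms dg_module_klin_dif[OF Bu.dg_module_axioms]]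
        cl mc xc dmc dxc sg_add[OF ag] sg_sg[OF ag] sg_closed[OF ag])
  \<comment> \<open>The summands trade places, and the exponents agree modulo 2: q p + q is q (p +
    1), and p + (q + 1) p exceeds q p by 2 p.\<close>
  also have "\<dots> = sg (FOb B u) (q * (p + 1)) (f t x u (dif (MM u t) m)) \<oplus>\<^bsub>FOb B u\<^esub> sg (FOb B u) (p + (q + 1) * p) (f t (dif (FOb A t) x) u m)"
    using sg_closed[OF ag cl] mc xc dmc dxc by (subst Bu.a_comm) (auto simp: algebra_simps intro!: arg_cong2[where f = "add (FOb B u)"] sg_cong)
  finally show "dif (FOb B u) (dot M (A, f, B) u t m x) =
      dot M (A, f, B) u t (dif (MM u t) m) x \<oplus>\<^bsub>FOb B u\<^esub> sg (FOb B u) p (dot M (A, f, B) u t m (dif (FOb A t) x))"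
    by (simp add: dot_homog[OF ob dm x] dot_homog[OF ob m dx] sg_sg[OF ag] cl mc dxc)
next
  fix u t t' p q r m a x assume ob: "u \<in> Ob U" "t \<in> Ob T" "t' \<in> Ob T" and m: "m \<in> grade (MM u t') p"
    and a: "a \<in> grade (Hom T t t') r" and x: "x \<in> grade (FOb A t) q"
  have ag: "abelian_group (FOb B u)" by (rule module_abelian_group[OF dg_module_module[OF dg_mod_ob[OF B ob(1)]]])
  note mc = gr_module.grade_carrier[OF M_gr[OF ob(1,3)] m] and xc = gr_module.grade_carrier[OF dg_module_gr_module[OF dg_mod_ob[OF A ob(2)]] x]
    and ac = gr_module.grade_carrier[OF T.gr_hom_module[OF ob(2,3)] a]
  note Rm = R_closed[OF ob ac mc]
  have c: "f t x u (R u t t' a m) \<in> carrier (FOb B u)" by (rule kbilin_closed[OF comma_kbilin[OF ob(1,2)] Rm xc])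
  have "f t' (FMor A t t' a x) u m = sg (FOb B u) (q * r) (f t x u (R u t t' a m))"
    using f_nat[OF ob(2,3) a xc, symmetric] GG_apply[OF ob(2,3) B comma_deg_f[OF ob(2) x] a ob(1) mc] by simp
  then have 1: "dot M (A, f, B) u t' m (FMor A t t' a x) = sg (FOb B u) ((q + r) * p + q * r) (f t x u (R u t t' a m))"
    by (simp add: dot_homog[OF ob(1,3) m dg_mod_grade[OF A ob(2,3) a x]] sg_sg[OF ag c])
  have "f t x u (sg (MM u t) (p * r) (R u t t' a m)) = sg (FOb B u) (p * r) (f t x u (R u t t' a m))"
    by (rule klin_sg[OF M_mod[OF ob(1,2)] dg_module_module[OF dg_mod_ob[OF B ob(1)]] kbilinD1[OF comma_kbilin[OF ob(1,2)] xc] Rm])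
  then have 2: "dot M (A, f, B) u t (bullet u t t' m a) x = sg (FOb B u) (q * (p + r) + p * r) (f t x u (R u t t' a m))"
    using dot_homog[OF ob(1,2) bullet_grade[OF ob m a] x] by (simp add: bullet_homog[OF ob m a] sg_sg[OF ag c])
  show "dot M (A, f, B) u t' m (FMor A t t' a x) = dot M (A, f, B) u t (bullet u t t' m a) x"
    unfolding 1 2 by (rule sg_cong) (simp add: algebra_simps)
next
  fix u u' t p q r m b x assume ob: "u \<in> Ob U" "u' \<in> Ob U" "t \<in> Ob T" and m: "m \<in> grade (MM u t) p"
    and b: "b \<in> grade (Hom U u u') r" and x: "x \<in> grade (FOb A t) q"
  note mB = dg_module_module[OF dg_mod_ob[OF B]]
  have ag: "abelian_group (FOb B u')" by (rule module_abelian_group[OF mB[OF ob(2)]])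
  note mc = gr_module.grade_carrier[OF M_gr[OF ob(1,3)] m] and xc = gr_module.grade_carrier[OF dg_module_gr_module[OF dg_mod_ob[OF A ob(3)]] x]
    and bc = gr_module.grade_carrier[OF U.gr_hom_module[OF ob(1,2)] b]
  note Lm = L_closed[OF ob bc mc]
  have c: "f t x u' (L u u' t b m) \<in> carrier (FOb B u')" by (rule kbilin_closed[OF comma_kbilin[OF ob(2,3)] Lm xc])
  have "FMor B u u' b (f t x u m) = sg (FOb B u') (q * r) (f t x u' (L u u' t b m))"
    using mnat_degD(3)[OF functor_M_at[OF ob(3)] B comma_deg_f[OF ob(3) x] ob(1,2) b, of m] mc by simp
  then have 1: "FMor B u u' b (dot M (A, f, B) u t m x) = sg (FOb B u') (q * p + q * r) (f t x u' (L u u' t b m))"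
    by (simp add: dot_homog[OF ob(1,3) m x] klin_sg[OF mB[OF ob(1)] mB[OF ob(2)] dg_mod_klin(1)[OF B ob(1,2) bc]]
        kbilin_closed[OF comma_kbilin[OF ob(1,3)] mc xc] sg_sg[OF ag c])
  show "FMor B u u' b (dot M (A, f, B) u t m x) = dot M (A, f, B) u' t (L u u' t b m) x"
    unfolding 1 dot_homog[OF ob(2,3) L_grade[OF ob b m] x] by (rule sg_cong) (simp add: algebra_simps)
qed

end

end

section \<open>From a pairing back to an object of the comma category\<close>

context dg_pairing
begin

text \<open>The sign in \<open>dot\<close> is its own inverse, so putting it on \<psi> gives the
  values f t x u m of the transformation sought.\<close>

definition chi :: "'uo \<Rightarrow> 'to \<Rightarrow> 'm \<Rightarrow> 'v \<Rightarrow> 'v" where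
  "chi u t = bilin_ext (MM u t) (FOb A t) (FOb B u) (\<lambda>p q m x. sg (FOb B u) (q * p) (\<psi> u t m x))"

definition pair_nat :: "'to \<Rightarrow> 'v \<Rightarrow> 'uo \<Rightarrow> 'm \<Rightarrow> 'v" where
  "pair_nat = (\<lambda>t\<in>Ob T. \<lambda>x\<in>carrier (FOb A t). \<lambda>u\<in>Ob U. \<lambda>m\<in>carrier (MM u t). chi u t m x)"

context
  fixes u t assumes ob: "u \<in> Ob U" "t \<in> Ob T"
begin

private lemma gb: "gr_bilin K (MM u t) (FOb A t) (FOb B u) (\<lambda>p q m x. sg (FOb B u) (q * p) (\<psi> u t m x))"
  by (intro kbilin_gr_bilin kbilin_sg M_gr A_gr B_mod bilin ob)

lemma kbilin_chi: "kbilin K (MM u t) (FOb A t) (FOb B u) (chi u t)"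
  using kbilin_bilin_ext[OF M_gr[OF ob] A_gr[OF ob(2)] B_mod[OF ob(1)] gb] by (simp add: kbilin_def klin_def chi_def)

lemma chi_homog: "m \<in> grade (MM u t) p \<Longrightarrow> x \<in> grade (FOb A t) q \<Longrightarrow> chi u t m x = sg (FOb B u) (q * p) (\<psi> u t m x)"
  using bilin_ext_homog[OF M_gr[OF ob] A_gr[OF ob(2)] B_mod[OF ob(1)] gb] by (simp add: chi_def)

end

lemma pair_nat_apply: "t \<in> Ob T \<Longrightarrow> x \<in> carrier (FOb A t) \<Longrightarrow> u \<in> Ob U \<Longrightarrow> m \<in> carrier (MM u t) \<Longrightarrow>
    pair_nat t x u m = chi u t m x"
  by (simp add: pair_nat_def)

text \<open>Compatibility with U is the naturality of this transformation: q p and q r + q (p + r)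
  have the same parity.\<close>

lemma pair_nat_deg:
  assumes t: "t \<in> Ob T" and x: "x \<in> grade (FOb A t) q"
  shows "pair_nat t x \<in> mnat_deg K U (Mt t) B q"
proof (rule mnat_degI[OF functor_M_at[OF t] B])
  note xc = gr_module.grade_carrier[OF A_gr[OF t] x]
  show "pair_nat t x \<in> extensional (Ob U)" using t xc by (simp add: pair_nat_def)
  show "pair_nat t x u \<in> hom_deg K (FOb (Mt t) u) (FOb B u) q" if u: "u \<in> Ob U" for u
  proof (rule hom_degI)
    interpret N: gr_module K "MM u t" by (rule M_gr[OF u t])
    interpret Bu: gr_module K "FOb B u" by (rule B_gr[OF u])
    show "klin K (FOb (Mt t) u) (FOb B u) (pair_nat t x u)"
      using kbilinD1[OF kbilin_chi[OF u t] xc] klin_cong[OF N.module_axioms pair_nat_apply[OF t xc u]] by simp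
    show "pair_nat t x u m \<in> grade (FOb B u) (p + q)" if "m \<in> grade (FOb (Mt t) u) p" for p m
      using that x pair_grade[OF u t] by (simp add: pair_nat_apply[OF t xc u N.grade_carrier] chi_homog[OF u t] Bu.grade_sg)
  qed (use t xc u in \<open>simp add: pair_nat_def\<close>)
  fix u u' r b m assume ob: "u \<in> Ob U" "u' \<in> Ob U" and b: "b \<in> grade (Hom U u u') r" and m: "m \<in> carrier (FOb (Mt t) u)"
  note bc = gr_module.grade_carrier[OF U.gr_hom_module[OF ob] b]
  have mc: "m \<in> carrier (MM u t)" using m by simp
  have ag: "abelian_group (FOb B u')" by (rule module_abelian_group[OF B_mod[OF ob(2)]])
  have "FMor B u u' b (chi u t m x) = sg (FOb B u') (q * r) (chi u' t (L u u' t b m) x)"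
  proof (rule gr_module.klin_eqI[OF M_gr[OF ob(1) t] B_mod[OF ob(2)] _ _ _ mc])
    show "klin K (MM u t) (FOb B u') (\<lambda>m. FMor B u u' b (chi u t m x))"
      by (rule klin_comp[OF kbilinD1[OF kbilin_chi[OF ob(1) t] xc] dg_mod_klin(1)[OF B ob bc]])
    show "klin K (MM u t) (FOb B u') (\<lambda>m. sg (FOb B u') (q * r) (chi u' t (L u u' t b m) x))"
      by (rule klin_sg_fun[OF B_mod[OF ob(2)] klin_comp[OF L_klin[OF ob t bc] kbilinD1[OF kbilin_chi[OF ob(2) t] xc]]])
    fix p m assume m: "m \<in> grade (MM u t) p"
    note mc = gr_module.grade_carrier[OF M_gr[OF ob(1) t] m]
    have "FMor B u u' b (chi u t m x) = sg (FOb B u') (q * p) (\<psi> u' t (L u u' t b m) x)"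
      by (simp add: chi_homog[OF ob(1) t m x] klin_sg[OF B_mod[OF ob(1)] B_mod[OF ob(2)] dg_mod_klin(1)[OF B ob bc]]
          pair_closed[OF ob(1) t mc xc] pair_left[OF ob t mc bc xc])
    also have "\<dots> = sg (FOb B u') (q * r + q * (p + r)) (\<psi> u' t (L u u' t b m) x)"
      by (rule sg_cong) (simp add: algebra_simps)
    finally show "FMor B u u' b (chi u t m x) = sg (FOb B u') (q * r) (chi u' t (L u u' t b m) x)"
      by (simp add: chi_homog[OF ob(2) t L_grade[OF ob t b m] x] sg_sg[OF ag pair_closed[OF ob(2) t L_closed[OF ob t bc mc] xc]])
  qed
  then show "FMor B u u' b (pair_nat t x u m) = sg (FOb B u') (q * r) (pair_nat t x u' (FMor (Mt t) u u' b m))"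
    using L_closed[OF ob t bc mc] by (simp add: pair_nat_apply t xc ob mc)
qed

lemma klin_pair_nat:
  assumes t: "t \<in> Ob T"
  shows "klin K (FOb A t) (EE B t) (pair_nat t)"
proof (rule klinI)
  interpret E: gr_module K "EE B t" by (rule dg_module_gr_module[OF dg_module_EE[OF B t]])
  interpret At: gr_module K "FOb A t" by (rule A_gr[OF t])
  show add: "pair_nat t (x \<oplus>\<^bsub>FOb A t\<^esub> y) = pair_nat t x \<oplus>\<^bsub>EE B t\<^esub> pair_nat t y"
    if "x \<in> carrier (FOb A t)" "y \<in> carrier (FOb A t)" for x y
    using that klin_add[OF kbilinD2[OF kbilin_chi[OF _ t]]] by (auto simp: pair_nat_def fun_eq_iff restrict_def t)
  show "pair_nat t (k \<odot>\<^bsub>FOb A t\<^esub> x) = k \<odot>\<^bsub>EE B t\<^esub> pair_nat t x" if "k \<in> carrier K" "x \<in> carrier (FOb A t)" for k x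
    using that klin_smult[OF kbilinD2[OF kbilin_chi[OF _ t]]] by (auto simp: pair_nat_def fun_eq_iff restrict_def t)
  show "pair_nat t x \<in> carrier (EE B t)" if "x \<in> carrier (FOb A t)" for x
    using that
  proof (induction rule: At.homog_induct)
    case (homog q x)
    then show ?case using E.grade_carrier[of _ q] pair_nat_deg[OF t homog] by simp
  next
    case (add x y)
    then show ?case using \<open>\<And>y x. _ \<Longrightarrow> _ \<Longrightarrow> pair_nat t (x \<oplus>\<^bsub>FOb A t\<^esub> y) = _\<close> E.a_closed by (simp del: mnat_simps)
  qed
qed

text \<open>The converse of \<open>dg_pairing_dot\<close>: compatibility with T yields naturality in
  t, and the Leibniz rule yields closedness, once elements are decomposed.\<close>

lemma comma_ob_pairing: "(A, pair_nat, B) \<in> Ob (comma K T U M)"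
  unfolding comma_ob_iff
proof (intro conjI ballI allI A B)
  show "pair_nat \<in> extensional (Ob T)" by (simp add: pair_nat_def)
  fix t assume t: "t \<in> Ob T"
  interpret E: dg_module K "EE B t" by (rule dg_module_EE[OF B t])
  interpret At: dg_module K "FOb A t" by (rule dg_mod_ob[OF A t])
  show "pair_nat t \<in> hom_deg K (FOb A t) (EE B t) 0"
    by (rule hom_degI[OF klin_pair_nat[OF t]]) (use t in \<open>simp add: pair_nat_def\<close>, simp add: pair_nat_deg[OF t])
  fix x assume x: "x \<in> carrier (FOb A t)"
  show "dif (EE B t) (pair_nat t x) = pair_nat t (dif (FOb A t) x)"
  proof (rule gr_module.klin_eqI[OF A_gr[OF t] E.module_axioms _ _ _ x])
    show "klin K (FOb A t) (EE B t) (\<lambda>x. dif (EE B t) (pair_nat t x))"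
      by (rule klin_comp[OF klin_pair_nat[OF t] dg_module_klin_dif[OF E.dg_module_axioms]])
    show "klin K (FOb A t) (EE B t) (\<lambda>x. pair_nat t (dif (FOb A t) x))"
      by (rule klin_comp[OF dg_module_klin_dif[OF At.dg_module_axioms] klin_pair_nat[OF t]])
    fix q x assume x: "x \<in> grade (FOb A t) q"
    note xc = gr_module.grade_carrier[OF A_gr[OF t] x]
    note dxc = At.dif_closed[OF xc] and dx = At.dif_grade[OF x]
    note fc = klin_closed[OF klin_pair_nat[OF t]]
    show "dif (EE B t) (pair_nat t x) = pair_nat t (dif (FOb A t) x)"
    proof (rule mnat_eqI[OF functor_M_at[OF t] B quiver_U E.dif_closed[OF fc[OF xc]] fc[OF dxc]])
      fix u m assume u: "u \<in> Ob U" and m: "m \<in> carrier (FOb (Mt t) u)"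
      interpret Bu: dg_module K "FOb B u" by (rule dg_mod_ob[OF B u])
      have ag: "abelian_group (FOb B u)" by (rule module_abelian_group[OF Bu.module_axioms])
      have mc: "m \<in> carrier (MM u t)" using m by simp
      note k = kbilinD1[OF kbilin_chi[OF u t]]
      \<comment> \<open>Closedness evaluated at x of degree q; being linear in m, it is reduced to
        homogeneous m and there to \<open>pair_dif\<close>.\<close>
      have "dif (FOb B u) (chi u t m x) \<oplus>\<^bsub>FOb B u\<^esub> sg (FOb B u) (q + 1) (chi u t (dif (MM u t) m) x) = chi u t m (dif (FOb A t) x)"
      proof (rule gr_module.klin_eqI[OF M_gr[OF u t] Bu.module_axioms _ k[OF dxc] _ mc])
        show "klin K (MM u t) (FOb B u) (\<lambda>m. dif (FOb B u) (chi u t m x) \<oplus>\<^bsub>FOb B u\<^esub> sg (FOb B u) (q + 1) (chi u t (dif (MM u t) m) x))"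
          by (intro klin_plus[OF M_mod[OF u t] Bu.module_axioms] klin_comp[OF k[OF xc] dg_module_klin_dif[OF Bu.dg_module_axioms]]
              klin_sg_fun[OF Bu.module_axioms] klin_comp[OF dg_module_klin_dif[OF M_module[OF u t]] k[OF xc]])
        fix p m assume m: "m \<in> grade (MM u t) p"
        note mc = gr_module.grade_carrier[OF M_gr[OF u t] m]
        note dm = dif_grade[OF M_module[OF u t] m] and dmc = dif_carrier[OF M_module[OF u t] mc]
        note [simp] = pair_closed[OF u t mc dxc] pair_closed[OF u t dmc xc] pair_closed[OF u t mc xc]
        \<comment> \<open>2 q is dropped from the exponent; in this form the two terms with d m
          visibly have opposite signs.\<close>
        have s: "sg (FOb B u) (q + 1 + q * (p + 1)) y = sg (FOb B u) (q * p + 1) y" for y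
          by (rule sg_cong) (simp add: algebra_simps)
        have "dif (FOb B u) (chi u t m x) \<oplus>\<^bsub>FOb B u\<^esub> sg (FOb B u) (q + 1) (chi u t (dif (MM u t) m) x) =
            sg (FOb B u) (q * p) (\<psi> u t (dif (MM u t) m) x) \<oplus>\<^bsub>FOb B u\<^esub> sg (FOb B u) (q * p + p) (\<psi> u t m (dif (FOb A t) x))
            \<oplus>\<^bsub>FOb B u\<^esub> sg (FOb B u) (q * p + 1) (\<psi> u t (dif (MM u t) m) x)"
          by (simp add: chi_homog[OF u t m x] chi_homog[OF u t dm x] s pair_dif[OF u t m xc] sg_add[OF ag] sg_closed[OF ag] sg_sg[OF ag]
              klin_sg[OF Bu.module_axioms Bu.module_axioms dg_module_klin_dif[OF Bu.dg_module_axioms]])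
        also have "\<dots> = sg (FOb B u) (q * p + p) (\<psi> u t m (dif (FOb A t) x))"
          by (simp add: sg_def Bu.a_ac Bu.r_neg Bu.l_neg Bu.r_neg1 Bu.r_neg2)
        also have "\<dots> = chi u t m (dif (FOb A t) x)"
          by (simp add: chi_homog[OF u t m dx] algebra_simps)
        finally show "dif (FOb B u) (chi u t m x) \<oplus>\<^bsub>FOb B u\<^esub> sg (FOb B u) (q + 1) (chi u t (dif (MM u t) m) x) = chi u t m (dif (FOb A t) x)" .
      qed
      then show "dif (EE B t) (pair_nat t x) u m = pair_nat t (dif (FOb A t) x) u m"
        using mnat_dif_eval[OF functor_M_at[OF t] B quiver_U pair_nat_deg[OF t x] u m] mc dif_carrier[OF M_module[OF u t] mc]
        by (simp add: pair_nat_apply t u xc dxc del: mnat_simps)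
    qed
  qed
next
  fix t t' r a x assume ob: "t \<in> Ob T" "t' \<in> Ob T" and a: "a \<in> grade (Hom T t t') r" and x: "x \<in> carrier (FOb A t)"
  note ac = gr_module.grade_carrier[OF T.gr_hom_module[OF ob] a]
  note mE = dg_module_module[OF dg_module_EE[OF B ob(2)]]
  show "FMor (FOb (GG K T U M) B) t t' a (pair_nat t x) = pair_nat t' (FMor A t t' a x)"
  proof (rule gr_module.klin_eqI[OF A_gr[OF ob(1)] mE _ _ _ x])
    show k1: "klin K (FOb A t) (EE B t') (\<lambda>x. FMor (FOb (GG K T U M) B) t t' a (pair_nat t x))"
      by (rule klin_comp[OF klin_pair_nat[OF ob(1)] klin_GG[OF ob B ac]])
    show k2: "klin K (FOb A t) (EE B t') (\<lambda>x. pair_nat t' (FMor A t t' a x))"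
      by (rule klin_comp[OF dg_mod_klin(1)[OF A ob ac] klin_pair_nat[OF ob(2)]])
    fix q x assume x: "x \<in> grade (FOb A t) q"
    note xc = gr_module.grade_carrier[OF A_gr[OF ob(1)] x]
    note ax = dg_mod_closed[OF A ob ac xc]
    show "FMor (FOb (GG K T U M) B) t t' a (pair_nat t x) = pair_nat t' (FMor A t t' a x)"
    proof (rule mnat_eqI[OF functor_M_at[OF ob(2)] B quiver_U klin_closed[OF k1 xc] klin_closed[OF k2 xc]])
      fix u m assume u: "u \<in> Ob U" and m: "m \<in> carrier (FOb (Mt t') u)"
      have mc: "m \<in> carrier (MM u t')" using m by simp
      have ag: "abelian_group (FOb B u)" by (rule module_abelian_group[OF B_mod[OF u]])
      have "sg (FOb B u) (q * r) (chi u t (R u t t' a m) x) = chi u t' m (FMor A t t' a x)"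
      proof (rule gr_module.klin_eqI[OF M_gr[OF u ob(2)] B_mod[OF u] _ kbilinD1[OF kbilin_chi[OF u ob(2)] ax] _ mc])
        show "klin K (MM u t') (FOb B u) (\<lambda>m. sg (FOb B u) (q * r) (chi u t (R u t t' a m) x))"
          by (rule klin_sg_fun[OF B_mod[OF u] klin_comp[OF R_klin[OF u ob ac] kbilinD1[OF kbilin_chi[OF u ob(1)] xc]]])
        fix p m assume m: "m \<in> grade (MM u t') p"
        note mc = gr_module.grade_carrier[OF M_gr[OF u ob(2)] m]
        note Rm = R_closed[OF u ob ac mc]
        note c = pair_closed[OF u ob(1) Rm xc]
        have "\<psi> u t' m (FMor A t t' a x) = sg (FOb B u) (p * r) (\<psi> u t (R u t t' a m) x)"
          by (simp add: pair_right[OF u ob mc ac xc] bullet_homog[OF u ob m a]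
              klin_sg[OF M_mod[OF u ob(1)] B_mod[OF u] kbilinD1[OF bilin[OF u ob(1)] xc] Rm])
        then have "chi u t' m (FMor A t t' a x) = sg (FOb B u) ((q + r) * p + p * r) (\<psi> u t (R u t t' a m) x)"
          by (simp add: chi_homog[OF u ob(2) m dg_mod_grade[OF A ob a x]] sg_sg[OF ag c])
        \<comment> \<open>Both exponents have the parity of q p.\<close>
        also have "\<dots> = sg (FOb B u) (q * r + q * (p + r)) (\<psi> u t (R u t t' a m) x)"
          by (rule sg_cong) (simp add: algebra_simps)
        finally show "sg (FOb B u) (q * r) (chi u t (R u t t' a m) x) = chi u t' m (FMor A t t' a x)"
          by (simp add: chi_homog[OF u ob(1) R_grade[OF u ob a m] x] sg_sg[OF ag c])
      qed
      then show "FMor (FOb (GG K T U M) B) t t' a (pair_nat t x) u m = pair_nat t' (FMor A t t' a x) u m"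
        using GG_apply[OF ob B pair_nat_deg[OF ob(1) x] a u mc] R_closed[OF u ob ac mc]
        by (simp add: pair_nat_apply ob xc u mc ax)
    qed
  qed
qed

text \<open>\<open>dot\<close> and \<open>chi\<close> apply the same sign, so passing from \<psi> to
  a transformation and back is the identity.\<close>

lemma dot_pair_nat:
  assumes ob: "u \<in> Ob U" "t \<in> Ob T" and m: "m \<in> carrier (MM u t)" and x: "x \<in> carrier (FOb A t)"
  shows "dot M (A, pair_nat, B) u t m x = \<psi> u t m x"
proof (rule kbilin_eqI[OF M_gr[OF ob] A_gr[OF ob(2)] B_mod[OF ob(1)] kbilin_dot[OF comma_ob_pairing ob] bilin[OF ob] _ m x])
  fix p q m x assume m: "m \<in> grade (MM u t) p" and x: "x \<in> grade (FOb A t) q"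
  note c = gr_module.grade_carrier[OF M_gr[OF ob] m] gr_module.grade_carrier[OF A_gr[OF ob(2)] x]
  show "dot M (A, pair_nat, B) u t m x = \<psi> u t m x"
    using pair_closed[OF ob c]
    by (simp add: dot_homog[OF comma_ob_pairing ob m x] pair_nat_apply ob c chi_homog[OF ob m x]
        sg_sg[OF module_abelian_group[OF B_mod[OF ob(1)]]])
qed

end

section \<open>Direct sums\<close>

lemma dg_sum_simps [simp]:
  "carrier (dg_sum M N) = carrier M \<times> carrier N" "zero (dg_sum M N) = (\<zero>\<^bsub>M\<^esub>, \<zero>\<^bsub>N\<^esub>)"
  "add (dg_sum M N) = (\<lambda>(x, y) (x', y'). (x \<oplus>\<^bsub>M\<^esub> x', y \<oplus>\<^bsub>N\<^esub> y'))"
  "smult (dg_sum M N) = (\<lambda>a (x, y). (a \<odot>\<^bsub>M\<^esub> x, a \<odot>\<^bsub>N\<^esub> y))"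
  "grade (dg_sum M N) = (\<lambda>n. grade M n \<times> grade N n)" "dif (dg_sum M N) = (\<lambda>(x, y). (dif M x, dif N y))"
  by (simp_all add: dg_sum_def)

context
  fixes K :: "'k ring" and M :: "('k, 'v) dgmod" and N :: "('k, 'w) dgmod"
  assumes M: "module K M" and N: "module K N"
begin

interpretation M: module K M by (rule M)
interpretation N: module K N by (rule N)

lemma module_dg_sum: "module K (dg_sum M N)"
proof (rule moduleI[OF M.R.is_cring])
  show "abelian_group (dg_sum M N)"
  proof (rule abelian_groupI)
    fix z assume "z \<in> carrier (dg_sum M N)"
    then show "\<exists>w\<in>carrier (dg_sum M N). w \<oplus>\<^bsub>dg_sum M N\<^esub> z = \<zero>\<^bsub>dg_sum M N\<^esub>"
      by (intro bexI[of _ "(\<ominus>\<^bsub>M\<^esub> fst z, \<ominus>\<^bsub>N\<^esub> snd z)"]) (auto simp: M.l_neg N.l_neg)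
  qed (auto simp: M.a_assoc N.a_assoc intro: M.a_comm N.a_comm)
qed (auto simp: M.smult_l_distr N.smult_l_distr M.smult_r_distr N.smult_r_distr M.smult_assoc1 N.smult_assoc1)

lemma a_inv_dg_sum: "x \<in> carrier M \<Longrightarrow> y \<in> carrier N \<Longrightarrow> \<ominus>\<^bsub>dg_sum M N\<^esub> (x, y) = (\<ominus>\<^bsub>M\<^esub> x, \<ominus>\<^bsub>N\<^esub> y)"
proof -
  assume "x \<in> carrier M" "y \<in> carrier N"
  then show ?thesis
    by (intro abelian_group.minus_equality[OF module_abelian_group[OF module_dg_sum]]) (simp_all add: M.l_neg N.l_neg)
qed

lemma sg_dg_sum: "x \<in> carrier M \<Longrightarrow> y \<in> carrier N \<Longrightarrow> sg (dg_sum M N) n (x, y) = (sg M n x, sg N n y)"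
  by (simp add: sg_def a_inv_dg_sum)

end

text \<open>The test for degree m is the pair of degree m components.\<close>

lemma gr_module_dg_sum:
  assumes M: "gr_module K M" and N: "gr_module K N"
  shows "gr_module K (dg_sum M N)"
proof -
  interpret M: gr_module K M by (rule M)
  interpret N: gr_module K N by (rule N)
  have S: "module K (dg_sum M N)" by (rule module_dg_sum[OF M.module_axioms N.module_axioms])
  have G: "submodule (grade (dg_sum M N) n) K (dg_sum M N)" for n
    by (rule submoduleI'[OF S]) (auto simp: M.grade_carrier N.grade_carrier M.grade_zero N.grade_zero
        M.grade_add N.grade_add M.grade_smult N.grade_smult)
  show ?thesis
  proof (rule gr_module_unique_sumI[where I = "\<lambda>_. {()}" and Q = "\<lambda>_ _. dg_sum M N"
        and ev = "\<lambda>m _ (x, y). (hcomp M x m, hcomp N y m)", OF S G])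
    show "abelian_group (dg_sum M N)" by (rule module_abelian_group[OF S])
    let ?F = "fin_sums \<zero>\<^bsub>dg_sum M N\<^esub> (add (dg_sum M N)) (\<Union>n. grade (dg_sum M N) n)"
    have sub: "submodule ?F K (dg_sum M N)" "grade (dg_sum M N) n \<subseteq> ?F" for n
      using module.submodule_fin_sums[where G = "grade (dg_sum M N)", OF S G] by auto
    note add = module.submoduleE(5)[OF S sub(1)]
    \<comment> \<open>x and y have components in different degrees, so (x, 0) and (0, y) are
      generated separately and then added.\<close>
    have 1: "(x, \<zero>\<^bsub>N\<^esub>) \<in> ?F" if "x \<in> carrier M" for x
      using that
    proof (induction rule: M.homog_induct)
      case (homog n x)
      then show ?case using sub(2)[of n] N.grade_zero by auto
    next
      case (add x x')
      then show ?case using \<open>\<And>b a. _ \<Longrightarrow> _ \<Longrightarrow> a \<oplus>\<^bsub>dg_sum M N\<^esub> b \<in> ?F\<close>[of "(x, \<zero>\<^bsub>N\<^esub>)" "(x', \<zero>\<^bsub>N\<^esub>)"] by simp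
    qed
    have 2: "(\<zero>\<^bsub>M\<^esub>, y) \<in> ?F" if "y \<in> carrier N" for y
      using that
    proof (induction rule: N.homog_induct)
      case (homog n x)
      then show ?case using sub(2)[of n] M.grade_zero by auto
    next
      case (add x x')
      then show ?case using \<open>\<And>b a. _ \<Longrightarrow> _ \<Longrightarrow> a \<oplus>\<^bsub>dg_sum M N\<^esub> b \<in> ?F\<close>[of "(\<zero>\<^bsub>M\<^esub>, x)" "(\<zero>\<^bsub>M\<^esub>, x')"] by simp
    qed
    show "z \<in> ?F" if "z \<in> carrier (dg_sum M N)" for z
      using that add[OF 1 2, of "fst z" "snd z"] by auto
    show "z = \<zero>\<^bsub>dg_sum M N\<^esub>" if "z \<in> grade (dg_sum M N) m"
      "\<And>i. i \<in> {()} \<Longrightarrow> (case z of (x, y) \<Rightarrow> (hcomp M x m, hcomp N y m)) = \<zero>\<^bsub>dg_sum M N\<^esub>" for m z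
      using that by (auto simp: M.hcomp_homog N.hcomp_homog)
  qed (auto simp: M.hcomp_closed N.hcomp_closed M.hcomp_add N.hcomp_add M.hcomp_homog N.hcomp_homog)
qed

lemma dg_module_dg_sum:
  assumes M: "dg_module K M" and N: "dg_module K N"
  shows "dg_module K (dg_sum M N)"
proof (rule dg_moduleI[OF gr_module_dg_sum[OF dg_module_gr_module[OF M] dg_module_gr_module[OF N]]])
  interpret M: dg_module K M by (rule M)
  interpret N: dg_module K N by (rule N)
  show "klin K (dg_sum M N) (dg_sum M N) (dif (dg_sum M N))"
    by (auto simp: klin_def M.dif_closed N.dif_closed M.dif_add N.dif_add M.dif_smult N.dif_smult)
qed (auto simp: dif_grade[OF M] dif_grade[OF N] dg_module.dif_dif[OF M] dg_module.dif_dif[OF N]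
    gr_module.grade_carrier[OF dg_module_gr_module[OF M]] gr_module.grade_carrier[OF dg_module_gr_module[OF N]])

section \<open>The comma category\<close>

lemma mnat_comp_eq_iff:
  "mnat_comp C F \<theta> \<eta> = mnat_comp C F \<theta>' \<eta>' \<longleftrightarrow> (\<forall>X\<in>Ob C. \<forall>x\<in>carrier (FOb F X). \<theta> X (\<eta> X x) = \<theta>' X (\<eta>' X x))"
proof
  assume "mnat_comp C F \<theta> \<eta> = mnat_comp C F \<theta>' \<eta>'"
  then show "\<forall>X\<in>Ob C. \<forall>x\<in>carrier (FOb F X). \<theta> X (\<eta> X x) = \<theta>' X (\<eta>' X x)"
    by (metis mnat_comp_apply)
qed (auto simp: mnat_comp_def compose_def fun_eq_iff)

context dg_bimodule
begin

text \<open>The condition f' \<alpha> = \<open>GG\<close>(\<beta>) f at an element, with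
  \<open>GG\<close>(\<beta>) written out as composition with \<beta>.\<close>

definition comma_square where
  "comma_square A f B A' f' B' \<alpha> \<beta> \<longleftrightarrow> (\<forall>t\<in>Ob T. \<forall>x\<in>carrier (FOb A t). f' t (\<alpha> t x) = mnat_comp U (Mt t) \<beta> (f t x))"

lemma comma_hom_simps:
  "add (Hom (comma K T U M) (A, f, B) (A', f', B')) = add (dg_sum (mnat K T A A') (mnat K U B B'))"
  "zero (Hom (comma K T U M) (A, f, B) (A', f', B')) = zero (dg_sum (mnat K T A A') (mnat K U B B'))"
  "smult (Hom (comma K T U M) (A, f, B) (A', f', B')) = smult (dg_sum (mnat K T A A') (mnat K U B B'))"
  "dif (Hom (comma K T U M) (A, f, B) (A', f', B')) = dif (dg_sum (mnat K T A A') (mnat K U B B'))"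
  "grade (Hom (comma K T U M) (A, f, B) (A', f', B')) = comma_deg K T U M (A, f, B) (A', f', B')"
  "carrier (Hom (comma K T U M) (A, f, B) (A', f', B')) = fin_sums \<zero>\<^bsub>dg_sum (mnat K T A A') (mnat K U B B')\<^esub>
    (add (dg_sum (mnat K T A A') (mnat K U B B'))) (\<Union>n. comma_deg K T U M (A, f, B) (A', f', B') n)"
  by (simp_all add: comma_def Let_def)

context
  fixes A A' :: "('k, 'to, 'th, 'v) dgm" and f f' and B B' :: "('k, 'uo, 'uh, 'v) dgm"
  assumes X: "(A, f, B) \<in> Ob (comma K T U M)" and X': "(A', f', B') \<in> Ob (comma K T U M)"
begin

lemma comma_functors: "dg_functor K T (DgModK K) A" "dg_functor K U (DgModK K) B"
  "dg_functor K T (DgModK K) A'" "dg_functor K U (DgModK K) B'"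
  using X X' unfolding comma_ob_iff by blast+

private lemmas fA = comma_functors(1) and fB = comma_functors(2) and fA' = comma_functors(3) and fB' = comma_functors(4)

private abbreviation "S \<equiv> dg_sum (mnat K T A A') (mnat K U B B')"
private abbreviation "H \<equiv> Hom (comma K T U M) (A, f, B) (A', f', B')"
private abbreviation "sq \<equiv> comma_square A f B A' f' B'"

private lemmas mA = dg_module_mnat[OF fA fA' quiver_T]
private lemmas mB = dg_module_mnat[OF fB fB' quiver_U]
private lemmas mS = dg_module_dg_sum[OF mA mB]

lemma comma_f_closed: "t \<in> Ob T \<Longrightarrow> x \<in> carrier (FOb A t) \<Longrightarrow> f t x \<in> carrier (EE B t)"
  by (rule klin_closed[OF comma_klin[OF X]])

lemma comma_deg_iff:
  "(\<alpha>, \<beta>) \<in> comma_deg K T U M (A, f, B) (A', f', B') n \<longleftrightarrow>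
    \<alpha> \<in> mnat_deg K T A A' n \<and> \<beta> \<in> mnat_deg K U B B' n \<and> sq \<alpha> \<beta>"
proof -
  have "mnat_comp T A f' \<alpha> = mnat_comp T A (FMor (GG K T U M) B B' \<beta>) f \<longleftrightarrow> sq \<alpha> \<beta>"
    by (simp add: mnat_comp_eq_iff GG_simps comma_f_closed comma_square_def)
  then show ?thesis by (simp add: comma_deg_def)
qed

lemma comma_square_zero: "sq (\<zero>\<^bsub>mnat K T A A'\<^esub>) (\<zero>\<^bsub>mnat K U B B'\<^esub>)"
proof -
  have "f' t (\<zero>\<^bsub>mnat K T A A'\<^esub> t x) = mnat_comp U (Mt t) (\<zero>\<^bsub>mnat K U B B'\<^esub>) (f t x)"
    if "t \<in> Ob T" "x \<in> carrier (FOb A t)" for t x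
    using that klin_zero[OF dg_module_module[OF dg_mod_ob[OF fA']] dg_module_module[OF dg_module_EE[OF fB']] comma_klin[OF X']]
      mnat_closed[OF functor_M_at fB quiver_U comma_f_closed]
    by (auto simp: mnat_comp_def compose_def fun_eq_iff restrict_def)
  then show ?thesis by (simp add: comma_square_def)
qed

lemma comma_square_add:
  assumes "\<alpha> \<in> carrier (mnat K T A A')" "\<alpha>' \<in> carrier (mnat K T A A')" "sq \<alpha> \<beta>" "sq \<alpha>' \<beta>'"
  shows "sq (\<alpha> \<oplus>\<^bsub>mnat K T A A'\<^esub> \<alpha>') (\<beta> \<oplus>\<^bsub>mnat K U B B'\<^esub> \<beta>')"
  unfolding comma_square_def
proof (intro ballI)
  fix t x assume t: "t \<in> Ob T" and x: "x \<in> carrier (FOb A t)"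
  have "f' t ((\<alpha> \<oplus>\<^bsub>mnat K T A A'\<^esub> \<alpha>') t x) = f' t (\<alpha> t x) \<oplus>\<^bsub>EE B' t\<^esub> f' t (\<alpha>' t x)"
    using t x klin_add[OF comma_klin[OF X' t] mnat_closed[OF fA fA' quiver_T assms(1) t x] mnat_closed[OF fA fA' quiver_T assms(2) t x]] by simp
  also have "\<dots> = mnat_comp U (Mt t) \<beta> (f t x) \<oplus>\<^bsub>EE B' t\<^esub> mnat_comp U (Mt t) \<beta>' (f t x)"
    using assms(3,4) t x by (simp add: comma_square_def)
  finally show "f' t ((\<alpha> \<oplus>\<^bsub>mnat K T A A'\<^esub> \<alpha>') t x) = mnat_comp U (Mt t) (\<beta> \<oplus>\<^bsub>mnat K U B B'\<^esub> \<beta>') (f t x)"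
    using mnat_comp_add_left[OF functor_M_at[OF t] fB fB' quiver_U comma_f_closed[OF t x]] by simp
qed

lemma comma_square_smult:
  assumes "a \<in> carrier K" "\<alpha> \<in> carrier (mnat K T A A')" "sq \<alpha> \<beta>"
  shows "sq (a \<odot>\<^bsub>mnat K T A A'\<^esub> \<alpha>) (a \<odot>\<^bsub>mnat K U B B'\<^esub> \<beta>)"
  unfolding comma_square_def
proof (intro ballI)
  fix t x assume t: "t \<in> Ob T" and x: "x \<in> carrier (FOb A t)"
  have "f' t ((a \<odot>\<^bsub>mnat K T A A'\<^esub> \<alpha>) t x) = a \<odot>\<^bsub>EE B' t\<^esub> f' t (\<alpha> t x)"
    using t x klin_smult[OF comma_klin[OF X' t] assms(1) mnat_closed[OF fA fA' quiver_T assms(2) t x]] by simp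
  also have "\<dots> = a \<odot>\<^bsub>EE B' t\<^esub> mnat_comp U (Mt t) \<beta> (f t x)"
    using assms(3) t x by (simp add: comma_square_def)
  finally show "f' t ((a \<odot>\<^bsub>mnat K T A A'\<^esub> \<alpha>) t x) = mnat_comp U (Mt t) (a \<odot>\<^bsub>mnat K U B B'\<^esub> \<beta>) (f t x)"
    using mnat_comp_smult_left[OF functor_M_at[OF t] fB fB' quiver_U comma_f_closed[OF t x]] by simp
qed

text \<open>Closedness of f and f' moves d across them; the Leibniz rule for \<beta> composed with f
  t x then produces d(\<beta>) composed with f t x and a further term, which the commutator defining
  d(\<alpha>) cancels.\<close>

lemma comma_square_dif:
  assumes \<alpha>: "\<alpha> \<in> mnat_deg K T A A' n" and \<beta>: "\<beta> \<in> mnat_deg K U B B' n" and sq: "sq \<alpha> \<beta>"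
  shows "sq (dif (mnat K T A A') \<alpha>) (dif (mnat K U B B') \<beta>)"
  unfolding comma_square_def
proof (intro ballI)
  fix t x assume t: "t \<in> Ob T" and x: "x \<in> carrier (FOb A t)"
  interpret E: dg_module K "EE B' t" by (rule dg_module_EE[OF fB' t])
  interpret A't: dg_module K "FOb A' t" by (rule dg_mod_ob[OF fA' t])
  have agE: "abelian_group (EE B' t)" by (rule module_abelian_group[OF E.module_axioms])
  have \<alpha>c: "\<alpha> \<in> carrier (mnat K T A A')" using gr_module.grade_carrier[OF dg_module_gr_module[OF mA], of \<alpha> n] \<alpha> by simp
  have \<beta>c: "\<beta> \<in> carrier (mnat K U B B')" using gr_module.grade_carrier[OF dg_module_gr_module[OF mB], of \<beta> n] \<beta> by simp
  note cl = mnat_comp_closed[OF functor_M_at[OF t] fB fB' quiver_U]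
  note fx = comma_f_closed[OF t x]
  note dx = dif_carrier[OF dg_mod_ob[OF fA t] x]
  note \<alpha>cl = mnat_closed[OF fA fA' quiver_T \<alpha>c t]
  note f'k = comma_klin[OF X' t]
  have dif_f: "dif (EE B t) (f t x) = f t (dif (FOb A t) x)" if "(A, f, B) \<in> Ob (comma K T U M)" "x \<in> carrier (FOb A t)"
    for A :: "('k, 'to, 'th, 'v) dgm" and f and B :: "('k, 'uo, 'uh, 'v) dgm" and x
    using that t unfolding comma_ob_iff by blast
  let ?y = "mnat_comp U (Mt t) (dif (mnat K U B B') \<beta>) (f t x)" and ?z = "mnat_comp U (Mt t) \<beta> (dif (EE B t) (f t x))"
  have yc: "?y \<in> carrier (EE B' t)" and zc: "?z \<in> carrier (EE B' t)"
    by (intro cl dif_carrier[OF mB] \<beta>c fx dif_carrier[OF dg_module_EE[OF fB t]])+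
  have z: "?z = f' t (\<alpha> t (dif (FOb A t) x))"
    using sq t dx by (simp add: comma_square_def dif_f[OF X x] del: mnat_simps)
  have "f' t (dif (FOb A' t) (\<alpha> t x)) = dif (EE B' t) (mnat_comp U (Mt t) \<beta> (f t x))"
    using sq t x by (simp add: comma_square_def dif_f[OF X' \<alpha>cl, symmetric] del: mnat_simps)
  also have "\<dots> = ?y \<oplus>\<^bsub>EE B' t\<^esub> sg (EE B' t) n ?z"
    by (rule mnat_comp_dif[OF functor_M_at[OF t] fB fB' quiver_U \<beta> fx])
  finally have 1: "f' t (dif (FOb A' t) (\<alpha> t x)) = ?y \<oplus>\<^bsub>EE B' t\<^esub> sg (EE B' t) n ?z" .
  \<comment> \<open>\<open>?z\<close> enters here with exponent n + 1 and through \<open>1\<close>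
    with exponent n, so it drops out.\<close>
  have "f' t (dif (mnat K T A A') \<alpha> t x) = f' t (dif (FOb A' t) (\<alpha> t x)) \<oplus>\<^bsub>EE B' t\<^esub> sg (EE B' t) (n + 1) ?z"
    by (simp only: z mnat_dif_eval[OF fA fA' quiver_T \<alpha> t x] klin_add[OF f'k] A't.dif_closed \<alpha>cl x dx
        sg_closed[OF module_abelian_group[OF A't.module_axioms]] klin_sg[OF A't.module_axioms E.module_axioms f'k])
  also have "\<dots> = ?y"
    unfolding 1 using yc zc E.a_inv_closed[OF zc] by (simp add: sg_def E.a_assoc E.r_neg E.l_neg del: mnat_simps)
  finally show "f' t (dif (mnat K T A A') \<alpha> t x) = ?y" .
qed

private lemma submodule_comma_deg: "submodule (comma_deg K T U M (A, f, B) (A', f', B') n) K S"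
proof (rule submoduleI'[OF dg_module_module[OF mS]])
  interpret GA: gr_module K "mnat K T A A'" by (rule dg_module_gr_module[OF mA])
  interpret GB: gr_module K "mnat K U B B'" by (rule dg_module_gr_module[OF mB])
  show "comma_deg K T U M (A, f, B) (A', f', B') n \<subseteq> carrier S"
    using GA.grade_carrier[of _ n] GB.grade_carrier[of _ n] by (auto simp: comma_deg_iff)
  show "\<zero>\<^bsub>S\<^esub> \<in> comma_deg K T U M (A, f, B) (A', f', B') n"
    using GA.grade_zero[of n] GB.grade_zero[of n] comma_square_zero by (simp add: comma_deg_iff del: mnat_simps(2-))
  show "z \<oplus>\<^bsub>S\<^esub> w \<in> comma_deg K T U M (A, f, B) (A', f', B') n"
    if "z \<in> comma_deg K T U M (A, f, B) (A', f', B') n" "w \<in> comma_deg K T U M (A, f, B) (A', f', B') n" for z w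
    using that GA.grade_add[of _ n] GB.grade_add[of _ n] comma_square_add GA.grade_carrier[of _ n]
    by (cases z; cases w) (simp add: comma_deg_iff del: mnat_simps(2-))
  show "a \<odot>\<^bsub>S\<^esub> z \<in> comma_deg K T U M (A, f, B) (A', f', B') n"
    if "a \<in> carrier K" "z \<in> comma_deg K T U M (A, f, B) (A', f', B') n" for a z
    using that GA.grade_smult[of _ _ n] GB.grade_smult[of _ _ n] comma_square_smult GA.grade_carrier[of _ n]
    by (cases z) (simp add: comma_deg_iff del: mnat_simps(2-))
qed

text \<open>Degrees are tested in the direct sum of the two modules of transformations, whose
  grading the comma morphisms inherit.\<close>

private lemma gr_comma: "gr_module K H" and comma_hom_sub: "carrier H \<subseteq> carrier S"
proof -
  interpret S: gr_module K S by (rule dg_module_gr_module[OF mS])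
  show "gr_module K H"
  proof (rule gr_module_fin_sumsI(1)[where P = S and I = "\<lambda>_. {()}" and Q = "\<lambda>_ _. S" and ev = "\<lambda>m _ z. hcomp S z m"])
    have sub: "z \<in> grade S n" if "z \<in> grade H n" for z n
      using that by (cases z) (simp add: comma_hom_simps comma_deg_iff)
    show "submodule (grade H n) K S" for n unfolding comma_hom_simps by (rule submodule_comma_deg)
    show "hcomp S z m = \<zero>\<^bsub>S\<^esub>" if "n \<noteq> m" "z \<in> grade H n" for m n z
      using S.hcomp_homog[OF sub[OF that(2)], of m] that(1) by (auto simp del: dg_sum_simps)
    show "z = \<zero>\<^bsub>S\<^esub>" if "z \<in> grade H m" "\<And>i. i \<in> {()} \<Longrightarrow> hcomp S z m = \<zero>\<^bsub>S\<^esub>" for m z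
      using S.hcomp_homog[OF sub[OF that(1)], of m] that(2) by (simp del: dg_sum_simps)
  qed (simp_all only: comma_hom_simps S.hcomp_closed S.hcomp_add S.module_axioms module_abelian_group[OF S.module_axioms])
  show "carrier H \<subseteq> carrier S"
    unfolding comma_hom_simps by (rule S.submoduleE(1)[OF S.submodule_fin_sums(1)[OF submodule_comma_deg]])
qed

lemma comma_hom_carrierD:
  assumes "(\<alpha>, \<beta>) \<in> carrier H"
  shows "\<alpha> \<in> carrier (mnat K T A A')" "\<beta> \<in> carrier (mnat K U B B')"
  using assms comma_hom_sub by auto

lemma dg_module_comma_hom: "dg_module K H"
proof (rule dg_moduleI[OF gr_comma])
  interpret GH: gr_module K H by (rule gr_comma)
  interpret S: dg_module K S by (rule mS)
  have deg: "dif H z \<in> grade H (n + 1)" if "z \<in> grade H n" for z n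
    using that comma_square_dif[of _ n] dif_grade[OF mA, of _ n] dif_grade[OF mB, of _ n]
    by (cases z) (simp add: comma_hom_simps comma_deg_iff del: mnat_simps(2-))
  then show "dif H z \<in> grade H (n + 1)" if "z \<in> grade H n" for z n using that .
  have add: "dif H (z \<oplus>\<^bsub>H\<^esub> w) = dif H z \<oplus>\<^bsub>H\<^esub> dif H w" if "z \<in> carrier H" "w \<in> carrier H" for z w
    using S.dif_add comma_hom_sub that by (simp only: comma_hom_simps(1-4) subset_iff)
  show "klin K H H (dif H)"
  proof (rule klinI[OF _ add])
    show "dif H z \<in> carrier H" if "z \<in> carrier H" for z
      using that
    proof (induction rule: GH.homog_induct)
      case (homog n z)
      then show ?case using deg GH.grade_carrier by blast
    next
      case (add z w)
      then show ?case using \<open>\<And>w z. _ \<Longrightarrow> _ \<Longrightarrow> dif H (z \<oplus>\<^bsub>H\<^esub> w) = _\<close> GH.a_closed by simp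
    qed
    show "dif H (a \<odot>\<^bsub>H\<^esub> z) = a \<odot>\<^bsub>H\<^esub> dif H z" if "a \<in> carrier K" "z \<in> carrier H" for a z
      using S.dif_smult comma_hom_sub that by (simp only: comma_hom_simps(1-4) subset_iff)
  qed
  show "dif H (dif H z) = \<zero>\<^bsub>H\<^esub>" if "z \<in> grade H n" for z n
    using S.dif_dif comma_hom_sub GH.grade_carrier[OF that] by (simp only: comma_hom_simps(1-4) subset_iff)
qed

end

lemma comma_simps:
  "Id (comma K T U M) (A, f, B) = (mnat_id T A, mnat_id U B)"
  "Comp (comma K T U M) (A, f, B) Y Z (\<alpha>', \<beta>') (\<alpha>, \<beta>) = (mnat_comp T A \<alpha>' \<alpha>, mnat_comp U B \<beta>' \<beta>)"
  by (simp_all add: comma_def split: prod.split)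

lemma comma_comp_deg:
  assumes X: "(A, f, B) \<in> Ob (comma K T U M)" and X': "(A', f', B') \<in> Ob (comma K T U M)"
    and X'': "(A'', f'', B'') \<in> Ob (comma K T U M)"
    and g: "(\<alpha>', \<beta>') \<in> comma_deg K T U M (A', f', B') (A'', f'', B'') p"
    and h: "(\<alpha>, \<beta>) \<in> comma_deg K T U M (A, f, B) (A', f', B') q"
  shows "(mnat_comp T A \<alpha>' \<alpha>, mnat_comp U B \<beta>' \<beta>) \<in> comma_deg K T U M (A, f, B) (A'', f'', B'') (p + q)"
proof -
  note g = g[unfolded comma_deg_iff[OF X' X'']] and h = h[unfolded comma_deg_iff[OF X X']]
  note F = comma_functors[OF X X'] and F'' = comma_functors(3,4)[OF X X'']
  have "\<alpha> \<in> grade (mnat K T A A') q" using h by simp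
  note \<alpha>c = gr_module.grade_carrier[OF dg_module_gr_module[OF dg_module_mnat[OF F(1,3) quiver_T]] this]
  have "f'' t (\<alpha>' t (\<alpha> t x)) = mnat_comp U (Mt t) (mnat_comp U B \<beta>' \<beta>) (f t x)"
    if t: "t \<in> Ob T" and x: "x \<in> carrier (FOb A t)" for t x
  proof -
    have "f'' t (\<alpha>' t (\<alpha> t x)) = mnat_comp U (Mt t) \<beta>' (mnat_comp U (Mt t) \<beta> (f t x))"
      using g h t x mnat_closed[OF F(1,3) quiver_T \<alpha>c t x] by (simp add: comma_square_def)
    also have "\<dots> = mnat_comp U (Mt t) (mnat_comp U B \<beta>' \<beta>) (f t x)"
      using mnat_closed[OF functor_M_at[OF t] F(2) quiver_U comma_f_closed[OF X X' t x]]
      by (auto simp: mnat_comp_def compose_def fun_eq_iff restrict_def)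
    finally show ?thesis .
  qed
  then have "comma_square A f B A'' f'' B'' (mnat_comp T A \<alpha>' \<alpha>) (mnat_comp U B \<beta>' \<beta>)"
    by (simp add: comma_square_def mnat_comp_apply)
  then show ?thesis
    unfolding comma_deg_iff[OF X X'']
    using mnat_comp_deg[OF F(1,3) F''(1) quiver_T, of \<alpha>' p \<alpha> q] mnat_comp_deg[OF F(2,4) F''(2) quiver_U, of \<beta>' p \<beta> q] g h by simp
qed

text \<open>Composition is componentwise, so the laws come from the two module categories; specific
  to the comma category is that identities and composites satisfy the square.\<close>

theorem dg_category_comma: "dg_category K (comma K T U M :: ('k, ('k, 'to, 'th, 'uo, 'uh, 'm, 'v) comma_ob, ('to, 'uo, 'v) comma_mor) dgcat)"
proof (intro dg_category.intro dg_category_axioms.intro)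
  let ?C = "comma K T U M :: ('k, ('k, 'to, 'th, 'uo, 'uh, 'm, 'v) comma_ob, ('to, 'uo, 'v) comma_mor) dgcat"
  interpret DT: dg_category K "DgMod K T :: ('k, ('k, 'to, 'th, 'v) dgm, 'to \<Rightarrow> 'v \<Rightarrow> 'v) dgcat" by (rule dg_category_DgMod[OF quiver_T])
  interpret DU: dg_category K "DgMod K U :: ('k, ('k, 'uo, 'uh, 'v) dgm, 'uo \<Rightarrow> 'v \<Rightarrow> 'v) dgcat" by (rule dg_category_DgMod[OF quiver_U])
  note DTs = DT.id_left DT.id_right DT.comp_assoc DT.comp_add_left DT.comp_add_right DT.comp_smult_left DT.comp_smult_right
  note DUs = DU.id_left DU.id_right DU.comp_assoc DU.comp_add_left DU.comp_add_right DU.comp_smult_left DU.comp_smult_right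
  have ob: "A \<in> Ob (DgMod K T)" "B \<in> Ob (DgMod K U)" if "(A, f, B) \<in> Ob ?C" for A f B
    using that by (auto simp: comma_ob_iff)
  have car: "\<alpha> \<in> carrier (Hom (DgMod K T) A A')" "\<beta> \<in> carrier (Hom (DgMod K U) B B')"
    if "(A, f, B) \<in> Ob ?C" "(A', f', B') \<in> Ob ?C" "(\<alpha>, \<beta>) \<in> carrier (Hom ?C (A, f, B) (A', f', B'))" for A f B A' f' B' \<alpha> \<beta>
    using comma_hom_carrierD[OF that] by simp_all
  have cm: "Comp ?C (A, f, B) (A', f', B') (A'', f'', B'') (\<alpha>', \<beta>') (\<alpha>, \<beta>) =
      (Comp (DgMod K T) A A' A'' \<alpha>' \<alpha>, Comp (DgMod K U) B B' B'' \<beta>' \<beta>)" for A f B A' f' B' A'' f'' B'' \<alpha>' \<beta>' \<alpha> \<beta>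
    by (simp add: comma_simps)
  have hs: "add (Hom ?C (A, f, B) (A', f', B')) = add (dg_sum (Hom (DgMod K T) A A') (Hom (DgMod K U) B B'))"
    "smult (Hom ?C (A, f, B) (A', f', B')) = smult (dg_sum (Hom (DgMod K T) A A') (Hom (DgMod K U) B B'))"
    "dif (Hom ?C (A, f, B) (A', f', B')) = dif (dg_sum (Hom (DgMod K T) A A') (Hom (DgMod K U) B B'))" for A f B A' f' B'
    by (simp_all add: comma_hom_simps del: dg_sum_simps mnat_simps)
  have mod: "dg_module K (Hom ?C X Y)" if "X \<in> Ob ?C" "Y \<in> Ob ?C" for X Y
    using that dg_module_comma_hom by (cases X; cases Y) auto
  show "cring K" by (rule T.is_cring)
  { fix X Y :: "('k, 'to, 'th, 'uo, 'uh, 'm, 'v) comma_ob" assume XY: "X \<in> Ob ?C" "Y \<in> Ob ?C"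
    obtain A f B A' f' B' where e: "X = (A, f, B)" "Y = (A', f', B')" by (metis prod_cases3)
    note XY = XY[unfolded e]
    show "dg_module K (Hom ?C X Y)" unfolding e by (rule mod[OF XY])
    show "Id ?C X \<in> carrier (Hom ?C X X)"
    proof -
      have "comma_square A f B A f B (mnat_id T A) (mnat_id U B)"
        unfolding comma_square_def
      proof (intro ballI)
        fix t x assume t: "t \<in> Ob T" and x: "x \<in> carrier (FOb A t)"
        note F = functor_M_at[OF t] comma_functors(2)[OF XY]
        note fc = comma_f_closed[OF XY t x]
        have "mnat_comp U (Mt t) (mnat_id U B) (f t x) = f t x"
          using mnat_carrierD(1)[OF F quiver_U fc] mnat_carrierD(4)[OF F quiver_U fc] mnat_closed[OF F quiver_U fc]
          by (intro extensionalityI[of _ "Ob U"] extensionalityI[of _ "carrier (MM _ t)"]) (auto simp: mnat_comp_def compose_def mnat_id_def)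
        then show "f t (mnat_id T A t x) = mnat_comp U (Mt t) (mnat_id U B) (f t x)" using t x by (simp add: mnat_id_def)
      qed
      then have "Id ?C X \<in> grade (Hom ?C X X) 0"
        unfolding e comma_simps comma_hom_simps comma_deg_iff[OF XY(1,1)]
        using mnat_id_deg[OF comma_functors(1)[OF XY] quiver_T] mnat_id_deg[OF comma_functors(2)[OF XY] quiver_U] by simp
      then show ?thesis
        using gr_module.grade_carrier[OF dg_module_gr_module[OF dg_module_comma_hom[OF XY(1,1)]]] unfolding e by blast
    qed
    fix g assume g: "g \<in> carrier (Hom ?C X Y)"
    obtain \<alpha> \<beta> where eg: "g = (\<alpha>, \<beta>)" by fastforce
    note gc = car[OF XY g[unfolded e eg]]
    show "Comp ?C X Y Y (Id ?C Y) g = g" "Comp ?C X X Y g (Id ?C X) = g"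
      using DT.id_left[OF ob(1)[OF XY(1)] ob(1)[OF XY(2)] gc(1)] DU.id_left[OF ob(2)[OF XY(1)] ob(2)[OF XY(2)] gc(2)]
        DT.id_right[OF ob(1)[OF XY(1)] ob(1)[OF XY(2)] gc(1)] DU.id_right[OF ob(2)[OF XY(1)] ob(2)[OF XY(2)] gc(2)]
      by (simp_all add: e eg comma_simps) }
  { fix X Y Z :: "('k, 'to, 'th, 'uo, 'uh, 'm, 'v) comma_ob" assume XYZ: "X \<in> Ob ?C" "Y \<in> Ob ?C" "Z \<in> Ob ?C"
    obtain A f B A' f' B' A'' f'' B'' where e: "X = (A, f, B)" "Y = (A', f', B')" "Z = (A'', f'', B'')" by (metis prod_cases3)
    note XYZ = XYZ[unfolded e]
    note o1 = ob(1)[OF XYZ(1)] ob(1)[OF XYZ(2)] ob(1)[OF XYZ(3)] and o2 = ob(2)[OF XYZ(1)] ob(2)[OF XYZ(2)] ob(2)[OF XYZ(3)]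
    note car1 = car[OF XYZ(2,3)] and car2 = car[OF XYZ(1,2)]
    interpret HYZ: gr_module K "Hom ?C Y Z" unfolding e by (rule dg_module_gr_module[OF mod[OF XYZ(2,3)]])
    interpret HXY: gr_module K "Hom ?C X Y" unfolding e by (rule dg_module_gr_module[OF mod[OF XYZ(1,2)]])
    interpret HXZ: gr_module K "Hom ?C X Z" unfolding e by (rule dg_module_gr_module[OF mod[OF XYZ(1,3)]])
    show deg: "Comp ?C X Y Z g h \<in> grade (Hom ?C X Z) (p + q)" if "g \<in> grade (Hom ?C Y Z) p" "h \<in> grade (Hom ?C X Y) q" for g h p q
      using that comma_comp_deg[OF XYZ] unfolding e by (cases g; cases h) (simp add: comma_hom_simps comma_simps)
    show addl: "Comp ?C X Y Z (g \<oplus>\<^bsub>Hom ?C Y Z\<^esub> g') h = Comp ?C X Y Z g h \<oplus>\<^bsub>Hom ?C X Z\<^esub> Comp ?C X Y Z g' h"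
      if "g \<in> carrier (Hom ?C Y Z)" "g' \<in> carrier (Hom ?C Y Z)" "h \<in> carrier (Hom ?C X Y)" for g g' h
      using that car1 car2 DT.comp_add_left[OF o1] DU.comp_add_left[OF o2] unfolding e
      by (cases g; cases g'; cases h) (simp only: hs cm dg_sum_simps split)
    show addr: "Comp ?C X Y Z g (h \<oplus>\<^bsub>Hom ?C X Y\<^esub> h') = Comp ?C X Y Z g h \<oplus>\<^bsub>Hom ?C X Z\<^esub> Comp ?C X Y Z g h'"
      if "g \<in> carrier (Hom ?C Y Z)" "h \<in> carrier (Hom ?C X Y)" "h' \<in> carrier (Hom ?C X Y)" for g h h'
      using that car1 car2 DT.comp_add_right[OF o1] DU.comp_add_right[OF o2] unfolding e
      by (cases g; cases h'; cases h) (simp only: hs cm dg_sum_simps split)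
    show "Comp ?C X Y Z (a \<odot>\<^bsub>Hom ?C Y Z\<^esub> g) h = a \<odot>\<^bsub>Hom ?C X Z\<^esub> Comp ?C X Y Z g h"
      if "a \<in> carrier K" "g \<in> carrier (Hom ?C Y Z)" "h \<in> carrier (Hom ?C X Y)" for a g h
      using that car1 car2 DT.comp_smult_left[OF o1] DU.comp_smult_left[OF o2] unfolding e
      by (cases g; cases h) (simp only: hs cm dg_sum_simps split)
    show "Comp ?C X Y Z g (a \<odot>\<^bsub>Hom ?C X Y\<^esub> h) = a \<odot>\<^bsub>Hom ?C X Z\<^esub> Comp ?C X Y Z g h"
      if "a \<in> carrier K" "g \<in> carrier (Hom ?C Y Z)" "h \<in> carrier (Hom ?C X Y)" for a g h
      using that car1 car2 DT.comp_smult_right[OF o1] DU.comp_smult_right[OF o2] unfolding e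
      by (cases g; cases h) (simp only: hs cm dg_sum_simps split)
    show comp_cl: "Comp ?C X Y Z g h \<in> carrier (Hom ?C X Z)" if g: "g \<in> carrier (Hom ?C Y Z)" and h: "h \<in> carrier (Hom ?C X Y)" for g h
      using g
    proof (induction rule: HYZ.homog_induct)
      case (homog p g)
      show ?case using h
      proof (induction rule: HXY.homog_induct)
        case (homog q h)
        show ?case by (rule HXZ.grade_carrier[OF deg[OF \<open>g \<in> grade _ p\<close> homog]])
      next
        case (add h h')
        then show ?case using addr[OF HYZ.grade_carrier[OF homog]] HXZ.a_closed by simp
      qed
    next
      case (add g g')
      then show ?case using addl[OF _ _ h] HXZ.a_closed by simp
    qed
    show "dif (Hom ?C X Z) (Comp ?C X Y Z g h) = Comp ?C X Y Z (dif (Hom ?C Y Z) g) h \<oplus>\<^bsub>Hom ?C X Z\<^esub>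
        sg (Hom ?C X Z) p (Comp ?C X Y Z g (dif (Hom ?C X Y) h))"
      if g: "g \<in> grade (Hom ?C Y Z) p" and h: "h \<in> carrier (Hom ?C X Y)" for g h p
    proof -
      obtain \<alpha>' \<beta>' \<alpha> \<beta> where eg: "g = (\<alpha>', \<beta>')" "h = (\<alpha>, \<beta>)" by fastforce
      have gd: "\<alpha>' \<in> grade (Hom (DgMod K T) A' A'') p" "\<beta>' \<in> grade (Hom (DgMod K U) B' B'') p"
        using g by (simp_all add: e eg comma_hom_simps comma_deg_iff[OF XYZ(2,3)])
      have gc: "\<alpha>' \<in> carrier (Hom (DgMod K T) A' A'')" "\<beta>' \<in> carrier (Hom (DgMod K U) B' B'')"
        using car1[OF HYZ.grade_carrier[OF g, unfolded e eg]] .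
      note hc = car2[OF h[unfolded e eg]]
      have dhc: "dif (Hom (DgMod K T) A A') \<alpha> \<in> carrier (Hom (DgMod K T) A A')" "dif (Hom (DgMod K U) B B') \<beta> \<in> carrier (Hom (DgMod K U) B B')"
        using dif_carrier[OF DT.hom_dg_module[OF o1(1,2)] hc(1)] dif_carrier[OF DU.hom_dg_module[OF o2(1,2)] hc(2)] by simp_all
      let ?z = "Comp ?C X Y Z g (dif (Hom ?C X Y) h)"
      have z: "?z = (Comp (DgMod K T) A A' A'' \<alpha>' (dif (Hom (DgMod K T) A A') \<alpha>), Comp (DgMod K U) B B' B'' \<beta>' (dif (Hom (DgMod K U) B B') \<beta>))"
        unfolding e eg by (simp only: hs cm dg_sum_simps split)
      have zc: "?z \<in> carrier (Hom ?C X Z)"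
        using comp_cl HYZ.grade_carrier[OF g] dif_carrier[OF mod h] XYZ unfolding e by blast
      \<comment> \<open>Inverses are defined relative to a carrier, and that of the comma Hom is in
        general smaller than that of the direct sum; both inverses are multiplication by -1 under
        the same scalar action.\<close>
      have "\<ominus>\<^bsub>Hom ?C X Z\<^esub> ?z = (\<ominus>\<^bsub>K\<^esub> \<one>\<^bsub>K\<^esub>) \<odot>\<^bsub>Hom ?C X Z\<^esub> ?z"
        using zc by (simp only: HXZ.smult_l_minus HXZ.smult_one T.one_closed)
      also have "\<dots> = (\<ominus>\<^bsub>K\<^esub> \<one>\<^bsub>K\<^esub>) \<odot>\<^bsub>dg_sum (Hom (DgMod K T) A A'') (Hom (DgMod K U) B B'')\<^esub> ?z"
        unfolding e by (simp only: hs)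
      also have "\<dots> = \<ominus>\<^bsub>dg_sum (Hom (DgMod K T) A A'') (Hom (DgMod K U) B B'')\<^esub> ?z"
      proof -
        interpret S: module K "dg_sum (Hom (DgMod K T) A A'') (Hom (DgMod K U) B B'')"
          by (rule module_dg_sum[OF DT.mod_hom[OF o1(1,3)] DU.mod_hom[OF o2(1,3)]])
        have "?z \<in> carrier (dg_sum (Hom (DgMod K T) A A'') (Hom (DgMod K U) B B''))"
          unfolding z using DT.comp_closed[OF o1 gc(1) dhc(1)] DU.comp_closed[OF o2 gc(2) dhc(2)] by (simp del: DgMod_simps)
        then show ?thesis by (simp only: S.smult_l_minus S.smult_one T.one_closed)
      qed
      finally have sgz: "sg (Hom ?C X Z) p ?z = sg (dg_sum (Hom (DgMod K T) A A'') (Hom (DgMod K U) B B'')) p ?z"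
        by (simp add: sg_def)
      show ?thesis
        unfolding sgz unfolding z
        unfolding sg_dg_sum[OF DT.mod_hom[OF o1(1,3)] DU.mod_hom[OF o2(1,3)] DT.comp_closed[OF o1 gc(1) dhc(1)] DU.comp_closed[OF o2 gc(2) dhc(2)]]
        unfolding e eg by (simp only: hs cm dg_sum_simps split DT.comp_dif[OF o1 gd(1) hc(1)] DU.comp_dif[OF o2 gd(2) hc(2)])
    qed }
  fix W X Y Z :: "('k, 'to, 'th, 'uo, 'uh, 'm, 'v) comma_ob" and h g k
  assume WXYZ: "W \<in> Ob ?C" "X \<in> Ob ?C" "Y \<in> Ob ?C" "Z \<in> Ob ?C"
    and hgk: "h \<in> carrier (Hom ?C Y Z)" "g \<in> carrier (Hom ?C X Y)" "k \<in> carrier (Hom ?C W X)"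
  obtain A0 f0 B0 A f B A' f' B' A'' f'' B'' where e: "W = (A0, f0, B0)" "X = (A, f, B)" "Y = (A', f', B')" "Z = (A'', f'', B'')"
    by (metis prod_cases3)
  obtain h1 h2 g1 g2 k1 k2 where e2: "h = (h1, h2)" "g = (g1, g2)" "k = (k1, k2)" by fastforce
  note WXYZ = WXYZ[unfolded e] and hgk = hgk[unfolded e e2]
  show "Comp ?C W X Z (Comp ?C X Y Z h g) k = Comp ?C W Y Z h (Comp ?C W X Y g k)"
    unfolding e e2 cm
    using DT.comp_assoc[OF ob(1)[OF WXYZ(1)] ob(1)[OF WXYZ(2)] ob(1)[OF WXYZ(3)] ob(1)[OF WXYZ(4)] car(1)[OF WXYZ(3,4) hgk(1)]
        car(1)[OF WXYZ(2,3) hgk(2)] car(1)[OF WXYZ(1,2) hgk(3)]]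
      DU.comp_assoc[OF ob(2)[OF WXYZ(1)] ob(2)[OF WXYZ(2)] ob(2)[OF WXYZ(3)] ob(2)[OF WXYZ(4)] car(2)[OF WXYZ(3,4) hgk(1)]
        car(2)[OF WXYZ(2,3) hgk(2)] car(2)[OF WXYZ(1,2) hgk(3)]]
    by (simp only: prod.inject)
qed

end

section \<open>A criterion for dg-equivalence\<close>

context
  fixes K :: "'k ring" and C :: "('k, 'o, 'h) dgcat" and D :: "('k, 'o2, 'h2) dgcat" and F :: "('o, 'h, 'o2, 'h2) dgfun"
  assumes C: "dg_category K C" and D: "dg_category K D" and F: "dg_functor K C D F"
    and faithful: "\<And>X Y f g. X \<in> Ob C \<Longrightarrow> Y \<in> Ob C \<Longrightarrow> f \<in> carrier (Hom C X Y) \<Longrightarrow> g \<in> carrier (Hom C X Y) \<Longrightarrow>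
      FMor F X Y f = FMor F X Y g \<Longrightarrow> f = g"
    and full: "\<And>X Y n g. X \<in> Ob C \<Longrightarrow> Y \<in> Ob C \<Longrightarrow> g \<in> grade (Hom D (FOb F X) (FOb F Y)) n \<Longrightarrow>
      \<exists>f\<in>grade (Hom C X Y) n. FMor F X Y f = g"
    and ess: "\<And>N. N \<in> Ob D \<Longrightarrow> \<exists>X\<in>Ob C. \<exists>\<phi>\<in>grade (Hom D (FOb F X) N) 0. \<exists>\<phi>'\<in>grade (Hom D N (FOb F X)) 0.
      dif (Hom D (FOb F X) N) \<phi> = \<zero>\<^bsub>Hom D (FOb F X) N\<^esub> \<and>
      Comp D (FOb F X) N (FOb F X) \<phi>' \<phi> = Id D (FOb F X) \<and> Comp D N (FOb F X) N \<phi> \<phi>' = Id D N"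
begin

interpretation C: dg_category K C by (rule C)
interpretation D: dg_category K D by (rule D)
interpretation F: dg_functor K C D F by (rule F)

private lemma gr: "f \<in> grade (Hom C X Y) n \<Longrightarrow> X \<in> Ob C \<Longrightarrow> Y \<in> Ob C \<Longrightarrow> f \<in> carrier (Hom C X Y)"
  and grD: "g \<in> grade (Hom D N P) n \<Longrightarrow> N \<in> Ob D \<Longrightarrow> P \<in> Ob D \<Longrightarrow> g \<in> carrier (Hom D N P)"
  using gr_module.grade_carrier[OF C.gr_hom_module] gr_module.grade_carrier[OF D.gr_hom_module] by blast+

text \<open>A chosen inverse of F on morphisms; faithfulness leaves only one candidate.\<close>

private definition I where
  "I X Y g = (SOME f. f \<in> carrier (Hom C X Y) \<and> FMor F X Y f = g)"

text \<open>Fullness is assumed for homogeneous morphisms; an arbitrary one is a finite sum of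
  these.\<close>

private lemma surj:
  assumes X: "X \<in> Ob C" and Y: "Y \<in> Ob C" and g: "g \<in> carrier (Hom D (FOb F X) (FOb F Y))"
  shows "\<exists>f. f \<in> carrier (Hom C X Y) \<and> FMor F X Y f = g"
proof -
  interpret HC: gr_module K "Hom C X Y" by (rule C.gr_hom_module[OF X Y])
  interpret HD: gr_module K "Hom D (FOb F X) (FOb F Y)" by (rule D.gr_hom_module[OF F.F_ob[OF X] F.F_ob[OF Y]])
  show ?thesis using g
  proof (induction rule: HD.homog_induct)
    case (homog n g)
    then show ?case using full[OF X Y homog] HC.grade_carrier by blast
  next
    case (add g h)
    then show ?case using F.F_add[OF X Y] HC.a_closed by metis
  qed
qed

private lemma I_spec:
  assumes "X \<in> Ob C" "Y \<in> Ob C" "g \<in> carrier (Hom D (FOb F X) (FOb F Y))"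
  shows "I X Y g \<in> carrier (Hom C X Y)" "FMor F X Y (I X Y g) = g"
  using someI_ex[OF surj[OF assms]] unfolding I_def by auto

private lemma I_eqI:
  assumes "X \<in> Ob C" "Y \<in> Ob C" "f \<in> carrier (Hom C X Y)" "FMor F X Y f = g"
  shows "I X Y g = f"
proof -
  have "g \<in> carrier (Hom D (FOb F X) (FOb F Y))" using F.F_closed[OF assms(1-3)] assms(4) by simp
  from I_spec[OF assms(1,2) this] show ?thesis using faithful[OF assms(1,2)] assms(3,4) by blast
qed

private lemma I_grade:
  assumes "X \<in> Ob C" "Y \<in> Ob C" "g \<in> grade (Hom D (FOb F X) (FOb F Y)) n"
  shows "I X Y g \<in> grade (Hom C X Y) n"
  using full[OF assms] I_eqI[OF assms(1,2) gr[OF _ assms(1,2)]] by metis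

private lemma I_dif:
  assumes X: "X \<in> Ob C" and Y: "Y \<in> Ob C" and g: "g \<in> carrier (Hom D (FOb F X) (FOb F Y))"
  shows "I X Y (dif (Hom D (FOb F X) (FOb F Y)) g) = dif (Hom C X Y) (I X Y g)"
  by (intro I_eqI[OF X Y] dif_carrier[OF C.hom_dg_module[OF X Y]] I_spec[OF X Y g])
    (simp add: F.F_dif[OF X Y] I_spec[OF X Y g])

private lemma F_zero: "X \<in> Ob C \<Longrightarrow> Y \<in> Ob C \<Longrightarrow> FMor F X Y \<zero>\<^bsub>Hom C X Y\<^esub> = \<zero>\<^bsub>Hom D (FOb F X) (FOb F Y)\<^esub>"
  by (rule klin_zero[OF C.mod_hom D.mod_hom])
    (auto intro!: klinI F.F_closed F.F_add F.F_smult F.F_ob)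

text \<open>Choose for each N an object and an isomorphism \<phi> from its image to N. Conjugating
  by \<phi> carries a morphism of D to one between objects in the image of F, and the unique
  preimages define the quasi-inverse.\<close>

theorem dg_equivalenceI: "dg_equivalence K C D F"
proof -
  define P where "P N X \<phi> \<phi>' \<longleftrightarrow> X \<in> Ob C \<and> \<phi> \<in> grade (Hom D (FOb F X) N) 0 \<and> \<phi>' \<in> grade (Hom D N (FOb F X)) 0 \<and>
      dif (Hom D (FOb F X) N) \<phi> = \<zero>\<^bsub>Hom D (FOb F X) N\<^esub> \<and>
      Comp D (FOb F X) N (FOb F X) \<phi>' \<phi> = Id D (FOb F X) \<and> Comp D N (FOb F X) N \<phi> \<phi>' = Id D N" for N X \<phi> \<phi>'
  \<comment> \<open>Object and both isomorphisms are packed into one triple so that a single choice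
    function yields them together.\<close>
  have "\<forall>N\<in>Ob D. \<exists>z. P N (fst z) (fst (snd z)) (snd (snd z))"
    using ess unfolding P_def by fastforce
  then obtain z where z: "\<forall>N\<in>Ob D. P N (fst (z N)) (fst (snd (z N))) (snd (snd (z N)))" by metis
  define G0 where "G0 N = fst (z N)" for N
  define \<phi> where "\<phi> N = fst (snd (z N))" for N
  define \<phi>' where "\<phi>' N = snd (snd (z N))" for N
  have P: "P N (G0 N) (\<phi> N) (\<phi>' N)" if "N \<in> Ob D" for N
    using z that by (simp add: G0_def \<phi>_def \<phi>'_def)
  have G0: "G0 N \<in> Ob C" and FG0: "FOb F (G0 N) \<in> Ob D" and \<phi>g: "\<phi> N \<in> grade (Hom D (FOb F (G0 N)) N) 0"
    and \<phi>'g: "\<phi>' N \<in> grade (Hom D N (FOb F (G0 N))) 0"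
    and d\<phi>: "dif (Hom D (FOb F (G0 N)) N) (\<phi> N) = \<zero>\<^bsub>Hom D (FOb F (G0 N)) N\<^esub>"
    and \<phi>'\<phi>: "Comp D (FOb F (G0 N)) N (FOb F (G0 N)) (\<phi>' N) (\<phi> N) = Id D (FOb F (G0 N))"
    and \<phi>\<phi>': "Comp D N (FOb F (G0 N)) N (\<phi> N) (\<phi>' N) = Id D N" if "N \<in> Ob D" for N
    using P[OF that] F.F_ob by (auto simp: P_def)
  have \<phi>c: "\<phi> N \<in> carrier (Hom D (FOb F (G0 N)) N)" and \<phi>'c: "\<phi>' N \<in> carrier (Hom D N (FOb F (G0 N)))" if "N \<in> Ob D" for N
    using grD[OF \<phi>g[OF that] FG0[OF that] that] grD[OF \<phi>'g[OF that] that FG0[OF that]] by auto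
  \<comment> \<open>Differentiate \<phi>' \<phi> = id: as d(\<phi>) = 0, this gives d(\<phi>')
    \<phi> = 0, and composing with \<phi>' on the right gives d(\<phi>') = 0.\<close>
  have d\<phi>': "dif (Hom D N (FOb F (G0 N))) (\<phi>' N) = \<zero>\<^bsub>Hom D N (FOb F (G0 N))\<^esub>" if N: "N \<in> Ob D" for N
  proof -
    let ?X = "FOb F (G0 N)"
    note X = FG0[OF N]
    interpret XX: dg_module K "Hom D ?X ?X" by (rule D.hom_dg_module[OF X X])
    note dc = dif_carrier[OF D.hom_dg_module[OF N X] \<phi>'c[OF N]]
    have "Comp D ?X N ?X (\<phi>' N) \<zero>\<^bsub>Hom D ?X N\<^esub> = \<zero>\<^bsub>Hom D ?X ?X\<^esub>"
      by (rule klin_zero[OF D.mod_hom[OF X N] D.mod_hom[OF X X] D.klin_comp_left[OF X N X \<phi>'c[OF N]]])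
    then have "Comp D ?X N ?X (dif (Hom D N ?X) (\<phi>' N)) (\<phi> N) = \<zero>\<^bsub>Hom D ?X ?X\<^esub>"
      using D.comp_dif[OF X N X \<phi>'g[OF N] \<phi>c[OF N]] D.comp_closed[OF X N X dc \<phi>c[OF N]]
      by (simp add: \<phi>'\<phi>[OF N] D.dif_id[OF X] d\<phi>[OF N])
    then have "Comp D N ?X ?X (Comp D ?X N ?X (dif (Hom D N ?X) (\<phi>' N)) (\<phi> N)) (\<phi>' N) = \<zero>\<^bsub>Hom D N ?X\<^esub>"
      using klin_zero[OF D.mod_hom[OF X X] D.mod_hom[OF N X] D.klin_comp_right[OF N X X \<phi>'c[OF N]]] by simp
    then show ?thesis
      using D.comp_assoc[OF N X N X dc \<phi>c[OF N] \<phi>'c[OF N]] by (simp add: \<phi>\<phi>'[OF N] D.id_right[OF N X dc])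
  qed
  \<comment> \<open>Conjugation with \<phi>; it preserves degrees, as \<phi> and \<phi>' have degree
    zero, and commutes with d, as both are closed.\<close>
  define S where "S N N' g = Comp D (FOb F (G0 N)) N' (FOb F (G0 N')) (\<phi>' N') (Comp D (FOb F (G0 N)) N N' g (\<phi> N))" for N N' g
  have kS: "klin K (Hom D N N') (Hom D (FOb F (G0 N)) (FOb F (G0 N'))) (S N N')" if N: "N \<in> Ob D" "N' \<in> Ob D" for N N'
    unfolding S_def
    by (rule klin_comp[OF D.klin_comp_right[OF FG0[OF N(1)] N \<phi>c[OF N(1)]]
          D.klin_comp_left[OF FG0[OF N(1)] N(2) FG0[OF N(2)] \<phi>'c[OF N(2)]]])
  note Sc = klin_closed[OF kS]
  have Sg: "S N N' g \<in> grade (Hom D (FOb F (G0 N)) (FOb F (G0 N'))) n" if N: "N \<in> Ob D" "N' \<in> Ob D" and "g \<in> grade (Hom D N N') n" for N N' g n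
    using D.comp_grade[OF FG0[OF N(1)] N(2) FG0[OF N(2)] \<phi>'g[OF N(2)] D.comp_grade[OF FG0[OF N(1)] N that(3) \<phi>g[OF N(1)]]]
    by (simp add: S_def)
  have \<phi>S: "Comp D (FOb F (G0 N)) (FOb F (G0 N')) N' (\<phi> N') (S N N' g) = Comp D (FOb F (G0 N)) N N' g (\<phi> N)"
    if N: "N \<in> Ob D" "N' \<in> Ob D" and g: "g \<in> carrier (Hom D N N')" for N N' g
  proof -
    note gc = D.comp_closed[OF FG0[OF N(1)] N g \<phi>c[OF N(1)]]
    show ?thesis unfolding S_def
      using D.comp_assoc[OF FG0[OF N(1)] N(2) FG0[OF N(2)] N(2) \<phi>c[OF N(2)] \<phi>'c[OF N(2)] gc]
      by (simp add: \<phi>\<phi>'[OF N(2)] D.id_left[OF FG0[OF N(1)] N(2) gc])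
  qed
  have Sid: "S N N (Id D N) = Id D (FOb F (G0 N))" if "N \<in> Ob D" for N
    using that by (simp add: S_def D.id_left FG0 \<phi>c \<phi>'\<phi>)
  have Scomp: "S N N'' (Comp D N N' N'' h g) = Comp D (FOb F (G0 N)) (FOb F (G0 N')) (FOb F (G0 N'')) (S N' N'' h) (S N N' g)"
    if N: "N \<in> Ob D" "N' \<in> Ob D" "N'' \<in> Ob D" and h: "h \<in> carrier (Hom D N' N'')" and g: "g \<in> carrier (Hom D N N')" for N N' N'' h g
  proof -
    note o = FG0[OF N(1)] FG0[OF N(2)] FG0[OF N(3)]
    note gc = D.comp_closed[OF o(1) N(1,2) g \<phi>c[OF N(1)]]
    have "Comp D (FOb F (G0 N)) (FOb F (G0 N')) (FOb F (G0 N'')) (S N' N'' h) (S N N' g) =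
        Comp D (FOb F (G0 N)) N'' (FOb F (G0 N'')) (\<phi>' N'') (Comp D (FOb F (G0 N)) (FOb F (G0 N')) N''
          (Comp D (FOb F (G0 N')) N' N'' h (\<phi> N')) (S N N' g))"
      unfolding S_def[of N' N'']
      by (rule D.comp_assoc[OF o(1,2) N(3) o(3) \<phi>'c[OF N(3)] D.comp_closed[OF o(2) N(2,3) h \<phi>c[OF N(2)]] Sc[OF N(1,2) g]])
    also have "Comp D (FOb F (G0 N)) (FOb F (G0 N')) N'' (Comp D (FOb F (G0 N')) N' N'' h (\<phi> N')) (S N N' g) =
        Comp D (FOb F (G0 N)) N' N'' h (Comp D (FOb F (G0 N)) N N' g (\<phi> N))"
      using D.comp_assoc[OF o(1,2) N(2,3) h \<phi>c[OF N(2)] Sc[OF N(1,2) g]] by (simp add: \<phi>S[OF N(1,2) g])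
    also have "\<dots> = Comp D (FOb F (G0 N)) N N'' (Comp D N N' N'' h g) (\<phi> N)"
      by (rule D.comp_assoc[OF o(1) N h g \<phi>c[OF N(1)], symmetric])
    finally show ?thesis by (simp add: S_def[of N N''])
  qed
  have Sdif: "S N N' (dif (Hom D N N') g) = dif (Hom D (FOb F (G0 N)) (FOb F (G0 N'))) (S N N' g)"
    if N: "N \<in> Ob D" "N' \<in> Ob D" and g: "g \<in> carrier (Hom D N N')" for N N' g
  proof -
    note o = FG0[OF N(1)] FG0[OF N(2)]
    interpret X: dg_module K "Hom D (FOb F (G0 N)) N'" by (rule D.hom_dg_module[OF o(1) N(2)])
    interpret Y: dg_module K "Hom D (FOb F (G0 N)) (FOb F (G0 N'))" by (rule D.hom_dg_module[OF o])
    \<comment> \<open>Since \<phi> is closed, composing with it on the right commutes with d; the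
      Leibniz rule wants a degree for g, hence the reduction to homogeneous g.\<close>
    have 1: "dif (Hom D (FOb F (G0 N)) N') (Comp D (FOb F (G0 N)) N N' g (\<phi> N)) = Comp D (FOb F (G0 N)) N N' (dif (Hom D N N') g) (\<phi> N)"
    proof (rule gr_module.klin_eqI[OF D.gr_hom_module[OF N] D.mod_hom[OF o(1) N(2)] _ _ _ g])
      note k = D.klin_comp_right[OF o(1) N \<phi>c[OF N(1)]]
      show "klin K (Hom D N N') (Hom D (FOb F (G0 N)) N') (\<lambda>g. dif (Hom D (FOb F (G0 N)) N') (Comp D (FOb F (G0 N)) N N' g (\<phi> N)))"
        by (rule klin_comp[OF k dg_module_klin_dif[OF X.dg_module_axioms]])
      show "klin K (Hom D N N') (Hom D (FOb F (G0 N)) N') (\<lambda>g. Comp D (FOb F (G0 N)) N N' (dif (Hom D N N') g) (\<phi> N))"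
        by (rule klin_comp[OF dg_module_klin_dif[OF D.hom_dg_module[OF N]] k])
      fix n g assume g: "g \<in> grade (Hom D N N') n"
      note gc = grD[OF g N]
      note z = klin_zero[OF D.mod_hom[OF o(1) N(1)] D.mod_hom[OF o(1) N(2)] D.klin_comp_left[OF o(1) N gc]]
      show "dif (Hom D (FOb F (G0 N)) N') (Comp D (FOb F (G0 N)) N N' g (\<phi> N)) = Comp D (FOb F (G0 N)) N N' (dif (Hom D N N') g) (\<phi> N)"
        using D.comp_dif[OF o(1) N g \<phi>c[OF N(1)]] D.comp_closed[OF o(1) N dif_carrier[OF D.hom_dg_module[OF N] gc] \<phi>c[OF N(1)]]
        by (simp add: d\<phi>[OF N(1)] z sg_zero[OF module_abelian_group[OF X.module_axioms]])
    qed
    note gc = D.comp_closed[OF o(1) N g \<phi>c[OF N(1)]]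
    note dgc = X.dif_closed[OF gc]
    have "Comp D (FOb F (G0 N)) N' (FOb F (G0 N')) (dif (Hom D N' (FOb F (G0 N'))) (\<phi>' N')) (Comp D (FOb F (G0 N)) N N' g (\<phi> N)) =
        \<zero>\<^bsub>Hom D (FOb F (G0 N)) (FOb F (G0 N'))\<^esub>"
      unfolding d\<phi>'[OF N(2)] by (rule klin_zero[OF D.mod_hom[OF N(2) o(2)] Y.module_axioms D.klin_comp_right[OF o(1) N(2) o(2) gc]])
    then show ?thesis
      using D.comp_dif[OF o(1) N(2) o(2) \<phi>'g[OF N(2)] gc] D.comp_closed[OF o(1) N(2) o(2) \<phi>'c[OF N(2)] dgc]
      by (simp add: S_def flip: 1)
  qed
  define G where "G = \<lparr>FOb = G0, FMor = (\<lambda>N N' g. I (G0 N) (G0 N') (S N N' g))\<rparr>"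
  have Gs: "FOb G = G0" "FMor G N N' g = I (G0 N) (G0 N') (S N N' g)" for N N' g by (simp_all add: G_def)
  have Ic: "I (G0 N) (G0 N') (S N N' g) \<in> carrier (Hom C (G0 N) (G0 N'))"
    and FI: "FMor F (G0 N) (G0 N') (I (G0 N) (G0 N') (S N N' g)) = S N N' g"
    if "N \<in> Ob D" "N' \<in> Ob D" "g \<in> carrier (Hom D N N')" for N N' g
    using I_spec[OF G0[OF that(1)] G0[OF that(2)] Sc[OF that]] by auto
  have G: "dg_functor K D C G"
  proof (intro dg_functor.intro, unfold Gs)
    fix N N' assume N: "N \<in> Ob D" "N' \<in> Ob D"
    note o = G0[OF N(1)] G0[OF N(2)]
    show "G0 N \<in> Ob C" by (rule o(1))
    show "I (G0 N) (G0 N) (S N N (Id D N)) = Id C (G0 N)"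
      unfolding Sid[OF N(1)] by (rule I_eqI[OF o(1,1) C.id_closed[OF o(1)] F.F_id[OF o(1)]])
    show "I (G0 N) (G0 N') (S N N' g) \<in> grade (Hom C (G0 N) (G0 N')) n" if "g \<in> grade (Hom D N N') n" for g n
      by (rule I_grade[OF o Sg[OF N that]])
    fix g assume g: "g \<in> carrier (Hom D N N')"
    show "I (G0 N) (G0 N') (S N N' g) \<in> carrier (Hom C (G0 N) (G0 N'))" by (rule Ic[OF N g])
    show "I (G0 N) (G0 N') (S N N' (dif (Hom D N N') g)) = dif (Hom C (G0 N) (G0 N')) (I (G0 N) (G0 N') (S N N' g))"
      unfolding Sdif[OF N g] by (rule I_dif[OF o Sc[OF N g]])
    show "I (G0 N) (G0 N') (S N N' (g \<oplus>\<^bsub>Hom D N N'\<^esub> h)) = I (G0 N) (G0 N') (S N N' g) \<oplus>\<^bsub>Hom C (G0 N) (G0 N')\<^esub> I (G0 N) (G0 N') (S N N' h)"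
      if h: "h \<in> carrier (Hom D N N')" for h
      unfolding klin_add[OF kS[OF N] g h]
      by (intro I_eqI[OF o] abelian_groupE(1)[OF module_abelian_group[OF C.mod_hom[OF o]]] Ic[OF N g] Ic[OF N h])
        (simp add: F.F_add[OF o Ic[OF N g] Ic[OF N h]] FI[OF N g] FI[OF N h])
    show "I (G0 N) (G0 N') (S N N' (a \<odot>\<^bsub>Hom D N N'\<^esub> g)) = a \<odot>\<^bsub>Hom C (G0 N) (G0 N')\<^esub> I (G0 N) (G0 N') (S N N' g)"
      if a: "a \<in> carrier K" for a
      unfolding klin_smult[OF kS[OF N] a g]
      by (intro I_eqI[OF o] module.smult_closed[OF C.mod_hom[OF o]] a Ic[OF N g]) (simp add: F.F_smult[OF o a Ic[OF N g]] FI[OF N g])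
    fix N'' h assume N'': "N'' \<in> Ob D" and h: "h \<in> carrier (Hom D N' N'')"
    note o'' = G0[OF N'']
    show "I (G0 N) (G0 N'') (S N N'' (Comp D N N' N'' h g)) =
        Comp C (G0 N) (G0 N') (G0 N'') (I (G0 N') (G0 N'') (S N' N'' h)) (I (G0 N) (G0 N') (S N N' g))"
      unfolding Scomp[OF N N'' h g]
      by (intro I_eqI[OF o(1) o''] C.comp_closed[OF o o''] Ic N N'' h g)
        (simp add: F.F_comp[OF o o'' Ic[OF N(2) N'' h] Ic[OF N g]] FI[OF N g] FI[OF N(2) N'' h])
  qed
  \<comment> \<open>The chosen \<phi> is the transformation from F G to the identity; its naturality
    is \<open>\<phi>S\<close>.\<close>
  have "closed_nat_iso D D (dg_fun_comp F G) dg_id_fun"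
    unfolding closed_nat_iso_def dg_nat_def dg_iso_def
    by (rule exI[of _ \<phi>])
      (auto simp: dg_fun_comp_def dg_id_fun_def Gs \<phi>g d\<phi> \<phi>c FI grD \<phi>S intro!: bexI[of _ "\<phi>' _"] \<phi>'\<phi> \<phi>\<phi>' \<phi>'c)
  moreover have "closed_nat_iso C C (dg_fun_comp G F) dg_id_fun"
  proof -
    \<comment> \<open>The transformation from G F to the identity consists of the preimages of
      \<phi> at F X; its properties are those of \<phi>, reflected along the faithful functor
      F.\<close>
    define \<eta> where "\<eta> X = I (G0 (FOb F X)) X (\<phi> (FOb F X))" for X
    define \<eta>' where "\<eta>' X = I X (G0 (FOb F X)) (\<phi>' (FOb F X))" for X
    note FO = F.F_ob
    have \<eta>c: "\<eta> X \<in> carrier (Hom C (G0 (FOb F X)) X)" "FMor F (G0 (FOb F X)) X (\<eta> X) = \<phi> (FOb F X)"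
      and \<eta>'c: "\<eta>' X \<in> carrier (Hom C X (G0 (FOb F X)))" "FMor F X (G0 (FOb F X)) (\<eta>' X) = \<phi>' (FOb F X)" if X: "X \<in> Ob C" for X
      using I_spec[OF G0[OF FO[OF X]] X \<phi>c[OF FO[OF X]]] I_spec[OF X G0[OF FO[OF X]] \<phi>'c[OF FO[OF X]]] by (simp_all add: \<eta>_def \<eta>'_def)
    have g: "\<eta> X \<in> grade (Hom C (G0 (FOb F X)) X) 0" if X: "X \<in> Ob C" for X
      unfolding \<eta>_def by (rule I_grade[OF G0[OF FO[OF X]] X \<phi>g[OF FO[OF X]]])
    have d: "dif (Hom C (G0 (FOb F X)) X) (\<eta> X) = \<zero>\<^bsub>Hom C (G0 (FOb F X)) X\<^esub>" if X: "X \<in> Ob C" for X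
    proof -
      note o = G0[OF FO[OF X]]
      have "\<zero>\<^bsub>Hom C (G0 (FOb F X)) X\<^esub> \<in> carrier (Hom C (G0 (FOb F X)) X)"
        by (rule abelian_groupE(2)[OF module_abelian_group[OF C.mod_hom[OF o X]]])
      from I_eqI[OF o X this F_zero[OF o X]] show ?thesis
        using I_dif[OF o X \<phi>c[OF FO[OF X]]] by (simp add: \<eta>_def d\<phi>[OF FO[OF X]])
    qed
    have 1: "Comp C (G0 (FOb F X)) X (G0 (FOb F X)) (\<eta>' X) (\<eta> X) = Id C (G0 (FOb F X))" if X: "X \<in> Ob C" for X
    proof (rule faithful[OF G0[OF FO[OF X]] G0[OF FO[OF X]]])
      note o = G0[OF FO[OF X]]
      show "FMor F (G0 (FOb F X)) (G0 (FOb F X)) (Comp C (G0 (FOb F X)) X (G0 (FOb F X)) (\<eta>' X) (\<eta> X)) =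
          FMor F (G0 (FOb F X)) (G0 (FOb F X)) (Id C (G0 (FOb F X)))"
        by (simp add: F.F_comp[OF o X o \<eta>'c(1)[OF X] \<eta>c(1)[OF X]] \<eta>c(2)[OF X] \<eta>'c(2)[OF X] F.F_id[OF o] \<phi>'\<phi>[OF FO[OF X]])
    qed (intro C.comp_closed G0 FO X \<eta>c \<eta>'c C.id_closed)+
    have 2: "Comp C X (G0 (FOb F X)) X (\<eta> X) (\<eta>' X) = Id C X" if X: "X \<in> Ob C" for X
    proof (rule faithful[OF X X])
      note o = G0[OF FO[OF X]]
      show "FMor F X X (Comp C X (G0 (FOb F X)) X (\<eta> X) (\<eta>' X)) = FMor F X X (Id C X)"
        by (simp add: F.F_comp[OF X o X \<eta>c(1)[OF X] \<eta>'c(1)[OF X]] \<eta>c(2)[OF X] \<eta>'c(2)[OF X] F.F_id[OF X] \<phi>\<phi>'[OF FO[OF X]])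
    qed (intro C.comp_closed G0 FO X \<eta>c \<eta>'c C.id_closed)+
    have nat: "Comp C (G0 (FOb F X)) X Y f (\<eta> X) = Comp C (G0 (FOb F X)) (G0 (FOb F Y)) Y (\<eta> Y)
        (I (G0 (FOb F X)) (G0 (FOb F Y)) (S (FOb F X) (FOb F Y) (FMor F X Y f)))"
      if X: "X \<in> Ob C" and Y: "Y \<in> Ob C" and f: "f \<in> carrier (Hom C X Y)" for X Y f
    proof (rule faithful[OF G0[OF FO[OF X]] Y])
      note o = G0[OF FO[OF X]] G0[OF FO[OF Y]]
      note Ff = F.F_closed[OF X Y f]
      note i = Ic[OF FO[OF X] FO[OF Y] Ff]
      show "FMor F (G0 (FOb F X)) Y (Comp C (G0 (FOb F X)) X Y f (\<eta> X)) = FMor F (G0 (FOb F X)) Y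
          (Comp C (G0 (FOb F X)) (G0 (FOb F Y)) Y (\<eta> Y) (I (G0 (FOb F X)) (G0 (FOb F Y)) (S (FOb F X) (FOb F Y) (FMor F X Y f))))"
        by (simp add: F.F_comp[OF o(1) X Y f \<eta>c(1)[OF X]] F.F_comp[OF o Y \<eta>c(1)[OF Y] i] \<eta>c(2)[OF X] \<eta>c(2)[OF Y]
            FI[OF FO[OF X] FO[OF Y] Ff] \<phi>S[OF FO[OF X] FO[OF Y] Ff])
    qed (intro C.comp_closed G0 FO X Y \<eta>c f Ic F.F_closed)+
    show ?thesis
      unfolding closed_nat_iso_def dg_nat_def dg_iso_def
      by (rule exI[of _ \<eta>])
        (auto simp: dg_fun_comp_def dg_id_fun_def Gs g d \<eta>c gr nat intro!: bexI[of _ "\<eta>' _"] 1 2 \<eta>'c)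
  qed
  ultimately show ?thesis
    unfolding dg_equivalence_def using C D F G by blast
qed

end

section \<open>Modules over the triangular matrix category\<close>

context dg_bimodule
begin

abbreviation "LL \<equiv> Lam K T U M"

lemma Lam_simps:
  "Ob LL = Ob T \<times> Ob U"
  "Hom LL (t, u) (t', u') = dg_sum (Hom T t t') (dg_sum (MM u' t) (Hom U u u'))"
  "Id LL (t, u) = (Id T t, \<zero>\<^bsub>MM u t\<^esub>, Id U u)"
  "Comp LL (t, u) (t', u') (t'', u'') (a\<^sub>2, m\<^sub>2, b\<^sub>2) (a\<^sub>1, m\<^sub>1, b\<^sub>1) =
    (Comp T t t' t'' a\<^sub>2 a\<^sub>1, bullet u'' t t' m\<^sub>2 a\<^sub>1 \<oplus>\<^bsub>MM u'' t\<^esub> L u' u'' t b\<^sub>2 m\<^sub>1, Comp U u u' u'' b\<^sub>2 b\<^sub>1)"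
  by (simp_all add: Lam_def bullet_m_def)

lemma quiver_Lam: "dg_quiver K LL"
  using T.is_cring by (auto simp: dg_quiver_def Lam_simps dg_module_dg_sum T.hom_dg_module U.hom_dg_module M_module
      simp del: dg_sum_simps)

lemma Lam_id_closed: "X \<in> Ob LL \<Longrightarrow> Id LL X \<in> carrier (Hom LL X X)"
  by (cases X) (auto simp: Lam_simps T.id_closed U.id_closed gr_module.grade_carrier[OF M_gr gr_module.grade_zero[OF M_gr]])

lemma Lam_comp_closed:
  assumes "X \<in> Ob LL" "Y \<in> Ob LL" "Z \<in> Ob LL" "g \<in> carrier (Hom LL Y Z)" "f \<in> carrier (Hom LL X Y)"
  shows "Comp LL X Y Z g f \<in> carrier (Hom LL X Z)"
  using assms
  by (cases X; cases Y; cases Z; cases g; cases f)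
    (auto simp: Lam_simps T.comp_closed U.comp_closed intro!: abelian_groupE(1)[OF module_abelian_group[OF M_mod]] bullet_closed L_closed)

lemma amalg_simps:
  "FOb (amalg M (A, f, B)) (t, u) = dg_sum (FOb A t) (FOb B u)"
  "FMor (amalg M (A, f, B)) (t, u) (t', u') (a, m, b) = (\<lambda>(x, y)\<in>carrier (dg_sum (FOb A t) (FOb B u)).
     (FMor A t t' a x, dot M (A, f, B) u' t m x \<oplus>\<^bsub>FOb B u'\<^esub> FMor B u u' b y))"
  by (simp_all add: amalg_def)

text \<open>The diagonal entries act through A and B. For the lower left entry, compatibility of the
  pairing with T and U is what functoriality on matrix products requires, and its Leibniz rule is
  that of the action.\<close>

lemma amalg_functor:
  assumes X: "(A, f, B) \<in> Ob (comma K T U M)"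
  shows "dg_functor K LL (DgModK K) (amalg M (A, f, B))"
proof -
  interpret P: dg_pairing K T U M A B "dot M (A, f, B)" by (rule dg_pairing_dot[OF X])
  note A = P.A and B = P.B
  let ?d = "dot M (A, f, B)" and ?F = "amalg M (A, f, B)"
  note agB = module_abelian_group[OF P.B_mod]
  show ?thesis
  proof (rule dg_mod_functorI)
    show "dg_module K (Hom LL X Y)" if "X \<in> Ob LL" "Y \<in> Ob LL" for X Y by (rule dg_quiver_hom[OF quiver_Lam that])
    show "dg_module K (FOb ?F X)" if "X \<in> Ob LL" for X
      using that by (cases X) (simp add: Lam_simps amalg_simps dg_module_dg_sum dg_mod_ob[OF A] dg_mod_ob[OF B] del: dg_sum_simps)
  next
    fix X Y f assume "X \<in> Ob LL" "Y \<in> Ob LL" "f \<in> carrier (Hom LL X Y)"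
    then obtain t u t' u' a m b where e: "X = (t, u)" "Y = (t', u')" "f = (a, m, b)"
      and ob: "t \<in> Ob T" "u \<in> Ob U" "t' \<in> Ob T" "u' \<in> Ob U"
      and c: "a \<in> carrier (Hom T t t')" "m \<in> carrier (MM u' t)" "b \<in> carrier (Hom U u u')"
      by (cases X; cases Y; cases f) (auto simp: Lam_simps)
    interpret At: module K "FOb A t" by (rule P.A_mod[OF ob(1)])
    interpret Bu: module K "FOb B u" by (rule P.B_mod[OF ob(2)])
    interpret Bu': module K "FOb B u'" by (rule P.B_mod[OF ob(4)])
    note k = dg_mod_klin(1)[OF A ob(1,3) c(1)] kbilinD2[OF P.bilin[OF ob(4,1)] c(2)] dg_mod_klin(1)[OF B ob(2,4) c(3)]
    note cl = klin_closed[OF k(1)] klin_closed[OF k(2)] klin_closed[OF k(3)]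
    show "klin K (FOb ?F X) (FOb ?F Y) (FMor ?F X Y f)"
      unfolding e amalg_simps
      by (rule klinI) (auto simp: cl klin_add[OF k(1)] klin_add[OF k(2)] klin_add[OF k(3)] klin_smult[OF k(1)] klin_smult[OF k(2)]
          klin_smult[OF k(3)] Bu'.a_ac Bu'.smult_r_distr)
    show "FMor ?F X Y f \<in> extensional (carrier (FOb ?F X))" unfolding e amalg_simps by simp
  next
    fix X Y z assume "X \<in> Ob LL" "Y \<in> Ob LL" "z \<in> carrier (FOb ?F X)"
    then obtain t u t' u' x y where e: "X = (t, u)" "Y = (t', u')" "z = (x, y)"
      and ob: "t \<in> Ob T" "u \<in> Ob U" "t' \<in> Ob T" "u' \<in> Ob U"
      and c: "x \<in> carrier (FOb A t)" "y \<in> carrier (FOb B u)"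
      by (cases X; cases Y; cases z) (auto simp: Lam_simps amalg_simps)
    interpret Bu': module K "FOb B u'" by (rule P.B_mod[OF ob(4)])
    note k = dg_mod_klin'[OF A ob(1,3) c(1)] kbilinD1[OF P.bilin[OF ob(4,1)] c(1)] dg_mod_klin'[OF B ob(2,4) c(2)]
    note cl = klin_closed[OF k(1)] klin_closed[OF k(2)] klin_closed[OF k(3)]
    show "klin K (Hom LL X Y) (FOb ?F Y) (\<lambda>f. FMor ?F X Y f z)"
      unfolding e Lam_simps
      by (rule klinI) (auto simp: amalg_simps c cl klin_add[OF k(1)] klin_add[OF k(2)] klin_add[OF k(3)] klin_smult[OF k(1)] klin_smult[OF k(2)]
          klin_smult[OF k(3)] Bu'.a_ac Bu'.smult_r_distr)
  next
    fix X z assume "X \<in> Ob LL" "z \<in> carrier (FOb ?F X)"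
    then obtain t u x y where e: "X = (t, u)" "z = (x, y)" and ob: "t \<in> Ob T" "u \<in> Ob U"
      and c: "x \<in> carrier (FOb A t)" "y \<in> carrier (FOb B u)"
      by (cases X; cases z) (auto simp: Lam_simps amalg_simps)
    have "?d u t \<zero>\<^bsub>MM u t\<^esub> x = \<zero>\<^bsub>FOb B u\<^esub>"
      by (rule klin_zero[OF M_mod[OF ob(2,1)] P.B_mod[OF ob(2)] kbilinD1[OF P.bilin[OF ob(2,1)] c(1)]])
    then show "FMor ?F X X (Id LL X) z = z"
      using c abelian_groupE(5)[OF agB[OF ob(2)] c(2)] by (simp add: e Lam_simps amalg_simps dg_mod_id[OF A ob(1)] dg_mod_id[OF B ob(2)])
  next
    fix X Y Z f g z assume "X \<in> Ob LL" "Y \<in> Ob LL" "Z \<in> Ob LL" "g \<in> carrier (Hom LL Y Z)" "f \<in> carrier (Hom LL X Y)"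
      "z \<in> carrier (FOb ?F X)"
    then obtain t u t' u' t'' u'' a m b a' m' b' x y where e: "X = (t, u)" "Y = (t', u')" "Z = (t'', u'')" "f = (a, m, b)" "g = (a', m', b')" "z = (x, y)"
      and ob: "t \<in> Ob T" "u \<in> Ob U" "t' \<in> Ob T" "u' \<in> Ob U" "t'' \<in> Ob T" "u'' \<in> Ob U"
      and c: "a \<in> carrier (Hom T t t')" "m \<in> carrier (MM u' t)" "b \<in> carrier (Hom U u u')"
        "a' \<in> carrier (Hom T t' t'')" "m' \<in> carrier (MM u'' t')" "b' \<in> carrier (Hom U u' u'')"
        "x \<in> carrier (FOb A t)" "y \<in> carrier (FOb B u)"
      by (cases X; cases Y; cases Z; cases f; cases g; cases z) (auto simp: Lam_simps amalg_simps)
    interpret Bu: module K "FOb B u''" by (rule P.B_mod[OF ob(6)])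
    note mx = P.pair_closed[OF ob(4,1) c(2,7)] and by' = dg_mod_closed[OF B ob(2,4) c(3,8)] and ax = dg_mod_closed[OF A ob(1,3) c(1,7)]
    note bl = bullet_closed[OF ob(6,1,3) c(5,1)] and l = L_closed[OF ob(4,6,1) c(6,2)]
    note bm = P.pair_closed[OF ob(6,1) bl c(7)] and lm = P.pair_closed[OF ob(6,1) l c(7)]
    \<comment> \<open>Lower left entry of a matrix product applied to x: the summand with m' uses
      compatibility with T, the one with m compatibility with U.\<close>
    have "?d u'' t (bullet u'' t t' m' a \<oplus>\<^bsub>MM u'' t\<^esub> L u' u'' t b' m) x =
        ?d u'' t' m' (FMor A t t' a x) \<oplus>\<^bsub>FOb B u''\<^esub> FMor B u' u'' b' (?d u' t m x)"
      using klin_add[OF kbilinD1[OF P.bilin[OF ob(6,1)] c(7)] bl l] P.pair_right[OF ob(6,1,3) c(5,1,7)] P.pair_left[OF ob(4,6,1) c(2,6,7)] by simp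
    then show "FMor ?F X Z (Comp LL X Y Z g f) z = FMor ?F Y Z g (FMor ?F X Y f z)"
      using c mx by' ax bm lm abelian_groupE(1)[OF agB[OF ob(4)] mx by'] P.pair_closed[OF ob(6,3) c(5) ax]
        dg_mod_closed[OF B ob(4,6) c(6) mx] dg_mod_closed[OF B ob(4,6) c(6) by']
      by (simp add: e Lam_simps amalg_simps dg_mod_comp[OF A ob(1,3,5)] dg_mod_comp[OF B ob(2,4,6)]
          klin_add[OF dg_mod_klin(1)[OF B ob(4,6) c(6)] mx by'] Bu.a_assoc)
  next
    fix X Y f z p q assume "X \<in> Ob LL" "Y \<in> Ob LL" "f \<in> grade (Hom LL X Y) p" "z \<in> grade (FOb ?F X) q"
    then obtain t u t' u' a m b x y where e: "X = (t, u)" "Y = (t', u')" "f = (a, m, b)" "z = (x, y)"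
      and ob: "t \<in> Ob T" "u \<in> Ob U" "t' \<in> Ob T" "u' \<in> Ob U"
      and g: "a \<in> grade (Hom T t t') p" "m \<in> grade (MM u' t) p" "b \<in> grade (Hom U u u') p" "x \<in> grade (FOb A t) q" "y \<in> grade (FOb B u) q"
      by (cases X; cases Y; cases f; cases z) (auto simp: Lam_simps amalg_simps)
    interpret Bu': dg_module K "FOb B u'" by (rule dg_mod_ob[OF B ob(4)])
    interpret At': dg_module K "FOb A t'" by (rule dg_mod_ob[OF A ob(3)])
    note ag = agB[OF ob(4)]
    note c = gr_module.grade_carrier[OF T.gr_hom_module[OF ob(1,3)] g(1)] gr_module.grade_carrier[OF M_gr[OF ob(4,1)] g(2)]
      gr_module.grade_carrier[OF U.gr_hom_module[OF ob(2,4)] g(3)] gr_module.grade_carrier[OF P.A_gr[OF ob(1)] g(4)]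
      gr_module.grade_carrier[OF P.B_gr[OF ob(2)] g(5)]
    show "FMor ?F X Y f z \<in> grade (FOb ?F Y) (q + p)"
      using c dg_mod_grade[OF A ob(1,3) g(1,4)] gr_module.grade_add[OF P.B_gr[OF ob(4)] _ dg_mod_grade[OF B ob(2,4) g(3,5)]]
        P.pair_grade[OF ob(4,1) g(2,4)] by (simp add: e amalg_simps add.commute[of q p])
    note dx = dif_carrier[OF dg_mod_ob[OF A ob(1)] c(4)] and dy = dif_carrier[OF dg_mod_ob[OF B ob(2)] c(5)]
    note dm = dif_carrier[OF M_module[OF ob(4,1)] c(2)] and db = dif_carrier[OF U.hom_dg_module[OF ob(2,4)] c(3)]
    note [simp] = P.pair_closed[OF ob(4,1) c(2,4)] P.pair_closed[OF ob(4,1) dm c(4)] P.pair_closed[OF ob(4,1) c(2) dx]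
      dg_mod_closed[OF B ob(2,4) c(3,5)] dg_mod_closed[OF B ob(2,4) db c(5)] dg_mod_closed[OF B ob(2,4) c(3) dy]
      dg_mod_closed[OF A ob(1,3) c(1,4)] dg_mod_closed[OF A ob(1,3) c(1) dx]
    show "dif (FOb ?F Y) (FMor ?F X Y f z) = FMor ?F X Y (dif (Hom LL X Y) f) z \<oplus>\<^bsub>FOb ?F Y\<^esub>
        sg (FOb ?F Y) p (FMor ?F X Y f (dif (FOb ?F X) z))"
      using c dx dy
      by (simp add: e Lam_simps amalg_simps sg_dg_sum[OF At'.module_axioms Bu'.module_axioms] dg_mod_dif[OF A ob(1,3) c(1) g(1)]
          Bu'.dif_add P.pair_dif[OF ob(4,1) g(2)] dg_mod_dif[OF B ob(2,4) c(3) g(3)] sg_add[OF ag] sg_closed[OF ag] Bu'.a_ac)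
  qed (simp_all add: Lam_id_closed Lam_comp_closed)
qed

abbreviation "FFT \<equiv> FF T U M"

lemma FF_simps:
  "FOb FFT X = amalg M X"
  "FMor FFT (A, f, B) Y (\<alpha>, \<beta>) = (\<lambda>(t, u)\<in>Ob T \<times> Ob U. \<lambda>(x, y)\<in>carrier (dg_sum (FOb A t) (FOb B u)). (\<alpha> t x, \<beta> u y))"
  by (simp_all add: FF_def)

context
  fixes A A' :: "('k, 'to, 'th, 'v) dgm" and f f' and B B' :: "('k, 'uo, 'uh, 'v) dgm"
  assumes X: "(A, f, B) \<in> Ob (comma K T U M)" and X': "(A', f', B') \<in> Ob (comma K T U M)"
begin

private abbreviation "CH \<equiv> Hom (comma K T U M) (A, f, B) (A', f', B')"
private abbreviation "F \<equiv> amalg M (A, f, B)"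
private abbreviation "F' \<equiv> amalg M (A', f', B')"

interpretation P: dg_pairing K T U M A B "dot M (A, f, B)" by (rule dg_pairing_dot[OF X])
interpretation P': dg_pairing K T U M A' B' "dot M (A', f', B')" by (rule dg_pairing_dot[OF X'])

text \<open>Expressing the square through \<open>dot\<close> introduces a sign: \<alpha> raises the
  degree q of x by n, so the two sides carry (q + n) p and q p, which differ by n p. This is the
  sign in naturality with respect to a morphism of degree p.\<close>

lemma comma_square_iff_dot:
  assumes \<alpha>: "\<alpha> \<in> mnat_deg K T A A' n" and \<beta>: "\<beta> \<in> mnat_deg K U B B' n"
  shows "comma_square A f B A' f' B' \<alpha> \<beta> \<longleftrightarrow> (\<forall>u\<in>Ob U. \<forall>t\<in>Ob T. \<forall>p. \<forall>m\<in>grade (MM u t) p. \<forall>x\<in>carrier (FOb A t).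
    dot M (A', f', B') u t m (\<alpha> t x) = sg (FOb B' u) (n * p) (\<beta> u (dot M (A, f, B) u t m x)))"
proof -
  note \<alpha>D = mnat_degD[OF P.A P'.A \<alpha>] and \<beta>D = mnat_degD[OF P.B P'.B \<beta>]
  have eq: "dot M (A', f', B') u t m (\<alpha> t x) = sg (FOb B' u) (n * p) (\<beta> u (dot M (A, f, B) u t m x)) \<longleftrightarrow>
      f' t (\<alpha> t x) u m = \<beta> u (f t x u m)"
    if u: "u \<in> Ob U" and t: "t \<in> Ob T" and m: "m \<in> grade (MM u t) p" and x: "x \<in> grade (FOb A t) q" for u t m x p q
  proof -
    have ag: "abelian_group (FOb B' u)" by (rule module_abelian_group[OF P'.B_mod[OF u]])
    note mc = gr_module.grade_carrier[OF M_gr[OF u t] m] and xc = gr_module.grade_carrier[OF P.A_gr[OF t] x]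
    note ax = hom_degD(3)[OF \<alpha>D(2)[OF t] x]
    have bf: "f t x u m \<in> carrier (FOb B u)" by (rule kbilin_closed[OF comma_kbilin[OF X u t] mc xc])
    have c1: "f' t (\<alpha> t x) u m \<in> carrier (FOb B' u)"
      by (rule kbilin_closed[OF comma_kbilin[OF X' u t] mc gr_module.grade_carrier[OF P'.A_gr[OF t] ax]])
    have c2: "\<beta> u (f t x u m) \<in> carrier (FOb B' u)" by (rule klin_closed[OF hom_degD(1)[OF \<beta>D(2)[OF u]] bf])
    \<comment> \<open>A sign is an involution, hence injective on the carrier.\<close>
    have s: "sg (FOb B' u) k y = sg (FOb B' u) k z \<longleftrightarrow> y = z" if "y \<in> carrier (FOb B' u)" "z \<in> carrier (FOb B' u)" for k y z
    proof
      assume "sg (FOb B' u) k y = sg (FOb B' u) k z"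
      then have "sg (FOb B' u) k (sg (FOb B' u) k y) = sg (FOb B' u) k (sg (FOb B' u) k z)" by simp
      then show "y = z" using that by (simp add: sg_sg[OF ag])
    qed simp
    have "sg (FOb B' u) (n * p) (\<beta> u (dot M (A, f, B) u t m x)) = sg (FOb B' u) ((q + n) * p) (\<beta> u (f t x u m))"
      using bf c2 by (simp add: dot_homog[OF X u t m x] klin_sg[OF P.B_mod[OF u] P'.B_mod[OF u] hom_degD(1)[OF \<beta>D(2)[OF u]]]
          sg_sg[OF ag] algebra_simps)
    then show ?thesis by (simp add: dot_homog[OF X' u t m ax] s c1 c2)
  qed
  have k1: "kbilin K (MM u t) (FOb A t) (FOb B' u) (\<lambda>m x. f' t (\<alpha> t x) u m)"
    and k2: "kbilin K (MM u t) (FOb A t) (FOb B' u) (\<lambda>m x. \<beta> u (f t x u m))"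
    and k3: "klin K (FOb A t) (FOb B' u) (\<lambda>x. dot M (A', f', B') u t m (\<alpha> t x))"
    and k4: "klin K (FOb A t) (FOb B' u) (\<lambda>x. sg (FOb B' u) j (\<beta> u (dot M (A, f, B) u t m x)))"
    if u: "u \<in> Ob U" and t: "t \<in> Ob T" and m: "m \<in> carrier (MM u t)" for u t m j
  proof -
    note ak = hom_degD(1)[OF \<alpha>D(2)[OF t]] and bk = hom_degD(1)[OF \<beta>D(2)[OF u]]
    show "kbilin K (MM u t) (FOb A t) (FOb B' u) (\<lambda>m x. f' t (\<alpha> t x) u m)"
      by (rule kbilin_comp_right[OF ak comma_kbilin[OF X' u t]])
    show "kbilin K (MM u t) (FOb A t) (FOb B' u) (\<lambda>m x. \<beta> u (f t x u m))"
      by (rule kbilin_comp_out[OF comma_kbilin[OF X u t] bk])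
    show "klin K (FOb A t) (FOb B' u) (\<lambda>x. dot M (A', f', B') u t m (\<alpha> t x))"
      by (rule klin_comp[OF ak kbilinD2[OF P'.bilin[OF u t] m]])
    show "klin K (FOb A t) (FOb B' u) (\<lambda>x. sg (FOb B' u) j (\<beta> u (dot M (A, f, B) u t m x)))"
      by (rule klin_sg_fun[OF P'.B_mod[OF u] klin_comp[OF kbilinD2[OF P.bilin[OF u t] m] bk]])
  qed
  have "comma_square A f B A' f' B' \<alpha> \<beta> \<longleftrightarrow> (\<forall>u\<in>Ob U. \<forall>t\<in>Ob T. \<forall>m\<in>carrier (MM u t). \<forall>x\<in>carrier (FOb A t).
      f' t (\<alpha> t x) u m = \<beta> u (f t x u m))" (is "_ \<longleftrightarrow> ?pt")
  proof
    assume "comma_square A f B A' f' B' \<alpha> \<beta>"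
    then show ?pt by (simp add: comma_square_def mnat_comp_apply)
  next
    assume pt: ?pt
    have \<alpha>c: "\<alpha> t x \<in> carrier (FOb A' t)" if "t \<in> Ob T" "x \<in> carrier (FOb A t)" for t x
      by (rule klin_closed[OF hom_degD(1)[OF \<alpha>D(2)[OF that(1)]] that(2)])
    have "\<beta> \<in> grade (mnat K U B B') n" using \<beta> by simp
    note \<beta>c = gr_module.grade_carrier[OF dg_module_gr_module[OF dg_module_mnat[OF P.B P'.B quiver_U]] this]
    show "comma_square A f B A' f' B' \<alpha> \<beta>"
      unfolding comma_square_def
    proof (intro ballI)
      fix t x assume t: "t \<in> Ob T" and x: "x \<in> carrier (FOb A t)"
      note Mt = functor_M_at[OF t]
      show "f' t (\<alpha> t x) = mnat_comp U (Mt t) \<beta> (f t x)"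
        by (rule mnat_eqI[OF Mt P'.B quiver_U comma_f_closed[OF X' X' t \<alpha>c[OF t x]]
              mnat_comp_closed[OF Mt P.B P'.B quiver_U \<beta>c comma_f_closed[OF X X' t x]]])
          (use pt t x in \<open>simp add: mnat_comp_apply\<close>)
    qed
  qed
  also have "\<dots> \<longleftrightarrow> (\<forall>u\<in>Ob U. \<forall>t\<in>Ob T. \<forall>p. \<forall>m\<in>grade (MM u t) p. \<forall>x\<in>carrier (FOb A t).
    dot M (A', f', B') u t m (\<alpha> t x) = sg (FOb B' u) (n * p) (\<beta> u (dot M (A, f, B) u t m x)))" (is "_ \<longleftrightarrow> ?dot")
  proof
    assume pt: ?pt
    show ?dot
    proof (intro ballI allI)
      fix u t p m x assume *: "u \<in> Ob U" "t \<in> Ob T" "m \<in> grade (MM u t) p" "x \<in> carrier (FOb A t)"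
      note mc = gr_module.grade_carrier[OF M_gr[OF *(1,2)] *(3)]
      show "dot M (A', f', B') u t m (\<alpha> t x) = sg (FOb B' u) (n * p) (\<beta> u (dot M (A, f, B) u t m x))"
      proof (rule gr_module.klin_eqI[OF P.A_gr[OF *(2)] P'.B_mod[OF *(1)] k3[OF *(1,2) mc] k4[OF *(1,2) mc] _ *(4)])
        fix q x assume x: "x \<in> grade (FOb A t) q"
        show "dot M (A', f', B') u t m (\<alpha> t x) = sg (FOb B' u) (n * p) (\<beta> u (dot M (A, f, B) u t m x))"
          using eq[OF *(1-3) x] pt * mc gr_module.grade_carrier[OF P.A_gr[OF *(2)] x] by blast
      qed
    qed
  next
    assume d: ?dot
    show ?pt
    proof (intro ballI)
      fix u t m x assume *: "u \<in> Ob U" "t \<in> Ob T" "m \<in> carrier (MM u t)" "x \<in> carrier (FOb A t)"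
      show "f' t (\<alpha> t x) u m = \<beta> u (f t x u m)"
      proof (rule kbilin_eqI[OF M_gr[OF *(1,2)] P.A_gr[OF *(2)] P'.B_mod[OF *(1)] k1[OF *(1-3)] k2[OF *(1-3)] _ *(3,4)])
        fix p q m x assume m: "m \<in> grade (MM u t) p" and x: "x \<in> grade (FOb A t) q"
        show "f' t (\<alpha> t x) u m = \<beta> u (f t x u m)"
          using eq[OF *(1,2) m x] d * m gr_module.grade_carrier[OF P.A_gr[OF *(2)] x] by blast
      qed
    qed
  qed
  finally show ?thesis .
qed

text \<open>Naturality with respect to a matrix splits into its three entries; the lower left one is
  the comma square in the form of \<open>comma_square_iff_dot\<close>.\<close>

lemma FF_grade:
  assumes g: "(\<alpha>, \<beta>) \<in> comma_deg K T U M (A, f, B) (A', f', B') n"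
  shows "FMor FFT (A, f, B) (A', f', B') (\<alpha>, \<beta>) \<in> mnat_deg K LL F F' n"
proof (rule mnat_degI[OF amalg_functor[OF X] amalg_functor[OF X']])
  note g = g[unfolded comma_deg_iff[OF X X']]
  note \<alpha>D = mnat_degD[OF P.A P'.A conjunct1[OF g]] and \<beta>D = mnat_degD[OF P.B P'.B conjunct1[OF conjunct2[OF g]]]
  note sq = g[THEN conjunct2, THEN conjunct2, unfolded comma_square_iff_dot[OF conjunct1[OF g] conjunct1[OF conjunct2[OF g]]]]
  show "FMor FFT (A, f, B) (A', f', B') (\<alpha>, \<beta>) \<in> extensional (Ob LL)"
    by (simp add: FF_simps Lam_simps)
  show "FMor FFT (A, f, B) (A', f', B') (\<alpha>, \<beta>) z \<in> hom_deg K (FOb F z) (FOb F' z) n" if z: "z \<in> Ob LL" for z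
  proof -
    obtain t u where e: "z = (t, u)" and ob: "t \<in> Ob T" "u \<in> Ob U"
      using z by (cases z) (auto simp: Lam_simps)
    interpret At: gr_module K "FOb A t" by (rule P.A_gr[OF ob(1)])
    interpret Bu: gr_module K "FOb B u" by (rule P.B_gr[OF ob(2)])
    note a = hom_degD[OF \<alpha>D(2)[OF ob(1)]] and b = hom_degD[OF \<beta>D(2)[OF ob(2)]]
    show ?thesis
      unfolding e amalg_simps
      by (rule hom_degI, rule klinI)
        (auto simp: FF_simps ob klin_closed[OF a(1)] klin_closed[OF b(1)] klin_add[OF a(1)] klin_add[OF b(1)]
          klin_smult[OF a(1)] klin_smult[OF b(1)] At.grade_carrier Bu.grade_carrier a(3) b(3))
  qed
  fix Z Z' p h z assume "Z \<in> Ob LL" "Z' \<in> Ob LL" "h \<in> grade (Hom LL Z Z') p" "z \<in> carrier (FOb F Z)"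
  then obtain t u t' u' a m b x y where e: "Z = (t, u)" "Z' = (t', u')" "h = (a, m, b)" "z = (x, y)"
    and ob: "t \<in> Ob T" "u \<in> Ob U" "t' \<in> Ob T" "u' \<in> Ob U"
    and h: "a \<in> grade (Hom T t t') p" "m \<in> grade (MM u' t) p" "b \<in> grade (Hom U u u') p"
    and c: "x \<in> carrier (FOb A t)" "y \<in> carrier (FOb B u)"
    by (cases Z; cases Z'; cases h; cases z) (auto simp: Lam_simps amalg_simps)
  note hc = gr_module.grade_carrier[OF T.gr_hom_module[OF ob(1,3)] h(1)] gr_module.grade_carrier[OF M_gr[OF ob(4,1)] h(2)]
    gr_module.grade_carrier[OF U.gr_hom_module[OF ob(2,4)] h(3)]
  note mx = P.pair_closed[OF ob(4,1) hc(2) c(1)] and by' = dg_mod_closed[OF P.B ob(2,4) hc(3) c(2)] and ax = dg_mod_closed[OF P.A ob(1,3) hc(1) c(1)]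
  interpret Bu': module K "FOb B u'" by (rule P.B_mod[OF ob(4)])
  note \<alpha>k = hom_degD(1)[OF \<alpha>D(2)] and \<beta>k = hom_degD(1)[OF \<beta>D(2)]
  have ag: "abelian_group (FOb B' u')" by (rule module_abelian_group[OF P'.B_mod[OF ob(4)]])
  show "FMor F' Z Z' h (FMor FFT (A, f, B) (A', f', B') (\<alpha>, \<beta>) Z z) =
      sg (FOb F' Z') (n * p) (FMor FFT (A, f, B) (A', f', B') (\<alpha>, \<beta>) Z' (FMor F Z Z' h z))"
    using sq ob h c mx by' ax klin_closed[OF \<alpha>k] klin_closed[OF \<beta>k] hc abelian_groupE(1)[OF ag]
    by (simp add: e amalg_simps FF_simps \<alpha>D(3)[OF ob(1,3) h(1)] \<beta>D(3)[OF ob(2,4) h(3)] klin_add[OF \<beta>k[OF ob(4)]]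
        sg_dg_sum[OF P'.A_mod P'.B_mod] sg_add[OF ag])
qed

lemma
  assumes "g \<in> carrier CH"
  shows FF_closed: "FMor FFT (A, f, B) (A', f', B') g \<in> carrier (mnat K LL F F')"
    and FF_add: "h \<in> carrier CH \<Longrightarrow> FMor FFT (A, f, B) (A', f', B') (g \<oplus>\<^bsub>CH\<^esub> h) =
      FMor FFT (A, f, B) (A', f', B') g \<oplus>\<^bsub>mnat K LL F F'\<^esub> FMor FFT (A, f, B) (A', f', B') h"
    and FF_smult: "a \<in> carrier K \<Longrightarrow> FMor FFT (A, f, B) (A', f', B') (a \<odot>\<^bsub>CH\<^esub> g) =
      a \<odot>\<^bsub>mnat K LL F F'\<^esub> FMor FFT (A, f, B) (A', f', B') g"
proof -
  interpret GH: gr_module K CH by (rule dg_module_gr_module[OF dg_module_comma_hom[OF X X']])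
  interpret N: gr_module K "mnat K LL F F'"
    by (rule dg_module_gr_module[OF dg_module_mnat[OF amalg_functor[OF X] amalg_functor[OF X'] quiver_Lam]])
  show add: "FMor FFT (A, f, B) (A', f', B') (g \<oplus>\<^bsub>CH\<^esub> h) =
      FMor FFT (A, f, B) (A', f', B') g \<oplus>\<^bsub>mnat K LL F F'\<^esub> FMor FFT (A, f, B) (A', f', B') h"
    if "h \<in> carrier CH" for g h
    by (cases g; cases h) (auto simp: comma_hom_simps FF_simps Lam_simps amalg_simps fun_eq_iff restrict_def)
  show "FMor FFT (A, f, B) (A', f', B') (a \<odot>\<^bsub>CH\<^esub> g) =
      a \<odot>\<^bsub>mnat K LL F F'\<^esub> FMor FFT (A, f, B) (A', f', B') g" for a
    by (cases g) (auto simp: comma_hom_simps FF_simps Lam_simps amalg_simps fun_eq_iff restrict_def)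
  show "FMor FFT (A, f, B) (A', f', B') g \<in> carrier (mnat K LL F F')"
    using assms
  proof (induction rule: GH.homog_induct)
    case (homog n g)
    obtain \<alpha> \<beta> where e: "g = (\<alpha>, \<beta>)" by fastforce
    have "FMor FFT (A, f, B) (A', f', B') g \<in> grade (mnat K LL F F') n"
      using FF_grade[of \<alpha> \<beta> n] homog by (simp add: e comma_hom_simps)
    then show ?case by (rule N.grade_carrier)
  next
    case (add g h)
    then show ?case using \<open>\<And>h g. _ \<Longrightarrow> FMor FFT (A, f, B) (A', f', B') (g \<oplus>\<^bsub>CH\<^esub> h) = _\<close> N.a_closed by (simp del: mnat_simps)
  qed
qed

lemma FF_dif:
  assumes g: "g \<in> carrier CH"
  shows "FMor FFT (A, f, B) (A', f', B') (dif CH g) = dif (mnat K LL F F') (FMor FFT (A, f, B) (A', f', B') g)"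
proof -
  note mH = dg_module_comma_hom[OF X X'] and F = amalg_functor[OF X] and F' = amalg_functor[OF X']
  note mN = dg_module_mnat[OF F F' quiver_Lam]
  interpret GH: gr_module K CH by (rule dg_module_gr_module[OF mH])
  have k: "klin K CH (mnat K LL F F') (FMor FFT (A, f, B) (A', f', B'))"
    by (intro klinI FF_closed FF_add FF_smult)
  show ?thesis
  proof (rule GH.klin_eqI[OF dg_module_module[OF mN] klin_comp[OF dg_module_klin_dif[OF mH] k]
        klin_comp[OF k dg_module_klin_dif[OF mN]] _ g])
    fix n g assume g: "g \<in> grade CH n"
    obtain \<alpha> \<beta> where e: "g = (\<alpha>, \<beta>)" by fastforce
    note gc = GH.grade_carrier[OF g]
    have gd: "(\<alpha>, \<beta>) \<in> comma_deg K T U M (A, f, B) (A', f', B') n" using g by (simp add: e comma_hom_simps)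
    then have \<alpha>: "\<alpha> \<in> mnat_deg K T A A' n" and \<beta>: "\<beta> \<in> mnat_deg K U B B' n" by (simp_all add: comma_deg_iff[OF X X'])
    note \<alpha>k = hom_degD(1)[OF mnat_degD(2)[OF P.A P'.A \<alpha>]] and \<beta>k = hom_degD(1)[OF mnat_degD(2)[OF P.B P'.B \<beta>]]
    show "FMor FFT (A, f, B) (A', f', B') (dif CH g) = dif (mnat K LL F F') (FMor FFT (A, f, B) (A', f', B') g)"
    proof (rule mnat_eqI[OF F F' quiver_Lam FF_closed[OF dif_carrier[OF mH gc]] dif_carrier[OF mN FF_closed[OF gc]]])
      fix Z z assume Zz: "Z \<in> Ob LL" "z \<in> carrier (FOb F Z)"
      obtain t u x y where ez: "Z = (t, u)" "z = (x, y)" and ob: "t \<in> Ob T" "u \<in> Ob U"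
        and c: "x \<in> carrier (FOb A t)" "y \<in> carrier (FOb B u)"
        using Zz by (cases Z; cases z) (auto simp: Lam_simps amalg_simps)
      note d = dif_carrier[OF dg_mod_ob[OF P.A ob(1)] c(1)] dif_carrier[OF dg_mod_ob[OF P.B ob(2)] c(2)]
      have "dif (mnat K LL F F') (FMor FFT (A, f, B) (A', f', B') g) Z z =
          (dif (mnat K T A A') \<alpha> t x, dif (mnat K U B B') \<beta> u y)"
        unfolding e mnat_dif_eval[OF F F' quiver_Lam FF_grade[OF gd] Zz] mnat_dif_eval[OF P.A P'.A quiver_T \<alpha> ob(1) c(1)]
          mnat_dif_eval[OF P.B P'.B quiver_U \<beta> ob(2) c(2)]
        using ob c d klin_closed[OF \<alpha>k] klin_closed[OF \<beta>k]
        by (simp add: ez amalg_simps FF_simps sg_dg_sum[OF P'.A_mod P'.B_mod])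
      then show "FMor FFT (A, f, B) (A', f', B') (dif CH g) Z z = dif (mnat K LL F F') (FMor FFT (A, f, B) (A', f', B') g) Z z"
        using ob c by (simp add: e ez comma_hom_simps FF_simps del: mnat_simps)
    qed
  qed
qed

end

theorem FF_functor:
  "dg_functor K (comma K T U M :: ('k, ('k, 'to, 'th, 'uo, 'uh, 'm, 'v) comma_ob, ('to, 'uo, 'v) comma_mor) dgcat) (DgMod K LL) FFT"
proof (intro dg_functor.intro)
  let ?C = "comma K T U M :: ('k, ('k, 'to, 'th, 'uo, 'uh, 'm, 'v) comma_ob, ('to, 'uo, 'v) comma_mor) dgcat"
  fix X Y :: "('k, 'to, 'th, 'uo, 'uh, 'm, 'v) comma_ob" assume X: "X \<in> Ob ?C" and Y: "Y \<in> Ob ?C"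
  obtain A f B A' f' B' where e: "X = (A, f, B)" "Y = (A', f', B')" by (metis prod_cases3)
  note X = X[unfolded e] and Y = Y[unfolded e]
  show "FOb FFT X \<in> Ob (DgMod K LL)" using amalg_functor[OF X] by (simp add: e FF_simps)
  show "FMor FFT X X (Id ?C X) = Id (DgMod K LL) (FOb FFT X)"
    by (auto simp: e comma_simps FF_simps mnat_id_def Lam_simps amalg_simps fun_eq_iff restrict_def)
  show "FMor FFT X Y g \<in> grade (Hom (DgMod K LL) (FOb FFT X) (FOb FFT Y)) n" if "g \<in> grade (Hom ?C X Y) n" for g n
    using that FF_grade[OF X Y] unfolding e by (cases g) (simp add: comma_hom_simps FF_simps(1) del: mnat_simps(2-))
  fix g assume g: "g \<in> carrier (Hom ?C X Y)"
  show "FMor FFT X Y g \<in> carrier (Hom (DgMod K LL) (FOb FFT X) (FOb FFT Y))"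
    "FMor FFT X Y (dif (Hom ?C X Y) g) = dif (Hom (DgMod K LL) (FOb FFT X) (FOb FFT Y)) (FMor FFT X Y g)"
    using FF_closed[OF X Y] FF_dif[OF X Y] g unfolding e by (simp_all add: FF_simps(1) del: mnat_simps)
  show "FMor FFT X Y (g \<oplus>\<^bsub>Hom ?C X Y\<^esub> h) = FMor FFT X Y g \<oplus>\<^bsub>Hom (DgMod K LL) (FOb FFT X) (FOb FFT Y)\<^esub> FMor FFT X Y h"
    if "h \<in> carrier (Hom ?C X Y)" for h
    using FF_add[OF X Y] g that unfolding e by (simp add: FF_simps(1) del: mnat_simps)
  show "FMor FFT X Y (a \<odot>\<^bsub>Hom ?C X Y\<^esub> g) = a \<odot>\<^bsub>Hom (DgMod K LL) (FOb FFT X) (FOb FFT Y)\<^esub> FMor FFT X Y g"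
    if "a \<in> carrier K" for a
    using FF_smult[OF X Y] g that unfolding e by (simp add: FF_simps(1) del: mnat_simps)
  fix Z :: "('k, 'to, 'th, 'uo, 'uh, 'm, 'v) comma_ob" and h assume Z: "Z \<in> Ob ?C" and h: "h \<in> carrier (Hom ?C Y Z)"
  obtain A'' f'' B'' where eZ: "Z = (A'', f'', B'')" by (metis prod_cases3)
  obtain \<alpha> \<beta> \<alpha>' \<beta>' where eg: "g = (\<alpha>, \<beta>)" "h = (\<alpha>', \<beta>')" by fastforce
  note gc = comma_hom_carrierD[OF X Y g[unfolded e eg]]
  note cl = mnat_closed[OF comma_functors(1,3)[OF X Y] quiver_T gc(1)] mnat_closed[OF comma_functors(2,4)[OF X Y] quiver_U gc(2)]
  show "FMor FFT X Z (Comp ?C X Y Z h g) = Comp (DgMod K LL) (FOb FFT X) (FOb FFT Y) (FOb FFT Z) (FMor FFT Y Z h) (FMor FFT X Y g)"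
    by (auto simp: e eZ eg comma_simps FF_simps mnat_comp_def[of LL] compose_def Lam_simps amalg_simps mnat_comp_apply cl
        fun_eq_iff restrict_def)
qed

end

section \<open>The comparison functor is fully faithful\<close>

context dg_bimodule
begin

text \<open>Matrix units. The objects are arguments because the zeros belong to modules that depend
  on them.\<close>

abbreviation "E11 t u t' u' a \<equiv> (a, \<zero>\<^bsub>MM u' t\<^esub>, \<zero>\<^bsub>Hom U u u'\<^esub>)"
abbreviation "E21 t u t' u' m \<equiv> (\<zero>\<^bsub>Hom T t t'\<^esub>, m, \<zero>\<^bsub>Hom U u u'\<^esub>)"
abbreviation "E22 t u t' u' b \<equiv> (\<zero>\<^bsub>Hom T t t'\<^esub>, \<zero>\<^bsub>MM u' t\<^esub>, b)"

context
  fixes t u t' u' assumes ob: "t \<in> Ob T" "u \<in> Ob U" "t' \<in> Ob T" "u' \<in> Ob U"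
begin

interpretation HT: gr_module K "Hom T t t'" by (rule T.gr_hom_module[OF ob(1,3)])
interpretation HU: gr_module K "Hom U u u'" by (rule U.gr_hom_module[OF ob(2,4)])
interpretation Mg: gr_module K "MM u' t" by (rule M_gr[OF ob(4,1)])

lemma E_grade:
  "a \<in> grade (Hom T t t') p \<Longrightarrow> E11 t u t' u' a \<in> grade (Hom LL (t, u) (t', u')) p"
  "m \<in> grade (MM u' t) p \<Longrightarrow> E21 t u t' u' m \<in> grade (Hom LL (t, u) (t', u')) p"
  "b \<in> grade (Hom U u u') p \<Longrightarrow> E22 t u t' u' b \<in> grade (Hom LL (t, u) (t', u')) p"
  by (simp_all add: Lam_simps HT.grade_zero HU.grade_zero Mg.grade_zero)

lemma E_closed:
  "a \<in> carrier (Hom T t t') \<Longrightarrow> E11 t u t' u' a \<in> carrier (Hom LL (t, u) (t', u'))"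
  "m \<in> carrier (MM u' t) \<Longrightarrow> E21 t u t' u' m \<in> carrier (Hom LL (t, u) (t', u'))"
  "b \<in> carrier (Hom U u u') \<Longrightarrow> E22 t u t' u' b \<in> carrier (Hom LL (t, u) (t', u'))"
  by (simp_all add: Lam_simps)

lemma E_klin:
  "klin K (Hom T t t') (Hom LL (t, u) (t', u')) (\<lambda>a. E11 t u t' u' a)"
  "klin K (MM u' t) (Hom LL (t, u) (t', u')) (\<lambda>m. E21 t u t' u' m)"
  "klin K (Hom U u u') (Hom LL (t, u) (t', u')) (\<lambda>b. E22 t u t' u' b)"
  by (simp_all add: klin_def Lam_simps)

lemma E_dif:
  "dif (Hom LL (t, u) (t', u')) (E11 t u t' u' a) = E11 t u t' u' (dif (Hom T t t') a)"
  "dif (Hom LL (t, u) (t', u')) (E21 t u t' u' m) = E21 t u t' u' (dif (MM u' t) m)"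
  "dif (Hom LL (t, u) (t', u')) (E22 t u t' u' b) = E22 t u t' u' (dif (Hom U u u') b)"
  using klin_zero[OF HT.module_axioms HT.module_axioms dg_module_klin_dif[OF T.hom_dg_module[OF ob(1,3)]]]
    klin_zero[OF HU.module_axioms HU.module_axioms dg_module_klin_dif[OF U.hom_dg_module[OF ob(2,4)]]]
    klin_zero[OF Mg.module_axioms Mg.module_axioms dg_module_klin_dif[OF M_module[OF ob(4,1)]]]
  by (simp_all add: Lam_simps)

end

context
  fixes A A' :: "('k, 'to, 'th, 'v) dgm" and f f' and B B' :: "('k, 'uo, 'uh, 'v) dgm"
  assumes X: "(A, f, B) \<in> Ob (comma K T U M)" and X': "(A', f', B') \<in> Ob (comma K T U M)"
    and nonempty: "Ob T = {} \<longleftrightarrow> Ob U = {}"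
begin

interpretation P: dg_pairing K T U M A B "dot M (A, f, B)" by (rule dg_pairing_dot[OF X])
interpretation P': dg_pairing K T U M A' B' "dot M (A', f', B')" by (rule dg_pairing_dot[OF X'])

text \<open>Reading off \<alpha> at t requires some object u, and reading off \<beta> at u some t;
  this is one place where the two object sets must be empty together. The other coordinate is filled
  with zero.\<close>

lemma FF_faithful:
  assumes g: "g \<in> carrier (Hom (comma K T U M) (A, f, B) (A', f', B'))" and h: "h \<in> carrier (Hom (comma K T U M) (A, f, B) (A', f', B'))"
    and eq: "FMor FFT (A, f, B) (A', f', B') g = FMor FFT (A, f, B) (A', f', B') h"
  shows "g = h"
proof -
  obtain \<alpha> \<beta> \<alpha>' \<beta>' where e: "g = (\<alpha>, \<beta>)" "h = (\<alpha>', \<beta>')" by fastforce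
  note gc = comma_hom_carrierD[OF X X' g[unfolded e]] and hc = comma_hom_carrierD[OF X X' h[unfolded e]]
  have pt: "\<alpha> t x = \<alpha>' t x \<and> \<beta> u y = \<beta>' u y"
    if "t \<in> Ob T" "u \<in> Ob U" "x \<in> carrier (FOb A t)" "y \<in> carrier (FOb B u)" for t u x y
    using fun_cong[OF fun_cong[OF eq, of "(t, u)"], of "(x, y)"] that by (simp add: e FF_simps)
  have "\<alpha> = \<alpha>'"
  proof (rule mnat_eqI[OF P.A P'.A quiver_T gc(1) hc(1)])
    fix t x assume t: "t \<in> Ob T" and x: "x \<in> carrier (FOb A t)"
    obtain u where u: "u \<in> Ob U" using t nonempty by blast
    show "\<alpha> t x = \<alpha>' t x" using pt[OF t u x abelian_groupE(2)[OF module_abelian_group[OF P.B_mod[OF u]]]] by blast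
  qed
  moreover have "\<beta> = \<beta>'"
  proof (rule mnat_eqI[OF P.B P'.B quiver_U gc(2) hc(2)])
    fix u y assume u: "u \<in> Ob U" and y: "y \<in> carrier (FOb B u)"
    obtain t where t: "t \<in> Ob T" using u nonempty by blast
    show "\<beta> u y = \<beta>' u y" using pt[OF t u abelian_groupE(2)[OF module_abelian_group[OF P.A_mod[OF t]]] y] by blast
  qed
  ultimately show ?thesis by (simp add: e)
qed

private lemma amalg_E:
  assumes ob: "t \<in> Ob T" "u \<in> Ob U" "t' \<in> Ob T" "u' \<in> Ob U" and C: "(C, g, D) \<in> Ob (comma K T U M)"
    and x: "x \<in> carrier (FOb C t)" and y: "y \<in> carrier (FOb D u)"
  shows "a \<in> carrier (Hom T t t') \<Longrightarrow> FMor (amalg M (C, g, D)) (t, u) (t', u') (E11 t u t' u' a) (x, y) = (FMor C t t' a x, \<zero>\<^bsub>FOb D u'\<^esub>)"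
    and "m \<in> carrier (MM u' t) \<Longrightarrow> FMor (amalg M (C, g, D)) (t, u) (t', u') (E21 t u t' u' m) (x, y) = (\<zero>\<^bsub>FOb C t'\<^esub>, dot M (C, g, D) u' t m x)"
    and "b \<in> carrier (Hom U u u') \<Longrightarrow> FMor (amalg M (C, g, D)) (t, u) (t', u') (E22 t u t' u' b) (x, y) = (\<zero>\<^bsub>FOb C t'\<^esub>, FMor D u u' b y)"
proof -
  interpret Q: dg_pairing K T U M C D "dot M (C, g, D)" by (rule dg_pairing_dot[OF C])
  interpret Du: module K "FOb D u'" by (rule Q.B_mod[OF ob(4)])
  note z = klin_zero[OF T.mod_hom[OF ob(1,3)] Q.A_mod[OF ob(3)] dg_mod_klin'[OF Q.A ob(1,3) x]]
    klin_zero[OF M_mod[OF ob(4,1)] Du.module_axioms kbilinD1[OF Q.bilin[OF ob(4,1)] x]]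
    klin_zero[OF U.mod_hom[OF ob(2,4)] Du.module_axioms dg_mod_klin'[OF Q.B ob(2,4) y]]
  show "a \<in> carrier (Hom T t t') \<Longrightarrow> FMor (amalg M (C, g, D)) (t, u) (t', u') (E11 t u t' u' a) (x, y) = (FMor C t t' a x, \<zero>\<^bsub>FOb D u'\<^esub>)"
    and "m \<in> carrier (MM u' t) \<Longrightarrow> FMor (amalg M (C, g, D)) (t, u) (t', u') (E21 t u t' u' m) (x, y) = (\<zero>\<^bsub>FOb C t'\<^esub>, dot M (C, g, D) u' t m x)"
    and "b \<in> carrier (Hom U u u') \<Longrightarrow> FMor (amalg M (C, g, D)) (t, u) (t', u') (E22 t u t' u' b) (x, y) = (\<zero>\<^bsub>FOb C t'\<^esub>, FMor D u u' b y)"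
    using x y Q.pair_closed[OF ob(4,1) _ x] dg_mod_closed[OF Q.B ob(2,4) _ y] by (simp_all add: amalg_simps z)
qed

text \<open>Naturality with respect to the matrix units, between different pairs of objects, forces
  \<open>\<eta>\<close> at \<open>(t, u)\<close> to be a diagonal map whose entries depend only on \<open>t\<close> and only on \<open>u\<close>.\<close>

lemma FF_full:
  assumes \<eta>: "\<eta> \<in> mnat_deg K LL (amalg M (A, f, B)) (amalg M (A', f', B')) n"
  shows "\<exists>g\<in>comma_deg K T U M (A, f, B) (A', f', B') n. FMor FFT (A, f, B) (A', f', B') g = \<eta>"
proof -
  note F = amalg_functor[OF X] and F' = amalg_functor[OF X']
  note \<eta>D = mnat_degD[OF F F' \<eta>]
  have \<eta>c: "fst (\<eta> (t, u) (x, y)) \<in> carrier (FOb A' t)" "snd (\<eta> (t, u) (x, y)) \<in> carrier (FOb B' u)"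
    and \<eta>k: "klin K (dg_sum (FOb A t) (FOb B u)) (dg_sum (FOb A' t) (FOb B' u)) (\<eta> (t, u))"
    and \<eta>g: "x \<in> grade (FOb A t) p \<Longrightarrow> y \<in> grade (FOb B u) p \<Longrightarrow>
      \<eta> (t, u) (x, y) \<in> grade (FOb A' t) (p + n) \<times> grade (FOb B' u) (p + n)"
    if "t \<in> Ob T" "u \<in> Ob U" "x \<in> carrier (FOb A t)" "y \<in> carrier (FOb B u)" for t u x y p
  proof -
    have h: "\<eta> (t, u) \<in> hom_deg K (dg_sum (FOb A t) (FOb B u)) (dg_sum (FOb A' t) (FOb B' u)) n"
      using \<eta>D(2)[of "(t, u)"] that(1,2) by (simp add: Lam_simps amalg_simps)
    note hD = hom_degD[OF this]
    show "klin K (dg_sum (FOb A t) (FOb B u)) (dg_sum (FOb A' t) (FOb B' u)) (\<eta> (t, u))" by (rule hD(1))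
    show "fst (\<eta> (t, u) (x, y)) \<in> carrier (FOb A' t)" "snd (\<eta> (t, u) (x, y)) \<in> carrier (FOb B' u)"
      using klin_closed[OF hD(1), of "(x, y)"] that(3,4) by (auto simp: mem_Times_iff)
    show "x \<in> grade (FOb A t) p \<Longrightarrow> y \<in> grade (FOb B u) p \<Longrightarrow> \<eta> (t, u) (x, y) \<in> grade (FOb A' t) (p + n) \<times> grade (FOb B' u) (p + n)"
      using hD(3)[of "(x, y)" p] by simp
  qed
  have nat: "FMor (amalg M (A', f', B')) (t, u) (t', u') h (fst (\<eta> (t, u) (x, y)), snd (\<eta> (t, u) (x, y))) =
      sg (dg_sum (FOb A' t') (FOb B' u')) (n * p) (\<eta> (t', u') (FMor (amalg M (A, f, B)) (t, u) (t', u') h (x, y)))"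
    if "t \<in> Ob T" "u \<in> Ob U" "t' \<in> Ob T" "u' \<in> Ob U" "h \<in> grade (Hom LL (t, u) (t', u')) p" "x \<in> carrier (FOb A t)" "y \<in> carrier (FOb B u)"
    for t u t' u' h p x y
    using \<eta>D(3)[of "(t, u)" "(t', u')" h p "(x, y)"] that by (simp add: Lam_simps(1) amalg_simps(1))
  have zA: "\<zero>\<^bsub>FOb A t\<^esub> \<in> carrier (FOb A t)" "\<zero>\<^bsub>FOb A' t\<^esub> \<in> carrier (FOb A' t)" if "t \<in> Ob T" for t
    using that P.A_mod P'.A_mod by (blast intro: abelian_groupE(2) module_abelian_group)+
  have zB: "\<zero>\<^bsub>FOb B u\<^esub> \<in> carrier (FOb B u)" "\<zero>\<^bsub>FOb B' u\<^esub> \<in> carrier (FOb B' u)" if "u \<in> Ob U" for u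
    using that P.B_mod P'.B_mod by (blast intro: abelian_groupE(2) module_abelian_group)+
  \<comment> \<open>The choice is meaningful only if objects exist. The facts below derive
    membership from the existence of an object on the other side, which leaves the empty case
    vacuous.\<close>
  define u0 where "u0 = (SOME u. u \<in> Ob U)"
  define t0 where "t0 = (SOME t. t \<in> Ob T)"
  have t0: "t0 \<in> Ob T" if "u \<in> Ob U" for u
    using that nonempty unfolding t0_def some_in_eq by blast
  have u0: "u0 \<in> Ob U" if "t \<in> Ob T" for t
    using that nonempty unfolding u0_def some_in_eq by blast
  \<comment> \<open>Entries are read at the base objects with the other coordinate zero;
    \<open>diag\<close> shows that this loses nothing.\<close>
  define \<alpha> where "\<alpha> = (\<lambda>t\<in>Ob T. \<lambda>x\<in>carrier (FOb A t). fst (\<eta> (t, u0) (x, \<zero>\<^bsub>FOb B u0\<^esub>)))"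
  define \<beta> where "\<beta> = (\<lambda>u\<in>Ob U. \<lambda>y\<in>carrier (FOb B u). snd (\<eta> (t0, u) (\<zero>\<^bsub>FOb A t0\<^esub>, y)))"
  have diag: "\<eta> (t, u) (x, y) = (\<alpha> t x, \<beta> u y)"
    if "t \<in> Ob T" "u \<in> Ob U" "x \<in> carrier (FOb A t)" "y \<in> carrier (FOb B u)" for t u x y
  proof -
    note b = t0[OF that(2)] u0[OF that(1)]
    note c = \<eta>c[OF that]
    \<comment> \<open>The unit with the identity of t in the upper corner, from (t, u) to (t, u0),
      sends (x, y) to (x, 0). Naturality moves it past \<eta>, so the first coordinate depends on
      neither u nor y.\<close>
    have e1: "(fst (\<eta> (t, u) (x, y)), \<zero>\<^bsub>FOb B' u0\<^esub>) = \<eta> (t, u0) (x, \<zero>\<^bsub>FOb B u0\<^esub>)"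
      using nat[OF that(1,2,1) b(2) E_grade(1)[OF that(1,2,1) b(2) T.id_grade[OF that(1)]] that(3,4)] that c b
        amalg_E(1)[OF that(1,2,1) b(2) X that(3,4) T.id_closed[OF that(1)]] amalg_E(1)[OF that(1,2,1) b(2) X' c T.id_closed[OF that(1)]]
      by (simp add: dg_mod_id[OF P.A that(1)] dg_mod_id[OF P'.A that(1)])
    have 1: "fst (\<eta> (t, u) (x, y)) = \<alpha> t x" using arg_cong[OF e1, of fst] that by (simp add: \<alpha>_def)
    have e2: "(\<zero>\<^bsub>FOb A' t0\<^esub>, snd (\<eta> (t, u) (x, y))) = \<eta> (t0, u) (\<zero>\<^bsub>FOb A t0\<^esub>, y)"
      using nat[OF that(1,2) b(1) that(2) E_grade(3)[OF that(1,2) b(1) that(2) U.id_grade[OF that(2)]] that(3,4)] that c b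
        amalg_E(3)[OF that(1,2) b(1) that(2) X that(3,4) U.id_closed[OF that(2)]] amalg_E(3)[OF that(1,2) b(1) that(2) X' c U.id_closed[OF that(2)]]
      by (simp add: dg_mod_id[OF P.B that(2)] dg_mod_id[OF P'.B that(2)])
    have 2: "snd (\<eta> (t, u) (x, y)) = \<beta> u y" using arg_cong[OF e2, of snd] that by (simp add: \<beta>_def)
    show ?thesis using 1 2 by (simp add: prod_eq_iff)
  qed
  have \<alpha>c: "\<alpha> t x \<in> carrier (FOb A' t)" if "t \<in> Ob T" "x \<in> carrier (FOb A t)" for t x
    using \<eta>c(1)[OF that(1) u0[OF that(1)] that(2) zB(1)[OF u0[OF that(1)]]] that by (simp add: \<alpha>_def)
  have \<beta>c: "\<beta> u y \<in> carrier (FOb B' u)" if "u \<in> Ob U" "y \<in> carrier (FOb B u)" for u y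
    using \<eta>c(2)[OF t0[OF that(1)] that(1) zA(1)[OF t0[OF that(1)]] that(2)] that by (simp add: \<beta>_def)
  have \<alpha>: "\<alpha> \<in> mnat_deg K T A A' n"
  proof (rule mnat_degI[OF P.A P'.A])
    show "\<alpha> \<in> extensional (Ob T)" by (simp add: \<alpha>_def)
    show "\<alpha> t \<in> hom_deg K (FOb A t) (FOb A' t) n" if t: "t \<in> Ob T" for t
    proof (rule hom_degI[OF klinI])
      have b: "u0 \<in> Ob U" using u0 t by metis
      interpret At: gr_module K "FOb A t" by (rule P.A_gr[OF t])
      interpret Bu: gr_module K "FOb B u0" by (rule P.B_gr[OF b])
      note k = \<eta>k[OF t b zA(1)[OF t] zB(1)[OF b]]
      show "\<alpha> t x \<in> carrier (FOb A' t)" if "x \<in> carrier (FOb A t)" for x by (rule \<alpha>c[OF t that])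
      show "\<alpha> t (x \<oplus>\<^bsub>FOb A t\<^esub> y) = \<alpha> t x \<oplus>\<^bsub>FOb A' t\<^esub> \<alpha> t y" if "x \<in> carrier (FOb A t)" "y \<in> carrier (FOb A t)" for x y
        using klin_add[OF k, of "(x, \<zero>\<^bsub>FOb B u0\<^esub>)" "(y, \<zero>\<^bsub>FOb B u0\<^esub>)"] that diag[OF t b _ zB(1)[OF b]] by simp
      show "\<alpha> t (a \<odot>\<^bsub>FOb A t\<^esub> x) = a \<odot>\<^bsub>FOb A' t\<^esub> \<alpha> t x" if "a \<in> carrier K" "x \<in> carrier (FOb A t)" for a x
        using klin_smult[OF k, of a "(x, \<zero>\<^bsub>FOb B u0\<^esub>)"] that diag[OF t b _ zB(1)[OF b]] by simp
      show "\<alpha> t x \<in> grade (FOb A' t) (p + n)" if "x \<in> grade (FOb A t) p" for p x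
        using \<eta>g[OF t b At.grade_carrier[OF that] zB(1)[OF b] that Bu.grade_zero] diag[OF t b At.grade_carrier[OF that] zB(1)[OF b]] by simp
    qed (use t in \<open>simp add: \<alpha>_def\<close>)
    fix t t' a p x assume t: "t \<in> Ob T" "t' \<in> Ob T" and a: "a \<in> grade (Hom T t t') p" and x: "x \<in> carrier (FOb A t)"
    have b: "u0 \<in> Ob U" using u0 t by metis
    note ac = gr_module.grade_carrier[OF T.gr_hom_module[OF t] a]
    \<comment> \<open>Naturality for the unit of a, from (t, u0) to (t', u0); the first coordinate
      is the claim.\<close>
    have "(FMor A' t t' a (\<alpha> t x), \<zero>\<^bsub>FOb B' u0\<^esub>) = sg (dg_sum (FOb A' t') (FOb B' u0)) (n * p) (\<alpha> t' (FMor A t t' a x), \<beta> u0 \<zero>\<^bsub>FOb B u0\<^esub>)"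
      using nat[OF t(1) b t(2) b E_grade(1)[OF t(1) b t(2) b a] x zB(1)[OF b]] diag[OF t(1) b x zB(1)[OF b]]
        diag[OF t(2) b dg_mod_closed[OF P.A t ac x] zB(1)[OF b]] amalg_E(1)[OF t(1) b t(2) b X x zB(1)[OF b] ac]
        amalg_E(1)[OF t(1) b t(2) b X' \<alpha>c[OF t(1) x] \<beta>c[OF b zB(1)[OF b]] ac] by simp
    then show "FMor A' t t' a (\<alpha> t x) = sg (FOb A' t') (n * p) (\<alpha> t' (FMor A t t' a x))"
      using sg_dg_sum[OF P'.A_mod[OF t(2)] P'.B_mod[OF b] \<alpha>c[OF t(2) dg_mod_closed[OF P.A t ac x]] \<beta>c[OF b zB(1)[OF b]]] by simp
  qed
  have \<beta>: "\<beta> \<in> mnat_deg K U B B' n"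
  proof (rule mnat_degI[OF P.B P'.B])
    show "\<beta> \<in> extensional (Ob U)" by (simp add: \<beta>_def)
    show "\<beta> u \<in> hom_deg K (FOb B u) (FOb B' u) n" if u: "u \<in> Ob U" for u
    proof (rule hom_degI[OF klinI])
      have b: "t0 \<in> Ob T" using t0 u by metis
      interpret At: gr_module K "FOb A t0" by (rule P.A_gr[OF b])
      interpret Bu: gr_module K "FOb B u" by (rule P.B_gr[OF u])
      note k = \<eta>k[OF b u zA(1)[OF b] zB(1)[OF u]]
      show "\<beta> u y \<in> carrier (FOb B' u)" if "y \<in> carrier (FOb B u)" for y by (rule \<beta>c[OF u that])
      show "\<beta> u (x \<oplus>\<^bsub>FOb B u\<^esub> y) = \<beta> u x \<oplus>\<^bsub>FOb B' u\<^esub> \<beta> u y" if "x \<in> carrier (FOb B u)" "y \<in> carrier (FOb B u)" for x y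
        using klin_add[OF k, of "(\<zero>\<^bsub>FOb A t0\<^esub>, x)" "(\<zero>\<^bsub>FOb A t0\<^esub>, y)"] that diag[OF b u zA(1)[OF b]] by simp
      show "\<beta> u (a \<odot>\<^bsub>FOb B u\<^esub> x) = a \<odot>\<^bsub>FOb B' u\<^esub> \<beta> u x" if "a \<in> carrier K" "x \<in> carrier (FOb B u)" for a x
        using klin_smult[OF k, of a "(\<zero>\<^bsub>FOb A t0\<^esub>, x)"] that diag[OF b u zA(1)[OF b]] by simp
      show "\<beta> u y \<in> grade (FOb B' u) (p + n)" if "y \<in> grade (FOb B u) p" for p y
        using \<eta>g[OF b u zA(1)[OF b] Bu.grade_carrier[OF that] At.grade_zero that] diag[OF b u zA(1)[OF b] Bu.grade_carrier[OF that]] by simp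
    qed (use u in \<open>simp add: \<beta>_def\<close>)
    fix u u' h p y assume u: "u \<in> Ob U" "u' \<in> Ob U" and h: "h \<in> grade (Hom U u u') p" and y: "y \<in> carrier (FOb B u)"
    have b: "t0 \<in> Ob T" using t0 u by metis
    note hc = gr_module.grade_carrier[OF U.gr_hom_module[OF u] h]
    have "(\<zero>\<^bsub>FOb A' t0\<^esub>, FMor B' u u' h (\<beta> u y)) = sg (dg_sum (FOb A' t0) (FOb B' u')) (n * p) (\<alpha> t0 \<zero>\<^bsub>FOb A t0\<^esub>, \<beta> u' (FMor B u u' h y))"
      using nat[OF b u(1) b u(2) E_grade(3)[OF b u(1) b u(2) h] zA(1)[OF b] y] diag[OF b u(1) zA(1)[OF b] y]
        diag[OF b u(2) zA(1)[OF b] dg_mod_closed[OF P.B u hc y]] amalg_E(3)[OF b u(1) b u(2) X zA(1)[OF b] y hc]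
        amalg_E(3)[OF b u(1) b u(2) X' \<alpha>c[OF b zA(1)[OF b]] \<beta>c[OF u(1) y] hc] by simp
    then show "FMor B' u u' h (\<beta> u y) = sg (FOb B' u') (n * p) (\<beta> u' (FMor B u u' h y))"
      using sg_dg_sum[OF P'.A_mod[OF b] P'.B_mod[OF u(2)] \<alpha>c[OF b zA(1)[OF b]] \<beta>c[OF u(2) dg_mod_closed[OF P.B u hc y]]] by simp
  qed
  have "comma_square A f B A' f' B' \<alpha> \<beta>"
    unfolding comma_square_iff_dot[OF X X' \<alpha> \<beta>]
  proof (intro ballI allI)
    fix u t p m x assume u: "u \<in> Ob U" and t: "t \<in> Ob T" and m: "m \<in> grade (MM u t) p" and x: "x \<in> carrier (FOb A t)"
    note b = t0[OF u] u0[OF t]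
    note mc = gr_module.grade_carrier[OF M_gr[OF u t] m] and z = zA(1)[OF b(1)] zB(1)[OF b(2)]
    note mx = P.pair_closed[OF u t mc x]
    \<comment> \<open>Naturality for the unit with entry m, from (t, u0) to (t0, u); the second
      coordinate gives the comma square with its sign.\<close>
    have "(\<zero>\<^bsub>FOb A' t0\<^esub>, dot M (A', f', B') u t m (\<alpha> t x)) =
        sg (dg_sum (FOb A' t0) (FOb B' u)) (n * p) (\<alpha> t0 \<zero>\<^bsub>FOb A t0\<^esub>, \<beta> u (dot M (A, f, B) u t m x))"
      using nat[OF t b(2,1) u E_grade(2)[OF t b(2,1) u m] x z(2)] diag[OF t b(2) x z(2)] diag[OF b(1) u z(1) mx]
        amalg_E(2)[OF t b(2,1) u X x z(2) mc] amalg_E(2)[OF t b(2,1) u X' \<alpha>c[OF t x] \<beta>c[OF b(2) z(2)] mc] by simp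
    then show "dot M (A', f', B') u t m (\<alpha> t x) = sg (FOb B' u) (n * p) (\<beta> u (dot M (A, f, B) u t m x))"
      using sg_dg_sum[OF P'.A_mod[OF b(1)] P'.B_mod[OF u] \<alpha>c[OF b(1) z(1)] \<beta>c[OF u mx]] by simp
  qed
  then have ab: "(\<alpha>, \<beta>) \<in> comma_deg K T U M (A, f, B) (A', f', B') n"
    by (simp add: comma_deg_iff[OF X X'] \<alpha> \<beta>)
  have "FMor FFT (A, f, B) (A', f', B') (\<alpha>, \<beta>) = \<eta>"
  proof (rule extensionalityI[of _ "Ob LL"])
    show "FMor FFT (A, f, B) (A', f', B') (\<alpha>, \<beta>) \<in> extensional (Ob LL)" by (simp add: FF_simps Lam_simps)
    show "\<eta> \<in> extensional (Ob LL)" by (rule \<eta>D(1))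
    fix Z assume Z: "Z \<in> Ob LL"
    obtain t u where e: "Z = (t, u)" and ob: "t \<in> Ob T" "u \<in> Ob U" using Z by (cases Z) (auto simp: Lam_simps)
    show "FMor FFT (A, f, B) (A', f', B') (\<alpha>, \<beta>) Z = \<eta> Z"
    proof (rule extensionalityI[of _ "carrier (dg_sum (FOb A t) (FOb B u))"])
      show "\<eta> Z \<in> extensional (carrier (dg_sum (FOb A t) (FOb B u)))"
        using hom_degD(2)[OF \<eta>D(2)[OF Z]] by (simp add: e amalg_simps)
    qed (use ob diag in \<open>auto simp: e FF_simps\<close>)
  qed
  with ab show ?thesis by blast
qed

end

end

section \<open>Splitting idempotents\<close>

definition dg_map :: "'k ring \<Rightarrow> ('k, 'v) dgmod \<Rightarrow> ('k, 'w) dgmod \<Rightarrow> ('v \<Rightarrow> 'w) \<Rightarrow> bool" where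
  "dg_map K M N f \<longleftrightarrow> klin K M N f \<and> (\<forall>n. \<forall>x\<in>grade M n. f x \<in> grade N n) \<and> (\<forall>x\<in>carrier M. f (dif M x) = dif N (f x))"

lemma dg_mapD:
  assumes "dg_map K M N f"
  shows "klin K M N f" "x \<in> carrier M \<Longrightarrow> f x \<in> carrier N" "x \<in> grade M n \<Longrightarrow> f x \<in> grade N n"
    "x \<in> carrier M \<Longrightarrow> f (dif M x) = dif N (f x)"
  using assms by (auto simp: dg_map_def klin_closed)

text \<open>The image of an idempotent, given by retraction data instead of as a subset, so that S
  may live in another type than P.\<close>

definition dg_splitting :: "'k ring \<Rightarrow> ('k, 'w) dgmod \<Rightarrow> ('w \<Rightarrow> 'w) \<Rightarrow> ('k, 'v) dgmod \<Rightarrow> ('v \<Rightarrow> 'w) \<Rightarrow> ('w \<Rightarrow> 'v) \<Rightarrow> bool" where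
  "dg_splitting K P e S \<iota> \<pi> \<longleftrightarrow> dg_module K S \<and> dg_map K S P \<iota> \<and> dg_map K P S \<pi> \<and>
     (\<forall>s\<in>carrier S. \<pi> (\<iota> s) = s) \<and> (\<forall>x\<in>carrier P. \<iota> (\<pi> x) = e x)"

text \<open>The injection \<open>j\<close> brings modules with values in \<open>'v \<times> 'v\<close> back into the universe \<open>'v\<close>.\<close>

lemma dg_splitting_exists:
  fixes P :: "('k, 'w) dgmod" and j :: "'w \<Rightarrow> 'v"
  assumes P: "dg_module K P" and j: "inj j" and e: "dg_map K P P e" and idem: "\<And>x. x \<in> carrier P \<Longrightarrow> e (e x) = e x"
  shows "\<exists>(S :: ('k, 'v) dgmod) \<iota> \<pi>. dg_splitting K P e S \<iota> \<pi>"
proof -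
  interpret P: dg_module K P by (rule P)
  interpret Pg: gr_module K P by (rule dg_module_gr_module[OF P])
  note ek = dg_mapD(1)[OF e] and ec = dg_mapD(2)[OF e] and eg = dg_mapD(3)[OF e] and ed = dg_mapD(4)[OF e]
  note mP = P.module_axioms
  define r where "r = inv_into UNIV j"
  have rj: "r (j x) = x" for x using j by (simp add: r_def)
  \<comment> \<open>Fixed points of e, renamed along j; since e is idempotent they form its image.
    The operations decode with the left inverse r of j.\<close>
  define S :: "('k, 'v) dgmod" where
    "S = \<lparr>carrier = j ` {x \<in> carrier P. e x = x}, mult = undefined, one = undefined, zero = j \<zero>\<^bsub>P\<^esub>,
      add = (\<lambda>s s'. j (r s \<oplus>\<^bsub>P\<^esub> r s')), smult = (\<lambda>a s. j (a \<odot>\<^bsub>P\<^esub> r s)),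
      grade = (\<lambda>n. j ` {x \<in> grade P n. e x = x}), dif = (\<lambda>s. j (dif P (r s)))\<rparr>"
  have S [simp]: "carrier S = j ` {x \<in> carrier P. e x = x}" "zero S = j \<zero>\<^bsub>P\<^esub>" "add S = (\<lambda>s s'. j (r s \<oplus>\<^bsub>P\<^esub> r s'))"
    "smult S = (\<lambda>a s. j (a \<odot>\<^bsub>P\<^esub> r s))" "grade S = (\<lambda>n. j ` {x \<in> grade P n. e x = x})" "dif S = (\<lambda>s. j (dif P (r s)))"
    by (simp_all add: S_def)
  have e0: "e \<zero>\<^bsub>P\<^esub> = \<zero>\<^bsub>P\<^esub>" by (rule klin_zero[OF mP mP ek])
  note eadd = klin_add[OF ek] and esm = klin_smult[OF ek]
  have mS: "module K S"
  proof (rule moduleI[OF P.R.is_cring])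
    show "abelian_group S"
    proof (rule abelian_groupI)
      fix s assume "s \<in> carrier S"
      then obtain x where x: "s = j x" "x \<in> carrier P" "e x = x" by auto
      show "\<exists>s'\<in>carrier S. s' \<oplus>\<^bsub>S\<^esub> s = \<zero>\<^bsub>S\<^esub>"
        by (rule bexI[of _ "j (\<ominus>\<^bsub>P\<^esub> x)"]) (simp_all add: x rj P.l_neg klin_minus[OF mP mP ek])
    qed (auto simp: rj e0 eadd P.a_assoc intro!: arg_cong[of _ _ j] intro: P.a_comm)
  qed (auto simp: rj esm eadd P.smult_l_distr P.smult_r_distr P.smult_assoc1)
  interpret mS: module K S by (rule mS)
  have subS: "submodule (grade S n) K S" for n
    by (rule submoduleI'[OF mS]) (auto simp: rj e0 eadd esm Pg.grade_carrier Pg.grade_zero Pg.grade_add Pg.grade_smult)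
  note FS = mS.submodule_fin_sums[of "grade S", OF subS]
  have grS: "gr_module K S"
  proof (rule gr_module_unique_sumI[where I = "\<lambda>_. UNIV :: unit set" and Q = "\<lambda>_ _. P" and ev = "\<lambda>m _ s. hcomp P (r s) m", OF mS subS])
    \<comment> \<open>Stated for e x with x arbitrary, since the induction decomposes x inside P,
      where summands need not be fixed by e.\<close>
    have "j (e x) \<in> fin_sums \<zero>\<^bsub>S\<^esub> (add S) (\<Union>n. grade S n)" if "x \<in> carrier P" for x
      using that
    proof (induction rule: Pg.homog_induct)
      case (homog n x)
      then have "j (e x) \<in> grade S n" using idem eg Pg.grade_carrier by auto
      then show ?case using FS(2) by blast
    next
      case (add x y)
      have "j (e (x \<oplus>\<^bsub>P\<^esub> y)) = j (e x) \<oplus>\<^bsub>S\<^esub> j (e y)" using add by (simp add: eadd rj)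
      then show ?case using mS.submoduleE(5)[OF FS(1) add(3,4)] by simp
    qed
    note gen = this
    fix s assume "s \<in> carrier S"
    then obtain x where x: "s = j x" "x \<in> carrier P" "e x = x" by auto
    show "s \<in> fin_sums \<zero>\<^bsub>S\<^esub> (add S) (\<Union>n. grade S n)" using gen[OF x(2)] x by simp
  next
    show "s = \<zero>\<^bsub>S\<^esub>" if "s \<in> grade S m" "\<And>i. i \<in> (UNIV :: unit set) \<Longrightarrow> hcomp P (r s) m = \<zero>\<^bsub>P\<^esub>" for m s
      using that by (auto simp: rj Pg.hcomp_homog)
  qed (auto simp: rj Pg.hcomp_closed Pg.hcomp_add Pg.hcomp_homog module_abelian_group[OF mP])
  have dS: "dg_module K S"
    by (rule dg_moduleI[OF grS]) (auto simp: klin_def rj ed P.dif_closed P.dif_add P.dif_smult P.dif_grade P.dif_dif Pg.grade_carrier)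
  have "dg_splitting K P e S r (\<lambda>x. j (e x))"
    using dS by (auto simp: dg_splitting_def dg_map_def klin_def rj ec eg eadd esm ed idem Pg.grade_carrier)
  then show ?thesis by blast
qed

section \<open>Restriction along a functor that does not preserve identities\<close>

text \<open>The restriction of \<open>N\<close> along such a functor takes its values on the images of the idempotents
  that the identities are sent to.\<close>

lemma corner_functor:
  fixes N :: "('k, 'o, 'h, 'w) dgm" and j :: "'w \<Rightarrow> 'v" and \<Phi>o :: "'to \<Rightarrow> 'o" and \<Phi> :: "'to \<Rightarrow> 'to \<Rightarrow> 'th \<Rightarrow> 'h"
  assumes T: "dg_category K T" and N: "dg_functor K C (DgModK K) N" and Q: "dg_quiver K C" and j: "inj j"
    and ob: "\<And>t. t \<in> Ob T \<Longrightarrow> \<Phi>o t \<in> Ob C"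
    and map: "\<And>t t'. t \<in> Ob T \<Longrightarrow> t' \<in> Ob T \<Longrightarrow> dg_map K (Hom T t t') (Hom C (\<Phi>o t) (\<Phi>o t')) (\<Phi> t t')"
    and comp: "\<And>t t' t'' a b. t \<in> Ob T \<Longrightarrow> t' \<in> Ob T \<Longrightarrow> t'' \<in> Ob T \<Longrightarrow> b \<in> carrier (Hom T t' t'') \<Longrightarrow> a \<in> carrier (Hom T t t') \<Longrightarrow>
      Comp C (\<Phi>o t) (\<Phi>o t') (\<Phi>o t'') (\<Phi> t' t'' b) (\<Phi> t t' a) = \<Phi> t t'' (Comp T t t' t'' b a)"
  shows "\<exists>(A :: ('k, 'to, 'th, 'v) dgm) \<iota> \<pi>. dg_functor K T (DgModK K) A \<and>
    (\<forall>t\<in>Ob T. dg_splitting K (FOb N (\<Phi>o t)) (FMor N (\<Phi>o t) (\<Phi>o t) (\<Phi> t t (Id T t))) (FOb A t) (\<iota> t) (\<pi> t)) \<and>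
    (\<forall>t\<in>Ob T. \<forall>t'\<in>Ob T. \<forall>a\<in>carrier (Hom T t t'). \<forall>x\<in>carrier (FOb A t).
      FMor A t t' a x = \<pi> t' (FMor N (\<Phi>o t) (\<Phi>o t') (\<Phi> t t' a) (\<iota> t x)))"
proof -
  interpret T: dg_category K T by (rule T)
  define P where "P t = FOb N (\<Phi>o t)" for t
  define n where "n t t' a = FMor N (\<Phi>o t) (\<Phi>o t') (\<Phi> t t' a)" for t t' a
  \<comment> \<open>The action of the image of an identity, in general only an idempotent.\<close>
  define e where "e t = n t t (Id T t)" for t
  have P: "dg_module K (P t)" if "t \<in> Ob T" for t
    unfolding P_def by (rule dg_mod_ob[OF N ob[OF that]])
  note Pm = dg_module_module[OF P] and Pg = dg_module_gr_module[OF P]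
  have ncomp: "n t' t'' b (n t t' a x) = n t t'' (Comp T t t' t'' b a) x"
    if "t \<in> Ob T" "t' \<in> Ob T" "t'' \<in> Ob T" "b \<in> carrier (Hom T t' t'')" "a \<in> carrier (Hom T t t')" "x \<in> carrier (P t)" for t t' t'' b a x
    using dg_mod_comp[OF N ob[OF that(1)] ob[OF that(2)] ob[OF that(3)] dg_mapD(2)[OF map[OF that(2,3)] that(4)]
        dg_mapD(2)[OF map[OF that(1,2)] that(5)], of x] that comp[OF that(1-5)] by (simp add: n_def P_def)
  have nk: "klin K (P t) (P t') (n t t' a)" if "t \<in> Ob T" "t' \<in> Ob T" "a \<in> carrier (Hom T t t')" for t t' a
    unfolding n_def P_def by (rule dg_mod_klin(1)[OF N ob[OF that(1)] ob[OF that(2)] dg_mapD(2)[OF map[OF that(1,2)] that(3)]])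
  have nk': "klin K (Hom T t t') (P t') (\<lambda>a. n t t' a x)" if "t \<in> Ob T" "t' \<in> Ob T" "x \<in> carrier (P t)" for t t' x
    unfolding n_def P_def using klin_comp[OF dg_mapD(1)[OF map[OF that(1,2)]] dg_mod_klin'[OF N ob[OF that(1)] ob[OF that(2)]]] that(3)
    by (simp add: P_def)
  have ng: "n t t' a x \<in> grade (P t') (q + p)" if "t \<in> Ob T" "t' \<in> Ob T" "a \<in> grade (Hom T t t') p" "x \<in> grade (P t) q" for t t' a x p q
    using dg_mod_grade[OF N ob[OF that(1)] ob[OF that(2)] dg_mapD(3)[OF map[OF that(1,2)] that(3)]] that(4) by (simp add: n_def P_def)
  have nd: "dif (P t') (n t t' a x) = n t t' (dif (Hom T t t') a) x \<oplus>\<^bsub>P t'\<^esub> sg (P t') p (n t t' a (dif (P t) x))"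
    if o: "t \<in> Ob T" "t' \<in> Ob T" and a: "a \<in> grade (Hom T t t') p" and x: "x \<in> carrier (P t)" for t t' a x p
  proof -
    note ac = gr_module.grade_carrier[OF T.gr_hom_module[OF o] a]
    show ?thesis
      using dg_mod_dif[OF N ob[OF o(1)] ob[OF o(2)] dg_mapD(2)[OF map[OF o] ac] dg_mapD(3)[OF map[OF o] a]] x dg_mapD(4)[OF map[OF o] ac]
      by (simp add: n_def P_def)
  qed
  have e: "dg_map K (P t) (P t) (e t)" and idem: "\<And>x. x \<in> carrier (P t) \<Longrightarrow> e t (e t x) = e t x" if t: "t \<in> Ob T" for t
  proof -
    note i = T.id_closed[OF t] and ig = T.id_grade[OF t]
    have z: "n t t \<zero>\<^bsub>Hom T t t\<^esub> x = \<zero>\<^bsub>P t\<^esub>" if "x \<in> carrier (P t)" for x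
      by (rule klin_zero[OF T.mod_hom[OF t t] Pm[OF t] nk'[OF t t that]])
    have "e t (dif (P t) x) = dif (P t) (e t x)" if x: "x \<in> carrier (P t)" for x
    proof -
      interpret Pt: dg_module K "P t" by (rule P[OF t])
      show ?thesis using nd[OF t t ig x] klin_closed[OF nk[OF t t i] Pt.dif_closed[OF x]] by (simp add: e_def T.dif_id[OF t] z[OF x])
    qed
    moreover have "e t x \<in> grade (P t) q" if "x \<in> grade (P t) q" for x q
      using ng[OF t t ig that] by (simp add: e_def)
    ultimately show "dg_map K (P t) (P t) (e t)" using nk[OF t t i] by (simp add: dg_map_def e_def)
    show "e t (e t x) = e t x" if "x \<in> carrier (P t)" for x
      using ncomp[OF t t t i i that] by (simp add: e_def T.id_left[OF t t i])
  qed
  have "\<exists>z :: ('k, 'v) dgmod \<times> ('v \<Rightarrow> 'w) \<times> ('w \<Rightarrow> 'v). dg_splitting K (P t) (e t) (fst z) (fst (snd z)) (snd (snd z))" if "t \<in> Ob T" for t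
    using dg_splitting_exists[OF P[OF that] j e[OF that] idem[OF that]] by force
  then obtain z :: "'to \<Rightarrow> ('k, 'v) dgmod \<times> ('v \<Rightarrow> 'w) \<times> ('w \<Rightarrow> 'v)"
    where z: "\<And>t. t \<in> Ob T \<Longrightarrow> dg_splitting K (P t) (e t) (fst (z t)) (fst (snd (z t))) (snd (snd (z t)))" by metis
  define S where "S t = fst (z t)" for t
  define \<iota> where "\<iota> t = fst (snd (z t))" for t
  define \<pi> where "\<pi> t = snd (snd (z t))" for t
  have sp: "dg_splitting K (P t) (e t) (S t) (\<iota> t) (\<pi> t)" if "t \<in> Ob T" for t
    using z[OF that] by (simp add: S_def \<iota>_def \<pi>_def)
  have S: "dg_module K (S t)" and \<iota>: "dg_map K (S t) (P t) (\<iota> t)" and \<pi>: "dg_map K (P t) (S t) (\<pi> t)"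
    and \<pi>\<iota>: "\<And>s. s \<in> carrier (S t) \<Longrightarrow> \<pi> t (\<iota> t s) = s" and \<iota>\<pi>: "\<And>x. x \<in> carrier (P t) \<Longrightarrow> \<iota> t (\<pi> t x) = e t x" if "t \<in> Ob T" for t
    using sp[OF that] by (simp_all add: dg_splitting_def)
  note \<iota>c = dg_mapD(2)[OF \<iota>] and \<pi>k = dg_mapD(1)[OF \<pi>]
  define A where "A = \<lparr>FOb = S, FMor = (\<lambda>t t' a. \<lambda>x\<in>carrier (S t). \<pi> t' (n t t' a (\<iota> t x)))\<rparr>"
  have As: "FOb A = S" "FMor A t t' a = (\<lambda>x\<in>carrier (S t). \<pi> t' (n t t' a (\<iota> t x)))" for t t' a
    by (simp_all add: A_def)
  have "dg_functor K T (DgModK K) A"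
  proof (rule dg_mod_functorI, unfold As)
    fix t t' assume o: "t \<in> Ob T" "t' \<in> Ob T"
    show "dg_module K (Hom T t t')" by (rule T.hom_dg_module[OF o])
    show "dg_module K (S t)" by (rule S[OF o(1)])
    show "klin K (S t) (S t') (\<lambda>x\<in>carrier (S t). \<pi> t' (n t t' a (\<iota> t x)))" if a: "a \<in> carrier (Hom T t t')" for a
      using klin_comp[OF klin_comp[OF dg_mapD(1)[OF \<iota>[OF o(1)]] nk[OF o a]] \<pi>k[OF o(2)]]
        klin_cong[OF dg_module_module[OF S[OF o(1)]], of "\<lambda>x\<in>carrier (S t). \<pi> t' (n t t' a (\<iota> t x))"] by simp
    show "(\<lambda>x\<in>carrier (S t). \<pi> t' (n t t' a (\<iota> t x))) \<in> extensional (carrier (S t))" for a by simp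
    show "klin K (Hom T t t') (S t') (\<lambda>a. (\<lambda>x\<in>carrier (S t). \<pi> t' (n t t' a (\<iota> t x))) x)" if x: "x \<in> carrier (S t)" for x
      using klin_comp[OF nk'[OF o \<iota>c[OF o(1) x]] \<pi>k[OF o(2)]] x by simp
    show "(\<lambda>x\<in>carrier (S t). \<pi> t (n t t (Id T t) (\<iota> t x))) x = x" if x: "x \<in> carrier (S t)" for x
      using \<iota>\<pi>[OF o(1) \<iota>c[OF o(1) x]] \<pi>\<iota>[OF o(1) x] x by (simp add: e_def)
    show "Id T t \<in> carrier (Hom T t t)" by (rule T.id_closed[OF o(1)])
  next
    fix t t' t'' b a x assume o: "t \<in> Ob T" "t' \<in> Ob T" "t'' \<in> Ob T" and b: "b \<in> carrier (Hom T t' t'')" and a: "a \<in> carrier (Hom T t t')"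
      and x: "x \<in> carrier (S t)"
    note ac = klin_closed[OF nk[OF o(1,2) a] \<iota>c[OF o(1) x]]
    \<comment> \<open>Between the two actions stands \<iota> \<pi> = e, which is absorbed because id
      \<circ> a = a.\<close>
    have "n t' t'' b (\<iota> t' (\<pi> t' (n t t' a (\<iota> t x)))) = n t t'' (Comp T t t' t'' b a) (\<iota> t x)"
      unfolding \<iota>\<pi>[OF o(2) ac] e_def
      using ncomp[OF o(1,2,2) T.id_closed[OF o(2)] a \<iota>c[OF o(1) x]] ncomp[OF o b a \<iota>c[OF o(1) x]] T.id_left[OF o(1,2) a] by simp
    then show "(\<lambda>x\<in>carrier (S t). \<pi> t'' (n t t'' (Comp T t t' t'' b a) (\<iota> t x))) x =
        (\<lambda>x\<in>carrier (S t'). \<pi> t'' (n t' t'' b (\<iota> t' x))) ((\<lambda>x\<in>carrier (S t). \<pi> t' (n t t' a (\<iota> t x))) x)"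
      using x klin_closed[OF \<pi>k[OF o(2)] ac] by simp
  next
    show "Comp T t t' t'' b a \<in> carrier (Hom T t t'')"
      if "t \<in> Ob T" "t' \<in> Ob T" "t'' \<in> Ob T" "b \<in> carrier (Hom T t' t'')" "a \<in> carrier (Hom T t t')" for t t' t'' b a
      by (rule T.comp_closed[OF that])
  next
    fix t t' p a q x assume o: "t \<in> Ob T" "t' \<in> Ob T" and a: "a \<in> grade (Hom T t t') p" and x: "x \<in> grade (S t) q"
    note ac = gr_module.grade_carrier[OF T.gr_hom_module[OF o] a] and xc = gr_module.grade_carrier[OF dg_module_gr_module[OF S[OF o(1)]] x]
    show "(\<lambda>x\<in>carrier (S t). \<pi> t' (n t t' a (\<iota> t x))) x \<in> grade (S t') (q + p)"
      using dg_mapD(3)[OF \<pi>[OF o(2)] ng[OF o a dg_mapD(3)[OF \<iota>[OF o(1)] x]]] xc by simp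
  next
    fix t t' p a q x assume o: "t \<in> Ob T" "t' \<in> Ob T" and a: "a \<in> grade (Hom T t t') p" and xg: "x \<in> grade (S t) q"
    note x = gr_module.grade_carrier[OF dg_module_gr_module[OF S[OF o(1)]] xg]
    note ac = gr_module.grade_carrier[OF T.gr_hom_module[OF o] a] and dac = dif_carrier[OF T.hom_dg_module[OF o]]
    note xc = \<iota>c[OF o(1) x] and dx = dif_carrier[OF S[OF o(1)] x]
    note nc = klin_closed[OF nk[OF o ac]]
    have ag: "abelian_group (P t')" by (rule module_abelian_group[OF Pm[OF o(2)]])
    show "dif (S t') ((\<lambda>x\<in>carrier (S t). \<pi> t' (n t t' a (\<iota> t x))) x) =
        (\<lambda>x\<in>carrier (S t). \<pi> t' (n t t' (dif (Hom T t t') a) (\<iota> t x))) x \<oplus>\<^bsub>S t'\<^esub>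
        sg (S t') p ((\<lambda>x\<in>carrier (S t). \<pi> t' (n t t' a (\<iota> t x))) (dif (S t) x))"
      using x dx nd[OF o a xc] dg_mapD(4)[OF \<iota>[OF o(1)] x] dg_mapD(4)[OF \<pi>[OF o(2)] nc[OF xc]]
        klin_add[OF \<pi>k[OF o(2)] klin_closed[OF nk[OF o dac[OF ac]] xc] sg_closed[OF ag nc[OF \<iota>c[OF o(1) dx]], of p]]
        klin_sg[OF Pm[OF o(2)] dg_module_module[OF S[OF o(2)]] \<pi>k[OF o(2)] nc[OF \<iota>c[OF o(1) dx]], of p]
      by simp
  qed
  then show ?thesis
    using sp by (intro exI[of _ A] exI[of _ \<iota>] exI[of _ \<pi>]) (simp add: As P_def e_def n_def)
qed

lemma (in dg_category) comp_zero:
  assumes "X \<in> Ob C" "Y \<in> Ob C" "Z \<in> Ob C"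
  shows "g \<in> carrier (Hom C Y Z) \<Longrightarrow> Comp C X Y Z g \<zero>\<^bsub>Hom C X Y\<^esub> = \<zero>\<^bsub>Hom C X Z\<^esub>"
    and "f \<in> carrier (Hom C X Y) \<Longrightarrow> Comp C X Y Z \<zero>\<^bsub>Hom C Y Z\<^esub> f = \<zero>\<^bsub>Hom C X Z\<^esub>"
  using klin_zero[OF mod_hom mod_hom klin_comp_left] klin_zero[OF mod_hom mod_hom klin_comp_right] assms by simp_all

section \<open>The comparison functor is essentially surjective\<close>

context dg_bimodule
begin

context
  fixes t u t' u' t'' u''
  assumes ob: "t \<in> Ob T" "u \<in> Ob U" "t' \<in> Ob T" "u' \<in> Ob U" "t'' \<in> Ob T" "u'' \<in> Ob U"
begin

private lemma zeros:
  "\<zero>\<^bsub>Hom T t t'\<^esub> \<in> carrier (Hom T t t')" "\<zero>\<^bsub>Hom T t' t''\<^esub> \<in> carrier (Hom T t' t'')" "\<zero>\<^bsub>Hom U u u'\<^esub> \<in> carrier (Hom U u u')"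
  "\<zero>\<^bsub>Hom U u' u''\<^esub> \<in> carrier (Hom U u' u'')" "\<zero>\<^bsub>MM u' t\<^esub> \<in> carrier (MM u' t)" "\<zero>\<^bsub>MM u'' t'\<^esub> \<in> carrier (MM u'' t')"
  using abelian_groupE(2)[OF module_abelian_group] T.mod_hom U.mod_hom M_mod ob by blast+

private lemma MM_zero: "\<zero>\<^bsub>MM u'' t\<^esub> \<oplus>\<^bsub>MM u'' t\<^esub> \<zero>\<^bsub>MM u'' t\<^esub> = \<zero>\<^bsub>MM u'' t\<^esub>"
  "m \<in> carrier (MM u'' t) \<Longrightarrow> \<zero>\<^bsub>MM u'' t\<^esub> \<oplus>\<^bsub>MM u'' t\<^esub> m = m" "m \<in> carrier (MM u'' t) \<Longrightarrow> m \<oplus>\<^bsub>MM u'' t\<^esub> \<zero>\<^bsub>MM u'' t\<^esub> = m"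
proof -
  interpret N: module K "MM u'' t" by (rule M_mod[OF ob(6,1)])
  show "\<zero>\<^bsub>MM u'' t\<^esub> \<oplus>\<^bsub>MM u'' t\<^esub> \<zero>\<^bsub>MM u'' t\<^esub> = \<zero>\<^bsub>MM u'' t\<^esub>"
    "m \<in> carrier (MM u'' t) \<Longrightarrow> \<zero>\<^bsub>MM u'' t\<^esub> \<oplus>\<^bsub>MM u'' t\<^esub> m = m" "m \<in> carrier (MM u'' t) \<Longrightarrow> m \<oplus>\<^bsub>MM u'' t\<^esub> \<zero>\<^bsub>MM u'' t\<^esub> = m"
    by simp_all
qed

private lemma bullet_zero:
  "m \<in> carrier (MM u'' t') \<Longrightarrow> bullet u'' t t' m \<zero>\<^bsub>Hom T t t'\<^esub> = \<zero>\<^bsub>MM u'' t\<^esub>"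
  "a \<in> carrier (Hom T t t') \<Longrightarrow> bullet u'' t t' \<zero>\<^bsub>MM u'' t'\<^esub> a = \<zero>\<^bsub>MM u'' t\<^esub>"
  using klin_zero[OF T.mod_hom[OF ob(1,3)] M_mod[OF ob(6,1)] kbilinD2[OF kbilin_bullet[OF ob(6,1,3)]]]
    klin_zero[OF M_mod[OF ob(6,3)] M_mod[OF ob(6,1)] kbilinD1[OF kbilin_bullet[OF ob(6,1,3)]]] by auto

private lemma L_zero:
  "b \<in> carrier (Hom U u' u'') \<Longrightarrow> L u' u'' t b \<zero>\<^bsub>MM u' t\<^esub> = \<zero>\<^bsub>MM u'' t\<^esub>"
  "m \<in> carrier (MM u' t) \<Longrightarrow> L u' u'' t \<zero>\<^bsub>Hom U u' u''\<^esub> m = \<zero>\<^bsub>MM u'' t\<^esub>"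
  using klin_zero[OF M_mod[OF ob(4,1)] M_mod[OF ob(6,1)] L_klin[OF ob(4,6,1)]]
    klin_zero[OF U.mod_hom[OF ob(4,6)] M_mod[OF ob(6,1)] L_klin'[OF ob(4,6,1)]] by auto

private lemmas z = zeros MM_zero bullet_zero L_zero T.comp_zero[OF ob(1,3,5)] U.comp_zero[OF ob(2,4,6)]

text \<open>The multiplication table of matrix units. The last two rows multiply an arbitrary matrix
  by a diagonal unit, which selects its first or second column.\<close>

lemma Lam_comp_E:
  "b \<in> carrier (Hom T t' t'') \<Longrightarrow> a \<in> carrier (Hom T t t') \<Longrightarrow>
    Comp LL (t, u) (t', u') (t'', u'') (E11 t' u' t'' u'' b) (E11 t u t' u' a) = E11 t u t'' u'' (Comp T t t' t'' b a)"
  "m \<in> carrier (MM u'' t') \<Longrightarrow> a \<in> carrier (Hom T t t') \<Longrightarrow>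
    Comp LL (t, u) (t', u') (t'', u'') (E21 t' u' t'' u'' m) (E11 t u t' u' a) = E21 t u t'' u'' (bullet u'' t t' m a)"
  "c \<in> carrier (Hom U u' u'') \<Longrightarrow> m' \<in> carrier (MM u' t) \<Longrightarrow>
    Comp LL (t, u) (t', u') (t'', u'') (E22 t' u' t'' u'' c) (E21 t u t' u' m') = E21 t u t'' u'' (L u' u'' t c m')"
  "c \<in> carrier (Hom U u' u'') \<Longrightarrow> d \<in> carrier (Hom U u u') \<Longrightarrow>
    Comp LL (t, u) (t', u') (t'', u'') (E22 t' u' t'' u'' c) (E22 t u t' u' d) = E22 t u t'' u'' (Comp U u u' u'' c d)"
  "b \<in> carrier (Hom T t' t'') \<Longrightarrow> d \<in> carrier (Hom U u u') \<Longrightarrow>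
    Comp LL (t, u) (t', u') (t'', u'') (E11 t' u' t'' u'' b) (E22 t u t' u' d) = \<zero>\<^bsub>Hom LL (t, u) (t'', u'')\<^esub>"
  "c \<in> carrier (Hom U u' u'') \<Longrightarrow> a \<in> carrier (Hom T t t') \<Longrightarrow>
    Comp LL (t, u) (t', u') (t'', u'') (E22 t' u' t'' u'' c) (E11 t u t' u' a) = \<zero>\<^bsub>Hom LL (t, u) (t'', u'')\<^esub>"
  "b \<in> carrier (Hom T t' t'') \<Longrightarrow> m \<in> carrier (MM u'' t') \<Longrightarrow> c \<in> carrier (Hom U u' u'') \<Longrightarrow> a \<in> carrier (Hom T t t') \<Longrightarrow>
    Comp LL (t, u) (t', u') (t'', u'') (b, m, c) (E11 t u t' u' a) = (Comp T t t' t'' b a, bullet u'' t t' m a, \<zero>\<^bsub>Hom U u u''\<^esub>)"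
  "b \<in> carrier (Hom T t' t'') \<Longrightarrow> m \<in> carrier (MM u'' t') \<Longrightarrow> c \<in> carrier (Hom U u' u'') \<Longrightarrow> d \<in> carrier (Hom U u u') \<Longrightarrow>
    Comp LL (t, u) (t', u') (t'', u'') (b, m, c) (E22 t u t' u' d) = E22 t u t'' u'' (Comp U u u' u'' c d)"
  by (simp_all add: Lam_simps z bullet_closed[OF ob(6,1,3)] L_closed[OF ob(4,6,1)])

end

section \<open>Reconstructing a comma object from a module over the matrix category\<close>

context
  fixes N :: "('k, 'to \<times> 'uo, 'th \<times> 'm \<times> 'uh, 'w) dgm" and t0 :: 'to and u0 :: 'uo
    and A :: "('k, 'to, 'th, 'v) dgm" and \<iota>A :: "'to \<Rightarrow> 'v \<Rightarrow> 'w" and \<pi>A :: "'to \<Rightarrow> 'w \<Rightarrow> 'v"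
    and B :: "('k, 'uo, 'uh, 'v) dgm" and \<iota>B :: "'uo \<Rightarrow> 'v \<Rightarrow> 'w" and \<pi>B :: "'uo \<Rightarrow> 'w \<Rightarrow> 'v"
  assumes N: "dg_functor K LL (DgModK K) N" and A: "dg_functor K T (DgModK K) A" and B: "dg_functor K U (DgModK K) B"
    and t0: "\<And>u. u \<in> Ob U \<Longrightarrow> t0 \<in> Ob T" and u0: "\<And>t. t \<in> Ob T \<Longrightarrow> u0 \<in> Ob U"
    and spA: "\<And>t. t \<in> Ob T \<Longrightarrow> dg_splitting K (FOb N (t, u0)) (FMor N (t, u0) (t, u0) (E11 t u0 t u0 (Id T t))) (FOb A t) (\<iota>A t) (\<pi>A t)"
    and spB: "\<And>u. u \<in> Ob U \<Longrightarrow> dg_splitting K (FOb N (t0, u)) (FMor N (t0, u) (t0, u) (E22 t0 u t0 u (Id U u))) (FOb B u) (\<iota>B u) (\<pi>B u)"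
    and FA: "\<And>t t' a x. t \<in> Ob T \<Longrightarrow> t' \<in> Ob T \<Longrightarrow> a \<in> carrier (Hom T t t') \<Longrightarrow> x \<in> carrier (FOb A t) \<Longrightarrow>
      FMor A t t' a x = \<pi>A t' (FMor N (t, u0) (t', u0) (E11 t u0 t' u0 a) (\<iota>A t x))"
    and FB: "\<And>u u' b y. u \<in> Ob U \<Longrightarrow> u' \<in> Ob U \<Longrightarrow> b \<in> carrier (Hom U u u') \<Longrightarrow> y \<in> carrier (FOb B u) \<Longrightarrow>
      FMor B u u' b y = \<pi>B u' (FMor N (t0, u) (t0, u') (E22 t0 u t0 u' b) (\<iota>B u y))"
begin

private abbreviation "n11 t u t' u' a \<equiv> FMor N (t, u) (t', u') (E11 t u t' u' a)"
private abbreviation "n21 t u t' u' m \<equiv> FMor N (t, u) (t', u') (E21 t u t' u' m)"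
private abbreviation "n22 t u t' u' b \<equiv> FMor N (t, u) (t', u') (E22 t u t' u' b)"

private lemma obL: "t \<in> Ob T \<Longrightarrow> u \<in> Ob U \<Longrightarrow> (t, u) \<in> Ob LL" by (simp add: Lam_simps)

private lemma N_dg: "t \<in> Ob T \<Longrightarrow> u \<in> Ob U \<Longrightarrow> dg_module K (FOb N (t, u))"
  by (rule dg_mod_ob[OF N obL])

private lemmas N_mod = dg_module_module[OF N_dg]

context
  fixes t u t' u' assumes ob: "t \<in> Ob T" "u \<in> Ob U" "t' \<in> Ob T" "u' \<in> Ob U"
begin

lemma n_klin:
  "a \<in> carrier (Hom T t t') \<Longrightarrow> klin K (FOb N (t, u)) (FOb N (t', u')) (n11 t u t' u' a)"
  "m \<in> carrier (MM u' t) \<Longrightarrow> klin K (FOb N (t, u)) (FOb N (t', u')) (n21 t u t' u' m)"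
  "b \<in> carrier (Hom U u u') \<Longrightarrow> klin K (FOb N (t, u)) (FOb N (t', u')) (n22 t u t' u' b)"
  by (intro dg_mod_klin(1)[OF N obL[OF ob(1,2)] obL[OF ob(3,4)]] E_closed[OF ob]; assumption)+

lemmas n_closed = klin_closed[OF n_klin(1)] klin_closed[OF n_klin(2)] klin_closed[OF n_klin(3)]

lemma n_grade:
  "a \<in> grade (Hom T t t') p \<Longrightarrow> z \<in> grade (FOb N (t, u)) q \<Longrightarrow> n11 t u t' u' a z \<in> grade (FOb N (t', u')) (q + p)"
  "m \<in> grade (MM u' t) p \<Longrightarrow> z \<in> grade (FOb N (t, u)) q \<Longrightarrow> n21 t u t' u' m z \<in> grade (FOb N (t', u')) (q + p)"
  "b \<in> grade (Hom U u u') p \<Longrightarrow> z \<in> grade (FOb N (t, u)) q \<Longrightarrow> n22 t u t' u' b z \<in> grade (FOb N (t', u')) (q + p)"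
  by (intro dg_mod_grade[OF N obL[OF ob(1,2)] obL[OF ob(3,4)]] E_grade[OF ob]; assumption)+

lemma n21_klin': "z \<in> carrier (FOb N (t, u)) \<Longrightarrow> klin K (MM u' t) (FOb N (t', u')) (\<lambda>m. n21 t u t' u' m z)"
  by (rule klin_comp[OF E_klin(2)[OF ob] dg_mod_klin'[OF N obL[OF ob(1,2)] obL[OF ob(3,4)]]])

lemma n_zero: "z \<in> carrier (FOb N (t, u)) \<Longrightarrow> FMor N (t, u) (t', u') \<zero>\<^bsub>Hom LL (t, u) (t', u')\<^esub> z = \<zero>\<^bsub>FOb N (t', u')\<^esub>"
  using klin_zero[OF dg_module_module[OF dg_quiver_hom[OF quiver_Lam obL[OF ob(1,2)] obL[OF ob(3,4)]]] N_mod[OF ob(3,4)]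
      dg_mod_klin'[OF N obL[OF ob(1,2)] obL[OF ob(3,4)]]] .

lemma n21_dif:
  "m \<in> grade (MM u' t) p \<Longrightarrow> z \<in> carrier (FOb N (t, u)) \<Longrightarrow> dif (FOb N (t', u')) (n21 t u t' u' m z) =
    n21 t u t' u' (dif (MM u' t) m) z \<oplus>\<^bsub>FOb N (t', u')\<^esub> sg (FOb N (t', u')) p (n21 t u t' u' m (dif (FOb N (t, u)) z))"
  using dg_mod_dif[OF N obL[OF ob(1,2)] obL[OF ob(3,4)] E_closed(2)[OF ob gr_module.grade_carrier[OF M_gr[OF ob(4,1)]]] E_grade(2)[OF ob]]
    E_dif(2)[OF ob] by simp

end

text \<open>The units with identity entries have degree zero and are closed, so their action
  commutes with d.\<close>

lemma n_dif_one:
  assumes ob: "t \<in> Ob T" "u \<in> Ob U" "t' \<in> Ob T" "u' \<in> Ob U"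
  shows "z \<in> carrier (FOb N (t, u)) \<Longrightarrow> dif (FOb N (t, u')) (n11 t u t u' (Id T t) z) = n11 t u t u' (Id T t) (dif (FOb N (t, u)) z)"
    and "z \<in> carrier (FOb N (t, u)) \<Longrightarrow> dif (FOb N (t', u)) (n22 t u t' u (Id U u) z) = n22 t u t' u (Id U u) (dif (FOb N (t, u)) z)"
proof -
  assume z: "z \<in> carrier (FOb N (t, u))"
  note dz = dif_carrier[OF N_dg[OF ob(1,2)] z]
  note o1 = ob(1,2,1,4) and o2 = ob(1,2,3,2)
  interpret N1: module K "FOb N (t, u')" by (rule N_mod[OF ob(1,4)])
  interpret N2: module K "FOb N (t', u)" by (rule N_mod[OF ob(3,2)])
  have d: "dif (Hom LL (t, u) (t, u')) (E11 t u t u' (Id T t)) = \<zero>\<^bsub>Hom LL (t, u) (t, u')\<^esub>"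
    "dif (Hom LL (t, u) (t', u)) (E22 t u t' u (Id U u)) = \<zero>\<^bsub>Hom LL (t, u) (t', u)\<^esub>"
    unfolding E_dif(1)[OF o1] E_dif(3)[OF o2] T.dif_id[OF ob(1)] U.dif_id[OF ob(2)] by (simp_all add: Lam_simps)
  show "dif (FOb N (t, u')) (n11 t u t u' (Id T t) z) = n11 t u t u' (Id T t) (dif (FOb N (t, u)) z)"
    using dg_mod_dif[OF N obL[OF ob(1,2)] obL[OF ob(1,4)] E_closed(1)[OF o1 T.id_closed[OF ob(1)]] E_grade(1)[OF o1 T.id_grade[OF ob(1)]] z]
      n_zero[OF o1 z] n_closed(1)[OF o1 T.id_closed[OF ob(1)] dz]
    by (simp add: d)
  show "dif (FOb N (t', u)) (n22 t u t' u (Id U u) z) = n22 t u t' u (Id U u) (dif (FOb N (t, u)) z)"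
    using dg_mod_dif[OF N obL[OF ob(1,2)] obL[OF ob(3,2)] E_closed(3)[OF o2 U.id_closed[OF ob(2)]] E_grade(3)[OF o2 U.id_grade[OF ob(2)]] z]
      n_zero[OF o2 z] n_closed(3)[OF o2 U.id_closed[OF ob(2)] dz]
    by (simp add: d)
qed

context
  fixes t u t' u' t'' u'' z
  assumes ob: "t \<in> Ob T" "u \<in> Ob U" "t' \<in> Ob T" "u' \<in> Ob U" "t'' \<in> Ob T" "u'' \<in> Ob U" and z: "z \<in> carrier (FOb N (t, u))"
begin

lemma n_comp: "g \<in> carrier (Hom LL (t', u') (t'', u'')) \<Longrightarrow> f \<in> carrier (Hom LL (t, u) (t', u')) \<Longrightarrow>
    FMor N (t', u') (t'', u'') g (FMor N (t, u) (t', u') f z) = FMor N (t, u) (t'', u'') (Comp LL (t, u) (t', u') (t'', u'') g f) z"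
  using dg_mod_comp[OF N obL[OF ob(1,2)] obL[OF ob(3,4)] obL[OF ob(5,6)] _ _ z] by simp

private lemmas Ec = E_closed[OF ob(1-4)] E_closed[OF ob(3-6)]

lemma n_comp_E:
  "b \<in> carrier (Hom T t' t'') \<Longrightarrow> a \<in> carrier (Hom T t t') \<Longrightarrow>
    n11 t' u' t'' u'' b (n11 t u t' u' a z) = n11 t u t'' u'' (Comp T t t' t'' b a) z"
  "m \<in> carrier (MM u'' t') \<Longrightarrow> a \<in> carrier (Hom T t t') \<Longrightarrow>
    n21 t' u' t'' u'' m (n11 t u t' u' a z) = n21 t u t'' u'' (bullet u'' t t' m a) z"
  "c \<in> carrier (Hom U u' u'') \<Longrightarrow> m' \<in> carrier (MM u' t) \<Longrightarrow>
    n22 t' u' t'' u'' c (n21 t u t' u' m' z) = n21 t u t'' u'' (L u' u'' t c m') z"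
  "c \<in> carrier (Hom U u' u'') \<Longrightarrow> d \<in> carrier (Hom U u u') \<Longrightarrow>
    n22 t' u' t'' u'' c (n22 t u t' u' d z) = n22 t u t'' u'' (Comp U u u' u'' c d) z"
  "b \<in> carrier (Hom T t' t'') \<Longrightarrow> d \<in> carrier (Hom U u u') \<Longrightarrow> n11 t' u' t'' u'' b (n22 t u t' u' d z) = \<zero>\<^bsub>FOb N (t'', u'')\<^esub>"
  "c \<in> carrier (Hom U u' u'') \<Longrightarrow> a \<in> carrier (Hom T t t') \<Longrightarrow> n22 t' u' t'' u'' c (n11 t u t' u' a z) = \<zero>\<^bsub>FOb N (t'', u'')\<^esub>"
  using n_comp[OF Ec(4) Ec(1)] n_comp[OF Ec(5) Ec(1)] n_comp[OF Ec(6) Ec(2)] n_comp[OF Ec(6) Ec(3)] n_comp[OF Ec(4) Ec(3)]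
    n_comp[OF Ec(6) Ec(1)] Lam_comp_E[OF ob] n_zero[OF ob(1,2,5,6) z] by simp_all

end

text \<open>The two diagonal idempotents at (t, u) add up to the identity matrix.\<close>

lemma n_one:
  assumes ob: "t \<in> Ob T" "u \<in> Ob U" and z: "z \<in> carrier (FOb N (t, u))"
  shows "n11 t u t u (Id T t) z \<oplus>\<^bsub>FOb N (t, u)\<^esub> n22 t u t u (Id U u) z = z"
proof -
  note i = T.id_closed[OF ob(1)] U.id_closed[OF ob(2)]
  interpret HT: module K "Hom T t t" by (rule T.mod_hom[OF ob(1,1)])
  interpret HU: module K "Hom U u u" by (rule U.mod_hom[OF ob(2,2)])
  interpret Mg: module K "MM u t" by (rule M_mod[OF ob(2,1)])
  note c = E_closed(1)[OF ob ob i(1)] E_closed(3)[OF ob ob i(2)]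
  have "E11 t u t u (Id T t) \<oplus>\<^bsub>Hom LL (t, u) (t, u)\<^esub> E22 t u t u (Id U u) = Id LL (t, u)"
    using i by (simp add: Lam_simps)
  then show ?thesis
    using klin_add[OF dg_mod_klin'[OF N obL[OF ob] obL[OF ob] z] c] dg_mod_id[OF N obL[OF ob] z] by simp
qed

text \<open>On the upper corner a matrix acts through its first column, which splits into the units
  of a and m.\<close>

lemma n_one_left:
  assumes ob: "t \<in> Ob T" "u \<in> Ob U" "u' \<in> Ob U" "t'' \<in> Ob T" "u'' \<in> Ob U" and z: "z \<in> carrier (FOb N (t, u))"
    and h: "a \<in> carrier (Hom T t t'')" "m \<in> carrier (MM u'' t)" "b \<in> carrier (Hom U u' u'')"
  shows "FMor N (t, u') (t'', u'') (a, m, b) (n11 t u t u' (Id T t) z) =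
    n11 t u t'' u'' a z \<oplus>\<^bsub>FOb N (t'', u'')\<^esub> n21 t u t'' u'' m z"
proof -
  note i = T.id_closed[OF ob(1)]
  interpret HT: module K "Hom T t t''" by (rule T.mod_hom[OF ob(1,4)])
  interpret HU: module K "Hom U u u''" by (rule U.mod_hom[OF ob(2,5)])
  interpret Mg: module K "MM u'' t" by (rule M_mod[OF ob(5,1)])
  have c: "(a, m, b) \<in> carrier (Hom LL (t, u') (t'', u''))" using h by (simp add: Lam_simps)
  have "E11 t u t'' u'' a \<oplus>\<^bsub>Hom LL (t, u) (t'', u'')\<^esub> E21 t u t'' u'' m = (a, m, \<zero>\<^bsub>Hom U u u''\<^esub>)"
    using h by (simp add: Lam_simps)
  then show ?thesis
    using n_comp[OF ob(1,2,1,3,4,5) z c E_closed(1)[OF ob(1,2,1,3) i]] Lam_comp_E(7)[OF ob(1,2,1,3,4,5) h i]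
      klin_add[OF dg_mod_klin'[OF N obL[OF ob(1,2)] obL[OF ob(4,5)] z] E_closed(1)[OF ob(1,2,4,5) h(1)] E_closed(2)[OF ob(1,2,4,5) h(2)]]
    by (simp add: T.id_right[OF ob(1,4) h(1)] bullet_id[OF ob(5,1) h(2)])
qed

text \<open>The upper right entry of a matrix is zero, so its second column consists of b
  alone.\<close>

lemma n_one_right:
  assumes ob: "t \<in> Ob T" "u \<in> Ob U" "t' \<in> Ob T" "t'' \<in> Ob T" "u'' \<in> Ob U" and z: "z \<in> carrier (FOb N (t, u))"
    and h: "a \<in> carrier (Hom T t' t'')" "m \<in> carrier (MM u'' t')" "b \<in> carrier (Hom U u u'')"
  shows "FMor N (t', u) (t'', u'') (a, m, b) (n22 t u t' u (Id U u) z) = n22 t u t'' u'' b z"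
proof -
  note i = U.id_closed[OF ob(2)]
  have c: "(a, m, b) \<in> carrier (Hom LL (t', u) (t'', u''))" using h by (simp add: Lam_simps)
  show ?thesis
    using n_comp[OF ob(1,2,3,2,4,5) z c E_closed(3)[OF ob(1,2,3,2) i]] Lam_comp_E(8)[OF ob(1,2,3,2,4,5) h i]
    by (simp add: U.id_right[OF ob(2,5) h(3)])
qed

private lemma A_split:
  assumes "t \<in> Ob T"
  shows "dg_map K (FOb A t) (FOb N (t, u0)) (\<iota>A t)" "dg_map K (FOb N (t, u0)) (FOb A t) (\<pi>A t)"
    "x \<in> carrier (FOb A t) \<Longrightarrow> \<pi>A t (\<iota>A t x) = x" "z \<in> carrier (FOb N (t, u0)) \<Longrightarrow> \<iota>A t (\<pi>A t z) = n11 t u0 t u0 (Id T t) z"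
  using spA[OF assms] by (simp_all add: dg_splitting_def)

private lemma B_split:
  assumes "u \<in> Ob U"
  shows "dg_map K (FOb B u) (FOb N (t0, u)) (\<iota>B u)" "dg_map K (FOb N (t0, u)) (FOb B u) (\<pi>B u)"
    "y \<in> carrier (FOb B u) \<Longrightarrow> \<pi>B u (\<iota>B u y) = y" "z \<in> carrier (FOb N (t0, u)) \<Longrightarrow> \<iota>B u (\<pi>B u z) = n22 t0 u t0 u (Id U u) z"
  using spB[OF assms] by (simp_all add: dg_splitting_def)

private lemmas \<iota>A = dg_mapD[OF A_split(1)] and \<pi>A = dg_mapD[OF A_split(2)] and \<iota>B = dg_mapD[OF B_split(1)] and \<pi>B = dg_mapD[OF B_split(2)]

text \<open>The unit with entry m acts from N(t, u0) to N(t0, u), hence, through the splittings,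
  from the corner A(t) to the corner B(u).\<close>

private definition psi where "psi u t m x = \<pi>B u (n21 t u0 t0 u m (\<iota>A t x))"

private lemma pairing: "dg_pairing K T U M A B psi"
proof (intro dg_pairing.intro dg_pairing_axioms.intro dg_bimodule_axioms A B)
  fix u t assume u: "u \<in> Ob U" and t: "t \<in> Ob T"
  note o = t u0[OF t] t0[OF u] u
  have k: "klin K (FOb A t) (FOb B u) (psi u t m)" if "m \<in> carrier (MM u t)" for m
    using klin_comp[OF klin_comp[OF \<iota>A(1)[OF t] n_klin(2)[OF o that]] \<pi>B(1)[OF u]] by (simp add: psi_def[abs_def])
  have k': "klin K (MM u t) (FOb B u) (\<lambda>m. psi u t m x)" if "x \<in> carrier (FOb A t)" for x
    using klin_comp[OF n21_klin'[OF o \<iota>A(2)[OF t that]] \<pi>B(1)[OF u]] by (simp add: psi_def[abs_def])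
  show "kbilin K (MM u t) (FOb A t) (FOb B u) (psi u t)" using k k' by (simp add: kbilin_def)
  fix p q m x assume m: "m \<in> grade (MM u t) p" and x: "x \<in> grade (FOb A t) q"
  note mc = gr_module.grade_carrier[OF M_gr[OF u t] m]
  note xc = gr_module.grade_carrier[OF dg_module_gr_module[OF dg_mod_ob[OF A t]] x]
  have g: "\<iota>A t x \<in> grade (FOb N (t, u0)) q" and c: "\<iota>A t x \<in> carrier (FOb N (t, u0))" by (rule \<iota>A(3)[OF t x], rule \<iota>A(2)[OF t xc])
  note n = n_closed(2)[OF o _ c]
  show "psi u t m x \<in> grade (FOb B u) (p + q)"
    using \<pi>B(3)[OF u n_grade(2)[OF o m g]] by (simp add: psi_def add.commute)
  have nd: "n21 t u0 t0 u m (dif (FOb N (t, u0)) (\<iota>A t x)) \<in> carrier (FOb N (t0, u))"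
    by (rule n_closed(2)[OF o mc dif_carrier[OF N_dg[OF o(1,2)] c]])
  have ag: "abelian_group (FOb N (t0, u))" by (rule module_abelian_group[OF N_mod[OF o(3,4)]])
  show "dif (FOb B u) (psi u t m x) = psi u t (dif (MM u t) m) x \<oplus>\<^bsub>FOb B u\<^esub> sg (FOb B u) p (psi u t m (dif (FOb A t) x))"
    using n21_dif[OF o m c] \<pi>B(4)[OF u n[OF mc]] \<iota>A(4)[OF t xc]
      klin_add[OF \<pi>B(1)[OF u] n[OF dif_carrier[OF M_module[OF u t] mc]] sg_closed[OF ag nd, of p]]
      klin_sg[OF N_mod[OF o(3,4)] dg_module_module[OF dg_mod_ob[OF B u]] \<pi>B(1)[OF u] nd, of p]
    by (simp add: psi_def)
next
  fix u t t' p q r m a x assume u: "u \<in> Ob U" and t: "t \<in> Ob T" "t' \<in> Ob T" and m: "m \<in> grade (MM u t') p"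
    and a: "a \<in> grade (Hom T t t') r" and x: "x \<in> grade (FOb A t) q"
  note mc = gr_module.grade_carrier[OF M_gr[OF u t(2)] m] and ac = gr_module.grade_carrier[OF T.gr_hom_module[OF t] a]
  note c = \<iota>A(2)[OF t(1) gr_module.grade_carrier[OF dg_module_gr_module[OF dg_mod_ob[OF A t(1)]] x]]
  note o = t(1) u0[OF t(1)] t(2) u0[OF t(1)] and xc = gr_module.grade_carrier[OF dg_module_gr_module[OF dg_mod_ob[OF A t(1)]] x]
  \<comment> \<open>Including after projecting applies the idempotent at t', which the unit of a
    absorbs.\<close>
  have "\<iota>A t' (FMor A t t' a x) = n11 t u0 t' u0 a (\<iota>A t x)"
    using FA[OF t ac xc] A_split(4)[OF t(2) n_closed(1)[OF o ac c]] n_comp_E(1)[OF o o(3,4) c T.id_closed[OF t(2)] ac]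
    by (simp add: T.id_left[OF t ac])
  then show "psi u t' m (FMor A t t' a x) = psi u t (bullet u t t' m a) x"
    using n_comp_E(2)[OF o t0[OF u] u c mc ac] by (simp add: psi_def)
next
  fix u u' t p q r m b x assume u: "u \<in> Ob U" "u' \<in> Ob U" and t: "t \<in> Ob T" and m: "m \<in> grade (MM u t) p"
    and b: "b \<in> grade (Hom U u u') r" and x: "x \<in> grade (FOb A t) q"
  note mc = gr_module.grade_carrier[OF M_gr[OF u(1) t] m] and bc = gr_module.grade_carrier[OF U.gr_hom_module[OF u] b]
  note xc = gr_module.grade_carrier[OF dg_module_gr_module[OF dg_mod_ob[OF A t]] x]
  note c = \<iota>A(2)[OF t xc]
  note o = t u0[OF t] t0[OF u(1)] u(1)
  note n = n_closed(2)[OF o mc c]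
  \<comment> \<open>The image of the unit of m is fixed by the lower idempotent, so the projection
    in \<open>psi\<close> loses nothing.\<close>
  have "\<iota>B u (psi u t m x) = n21 t u0 t0 u m (\<iota>A t x)"
    using B_split(4)[OF u(1) n] n_comp_E(3)[OF o o(3,4) c U.id_closed[OF u(1)] mc] by (simp add: psi_def L_id[OF u(1) t mc])
  then show "FMor B u u' b (psi u t m x) = psi u' t (L u u' t b m) x"
    using FB[OF u bc, of "psi u t m x"] \<pi>B(2)[OF u(1) n] n_comp_E(3)[OF o o(3) u(2) c bc mc] by (simp add: psi_def)
qed

interpretation P: dg_pairing K T U M A B psi by (rule pairing)

private abbreviation "AB \<equiv> amalg M (A, P.pair_nat, B)"

text \<open>The units with identity entries carry the corners at (t, u0) and (t0, u) into N(t, u);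
  \<open>phi'\<close> uses the units in the opposite direction.\<close>

private definition phi where
  "phi = (\<lambda>(t, u)\<in>Ob LL. \<lambda>(x, y)\<in>carrier (dg_sum (FOb A t) (FOb B u)).
    n11 t u0 t u (Id T t) (\<iota>A t x) \<oplus>\<^bsub>FOb N (t, u)\<^esub> n22 t0 u t u (Id U u) (\<iota>B u y))"

private definition phi' where
  "phi' = (\<lambda>(t, u)\<in>Ob LL. \<lambda>z\<in>carrier (FOb N (t, u)). (\<pi>A t (n11 t u t u0 (Id T t) z), \<pi>B u (n22 t u t0 u (Id U u) z)))"

private lemmas F_functor = amalg_functor[OF P.comma_ob_pairing]

context
  fixes t u assumes ob: "t \<in> Ob T" "u \<in> Ob U"
begin

private lemmas o = u0[OF ob(1)] t0[OF ob(2)] and i = T.id_closed[OF ob(1)] U.id_closed[OF ob(2)]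

lemma phi_apply: "x \<in> carrier (FOb A t) \<Longrightarrow> y \<in> carrier (FOb B u) \<Longrightarrow>
    phi (t, u) (x, y) = n11 t u0 t u (Id T t) (\<iota>A t x) \<oplus>\<^bsub>FOb N (t, u)\<^esub> n22 t0 u t u (Id U u) (\<iota>B u y)"
  using ob by (simp add: phi_def Lam_simps)

lemma phi'_apply: "z \<in> carrier (FOb N (t, u)) \<Longrightarrow> phi' (t, u) z = (\<pi>A t (n11 t u t u0 (Id T t) z), \<pi>B u (n22 t u t0 u (Id U u) z))"
  using ob by (simp add: phi'_def Lam_simps)

lemma n11_\<iota>A: "x \<in> carrier (FOb A t) \<Longrightarrow> n11 t u0 t u0 (Id T t) (\<iota>A t x) = \<iota>A t x"
  using A_split(4)[OF ob(1) \<iota>A(2)[OF ob(1)]] A_split(3)[OF ob(1)] by simp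

lemma n22_\<iota>B: "y \<in> carrier (FOb B u) \<Longrightarrow> n22 t0 u t0 u (Id U u) (\<iota>B u y) = \<iota>B u y"
  using B_split(4)[OF ob(2) \<iota>B(2)[OF ob(2)]] B_split(3)[OF ob(2)] by simp

lemma phi_summands:
  "x \<in> carrier (FOb A t) \<Longrightarrow> n11 t u0 t u (Id T t) (\<iota>A t x) \<in> carrier (FOb N (t, u))"
  "y \<in> carrier (FOb B u) \<Longrightarrow> n22 t0 u t u (Id U u) (\<iota>B u y) \<in> carrier (FOb N (t, u))"
  by (rule n_closed(1)[OF ob(1) o(1) ob i(1) \<iota>A(2)[OF ob(1)]], assumption)
    (rule n_closed(3)[OF o(2) ob(2) ob i(2) \<iota>B(2)[OF ob(2)]])

lemma phi_hom: "phi (t, u) \<in> hom_deg K (FOb AB (t, u)) (FOb N (t, u)) 0"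
proof -
  interpret N1: gr_module K "FOb N (t, u)" by (rule dg_module_gr_module[OF N_dg[OF ob]])
  interpret At: gr_module K "FOb A t" by (rule P.A_gr[OF ob(1)])
  interpret Bu: gr_module K "FOb B u" by (rule P.B_gr[OF ob(2)])
  note kA = klin_comp[OF \<iota>A(1)[OF ob(1)] n_klin(1)[OF ob(1) o(1) ob i(1)]]
    and kB = klin_comp[OF \<iota>B(1)[OF ob(2)] n_klin(3)[OF o(2) ob(2) ob i(2)]]
  show ?thesis
    unfolding amalg_simps
  proof (rule hom_degI[OF klinI])
    fix z assume "z \<in> carrier (dg_sum (FOb A t) (FOb B u))"
    then obtain x y where z: "z = (x, y)" "x \<in> carrier (FOb A t)" "y \<in> carrier (FOb B u)" by auto
    show "phi (t, u) z \<in> carrier (FOb N (t, u))" using z by (simp add: phi_apply phi_summands)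
    show "phi (t, u) (a \<odot>\<^bsub>dg_sum (FOb A t) (FOb B u)\<^esub> z) = a \<odot>\<^bsub>FOb N (t, u)\<^esub> phi (t, u) z" if "a \<in> carrier K" for a
      using z that by (simp add: phi_apply phi_summands klin_smult[OF kA] klin_smult[OF kB] N1.smult_r_distr)
    fix z' assume "z' \<in> carrier (dg_sum (FOb A t) (FOb B u))"
    then obtain x' y' where z': "z' = (x', y')" "x' \<in> carrier (FOb A t)" "y' \<in> carrier (FOb B u)" by auto
    show "phi (t, u) (z \<oplus>\<^bsub>dg_sum (FOb A t) (FOb B u)\<^esub> z') = phi (t, u) z \<oplus>\<^bsub>FOb N (t, u)\<^esub> phi (t, u) z'"
      using z z' by (simp add: phi_apply phi_summands klin_add[OF kA] klin_add[OF kB] N1.a_ac)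
  next
    show "phi (t, u) \<in> extensional (carrier (dg_sum (FOb A t) (FOb B u)))" using ob by (simp add: phi_def Lam_simps)
  next
    fix p z assume "z \<in> grade (dg_sum (FOb A t) (FOb B u)) p"
    then obtain x y where z: "z = (x, y)" "x \<in> grade (FOb A t) p" "y \<in> grade (FOb B u) p" by auto
    show "phi (t, u) z \<in> grade (FOb N (t, u)) (p + 0)"
      using z n_grade(1)[OF ob(1) o(1) ob T.id_grade[OF ob(1)] \<iota>A(3)[OF ob(1) z(2)]] n_grade(3)[OF o(2) ob(2) ob U.id_grade[OF ob(2)] \<iota>B(3)[OF ob(2) z(3)]]
      by (simp add: phi_apply At.grade_carrier Bu.grade_carrier N1.grade_add)
  qed
qed

lemma phi'_hom: "phi' (t, u) \<in> hom_deg K (FOb N (t, u)) (FOb AB (t, u)) 0"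
proof -
  interpret N1: gr_module K "FOb N (t, u)" by (rule dg_module_gr_module[OF N_dg[OF ob]])
  note k = klin_comp[OF n_klin(1)[OF ob ob(1) o(1) i(1)] \<pi>A(1)[OF ob(1)]] klin_comp[OF n_klin(3)[OF ob o(2) ob(2) i(2)] \<pi>B(1)[OF ob(2)]]
  show ?thesis
    unfolding amalg_simps
  proof (rule hom_degI[OF klinI])
    fix p z assume z: "z \<in> grade (FOb N (t, u)) p"
    show "phi' (t, u) z \<in> grade (dg_sum (FOb A t) (FOb B u)) (p + 0)"
      using \<pi>A(3)[OF ob(1) n_grade(1)[OF ob ob(1) o(1) T.id_grade[OF ob(1)] z]] \<pi>B(3)[OF ob(2) n_grade(3)[OF ob o(2) ob(2) U.id_grade[OF ob(2)] z]]
      by (simp add: phi'_apply N1.grade_carrier[OF z])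
  qed (use ob in \<open>auto simp: phi'_apply klin_closed[OF k(1)] klin_closed[OF k(2)] klin_add[OF k(1)] klin_add[OF k(2)]
      klin_smult[OF k(1)] klin_smult[OF k(2)] phi'_def Lam_simps\<close>)
qed

text \<open>The mixed terms vanish because an upper and a lower diagonal unit multiply to
  zero.\<close>

lemma phi'_phi: "w \<in> carrier (FOb AB (t, u)) \<Longrightarrow> phi' (t, u) (phi (t, u) w) = w"
proof -
  assume "w \<in> carrier (FOb AB (t, u))"
  then obtain x y where w: "w = (x, y)" and x: "x \<in> carrier (FOb A t)" and y: "y \<in> carrier (FOb B u)" by (auto simp: amalg_simps)
  interpret N1: module K "FOb N (t, u)" by (rule N_mod[OF ob])
  interpret NA: module K "FOb N (t, u0)" by (rule N_mod[OF ob(1) o(1)])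
  interpret NB: module K "FOb N (t0, u)" by (rule N_mod[OF o(2) ob(2)])
  note ix = \<iota>A(2)[OF ob(1) x] and iy = \<iota>B(2)[OF ob(2) y]
  show ?thesis
    using n_comp_E(1)[OF ob(1) o(1) ob ob(1) o(1) ix i(1,1)] n_comp_E(5)[OF o(2) ob(2) ob ob(1) o(1) iy i]
      n_comp_E(6)[OF ob(1) o(1) ob o(2) ob(2) ix i(2,1)] n_comp_E(4)[OF o(2) ob(2) ob o(2) ob(2) iy i(2,2)]
      n11_\<iota>A[OF x] n22_\<iota>B[OF y] ix iy
    by (simp add: w x y phi_apply phi'_apply phi_summands klin_add[OF n_klin(1)[OF ob ob(1) o(1) i(1)]] klin_add[OF n_klin(3)[OF ob o(2) ob(2) i(2)]]
        T.id_left[OF ob(1,1) i(1)] U.id_left[OF ob(2,2) i(2)] A_split(3)[OF ob(1)] B_split(3)[OF ob(2)])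
qed

text \<open>Going to the base corners and back gives the two diagonal idempotents at (t, u), whose
  sum is the identity by \<open>n_one\<close>.\<close>

lemma phi_phi': "z \<in> carrier (FOb N (t, u)) \<Longrightarrow> phi (t, u) (phi' (t, u) z) = z"
proof -
  assume z: "z \<in> carrier (FOb N (t, u))"
  note c = n_closed(1)[OF ob ob(1) o(1) i(1) z] n_closed(3)[OF ob o(2) ob(2) i(2) z]
  show ?thesis
    using n_comp_E(1)[OF ob ob(1) o(1) ob(1) o(1) z i(1,1)] n_comp_E(1)[OF ob ob(1) o(1) ob z i(1,1)]
      n_comp_E(4)[OF ob o(2) ob(2) o(2) ob(2) z i(2,2)] n_comp_E(4)[OF ob o(2) ob(2) ob z i(2,2)] n_one[OF ob z]
    by (simp add: phi_apply phi'_apply z \<pi>A(2)[OF ob(1) c(1)] \<pi>B(2)[OF ob(2) c(2)] A_split(4)[OF ob(1) c(1)] B_split(4)[OF ob(2) c(2)]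
        T.id_left[OF ob(1,1) i(1)] U.id_left[OF ob(2,2) i(2)])
qed

lemma phi_dif: "w \<in> carrier (FOb AB (t, u)) \<Longrightarrow> phi (t, u) (dif (FOb AB (t, u)) w) = dif (FOb N (t, u)) (phi (t, u) w)"
proof -
  assume "w \<in> carrier (FOb AB (t, u))"
  then obtain x y where w: "w = (x, y)" and x: "x \<in> carrier (FOb A t)" and y: "y \<in> carrier (FOb B u)" by (auto simp: amalg_simps)
  note d = dif_carrier[OF dg_mod_ob[OF A ob(1)] x] dif_carrier[OF dg_mod_ob[OF B ob(2)] y]
  show ?thesis
    using n_dif_one(1)[OF ob(1) o(1) ob \<iota>A(2)[OF ob(1) x]] n_dif_one(2)[OF o(2) ob(2) ob \<iota>B(2)[OF ob(2) y]]
    by (simp add: w amalg_simps phi_apply x y d \<iota>A(4)[OF ob(1) x] \<iota>B(4)[OF ob(2) y]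
        klin_add[OF dg_module_klin_dif[OF N_dg[OF ob]] phi_summands(1)[OF x] phi_summands(2)[OF y]])
qed

end

text \<open>Both sides reduce to the same three terms, the actions of a and m on the included x and
  of b on the included y. The identities \<open>e1\<close> to \<open>e3\<close> absorb the
  idempotents; the columns of h give the other side.\<close>

lemma phi_natural:
  assumes ob: "t \<in> Ob T" "u \<in> Ob U" "t' \<in> Ob T" "u' \<in> Ob U" and h: "h \<in> carrier (Hom LL (t, u) (t', u'))" and w: "w \<in> carrier (FOb AB (t, u))"
  shows "FMor N (t, u) (t', u') h (phi (t, u) w) = phi (t', u') (FMor AB (t, u) (t', u') h w)"
proof -
  obtain x y where xy: "w = (x, y)" and x: "x \<in> carrier (FOb A t)" and y: "y \<in> carrier (FOb B u)" using w by (auto simp: amalg_simps)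
  obtain a m b where amb: "h = (a, m, b)" and hc: "a \<in> carrier (Hom T t t')" "m \<in> carrier (MM u' t)" "b \<in> carrier (Hom U u u')"
    using h by (cases h) (auto simp: Lam_simps)
  note o = u0[OF ob(1)] t0[OF ob(2)] and ix = \<iota>A(2)[OF ob(1) x] and iy = \<iota>B(2)[OF ob(2) y]
  note ax = dg_mod_closed[OF A ob(1,3) hc(1) x] and by' = dg_mod_closed[OF B ob(2,4) hc(3) y] and mx = P.pair_closed[OF ob(4,1) hc(2) x]
  interpret B': module K "FOb B u'" by (rule P.B_mod[OF ob(4)])
  interpret N': module K "FOb N (t', u')" by (rule N_mod[OF ob(3,4)])
  note i = T.id_closed[OF ob(3)] U.id_closed[OF ob(4)]
  have e1: "n11 t' u0 t' u' (Id T t') (\<iota>A t' (FMor A t t' a x)) = n11 t u0 t' u' a (\<iota>A t x)"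
    using n_comp_E(1)[OF ob(1) o(1) ob(3) o(1) ob(3) o(1) ix i(1) hc(1)] n_comp_E(1)[OF ob(1) o(1) ob(3) o(1) ob(3,4) ix i(1) hc(1)]
    by (simp add: FA[OF ob(1,3) hc(1) x] A_split(4)[OF ob(3) n_closed(1)[OF ob(1) o(1) ob(3) o(1) hc(1) ix]] T.id_left[OF ob(1,3) hc(1)])
  have e2: "n22 t0 u' t' u' (Id U u') (\<iota>B u' (FMor B u u' b y)) = n22 t0 u t' u' b (\<iota>B u y)"
    using n_comp_E(4)[OF o(2) ob(2) o(2) ob(4) o(2) ob(4) iy i(2) hc(3)] n_comp_E(4)[OF o(2) ob(2) o(2) ob(4) ob(3,4) iy i(2) hc(3)]
    by (simp add: FB[OF ob(2,4) hc(3) y] B_split(4)[OF ob(4) n_closed(3)[OF o(2) ob(2) o(2) ob(4) hc(3) iy]] U.id_left[OF ob(2,4) hc(3)])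
  have e3: "n22 t0 u' t' u' (Id U u') (\<iota>B u' (psi u' t m x)) = n21 t u0 t' u' m (\<iota>A t x)"
    using n_comp_E(3)[OF ob(1) o(1) o(2) ob(4) o(2) ob(4) ix i(2) hc(2)] n_comp_E(3)[OF ob(1) o(1) o(2) ob(4) ob(3,4) ix i(2) hc(2)]
    by (simp add: psi_def B_split(4)[OF ob(4) n_closed(2)[OF ob(1) o(1) o(2) ob(4) hc(2) ix]] L_id[OF ob(4,1) hc(2)])
  note kB = klin_comp[OF \<iota>B(1)[OF ob(4)] n_klin(3)[OF o(2) ob(4) ob(3,4) i(2)]]
  have c: "n11 t u0 t' u' a (\<iota>A t x) \<in> carrier (FOb N (t', u'))" "n21 t u0 t' u' m (\<iota>A t x) \<in> carrier (FOb N (t', u'))"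
    "n22 t0 u t' u' b (\<iota>B u y) \<in> carrier (FOb N (t', u'))"
    by (rule n_closed(1)[OF ob(1) o(1) ob(3,4) hc(1) ix], rule n_closed(2)[OF ob(1) o(1) ob(3,4) hc(2) ix], rule n_closed(3)[OF o(2) ob(2) ob(3,4) hc(3) iy])
  have "phi (t', u') (FMor AB (t, u) (t', u') h w) =
      n11 t u0 t' u' a (\<iota>A t x) \<oplus>\<^bsub>FOb N (t', u')\<^esub> (n21 t u0 t' u' m (\<iota>A t x) \<oplus>\<^bsub>FOb N (t', u')\<^esub> n22 t0 u t' u' b (\<iota>B u y))"
    by (simp add: xy amb amalg_simps x y P.dot_pair_nat[OF ob(4,1) hc(2) x] phi_apply[OF ob(3,4)] ax by' mx klin_add[OF kB mx by'] e1 e2 e3)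
  also have "\<dots> = FMor N (t, u) (t', u') h (phi (t, u) w)"
    using n_one_left[OF ob(1) o(1) ob(2-4) ix hc] n_one_right[OF o(2) ob(2) ob(1,3,4) iy hc] c
      klin_add[OF dg_mod_klin(1)[OF N obL[OF ob(1,2)] obL[OF ob(3,4)] h] phi_summands(1)[OF ob(1,2) x] phi_summands(2)[OF ob(1,2) y]]
    by (simp add: xy amb phi_apply[OF ob(1,2) x y] N'.a_assoc)
  finally show ?thesis by simp
qed

lemma phi_deg: "phi \<in> mnat_deg K LL AB N 0"
proof (rule mnat_degI[OF F_functor N])
  show "phi \<in> extensional (Ob LL)" by (simp add: phi_def)
  show "phi X \<in> hom_deg K (FOb AB X) (FOb N X) 0" if "X \<in> Ob LL" for X
    using that phi_hom by (cases X) (simp add: Lam_simps)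
  fix X Y h p w assume X: "X \<in> Ob LL" and Y: "Y \<in> Ob LL" and h: "h \<in> grade (Hom LL X Y) p" and w: "w \<in> carrier (FOb AB X)"
  obtain t u t' u' where e: "X = (t, u)" "Y = (t', u')" by fastforce
  have "h \<in> carrier (Hom LL X Y)" by (rule gr_module.grade_carrier[OF dg_module_gr_module[OF dg_quiver_hom[OF quiver_Lam X Y]] h])
  then show "FMor N X Y h (phi X w) = sg (FOb N Y) (0 * p) (phi Y (FMor AB X Y h w))"
    using phi_natural[of t u t' u' h w] X Y w by (simp add: e Lam_simps(1))
qed

text \<open>Naturality of a pointwise inverse follows from that of \<open>phi\<close>.\<close>

lemma phi'_deg: "phi' \<in> mnat_deg K LL N AB 0"
proof (rule mnat_degI[OF N F_functor])
  show "phi' \<in> extensional (Ob LL)" by (simp add: phi'_def)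
  show "phi' X \<in> hom_deg K (FOb N X) (FOb AB X) 0" if "X \<in> Ob LL" for X
    using that phi'_hom by (cases X) (simp add: Lam_simps)
  fix X Y h p z assume X: "X \<in> Ob LL" and Y: "Y \<in> Ob LL" and h: "h \<in> grade (Hom LL X Y) p" and z: "z \<in> carrier (FOb N X)"
  obtain t u t' u' where e: "X = (t, u)" "Y = (t', u')" by fastforce
  have ob: "t \<in> Ob T" "u \<in> Ob U" "t' \<in> Ob T" "u' \<in> Ob U" using X Y by (simp_all add: e Lam_simps(1))
  have hc: "h \<in> carrier (Hom LL X Y)" by (rule gr_module.grade_carrier[OF dg_module_gr_module[OF dg_quiver_hom[OF quiver_Lam X Y]] h])
  have pz: "phi' X z \<in> carrier (FOb AB X)" using klin_closed[OF hom_degD(1)[OF phi'_hom[OF ob(1,2)]]] z by (simp add: e)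
  have "FMor N X Y h z = phi Y (FMor AB X Y h (phi' X z))"
    using phi_natural[OF ob, of h "phi' X z"] hc pz phi_phi'[OF ob(1,2), of z] z by (simp add: e)
  then show "FMor AB X Y h (phi' X z) = sg (FOb AB Y) (0 * p) (phi' Y (FMor N X Y h z))"
    using phi'_phi[OF ob(3,4), of "FMor AB X Y h (phi' X z)"] dg_mod_closed[OF F_functor X Y hc pz] by (simp add: e)
qed

lemma amalg_iso:
  "\<exists>X\<in>Ob (comma K T U M :: ('k, ('k, 'to, 'th, 'uo, 'uh, 'm, 'v) comma_ob, ('to, 'uo, 'v) comma_mor) dgcat). \<exists>\<phi>\<in>mnat_deg K LL (amalg M X) N 0. \<exists>\<phi>'\<in>mnat_deg K LL N (amalg M X) 0.
    dif (mnat K LL (amalg M X) N) \<phi> = \<zero>\<^bsub>mnat K LL (amalg M X) N\<^esub> \<and>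
    mnat_comp LL (amalg M X) \<phi>' \<phi> = mnat_id LL (amalg M X) \<and> mnat_comp LL N \<phi> \<phi>' = mnat_id LL N"
proof -
  interpret FN: dg_module K "mnat K LL AB N" by (rule dg_module_mnat[OF F_functor N quiver_Lam])
  have phi_c: "phi \<in> carrier (mnat K LL AB N)"
    using gr_module.grade_carrier[OF dg_module_gr_module[OF FN.dg_module_axioms], of phi 0] phi_deg by simp
  have 1: "dif (mnat K LL AB N) phi = \<zero>\<^bsub>mnat K LL AB N\<^esub>"
  proof (rule mnat_eqI[OF F_functor N quiver_Lam FN.dif_closed[OF phi_c] FN.zero_closed])
    fix X w assume X: "X \<in> Ob LL" and w: "w \<in> carrier (FOb AB X)"
    obtain t u where e: "X = (t, u)" by fastforce
    interpret NX: dg_module K "FOb N X" by (rule dg_mod_ob[OF N X])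
    have pc: "phi X w \<in> carrier (FOb N X)" by (rule mnat_closed[OF F_functor N quiver_Lam phi_c X w])
    \<comment> \<open>\<open>phi\<close> commutes with d, so the two terms of the commutator in
      degree zero are equal and cancel.\<close>
    have "dif (mnat K LL AB N) phi X w = dif (FOb N X) (phi X w) \<oplus>\<^bsub>FOb N X\<^esub> sg (FOb N X) 1 (dif (FOb N X) (phi X w))"
      using mnat_dif_eval[OF F_functor N quiver_Lam phi_deg X w] phi_dif[of t u w] X w by (simp add: e Lam_simps(1) del: mnat_simps)
    then show "dif (mnat K LL AB N) phi X w = \<zero>\<^bsub>mnat K LL AB N\<^esub> X w"
      using NX.dif_closed[OF pc] X w by (simp add: sg_def NX.r_neg del: mnat_simps(5))
  qed
  have 2: "mnat_comp LL AB phi' phi = mnat_id LL AB"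
    by (auto simp: mnat_comp_def mnat_id_def compose_def fun_eq_iff restrict_def phi'_phi Lam_simps(1))
  have 3: "mnat_comp LL N phi phi' = mnat_id LL N"
    by (auto simp: mnat_comp_def mnat_id_def compose_def fun_eq_iff restrict_def phi_phi' Lam_simps(1))
  show ?thesis
    by (rule bexI[OF _ P.comma_ob_pairing], rule bexI[OF _ phi_deg], rule bexI[OF _ phi'_deg], intro conjI 1 2 3)
qed

end

text \<open>Sending a to the unit \<open>E11\<close> and b to the unit \<open>E22\<close> respects
  composition but not identities; \<open>corner_functor\<close> at the base objects turns these
  assignments into A and B, and j takes care of the universe.\<close>

lemma FF_ess_surj:
  fixes N :: "('k, 'to \<times> 'uo, 'th \<times> 'm \<times> 'uh, 'w) dgm" and j :: "'w \<Rightarrow> 'v"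
  assumes N: "dg_functor K LL (DgModK K) N" and j: "inj j" and ne: "Ob T = {} \<longleftrightarrow> Ob U = {}"
  shows "\<exists>X\<in>Ob (comma K T U M :: ('k, ('k, 'to, 'th, 'uo, 'uh, 'm, 'v) comma_ob, ('to, 'uo, 'v) comma_mor) dgcat).
    \<exists>\<phi>\<in>mnat_deg K LL (amalg M X) N 0. \<exists>\<phi>'\<in>mnat_deg K LL N (amalg M X) 0.
    dif (mnat K LL (amalg M X) N) \<phi> = \<zero>\<^bsub>mnat K LL (amalg M X) N\<^esub> \<and>
    mnat_comp LL (amalg M X) \<phi>' \<phi> = mnat_id LL (amalg M X) \<and> mnat_comp LL N \<phi> \<phi>' = mnat_id LL N"
proof -
  define u0 where "u0 = (SOME u. u \<in> Ob U)"
  define t0 where "t0 = (SOME t. t \<in> Ob T)"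
  have t0: "t0 \<in> Ob T" if "u \<in> Ob U" for u using that ne unfolding t0_def some_in_eq by blast
  have u0: "u0 \<in> Ob U" if "t \<in> Ob T" for t using that ne unfolding u0_def some_in_eq by blast
  have mT: "dg_map K (Hom T t t') (Hom LL (t, u0) (t', u0)) (\<lambda>a. E11 t u0 t' u0 a)" if "t \<in> Ob T" "t' \<in> Ob T" for t t'
    using E_klin(1) E_grade(1) E_dif(1) that u0[OF that(1)] unfolding dg_map_def by metis
  have mU: "dg_map K (Hom U u u') (Hom LL (t0, u) (t0, u')) (\<lambda>b. E22 t0 u t0 u' b)" if "u \<in> Ob U" "u' \<in> Ob U" for u u'
    using E_klin(3) E_grade(3) E_dif(3) that t0[OF that(1)] unfolding dg_map_def by metis
  obtain A :: "('k, 'to, 'th, 'v) dgm" and \<iota>A \<pi>A where A: "dg_functor K T (DgModK K) A"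
    "\<forall>t\<in>Ob T. dg_splitting K (FOb N (t, u0)) (FMor N (t, u0) (t, u0) (E11 t u0 t u0 (Id T t))) (FOb A t) (\<iota>A t) (\<pi>A t)"
    "\<forall>t\<in>Ob T. \<forall>t'\<in>Ob T. \<forall>a\<in>carrier (Hom T t t'). \<forall>x\<in>carrier (FOb A t).
      FMor A t t' a x = \<pi>A t' (FMor N (t, u0) (t', u0) (E11 t u0 t' u0 a) (\<iota>A t x))"
    using corner_functor[OF T.dg_category_axioms N quiver_Lam j, of "\<lambda>t. (t, u0)" "\<lambda>t t' a. E11 t u0 t' u0 a", OF _ mT]
      Lam_comp_E(1) u0 by (auto simp: Lam_simps(1))
  obtain B :: "('k, 'uo, 'uh, 'v) dgm" and \<iota>B \<pi>B where B: "dg_functor K U (DgModK K) B"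
    "\<forall>u\<in>Ob U. dg_splitting K (FOb N (t0, u)) (FMor N (t0, u) (t0, u) (E22 t0 u t0 u (Id U u))) (FOb B u) (\<iota>B u) (\<pi>B u)"
    "\<forall>u\<in>Ob U. \<forall>u'\<in>Ob U. \<forall>b\<in>carrier (Hom U u u'). \<forall>y\<in>carrier (FOb B u).
      FMor B u u' b y = \<pi>B u' (FMor N (t0, u) (t0, u') (E22 t0 u t0 u' b) (\<iota>B u y))"
    using corner_functor[OF U.dg_category_axioms N quiver_Lam j, of "\<lambda>u. (t0, u)" "\<lambda>u u' b. E22 t0 u t0 u' b", OF _ mU]
      Lam_comp_E(4) t0 by (auto simp: Lam_simps(1))
  show ?thesis
    by (rule amalg_iso[OF N A(1) B(1), of t0 u0 \<iota>A \<pi>A \<iota>B \<pi>B]) (use t0 u0 A(2,3) B(2,3) in auto)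
qed

end

theorem theorem3p19:
  fixes K :: "'k ring"
    and T :: "('k, 'to, 'th) dgcat"
    and U :: "('k, 'uo, 'uh) dgcat"
    and M :: "('k, 'to, 'th, 'uo, 'uh, 'm) bimod"
  assumes "cring K"
    and "dg_category K T"
    and "dg_category K U"
    and "M \<in> Ob (DgMod K (dg_tensor_cat K U (dg_op T)))"
    and "Ob T = {} \<longleftrightarrow> Ob U = {}"
    and "infinite (UNIV :: 'v set)"
  shows "dg_equivalence K
    (comma K T U M :: ('k, ('k, 'to, 'th, 'uo, 'uh, 'm, 'v) comma_ob, ('to, 'uo, 'v) comma_mor) dgcat)
    (DgMod K (Lam K T U M))
    (FF T U M)"
proof -
  interpret dg_bimodule K T U M
    using assms by (intro dg_bimodule.intro dg_bimodule_axioms.intro) simp_all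
  \<comment> \<open>Infiniteness of the universe provides the bijection by which the corners of
    modules with values in \<open>'v \<times> 'v\<close> are brought back into
    \<open>'v\<close>.\<close>
  obtain j :: "'v \<times> 'v \<Rightarrow> 'v" where "bij_betw j (UNIV \<times> UNIV) UNIV"
    using card_of_Times_same_infinite[OF assms(6)] unfolding card_of_ordIso[symmetric] by blast
  then have j: "inj j" by (simp add: bij_betw_def)
  show ?thesis
  proof (rule dg_equivalenceI[OF dg_category_comma dg_category_DgMod[OF quiver_Lam] FF_functor])
    fix X Y :: "('k, 'to, 'th, 'uo, 'uh, 'm, 'v) comma_ob"
    assume X: "X \<in> Ob (comma K T U M)" and Y: "Y \<in> Ob (comma K T U M)"
    obtain A f B A' f' B' where e: "X = (A, f, B)" "Y = (A', f', B')" by (metis prod_cases3)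
    show "g = h" if "g \<in> carrier (Hom (comma K T U M) X Y)" "h \<in> carrier (Hom (comma K T U M) X Y)" "FMor FFT X Y g = FMor FFT X Y h" for g h
      using FF_faithful[of A f B A' f' B' g h] X Y assms(5) that by (simp add: e)
    show "\<exists>g\<in>grade (Hom (comma K T U M) X Y) n. FMor FFT X Y g = \<eta>" if "\<eta> \<in> grade (Hom (DgMod K LL) (FOb FFT X) (FOb FFT Y)) n" for \<eta> n
      using FF_full[of A f B A' f' B' \<eta> n] X Y assms(5) that by (simp add: e FF_simps(1) comma_hom_simps)
  next
    fix N :: "('k, 'to \<times> 'uo, 'th \<times> 'm \<times> 'uh, 'v \<times> 'v) dgm" assume N: "N \<in> Ob (DgMod K LL)"
    show "\<exists>X\<in>Ob (comma K T U M). \<exists>\<phi>\<in>grade (Hom (DgMod K LL) (FOb FFT X) N) 0. \<exists>\<phi>'\<in>grade (Hom (DgMod K LL) N (FOb FFT X)) 0.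
        dif (Hom (DgMod K LL) (FOb FFT X) N) \<phi> = \<zero>\<^bsub>Hom (DgMod K LL) (FOb FFT X) N\<^esub> \<and>
        Comp (DgMod K LL) (FOb FFT X) N (FOb FFT X) \<phi>' \<phi> = Id (DgMod K LL) (FOb FFT X) \<and>
        Comp (DgMod K LL) N (FOb FFT X) N \<phi> \<phi>' = Id (DgMod K LL) N"
      using FF_ess_surj[OF _ j assms(5), of N] N by (simp add: FF_simps(1) del: mnat_simps(2-))
  qed
qed

end
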